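(* Assume that $V\in C^\infty(\mathbb R^n;\mathbb R)$ satisfies $\partial_x^\alpha V\in L^\infty(\mathbb R^n)$ for all multiindices $\alpha\in\mathbb N^n$ with $|\alpha|\ge2$. Let $p\in(1,\infty)$. There exist $c,C>0$ such that the spectrum of $\mathcal P$ on $L^p(\mathbb R^{2n})$ is contained in the set $$\Big\{z\in\mathbb C\ \Big|\ \mathrm{Re}(z)\ge-c,\ |\mathrm{Im}(z)|\le C\big(\mathrm{Re}(z)^2+1\big)\Big\},$$ and for $z$ outside this set one has the resolvent estimate $$\big\|(\mathcal P-z)^{-1}\big\|_{L^p\to L^p}\le C\big(1+|\mathrm{Re}(z)|+|\mathrm{Im}(z)|^{\frac12}\big)^{-1}.$$
   Context: Let $n\ge1$ be an integer, $m,\beta,\gamma>0$ constants; points of $\mathbb R^{2n}$ are written $(x,v)$. The Fokker--Planck operator is $\mathcal P=\mathcal T+\mathcal H$ with $\mathcal T=m\,v\cdot\partial_x-\nabla V(x)\cdot\partial_v$ and $\mathcal H=\frac\gamma\beta\big(-\Delta_v+\frac{m^2\beta^2}{4}|v|^2-\frac{m\beta n}{2}\big)$. On $L^p(\mathbb R^{2n})$, $p\in(1,\infty)$, $\mathcal P$ denotes the closed operator with domain $\{f\in L^p:\mathcal Pf\in L^p\}$ (distributional sense), which is the closure of $\mathcal P$ on $C_c^\infty(\mathbb R^{2n})$. *)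

theory Defs
  imports "HOL-Analysis.Analysis"
begin

section \<open>Smooth functions and iterated partial derivatives\<close>

definition dir_deriv ::
  "'a::euclidean_space \<Rightarrow> ('a \<Rightarrow> 'b::real_normed_vector) \<Rightarrow> 'a \<Rightarrow> 'b" where
  "dir_deriv w f z = frechet_derivative f (at z) w"

text \<open>A list of basis vectors encodes a partial derivative; its length is the order.  Every
  multiindex \<open>\<alpha>\<close> is encoded by the lists containing the \<open>i\<close>-th basis vector \<open>\<alpha>\<^sub>i\<close> times, and for
  smooth functions the order of the list is immaterial (Schwarz).\<close>

fun iter_partial ::
  "'a::euclidean_space list \<Rightarrow> ('a \<Rightarrow> 'b::real_normed_vector) \<Rightarrow> 'a \<Rightarrow> 'b" where
  "iter_partial [] f = f"
| "iter_partial (b # bs) f = dir_deriv b (iter_partial bs f)"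

definition smooth :: "('a::euclidean_space \<Rightarrow> 'b::real_normed_vector) \<Rightarrow> bool" where
  "smooth f \<longleftrightarrow> (\<forall>bs \<in> lists Basis. \<forall>z. iter_partial bs f differentiable (at z))"

definition Linf :: "('a::euclidean_space \<Rightarrow> 'b::real_normed_vector) set" where
  "Linf = {f \<in> borel_measurable lborel. \<exists>K. AE z in lborel. norm (f z) \<le> K}"

definition test_functions :: "('a::euclidean_space \<Rightarrow> complex) set" where
  "test_functions = {\<phi>. smooth \<phi> \<and> compact (closure {z. \<phi> z \<noteq> 0})}"


section \<open>Measurable functions modulo null sets, and the spaces \<open>L\<^sup>p\<close>\<close>

definition ae_rel :: "('a::euclidean_space \<Rightarrow> complex) \<Rightarrow> ('a \<Rightarrow> complex) \<Rightarrow> bool" where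
  "ae_rel f g \<longleftrightarrow> f \<in> borel_measurable lborel \<and> g \<in> borel_measurable lborel
                  \<and> (AE z in lborel. f z = g z)"

lemma part_equivp_ae_rel: "part_equivp ae_rel"
proof (rule part_equivpI)
  show "\<exists>f. ae_rel f (f :: 'a \<Rightarrow> complex)"
    by (rule exI[of _ "\<lambda>_. 0"]) (simp add: ae_rel_def)
  show "symp ae_rel"
    by (rule sympI) (auto simp: ae_rel_def elim: eventually_mono)
  show "transp ae_rel"
    by (rule transpI) (auto simp: ae_rel_def elim: eventually_elim2)
qed

quotient_type (overloaded) 'a L0 = "'a::euclidean_space \<Rightarrow> complex" / partial: ae_rel
  by (rule part_equivp_ae_rel)

instantiation L0 :: (euclidean_space) ab_group_add
begin

lift_definition zero_L0 :: "'a L0" is "\<lambda>_. 0"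
  by (simp add: ae_rel_def)

lift_definition plus_L0 :: "'a L0 \<Rightarrow> 'a L0 \<Rightarrow> 'a L0" is "\<lambda>f g z. f z + g z"
  by (auto simp: ae_rel_def elim: eventually_elim2)

lift_definition minus_L0 :: "'a L0 \<Rightarrow> 'a L0 \<Rightarrow> 'a L0" is "\<lambda>f g z. f z - g z"
  by (auto simp: ae_rel_def elim: eventually_elim2)

lift_definition uminus_L0 :: "'a L0 \<Rightarrow> 'a L0" is "\<lambda>f z. - f z"
  by (auto simp: ae_rel_def elim: eventually_mono)

instance
  by standard (transfer; auto simp: ae_rel_def algebra_simps elim: eventually_mono)+

end

lift_definition cscale :: "complex \<Rightarrow> 'a::euclidean_space L0 \<Rightarrow> 'a L0" is "\<lambda>c f z. c * f z"
  by (auto simp: ae_rel_def elim: eventually_mono)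

lift_definition Lp_integrable :: "real \<Rightarrow> 'a::euclidean_space L0 \<Rightarrow> bool" is
  "\<lambda>p f. integrable lborel (\<lambda>z. norm (f z) powr p)"
  unfolding ae_rel_def by (intro integrable_cong_AE) (auto elim: eventually_mono)

definition Lp :: "real \<Rightarrow> 'a::euclidean_space L0 set" where
  "Lp p = {f. Lp_integrable p f}"

lift_definition Lp_norm :: "real \<Rightarrow> 'a::euclidean_space L0 \<Rightarrow> real" is
  "\<lambda>p f. (\<integral>z. norm (f z) powr p \<partial>lborel) powr (1 / p)"
  unfolding ae_rel_def
  by (intro arg_cong[where f = "\<lambda>t. t powr _"] integral_cong_AE) (auto elim: eventually_mono)


section \<open>Distributions\<close>

text \<open>A distribution is represented by its action on test functions; the values of the functional
  on other functions are irrelevant.\<close>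

type_synonym 'a distr = "('a \<Rightarrow> complex) \<Rightarrow> complex"

text \<open>The completed measure makes the integral invariant under almost everywhere equality of the
  first factor even when \<open>\<phi>\<close> is not measurable, as the lifting to classes requires.\<close>

lift_definition distr_of :: "'a::euclidean_space L0 \<Rightarrow> 'a distr" is
  "\<lambda>f \<phi>. \<integral>z. f z * \<phi> z \<partial>lebesgue"
proof (rule ext)
  fix f g \<phi> :: "'a \<Rightarrow> complex"
  assume "ae_rel f g"
  then have ae: "AE z in lebesgue. f z * \<phi> z = g z * \<phi> z"
    unfolding ae_rel_def by (intro AE_completion) (auto elim: eventually_mono)
  show "(\<integral>z. f z * \<phi> z \<partial>lebesgue) = (\<integral>z. g z * \<phi> z \<partial>lebesgue)"
  proof (cases "(\<lambda>z. f z * \<phi> z) \<in> borel_measurable lebesgue")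
    case True
    with ae show ?thesis
      by (intro integral_cong_AE) (auto intro: borel_measurable_AE)
  next
    case False
    moreover have "(\<lambda>z. g z * \<phi> z) \<notin> borel_measurable lebesgue"
    proof
      assume "(\<lambda>z. g z * \<phi> z) \<in> borel_measurable lebesgue"
      then have "(\<lambda>z. f z * \<phi> z) \<in> borel_measurable lebesgue"
        by (rule borel_measurable_AE) (use ae in \<open>auto elim: eventually_mono\<close>)
      with False show False ..
    qed
    ultimately show ?thesis
      by (metis borel_measurable_integrable not_integrable_integral_eq)
  qed
qed

text \<open>The usual duality formulas: \<open>a u\<close> acts by \<open>\<phi> \<mapsto> u (a \<phi>)\<close> (for smooth \<open>a\<close>), and \<open>\<partial>\<^sub>w u\<close> by
  \<open>\<phi> \<mapsto> - u (\<partial>\<^sub>w \<phi>)\<close>.\<close>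

definition distr_mult :: "('a::euclidean_space \<Rightarrow> real) \<Rightarrow> 'a distr \<Rightarrow> 'a distr" where
  "distr_mult a u = (\<lambda>\<phi>. u (\<lambda>z. complex_of_real (a z) * \<phi> z))"

definition distr_deriv :: "'a::euclidean_space \<Rightarrow> 'a distr \<Rightarrow> 'a distr" where
  "distr_deriv w u = (\<lambda>\<phi>. - u (dir_deriv w \<phi>))"


section \<open>The Fokker--Planck operator\<close>

abbreviation basis_x :: "'n::finite \<Rightarrow> (real^'n) \<times> (real^'n)" where
  "basis_x i \<equiv> (axis i 1, 0)"

abbreviation basis_v :: "'n::finite \<Rightarrow> (real^'n) \<times> (real^'n)" where
  "basis_v i \<equiv> (0, axis i 1)"

definition transport ::
  "real \<Rightarrow> (real^'n::finite \<Rightarrow> real) \<Rightarrow> ((real^'n) \<times> (real^'n)) distr \<Rightarrow> ((real^'n) \<times> (real^'n)) distr" where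
  "transport m V u = (\<lambda>\<phi>.
     (\<Sum>i\<in>UNIV. distr_mult (\<lambda>(x, v). m * v $ i) (distr_deriv (basis_x i) u) \<phi>)
   - (\<Sum>i\<in>UNIV. distr_mult (\<lambda>(x, v). dir_deriv (axis i 1) V x) (distr_deriv (basis_v i) u) \<phi>))"

definition oscillator ::
  "real \<Rightarrow> real \<Rightarrow> real \<Rightarrow> ((real^'n::finite) \<times> (real^'n)) distr \<Rightarrow> ((real^'n) \<times> (real^'n)) distr" where
  "oscillator m \<beta> \<gamma> u = (\<lambda>\<phi>. complex_of_real (\<gamma> / \<beta>) *
     (- (\<Sum>i\<in>UNIV. distr_deriv (basis_v i) (distr_deriv (basis_v i) u) \<phi>)
      + distr_mult (\<lambda>(x, v). m\<^sup>2 * \<beta>\<^sup>2 / 4 * (norm v)\<^sup>2) u \<phi>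
      - complex_of_real (m * \<beta> * real CARD('n) / 2) * u \<phi>))"

definition fokker_planck ::
  "real \<Rightarrow> real \<Rightarrow> real \<Rightarrow> (real^'n::finite \<Rightarrow> real)
     \<Rightarrow> ((real^'n) \<times> (real^'n)) distr \<Rightarrow> ((real^'n) \<times> (real^'n)) distr" where
  "fokker_planck m \<beta> \<gamma> V u = (\<lambda>\<phi>. transport m V u \<phi> + oscillator m \<beta> \<gamma> u \<phi>)"

text \<open>\<open>fp_maps m \<beta> \<gamma> V f g\<close>: the distribution \<open>P f\<close> is (represented by) the function \<open>g\<close>.\<close>

definition fp_maps ::
  "real \<Rightarrow> real \<Rightarrow> real \<Rightarrow> (real^'n::finite \<Rightarrow> real)
     \<Rightarrow> ((real^'n) \<times> (real^'n)) L0 \<Rightarrow> ((real^'n) \<times> (real^'n)) L0 \<Rightarrow> bool" where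
  "fp_maps m \<beta> \<gamma> V f g \<longleftrightarrow>
     (\<forall>\<phi>\<in>test_functions. fokker_planck m \<beta> \<gamma> V (distr_of f) \<phi> = distr_of g \<phi>)"

definition fp_domain ::
  "real \<Rightarrow> real \<Rightarrow> real \<Rightarrow> (real^'n::finite \<Rightarrow> real) \<Rightarrow> real
     \<Rightarrow> ((real^'n) \<times> (real^'n)) L0 set" where
  "fp_domain m \<beta> \<gamma> V p = {f \<in> Lp p. \<exists>g \<in> Lp p. fp_maps m \<beta> \<gamma> V f g}"

text \<open>The description below is meaningful for \<open>f\<close> in the domain: a locally integrable function is
  determined almost everywhere by the distribution it defines.\<close>

definition fp_op ::
  "real \<Rightarrow> real \<Rightarrow> real \<Rightarrow> (real^'n::finite \<Rightarrow> real) \<Rightarrow> real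
     \<Rightarrow> ((real^'n) \<times> (real^'n)) L0 \<Rightarrow> ((real^'n) \<times> (real^'n)) L0" where
  "fp_op m \<beta> \<gamma> V p f = (THE g. g \<in> Lp p \<and> fp_maps m \<beta> \<gamma> V f g)"


section \<open>Spectrum and resolvent of an operator on \<open>L\<^sup>p\<close>\<close>

text \<open>An (unbounded) operator on \<open>L\<^sup>p\<close> is given by its domain \<open>D\<close> and its action \<open>A\<close> on \<open>D\<close>.\<close>

definition resolvent ::
  "'a::euclidean_space L0 set \<Rightarrow> ('a L0 \<Rightarrow> 'a L0) \<Rightarrow> complex \<Rightarrow> 'a L0 \<Rightarrow> 'a L0" where
  "resolvent D A z = inv_into D (\<lambda>f. A f - cscale z f)"

definition Lp_bounded :: "real \<Rightarrow> ('a::euclidean_space L0 \<Rightarrow> 'a L0) \<Rightarrow> bool" where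
  "Lp_bounded p R \<longleftrightarrow> (\<exists>K. \<forall>g \<in> Lp p. Lp_norm p (R g) \<le> K * Lp_norm p g)"

text \<open>Only meaningful for bounded \<open>R\<close>, since the supremum is real valued.\<close>

definition Lp_opnorm :: "real \<Rightarrow> ('a::euclidean_space L0 \<Rightarrow> 'a L0) \<Rightarrow> real" where
  "Lp_opnorm p R = (SUP g \<in> {g \<in> Lp p. Lp_norm p g \<le> 1}. Lp_norm p (R g))"

definition resolvent_set ::
  "real \<Rightarrow> 'a::euclidean_space L0 set \<Rightarrow> ('a L0 \<Rightarrow> 'a L0) \<Rightarrow> complex set" where
  "resolvent_set p D A =
     {z. bij_betw (\<lambda>f. A f - cscale z f) D (Lp p) \<and> Lp_bounded p (resolvent D A z)}"

definition spectrum ::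
  "real \<Rightarrow> 'a::euclidean_space L0 set \<Rightarrow> ('a L0 \<Rightarrow> 'a L0) \<Rightarrow> complex set" where
  "spectrum p D A = - resolvent_set p D A"

end

theory Submission
  imports Defs "HOL-Probability.Probability"
begin

text \<open>Freezing the force at the pole turns \<open>\<partial>\<^sub>t + P\<close> into an operator with an explicit Gaussian
  fundamental solution \<open>k\<close>, up to a factor \<open>err\<close> that is controlled because \<open>\<nabla>V\<close> is Lipschitz.
  Integrating \<open>e\<^sup>z\<^sup>t k\<close> over a short time interval gives kernels \<open>G\<close>, \<open>E\<close> with
  \<open>f + E f = G (P - z) f\<close>.  By the Schur test the norms of \<open>G\<close> and \<open>E\<close> on \<open>L\<^sup>p\<close> are
  \<open>O(1/|Re z|)\<close>, and that of \<open>G\<close> is \<open>O(|z|\<^sup>-\<^sup>1\<^sup>/\<^sup>2)\<close> since \<open>\<partial>\<^sub>t k\<close> costs \<open>t\<^sup>-\<^sup>2\<close>.  For \<open>Re z \<le> - c\<close> the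
  error \<open>E\<close> is a contraction, which yields the a priori estimate; the same identity for the
  transposed operator and test functions yields solvability by duality.  The remaining part of the
  region is reached from the line \<open>Re z = - c\<close> by a Neumann series, because there the resolvent is
  \<open>O(|Im z|\<^sup>-\<^sup>1\<^sup>/\<^sup>2)\<close> while the distance \<open>Re z + c\<close> is small against \<open>|Im z|\<^sup>1\<^sup>/\<^sup>2\<close>.\<close>

section \<open>Calculus of smooth functions\<close>

text \<open>Diffusion acts in \<open>v\<close> only, and the coefficients \<open>v\<close> and
  \<open>F\<close> are unbounded. Position is smoothed only through transport, so the kernel has
  width \<open>t^(1/2)\<close> in velocity and \<open>t^(3/2)\<close> in position. The unbounded
  coefficients are paid for by the quadratic potential: the factor \<open>exp (- b * W)\<close>
  confines the velocity at the pole to size \<open>t^(-1/2)\<close> and the force there to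
  \<open>t^(-3/2)\<close>. In these weights the error of freezing has order one: a velocity
  deviation \<open>t^(1/2)\<close> meets a velocity \<open>t^(-1/2)\<close>, and a force variation
  \<open>t^(1/2)\<close> meets a logarithmic velocity gradient \<open>t^(-1/2)\<close> of the
  kernel. The time derivative costs \<open>t^(-2)\<close>, because moving at speed
  \<open>t^(-1/2)\<close> across a width \<open>t^(3/2)\<close> changes the kernel at that rate.
  This loss, larger than the diffusive \<open>t^(-1)\<close>, is the source of the exponent 1/2 of
  \<open>Im z\<close> and of the parabolic shape of the region. Since \<open>P f\<close> exists only
  as a distribution, \<open>f\<close> is never differentiated: the kernel, smooth in its second
  argument because the force is frozen at the first, takes the place of the test function.\<close>

primrec Cn :: "nat \<Rightarrow> ('a::euclidean_space \<Rightarrow> 'b::real_normed_vector) \<Rightarrow> bool" where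
  "Cn 0 f \<longleftrightarrow> True"
| "Cn (Suc k) f \<longleftrightarrow> (\<forall>z. f differentiable (at z)) \<and> (\<forall>b\<in>Basis. Cn k (dir_deriv b f))"

lemma iter_partial_append: "iter_partial (bs @ cs) f = iter_partial bs (iter_partial cs f)"
  by (induction bs) auto

text \<open>\<open>smooth\<close> peels partial derivatives off from the outside, \<open>Cn\<close>
  from the inside. The inner recursion suits the sum, product and chain rules, where a first
  derivative is again built from functions of the same kind; taking the list apart at its end
  translates between the two.\<close>

lemma Cn_iff_iter_partial:
  "Cn k f \<longleftrightarrow> (\<forall>bs\<in>lists Basis. length bs < k \<longrightarrow> (\<forall>z. iter_partial bs f differentiable (at z)))"
proof (induction k arbitrary: f)
  case (Suc k)
  show ?case
  proof
    assume *: "Cn (Suc k) f"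
    show "\<forall>bs\<in>lists Basis. length bs < Suc k \<longrightarrow> (\<forall>z. iter_partial bs f differentiable at z)"
    proof (intro ballI impI allI)
      fix bs :: "'a list" and z assume bs: "bs \<in> lists Basis" "length bs < Suc k"
      show "iter_partial bs f differentiable at z"
      proof (cases bs rule: rev_cases)
        case Nil
        then show ?thesis using * by simp
      next
        case (snoc cs c)
        then have "Cn k (dir_deriv c f)" using * bs by auto
        then show ?thesis using Suc.IH[of "dir_deriv c f"] bs snoc by (auto simp: iter_partial_append)
      qed
    qed
  next
    assume *: "\<forall>bs\<in>lists Basis. length bs < Suc k \<longrightarrow> (\<forall>z. iter_partial bs f differentiable at z)"
    have "f differentiable at z" for z
      using *[rule_format, of "[]" z] by simp
    moreover have "Cn k (dir_deriv b f)" if "b \<in> Basis" for b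
      unfolding Suc.IH
    proof (intro ballI impI allI)
      fix bs :: "'a list" and z assume "bs \<in> lists Basis" "length bs < k"
      then show "iter_partial bs (dir_deriv b f) differentiable at z"
        using *[rule_format, of "bs @ [b]" z] that by (simp add: iter_partial_append)
    qed
    ultimately show "Cn (Suc k) f" by simp
  qed
qed simp

lemma smooth_iff_Cn: "smooth f \<longleftrightarrow> (\<forall>k. Cn k f)"
  unfolding smooth_def Cn_iff_iter_partial by blast

lemma smooth_iff:
  "smooth f \<longleftrightarrow> (\<forall>z. f differentiable (at z)) \<and> (\<forall>b\<in>Basis. smooth (dir_deriv b f))"
proof -
  have "smooth f \<longleftrightarrow> (\<forall>k. Cn (Suc k) f)"
    unfolding smooth_iff_Cn by (metis Cn.simps(1) not0_implies_Suc)
  then show ?thesis by (auto simp: smooth_iff_Cn)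
qed

lemma smooth_differentiable: "smooth f \<Longrightarrow> f differentiable (at z)"
  using smooth_iff by blast

lemma smooth_dir_deriv: "smooth f \<Longrightarrow> b \<in> Basis \<Longrightarrow> smooth (dir_deriv b f)"
  using smooth_iff by blast

lemma smooth_continuous_on: "smooth f \<Longrightarrow> continuous_on S f"
  by (auto intro!: continuous_at_imp_continuous_on differentiable_imp_continuous_within
      smooth_differentiable)

lemma dir_deriv_eq: "(f has_derivative f') (at z) \<Longrightarrow> dir_deriv w f z = f' w"
  unfolding dir_deriv_def by (metis frechet_derivative_at)

lemma has_derivative_dir_deriv:
  "f differentiable (at z) \<Longrightarrow> (f has_derivative (\<lambda>w. dir_deriv w f z)) (at z)"
  unfolding dir_deriv_def by (simp add: frechet_derivative_works[symmetric])

lemma Cn_pred: "Cn (Suc k) f \<Longrightarrow> Cn k f"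
  by (simp add: Cn_iff_iter_partial)

lemma Cn_const: "Cn k (\<lambda>z. c)"
proof (induction k arbitrary: c)
  case (Suc k)
  have "dir_deriv b (\<lambda>z. c) = (\<lambda>z. 0)" for b :: 'a
    by (rule ext, rule dir_deriv_eq) (rule has_derivative_const)
  then show ?case using Suc by simp
qed simp

lemma Cn_add: "Cn k f \<Longrightarrow> Cn k g \<Longrightarrow> Cn k (\<lambda>z. f z + g z)"
proof (induction k arbitrary: f g)
  case (Suc k)
  have "dir_deriv b (\<lambda>z. f z + g z) = (\<lambda>z. dir_deriv b f z + dir_deriv b g z)" for b
    by (rule ext, rule dir_deriv_eq)
       (use Suc.prems in \<open>auto intro!: has_derivative_add has_derivative_dir_deriv\<close>)
  then show ?case using Suc by (auto intro: differentiable_add)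
qed simp

lemma Cn_bounded_linear_compose:
  assumes "bounded_linear h"
  shows "Cn k f \<Longrightarrow> Cn k (\<lambda>z. h (f z))"
proof (induction k arbitrary: f)
  case (Suc k)
  have *: "((\<lambda>z. h (f z)) has_derivative (\<lambda>w. h (dir_deriv w f z))) (at z)" for z
    by (rule bounded_linear.has_derivative[OF assms has_derivative_dir_deriv]) (use Suc.prems in auto)
  have "dir_deriv b (\<lambda>z. h (f z)) = (\<lambda>z. h (dir_deriv b f z))" for b
    by (rule ext, rule dir_deriv_eq[OF *])
  then show ?case using Suc * by (auto simp: differentiable_def)
qed simp

lemma Cn_bounded_linear:
  assumes "bounded_linear f"
  shows "Cn k f"
proof (cases k)
  case (Suc j)
  have *: "(f has_derivative f) (at z)" for z
    by (rule bounded_linear_imp_has_derivative[OF assms])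
  have "dir_deriv b f = (\<lambda>z. f b)" for b
    by (rule ext, rule dir_deriv_eq[OF *])
  then show ?thesis using * by (auto simp: Suc Cn_const differentiable_def)
qed simp

lemma Cn_mult:
  fixes f g :: "'a::euclidean_space \<Rightarrow> 'b::real_normed_algebra"
  shows "Cn k f \<Longrightarrow> Cn k g \<Longrightarrow> Cn k (\<lambda>z. f z * g z)"
proof (induction k arbitrary: f g)
  case (Suc k)
  have *: "((\<lambda>z. f z * g z) has_derivative (\<lambda>w. f z * dir_deriv w g z + dir_deriv w f z * g z)) (at z)"
    for z by (rule has_derivative_mult) (use Suc.prems in \<open>auto intro: has_derivative_dir_deriv\<close>)
  have "dir_deriv b (\<lambda>z. f z * g z) = (\<lambda>z. f z * dir_deriv b g z + dir_deriv b f z * g z)" for b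
    by (rule ext, rule dir_deriv_eq[OF *])
  moreover have "(\<lambda>z. f z * g z) differentiable (at z)" for z
    unfolding differentiable_def using * by blast
  ultimately show ?case using Suc.prems Cn_pred[OF Suc.prems(1)] Cn_pred[OF Suc.prems(2)]
    by (simp add: Cn_add Suc.IH)
qed simp

lemma Cn_compose:
  fixes f :: "'a::euclidean_space \<Rightarrow> real" and h :: "real \<Rightarrow> real"
  shows "Cn k h \<Longrightarrow> Cn k f \<Longrightarrow> Cn k (\<lambda>z. h (f z))"
proof (induction k arbitrary: h)
  case (Suc k)
  have *: "((\<lambda>z. h (f z)) has_derivative (\<lambda>w. dir_deriv 1 h (f z) * dir_deriv w f z)) (at z)" for z
  proof -
    have "(h has_derivative (\<lambda>w. dir_deriv w h (f z))) (at (f z))"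
      using Suc.prems(1) by (intro has_derivative_dir_deriv) simp
    moreover have "(\<lambda>w. dir_deriv w h (f z)) = (\<lambda>w. dir_deriv 1 h (f z) * w)"
    proof
      fix w
      have "linear (\<lambda>w. dir_deriv w h (f z))"
        by (rule has_derivative_linear[OF calculation])
      from linear_scale[OF this, of w 1] show "dir_deriv w h (f z) = dir_deriv 1 h (f z) * w"
        by (simp add: mult.commute)
    qed
    ultimately have "(h has_derivative (\<lambda>w. dir_deriv 1 h (f z) * w)) (at (f z))" by (rule back_subst)
    moreover have "(f has_derivative (\<lambda>w. dir_deriv w f z)) (at z)"
      using Suc.prems(2) by (intro has_derivative_dir_deriv) simp
    ultimately show ?thesis by (rule has_derivative_compose[where g=h, rotated])
  qed
  have "dir_deriv b (\<lambda>z. h (f z)) = (\<lambda>z. dir_deriv 1 h (f z) * dir_deriv b f z)" for b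
    by (rule ext, rule dir_deriv_eq[OF *])
  moreover have "Cn k (\<lambda>z. dir_deriv 1 h (f z))"
    using Suc.prems(1) Cn_pred[OF Suc.prems(2)] by (simp add: Suc.IH[of "dir_deriv 1 h"])
  moreover have "(\<lambda>z. h (f z)) differentiable (at z)" for z
    unfolding differentiable_def using * by blast
  ultimately show ?case using Suc.prems(2) by (simp add: Cn_mult)
qed simp

lemma smooth_const: "smooth (\<lambda>z. c)"
  by (simp add: smooth_iff_Cn Cn_const)

lemma smooth_add: "smooth f \<Longrightarrow> smooth g \<Longrightarrow> smooth (\<lambda>z. f z + g z)"
  by (simp add: smooth_iff_Cn Cn_add)

lemma smooth_bounded_linear: "bounded_linear f \<Longrightarrow> smooth f"
  by (simp add: smooth_iff_Cn Cn_bounded_linear)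

lemma smooth_bounded_linear_compose: "bounded_linear h \<Longrightarrow> smooth f \<Longrightarrow> smooth (\<lambda>z. h (f z))"
  unfolding smooth_iff_Cn by (blast intro: Cn_bounded_linear_compose)

lemma smooth_mult:
  fixes f g :: "'a::euclidean_space \<Rightarrow> 'b::real_normed_algebra"
  shows "smooth f \<Longrightarrow> smooth g \<Longrightarrow> smooth (\<lambda>z. f z * g z)"
  by (simp add: smooth_iff_Cn Cn_mult)

lemma smooth_compose:
  fixes f :: "'a::euclidean_space \<Rightarrow> real" and h :: "real \<Rightarrow> real"
  shows "smooth h \<Longrightarrow> smooth f \<Longrightarrow> smooth (\<lambda>z. h (f z))"
  unfolding smooth_iff_Cn by (blast intro: Cn_compose)

lemma smooth_sum: "(\<And>i. i \<in> I \<Longrightarrow> smooth (f i)) \<Longrightarrow> smooth (\<lambda>z. \<Sum>i\<in>I. f i z)"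
  by (induction I rule: infinite_finite_induct) (auto intro: smooth_const smooth_add)

lemma smooth_prod:
  fixes f :: "'i \<Rightarrow> 'a::euclidean_space \<Rightarrow> 'b::{real_normed_algebra, comm_ring_1}"
  shows "(\<And>i. i \<in> I \<Longrightarrow> smooth (f i)) \<Longrightarrow> smooth (\<lambda>z. \<Prod>i\<in>I. f i z)"
  by (induction I rule: infinite_finite_induct) (auto intro: smooth_const smooth_mult)

lemma smooth_of_real: "smooth f \<Longrightarrow> smooth (\<lambda>z. complex_of_real (f z))"
  by (rule smooth_bounded_linear_compose[OF bounded_linear_of_real])

lemma smooth_exp: "smooth (exp :: real \<Rightarrow> real)"
proof -
  have "Cn k (exp :: real \<Rightarrow> real)" for k
  proof (induction k)
    case (Suc k)
    have *: "(exp has_derivative (\<lambda>w. exp x * w)) (at x)" for x :: real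
      using DERIV_exp[of x] by (simp add: has_field_derivative_def mult_commute_abs)
    then have "dir_deriv 1 exp = (exp :: real \<Rightarrow> real)" and "exp differentiable at x" for x :: real
      by (auto simp: dir_deriv_eq[OF *] fun_eq_iff differentiable_def)
    then show ?case using Suc by auto
  qed simp
  then show ?thesis by (simp add: smooth_iff_Cn)
qed

lemma smooth_norm_sq:
  fixes f :: "'a::euclidean_space \<Rightarrow> 'b::euclidean_space"
  assumes "smooth f" shows "smooth (\<lambda>z. (norm (f z))\<^sup>2)"
proof -
  have "(norm (f z))\<^sup>2 = (\<Sum>b\<in>Basis. (f z \<bullet> b) * (f z \<bullet> b))" for z
    unfolding power2_norm_eq_inner by (rule euclidean_inner)
  then show ?thesis
    by (simp add: smooth_sum smooth_mult smooth_bounded_linear_compose[OF bounded_linear_inner_left assms])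
qed

text \<open>The classical function \<open>exp (- 1 / x)\<close> extended by zero. The powers of
  \<open>1 / x\<close> make the family closed under differentiation, so that one induction over the
  order covers all \<open>j\<close>; \<open>flat 0\<close> later builds the bumps on boxes and the
  radial cut-off.\<close>

definition flat :: "nat \<Rightarrow> real \<Rightarrow> real" where
  "flat j x = (if x > 0 then exp (- inverse x) * inverse x ^ j else 0)"

lemma flat_deriv:
  "(flat j has_real_derivative (flat (j + 2) x - real j * flat (Suc j) x)) (at x)"
proof -
  consider "x > 0" | "x < 0" | "x = 0" by linarith
  then show ?thesis
  proof cases
    case 1
    have "((\<lambda>x. exp (- inverse x) * inverse x ^ j) has_real_derivative
      exp (- inverse x) * (inverse x * inverse x) * inverse x ^ j
      - exp (- inverse x) * (real j * inverse x ^ (j - 1) * (inverse x * inverse x))) (at x)"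
      using 1 by (auto intro!: derivative_eq_intros)
    moreover have "exp (- inverse x) * (inverse x * inverse x) * inverse x ^ j
      - exp (- inverse x) * (real j * inverse x ^ (j - 1) * (inverse x * inverse x))
      = flat (j + 2) x - real j * flat (Suc j) x"
      using 1 by (cases j) (simp_all add: flat_def)
    ultimately have "((\<lambda>x. exp (- inverse x) * inverse x ^ j) has_real_derivative
      (flat (j + 2) x - real j * flat (Suc j) x)) (at x)"
      by simp
    then show ?thesis
      by (rule has_field_derivative_transform_within_open[where S="{0<..}"]) (use 1 in \<open>auto simp: flat_def\<close>)
  next
    case 2
    have "((\<lambda>x. 0) has_real_derivative 0) (at x)" by simp
    then have "(flat j has_real_derivative 0) (at x)"
      by (rule has_field_derivative_transform_within_open[where S="{..<0}"]) (use 2 in \<open>auto simp: flat_def\<close>)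
    then show ?thesis using 2 by (simp add: flat_def)
  next
    case 3
    have r: "((\<lambda>x. exp (- inverse x) * inverse x ^ (Suc j)) \<longlongrightarrow> 0) (at_right (0::real))"
      by real_asymp
    have "((\<lambda>y. flat j y / y) \<longlongrightarrow> 0) (at_right 0)"
      by (rule Lim_transform_eventually[OF r])
         (auto simp: eventually_at_right_field flat_def field_simps intro!: exI[of _ 1])
    moreover have "((\<lambda>y. flat j y / y) \<longlongrightarrow> 0) (at_left 0)"
      by (rule Lim_transform_eventually[OF tendsto_const])
         (auto simp: eventually_at_left_field flat_def intro!: exI[of _ "-1"])
    ultimately have "((\<lambda>y. flat j y / y) \<longlongrightarrow> 0) (at 0)"
      by (simp add: filterlim_split_at)
    then show ?thesis using 3 by (simp add: has_field_derivative_iff flat_def)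
  qed
qed

lemma smooth_flat: "smooth (flat j)"
proof -
  have "Cn k (flat j)" for k
  proof (induction k arbitrary: j)
    case (Suc k)
    have *: "(flat j has_derivative (\<lambda>w. (flat (j + 2) x - real j * flat (Suc j) x) * w)) (at x)" for x
      using flat_deriv[of j x] by (simp add: has_field_derivative_def)
    have "dir_deriv 1 (flat j) = (\<lambda>x. flat (j + 2) x + (- real j) * flat (Suc j) x)"
      by (rule ext) (simp add: dir_deriv_eq[OF *])
    moreover have "Cn k (\<lambda>x. flat (j + 2) x + (- real j) * flat (Suc j) x)"
      by (rule Cn_add[OF Suc.IH Cn_mult[OF Cn_const Suc.IH]])
    moreover have "flat j differentiable at x" for x unfolding differentiable_def using * by blast
    ultimately show ?case by (simp del: add_2_eq_Suc')
  qed simp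
  then show ?thesis by (simp add: smooth_iff_Cn)
qed

section \<open>Test functions and the fundamental lemma\<close>

lemma test_functions_iff:
  "\<phi> \<in> test_functions \<longleftrightarrow> smooth \<phi> \<and> (\<exists>R. \<forall>z. R < norm z \<longrightarrow> \<phi> z = 0)"
proof -
  have "compact (closure {z. \<phi> z \<noteq> 0}) \<longleftrightarrow> bounded {z. \<phi> z \<noteq> 0}"
    using bounded_closure bounded_subset closure_subset compact_eq_bounded_closed closed_closure by metis
  also have "\<dots> \<longleftrightarrow> (\<exists>R. \<forall>z. R < norm z \<longrightarrow> \<phi> z = 0)"
    unfolding bounded_iff by (auto simp: not_less[symmetric])
  finally show ?thesis by (simp add: test_functions_def)
qed

lemma test_function_smooth: "\<phi> \<in> test_functions \<Longrightarrow> smooth \<phi>"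
  by (simp add: test_functions_iff)

lemma test_function_continuous: "\<phi> \<in> test_functions \<Longrightarrow> continuous_on S \<phi>"
  by (simp add: test_functions_iff smooth_continuous_on)

lemma test_function_measurable [measurable_dest]:
  "\<phi> \<in> test_functions \<Longrightarrow> \<phi> \<in> borel_measurable borel"
  by (simp add: borel_measurable_continuous_onI test_function_continuous)

lemma test_function_dir_deriv:
  assumes "\<phi> \<in> test_functions" "b \<in> Basis" shows "dir_deriv b \<phi> \<in> test_functions"
proof -
  obtain R where R: "\<And>z. R < norm z \<Longrightarrow> \<phi> z = 0" using assms by (auto simp: test_functions_iff)
  have "dir_deriv b \<phi> z = 0" if "R < norm z" for z
  proof -
    have "((\<lambda>z. 0) has_derivative (\<lambda>w. 0)) (at z)" by simp
    moreover have "open {z::'a. R < norm z}" by (intro open_Collect_less continuous_intros)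
    ultimately have "(\<phi> has_derivative (\<lambda>w. 0)) (at z)"
      by (rule has_derivative_transform_within_open[where f="\<lambda>z. 0" and s="{z. R < norm z}"]) (use that R in auto)
    then show ?thesis by (rule dir_deriv_eq)
  qed
  then show ?thesis using assms smooth_dir_deriv by (auto simp: test_functions_iff)
qed

lemma test_function_mult:
  "\<phi> \<in> test_functions \<Longrightarrow> smooth a \<Longrightarrow> (\<lambda>z. a z * \<phi> z) \<in> test_functions"
  by (auto simp: test_functions_iff smooth_mult)

lemma continuous_compact_support_bounded:
  fixes \<phi> :: "'a::euclidean_space \<Rightarrow> 'b::real_normed_vector"
  assumes "continuous_on UNIV \<phi>" "\<And>z. R < norm z \<Longrightarrow> \<phi> z = 0"
  obtains C where "C > 0" "\<And>z. norm (\<phi> z) \<le> C * indicator (cball 0 R) z"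
proof -
  have "compact (\<phi> ` cball 0 R)"
    by (intro compact_continuous_image continuous_on_subset[OF assms(1)]) auto
  from bounded_pos[THEN iffD1, OF compact_imp_bounded[OF this]]
  obtain C where C: "C > 0" "\<And>z. z \<in> cball 0 R \<Longrightarrow> norm (\<phi> z) \<le> C" by auto
  show thesis
  proof (rule that[OF C(1)])
    show "norm (\<phi> z) \<le> C * indicator (cball 0 R) z" for z
      using C(2)[of z] assms(2)[of z] by (cases "R < norm z") (auto simp: indicator_def)
  qed
qed

lemma test_function_bounded:
  assumes "\<phi> \<in> test_functions"
  obtains C R where "C > 0" "\<And>z. norm (\<phi> z) \<le> C * indicator (cball 0 R) z"
proof -
  obtain R where "\<And>z. R < norm z \<Longrightarrow> \<phi> z = 0" using assms by (auto simp: test_functions_iff)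
  then show thesis
    using continuous_compact_support_bounded[OF test_function_continuous[OF assms]] that by metis
qed

definition locally_integrable :: "('a::euclidean_space \<Rightarrow> complex) \<Rightarrow> bool" where
  "locally_integrable f \<longleftrightarrow> f \<in> borel_measurable borel
     \<and> (\<forall>R. integrable lborel (\<lambda>z. indicator (cball 0 R) z *\<^sub>R f z))"

lemma locally_integrable_mult:
  assumes f: "locally_integrable f" and [measurable]: "\<phi> \<in> borel_measurable borel"
    and C: "\<And>z. norm (\<phi> z) \<le> C * indicator (cball 0 R) z"
  shows "integrable lborel (\<lambda>z. f z * \<phi> z)"
proof -
  have [measurable]: "f \<in> borel_measurable borel" using f by (simp add: locally_integrable_def)
  have "integrable lborel (\<lambda>z. C *\<^sub>R (indicator (cball 0 R) z *\<^sub>R f z))"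
    using f unfolding locally_integrable_def by (intro integrable_scaleR_right) auto
  then show ?thesis
  proof (rule Bochner_Integration.integrable_bound)
    have "norm (f z * \<phi> z) \<le> norm (C *\<^sub>R (indicator (cball 0 R) z *\<^sub>R f z))" for z
    proof -
      have "norm (f z * \<phi> z) \<le> norm (f z) * (C * indicator (cball 0 R) z)"
        unfolding norm_mult by (intro mult_left_mono C) auto
      also have "\<dots> = C * (indicator (cball 0 R) z * norm (f z))" by simp
      also have "\<dots> \<le> \<bar>C\<bar> * (indicator (cball 0 R) z * norm (f z))"
        by (intro mult_right_mono) auto
      finally show ?thesis by (simp add: norm_mult abs_mult mult.assoc)
    qed
    then show "AE z in lborel. norm (f z * \<phi> z) \<le> norm (C *\<^sub>R (indicator (cball 0 R) z *\<^sub>R f z))"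
      by simp
  qed measurable
qed

lemma locally_integrable_test:
  "locally_integrable f \<Longrightarrow> \<phi> \<in> test_functions \<Longrightarrow> integrable lborel (\<lambda>z. f z * \<phi> z)"
  by (metis locally_integrable_mult test_function_bounded test_function_measurable)

text \<open>Since \<open>ennreal\<close> sends negative numbers to 0, the two densities are the
  positive and the negative part of \<open>r\<close>. The hypotheses make the measures finite and
  equal on boxes, an intersection-stable generator, so the measures and hence the densities agree;
  and a number equal to its own negative part in this way is 0.\<close>

lemma AE_zero_of_box_integrals_zero:
  fixes r :: "'a::euclidean_space \<Rightarrow> real"
  assumes [measurable]: "r \<in> borel_measurable borel"
    and int: "\<And>l u. integrable lborel (\<lambda>z. indicator (box l u) z * r z)"
    and zero: "\<And>l u. (\<integral>z. indicator (box l u) z * r z \<partial>lborel) = 0"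
  shows "AE z in lborel. r z = 0"
proof -
  define M where "M = density lborel (\<lambda>z. ennreal (r z))"
  define N where "N = density lborel (\<lambda>z. ennreal (- r z))"
  have M: "emeasure M (box l u) = (\<integral>\<^sup>+z. ennreal (indicator (box l u) z * r z) \<partial>lborel)" for l u
    unfolding M_def by (subst emeasure_density) (auto intro!: nn_integral_cong simp: indicator_def)
  have N: "emeasure N (box l u) = (\<integral>\<^sup>+z. ennreal (- (indicator (box l u) z * r z)) \<partial>lborel)" for l u
    unfolding N_def by (subst emeasure_density) (auto intro!: nn_integral_cong simp: indicator_def)
  have fin: "emeasure M (box l u) \<noteq> \<infinity>" "emeasure N (box l u) \<noteq> \<infinity>" for l u
    using int[of l u] unfolding M N real_integrable_def by auto
  have eq: "emeasure M (box l u) = emeasure N (box l u)" for l u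
  proof -
    have "enn2real (emeasure M (box l u)) = enn2real (emeasure N (box l u))"
      using zero[of l u] unfolding real_lebesgue_integral_def[OF int] M N by simp
    then show ?thesis using fin[of l u] by (metis enn2real_eq_0_iff ennreal_enn2real infinity_ennreal_def top.not_eq_extremum)
  qed
  have "M = N"
  proof (rule measure_eqI_generator_eq)
    let ?E = "range (\<lambda>(a, b). box a b::'a set)"
    show "Int_stable ?E"
      by (auto simp: Int_stable_def box_Int_box)
    show "?E \<subseteq> Pow UNIV" "sets M = sigma_sets UNIV ?E" "sets N = sigma_sets UNIV ?E"
      by (simp_all add: borel_eq_box M_def N_def)
    let ?A = "\<lambda>n::nat. box (- (real n *\<^sub>R One)) (real n *\<^sub>R One) :: 'a set"
    show "range ?A \<subseteq> ?E" "(\<Union>i. ?A i) = UNIV"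
      unfolding UN_box_eq_UNIV by auto
    show "emeasure M (?A i) \<noteq> \<infinity>" for i using fin by auto
    show "emeasure M X = emeasure N X" if "X \<in> ?E" for X
      using that eq by auto
  qed
  then have "AE z in lborel. ennreal (r z) = ennreal (- r z)"
    unfolding M_def N_def
    by (intro sigma_finite_measure.density_unique[OF sigma_finite_lborel]) auto
  then show ?thesis
  proof eventually_elim
    case (elim z)
    then show ?case by (cases "r z \<ge> 0") (auto simp: ennreal_neg)
  qed
qed

text \<open>Smooth functions that lie below the indicator of the box and converge to it: increasing
  \<open>k\<close> steepens every factor towards 1 inside the box.\<close>

definition box_bump :: "'a::euclidean_space \<Rightarrow> 'a \<Rightarrow> nat \<Rightarrow> 'a \<Rightarrow> real" where
  "box_bump l u k z =
     (\<Prod>b\<in>Basis. flat 0 (real k * ((z - l) \<bullet> b)) * flat 0 (real k * ((u - z) \<bullet> b)))"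

lemma smooth_affine_inner: "smooth (\<lambda>z::'a::euclidean_space. c * ((z - l) \<bullet> b))"
proof -
  have "smooth (\<lambda>z::'a. (\<lambda>z. c * (z \<bullet> b)) z + (- c * (l \<bullet> b)))"
    by (intro smooth_add smooth_const smooth_bounded_linear bounded_linear_intros)
  then show ?thesis by (simp add: inner_diff_left algebra_simps)
qed

lemma box_bump_smooth: "smooth (box_bump l u k)"
proof -
  have "smooth (\<lambda>z. flat 0 (real k * ((z - l) \<bullet> b)))" for b
    by (rule smooth_compose[OF smooth_flat smooth_affine_inner])
  moreover have "smooth (\<lambda>z. flat 0 (real k * ((u - z) \<bullet> b)))" for b
  proof -
    have "smooth (\<lambda>z. flat 0 (- real k * ((z - u) \<bullet> b)))"
      by (rule smooth_compose[OF smooth_flat smooth_affine_inner])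
    then show ?thesis by (simp add: inner_diff_left algebra_simps)
  qed
  ultimately show ?thesis unfolding box_bump_def[abs_def]
    by (intro smooth_prod smooth_mult) auto
qed

lemma flat_0_bounds: "0 \<le> flat 0 x" "flat 0 x \<le> 1" "x \<le> 0 \<Longrightarrow> flat 0 x = 0"
  by (auto simp: flat_def)

lemma box_bump_bounds: "0 \<le> box_bump l u k z" "box_bump l u k z \<le> indicator (box l u) z"
proof -
  show "0 \<le> box_bump l u k z" unfolding box_bump_def
    by (intro prod_nonneg ballI mult_nonneg_nonneg flat_0_bounds)
  show "box_bump l u k z \<le> indicator (box l u) z"
  proof (cases "z \<in> box l u")
    case True
    have "box_bump l u k z \<le> (\<Prod>b\<in>(Basis::'a set). 1)" unfolding box_bump_def
      by (intro prod_mono conjI mult_nonneg_nonneg mult_le_one flat_0_bounds)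
    then show ?thesis using True by simp
  next
    case False
    then obtain b where b: "b \<in> Basis" "(z - l) \<bullet> b \<le> 0 \<or> (u - z) \<bullet> b \<le> 0"
      by (auto simp: box_def inner_diff_left not_less)
    then have "flat 0 (real k * ((z - l) \<bullet> b)) * flat 0 (real k * ((u - z) \<bullet> b)) = 0"
      using flat_0_bounds(3) mult_nonneg_nonpos[of "real k"] by fastforce
    then have "box_bump l u k z = 0" unfolding box_bump_def using b by (intro prod_zero) auto
    then show ?thesis by simp
  qed
qed

lemma box_bump_tendsto: "(\<lambda>k. box_bump l u k z) \<longlonglongrightarrow> indicator (box l u) z"
proof (cases "z \<in> box l u")
  case True
  have *: "(\<lambda>k. flat 0 (real k * x)) \<longlonglongrightarrow> 1" if "x > 0" for x
  proof -
    have "(\<lambda>k. exp (- inverse (real k * x))) \<longlonglongrightarrow> 1"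
      using that by real_asymp
    then show ?thesis
      by (rule Lim_transform_eventually)
         (use that in \<open>auto simp: flat_def eventually_at_top_linorder intro!: exI[of _ 1]\<close>)
  qed
  have "(\<lambda>k. box_bump l u k z) \<longlonglongrightarrow> (\<Prod>b\<in>(Basis::'a set). 1 * 1)" unfolding box_bump_def
    by (intro tendsto_prod tendsto_mult *) (use True in \<open>auto simp: box_def inner_diff_left\<close>)
  then show ?thesis using True by simp
next
  case False
  then have "box_bump l u k z = 0" for k
    using box_bump_bounds[of l u k z] by (simp add: indicator_def)
  then show ?thesis using False by simp
qed

lemma box_bump_test: "(\<lambda>z. complex_of_real (box_bump l u k z)) \<in> test_functions"
proof -
  obtain R where R: "\<And>z. z \<in> box l u \<Longrightarrow> norm z \<le> R"
    using bounded_box[of l u] by (auto simp: bounded_iff)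
  have "box_bump l u k z = 0" if "R < norm z" for z
  proof -
    have "z \<notin> box l u" using R[of z] that by auto
    then show ?thesis using box_bump_bounds[of l u k z] by (simp add: indicator_def)
  qed
  then show ?thesis by (auto simp: test_functions_iff intro!: smooth_of_real box_bump_smooth)
qed

text \<open>The bumps are dominated by the indicator of their box, so the integrals of
  \<open>h\<close> over all boxes are limits of vanishing test integrals. Real and imaginary part
  are then treated separately.\<close>

lemma fundamental_lemma:
  fixes h :: "'a::euclidean_space \<Rightarrow> complex"
  assumes h: "locally_integrable h"
    and zero: "\<And>\<phi>. \<phi> \<in> test_functions \<Longrightarrow> (\<integral>z. h z * \<phi> z \<partial>lborel) = 0"
  shows "AE z in lborel. h z = 0"
proof -
  have [measurable]: "h \<in> borel_measurable borel" using h by (simp add: locally_integrable_def)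
  have [measurable]: "box_bump l u k \<in> borel_measurable borel" for l u :: 'a and k
    by (intro borel_measurable_continuous_onI smooth_continuous_on box_bump_smooth)
  have int: "integrable lborel (\<lambda>z. indicator (box l u) z *\<^sub>R h z)" for l u
  proof -
    obtain R where R: "\<And>z. z \<in> box l u \<Longrightarrow> norm z \<le> R"
      using bounded_box[of l u] by (auto simp: bounded_iff)
    have "integrable lborel (\<lambda>z. indicator (cball 0 R) z *\<^sub>R h z)"
      using h by (simp add: locally_integrable_def)
    then show ?thesis
      by (rule Bochner_Integration.integrable_bound) (use R in \<open>auto simp: indicator_def\<close>)
  qed
  have z: "(\<integral>z. indicator (box l u) z *\<^sub>R h z \<partial>lborel) = 0" for l u
  proof -
    have "(\<lambda>k. \<integral>z. box_bump l u k z *\<^sub>R h z \<partial>lborel) \<longlonglongrightarrow> (\<integral>z. indicator (box l u) z *\<^sub>R h z \<partial>lborel)"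
    proof (rule integral_dominated_convergence)
      show "integrable lborel (\<lambda>z. norm (indicator (box l u) z *\<^sub>R h z))"
        using int by (rule integrable_norm)
      show "AE z in lborel. (\<lambda>k. box_bump l u k z *\<^sub>R h z) \<longlonglongrightarrow> indicator (box l u) z *\<^sub>R h z"
        by (intro AE_I2 tendsto_scaleR tendsto_const box_bump_tendsto)
      show "AE z in lborel. norm (box_bump l u k z *\<^sub>R h z) \<le> norm (indicator (box l u) z *\<^sub>R h z)" for k
        using box_bump_bounds[of l u k] by (auto intro!: AE_I2 mult_right_mono)
    qed measurable
    moreover have "(\<integral>z. box_bump l u k z *\<^sub>R h z \<partial>lborel) = 0" for k
      using zero[OF box_bump_test[of l u k]] by (simp add: scaleR_conv_of_real mult.commute)
    ultimately have "(\<lambda>k::nat. 0) \<longlonglongrightarrow> (\<integral>z. indicator (box l u) z *\<^sub>R h z \<partial>lborel)" by simp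
    then show ?thesis by (simp add: LIMSEQ_const_iff)
  qed
  have "AE z in lborel. Re (h z) = 0"
  proof (rule AE_zero_of_box_integrals_zero)
    fix l u
    show "integrable lborel (\<lambda>z. indicator (box l u) z * Re (h z))"
      using integrable_Re[OF int[of l u]] by simp
    show "(\<integral>z. indicator (box l u) z * Re (h z) \<partial>lborel) = 0"
      using integral_Re[OF int[of l u]] z[of l u] by simp
  qed measurable
  moreover have "AE z in lborel. Im (h z) = 0"
  proof (rule AE_zero_of_box_integrals_zero)
    fix l u
    show "integrable lborel (\<lambda>z. indicator (box l u) z * Im (h z))"
      using integrable_Im[OF int[of l u]] by simp
    show "(\<integral>z. indicator (box l u) z * Im (h z) \<partial>lborel) = 0"
      using integral_Im[OF int[of l u]] z[of l u] by simp
  qed measurable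
  ultimately show ?thesis by eventually_elim (simp add: complex_eq_iff)
qed

section \<open>Integrals of derivatives of test functions\<close>

lemma lborel_integral_translate:
  fixes f :: "'a::euclidean_space \<Rightarrow> 'b::{banach, second_countable_topology}"
  assumes [measurable]: "f \<in> borel_measurable borel"
  shows "(\<integral>z. f (c + z) \<partial>lborel) = (\<integral>z. f z \<partial>lborel)"
proof -
  have "(\<integral>z. f z \<partial>lborel) = (\<integral>z. f z \<partial>distr lborel borel ((+) c))"
    by (simp add: lborel_distr_plus)
  also have "\<dots> = (\<integral>z. f (c + z) \<partial>lborel)"
    by (subst integral_distr) auto
  finally show ?thesis by simp
qed

text \<open>Every difference quotient has integral zero by translation invariance, and the quotients
  converge dominatedly to the derivative. This is the only integration by parts that the
  transposition of the operator requires.\<close>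

lemma integral_dir_deriv_test:
  assumes \<phi>: "\<phi> \<in> test_functions" and w: "w \<in> Basis"
  shows "(\<integral>z. dir_deriv w \<phi> z \<partial>lborel) = 0"
proof -
  have [measurable]: "\<phi> \<in> borel_measurable borel" "dir_deriv w \<phi> \<in> borel_measurable borel"
    using \<phi> test_function_dir_deriv[OF \<phi> w] by measurable
  obtain C R where C: "C > 0" "\<And>z. norm (dir_deriv w \<phi> z) \<le> C * indicator (cball 0 R) z"
    using test_function_bounded[OF test_function_dir_deriv[OF \<phi> w]] by metis
  obtain R' where R': "\<And>z. R' < norm z \<Longrightarrow> \<phi> z = 0" using \<phi> by (auto simp: test_functions_iff)
  obtain C' where C': "C' > 0" "\<And>z. norm (\<phi> z) \<le> C' * indicator (cball 0 R') z"
    using continuous_compact_support_bounded[OF test_function_continuous[OF \<phi>] R'] by metis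
  have int: "integrable lborel \<phi>"
  proof (rule Bochner_Integration.integrable_bound)
    show "integrable lborel (\<lambda>z::'a. C' * indicator (cball 0 R') z)"
      by (intro integrable_mult_right integrable_real_indicator)
         (auto intro: emeasure_lborel_cball_finite[unfolded infinity_ennreal_def])
  qed (use C' in \<open>auto simp: abs_mult\<close>)
  have int': "integrable lborel (\<lambda>z. \<phi> (s *\<^sub>R w + z))" for s
  proof -
    have "integrable (distr lborel borel ((+) (s *\<^sub>R w))) \<phi>" using int by (simp add: lborel_distr_plus)
    then show ?thesis by (subst (asm) integrable_distr_eq) auto
  qed
  have line: "((\<lambda>s. \<phi> (s *\<^sub>R w + z)) has_derivative (\<lambda>r. r *\<^sub>R dir_deriv w \<phi> (s *\<^sub>R w + z))) (at s)" for s z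
  proof -
    have d: "(\<phi> has_derivative (\<lambda>v. dir_deriv v \<phi> (s *\<^sub>R w + z))) (at (s *\<^sub>R w + z))"
      by (intro has_derivative_dir_deriv smooth_differentiable test_function_smooth \<phi>)
    have "((\<lambda>s. s *\<^sub>R w + z) has_derivative (\<lambda>r. r *\<^sub>R w)) (at s)"
      by (auto intro!: derivative_eq_intros)
    from has_derivative_compose[OF this d]
    have "((\<lambda>s. \<phi> (s *\<^sub>R w + z)) has_derivative (\<lambda>r. dir_deriv (r *\<^sub>R w) \<phi> (s *\<^sub>R w + z))) (at s)" .
    moreover have "dir_deriv (r *\<^sub>R w) \<phi> (s *\<^sub>R w + z) = r *\<^sub>R dir_deriv w \<phi> (s *\<^sub>R w + z)" for r
      using linear_scale[OF has_derivative_linear[OF d]] .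
    ultimately show ?thesis by simp
  qed
  define q where "q k z = real (Suc k) *\<^sub>R (\<phi> ((1 / real (Suc k)) *\<^sub>R w + z) - \<phi> z)" for k z
  have "(\<lambda>k. \<integral>z. q k z \<partial>lborel) \<longlonglongrightarrow> (\<integral>z. dir_deriv w \<phi> z \<partial>lborel)"
  proof (rule integral_dominated_convergence)
    \<comment> \<open>The steps are at most 1, so a quotient vanishes outside the support of
      \<open>\<phi>\<close> enlarged by \<open>norm w\<close>; inside this ball the mean value
      inequality bounds it by the supremum of the derivative.\<close>
    show "integrable lborel (\<lambda>z::'a. C * indicator (cball 0 (R' + norm w)) z)"
      by (intro integrable_mult_right integrable_real_indicator)
         (auto intro: emeasure_lborel_cball_finite[unfolded infinity_ennreal_def])
    show "AE z in lborel. norm (q k z) \<le> C * indicator (cball 0 (R' + norm w)) z" for k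
    proof (rule AE_I2)
      fix z
      let ?s = "1 / real (Suc k)"
      show "norm (q k z) \<le> C * indicator (cball 0 (R' + norm w)) z"
      proof (cases "norm z \<le> R' + norm w")
        case True
        have "norm (\<phi> (?s *\<^sub>R w + z) - \<phi> (0 *\<^sub>R w + z)) \<le> C * norm (?s - 0)"
        proof (rule differentiable_bound[OF convex_UNIV])
          show "((\<lambda>s. \<phi> (s *\<^sub>R w + z)) has_derivative (\<lambda>r. r *\<^sub>R dir_deriv w \<phi> (s *\<^sub>R w + z))) (at s)" for s
            by (rule line)
          show "onorm (\<lambda>r. r *\<^sub>R dir_deriv w \<phi> (s *\<^sub>R w + z)) \<le> C" for s
          proof (rule onorm_le)
            fix r :: real
            have "norm (dir_deriv w \<phi> (s *\<^sub>R w + z)) \<le> C"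
              using C(2)[of "s *\<^sub>R w + z"] C(1) by (auto simp: indicator_def of_bool_def split: if_splits)
            then show "norm (r *\<^sub>R dir_deriv w \<phi> (s *\<^sub>R w + z)) \<le> C * norm r"
              by (metis mult.commute mult_right_mono norm_ge_zero norm_scaleR real_norm_def)
          qed
        qed auto
        then have "norm (\<phi> (?s *\<^sub>R w + z) - \<phi> z) \<le> C * ?s" by (simp del: of_nat_Suc)
        then have "real (Suc k) * norm (\<phi> (?s *\<^sub>R w + z) - \<phi> z) \<le> real (Suc k) * (C * ?s)"
          by (rule mult_left_mono) simp
        moreover have "real (Suc k) * (C * ?s) = C" by (simp del: of_nat_Suc)
        moreover have "norm (q k z) = real (Suc k) * norm (\<phi> (?s *\<^sub>R w + z) - \<phi> z)"
          unfolding q_def norm_scaleR by simp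
        moreover have "indicat_real (cball 0 (R' + norm w)) z = 1" using True by simp
        ultimately show ?thesis by simp
      next
        case False
        have "?s * norm w \<le> 1 * norm w" by (rule mult_right_mono) auto
        then have "norm (?s *\<^sub>R w) \<le> norm w" unfolding norm_scaleR by simp
        then have "R' < norm (?s *\<^sub>R w + z)"
          using False norm_triangle_ineq4[of "?s *\<^sub>R w + z" "?s *\<^sub>R w"] by (simp only: add_diff_cancel_left')
        then have 1: "\<phi> (?s *\<^sub>R w + z) = 0" by (rule R')
        have "R' < norm z" using False norm_ge_zero[of w] by linarith
        then have "\<phi> z = 0" by (rule R')
        with 1 show ?thesis unfolding q_def using C(1) by simp
      qed
    qed
    show "AE z in lborel. (\<lambda>k. q k z) \<longlonglongrightarrow> dir_deriv w \<phi> z"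
    proof (rule AE_I2)
      fix z
      let ?D = "dir_deriv w \<phi> z"
      define X where "X s = \<phi> (s *\<^sub>R w + z) - \<phi> z" for s
      have lim: "((\<lambda>s. norm (X s - s *\<^sub>R ?D) / norm s) \<longlongrightarrow> 0) (at 0)"
        using line[where z=z and s=0] unfolding has_derivative_at X_def by simp
      have eq: "norm (X s - s *\<^sub>R ?D) / norm s = norm (X s /\<^sub>R s - ?D)" if "s \<noteq> 0" for s
      proof -
        have "X s /\<^sub>R s - ?D = inverse s *\<^sub>R (X s - s *\<^sub>R ?D)"
          using that by (simp add: scaleR_diff_right)
        then show ?thesis by (simp add: divide_inverse mult.commute)
      qed
      have "\<forall>\<^sub>F s in at 0. norm (X s - s *\<^sub>R ?D) / norm s = norm (X s /\<^sub>R s - ?D)"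
        unfolding eventually_at_filter by (rule always_eventually) (use eq in blast)
      from Lim_transform_eventually[OF lim this]
      have "((\<lambda>s. X s /\<^sub>R s - ?D) \<longlongrightarrow> 0) (at 0)"
        by (rule tendsto_norm_zero_cancel)
      then have "((\<lambda>s. X s /\<^sub>R s) \<longlongrightarrow> ?D) (at 0)"
        by (rule LIM_zero_cancel)
      moreover have "filterlim (\<lambda>k. 1 / real (Suc k)) (at 0) sequentially"
        using LIMSEQ_Suc[OF lim_1_over_n] by (intro filterlim_atI) auto
      ultimately have "(\<lambda>k. X (1 / real (Suc k)) /\<^sub>R (1 / real (Suc k))) \<longlonglongrightarrow> ?D"
        by (rule filterlim_compose)
      moreover have "X (1 / real (Suc k)) /\<^sub>R (1 / real (Suc k)) = q k z" for k
        by (simp add: q_def X_def inverse_eq_divide del: of_nat_Suc)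
      ultimately show "(\<lambda>k. q k z) \<longlonglongrightarrow> ?D" by simp
    qed
  qed (unfold q_def, measurable)
  moreover have "(\<integral>z. q k z \<partial>lborel) = 0" for k
    unfolding q_def using int int'[of "1 / real (Suc k)"]
    by (simp add: lborel_integral_translate del: of_nat_Suc)
  ultimately have "(\<lambda>k::nat. 0) \<longlonglongrightarrow> (\<integral>z. dir_deriv w \<phi> z \<partial>lborel)" by simp
  then show ?thesis by (simp add: LIMSEQ_const_iff)
qed

section \<open>The seminorm of \<open>L\<^sup>p\<close> on functions\<close>

text \<open>All estimates are made for Borel functions with a seminorm; classes modulo null sets
  enter only in the last section. The codomain is general because real sums of norms occur beside
  complex functions.\<close>

definition mLp :: "real \<Rightarrow> ('a::euclidean_space \<Rightarrow> 'b::{banach, second_countable_topology}) \<Rightarrow> bool" where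
  "mLp p f \<longleftrightarrow> f \<in> borel_measurable borel \<and> integrable lborel (\<lambda>z. norm (f z) powr p)"

definition nLp :: "real \<Rightarrow> ('a::euclidean_space \<Rightarrow> 'b::{banach, second_countable_topology}) \<Rightarrow> real" where
  "nLp p f = (\<integral>z. norm (f z) powr p \<partial>lborel) powr (1 / p)"

lemma nLp_nonneg: "0 \<le> nLp p f"
  by (simp add: nLp_def)

lemma mLp_nn_integral:
  assumes "mLp p f" "p > 1"
  shows "(\<integral>\<^sup>+z. ennreal (norm (f z) powr p) \<partial>lborel) = ennreal (nLp p f powr p)"
proof -
  have "(\<integral>\<^sup>+z. ennreal (norm (f z) powr p) \<partial>lborel) = ennreal (\<integral>z. norm (f z) powr p \<partial>lborel)"
    using assms by (intro nn_integral_eq_integral) (auto simp: mLp_def)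
  also have "(\<integral>z. norm (f z) powr p \<partial>lborel) = nLp p f powr p"
    using assms by (simp add: nLp_def powr_powr)
  finally show ?thesis .
qed

lemma mLpI:
  assumes "f \<in> borel_measurable borel" "p > 1" "B \<ge> 0"
    and le: "(\<integral>\<^sup>+z. ennreal (norm (f z) powr p) \<partial>lborel) \<le> ennreal (B powr p)"
  shows "mLp p f" and "nLp p f \<le> B"
proof -
  have [measurable]: "f \<in> borel_measurable borel" by fact
  show *: "mLp p f" unfolding mLp_def
    using le by (intro conjI integrableI_bounded assms) (auto simp: top_unique le_less_trans)
  have "ennreal (nLp p f powr p) \<le> ennreal (B powr p)"
    using le mLp_nn_integral[OF * \<open>p > 1\<close>] by simp
  then have "nLp p f powr p \<le> B powr p" by (simp add: ennreal_le_iff)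
  then show "nLp p f \<le> B" using assms
    by (metis less_trans not_le powr_less_mono2 zero_less_one)
qed

lemma mLp_cong_AE:
  assumes "mLp p f" "g \<in> borel_measurable borel" "AE z in lborel. f z = g z"
  shows "mLp p g" "nLp p g = nLp p f"
proof -
  have [measurable]: "f \<in> borel_measurable borel" "g \<in> borel_measurable borel"
    using assms by (auto simp: mLp_def)
  have ae: "AE z in lborel. norm (f z) powr p = norm (g z) powr p" using assms(3) by eventually_elim simp
  show "mLp p g" using assms(1) integrable_cong_AE[OF _ _ ae] assms(2) by (auto simp: mLp_def)
  show "nLp p g = nLp p f" unfolding nLp_def
    by (subst integral_cong_AE[OF _ _ ae]) auto
qed

lemma mLp_0: "mLp p (\<lambda>z. 0)" "p > 1 \<Longrightarrow> nLp p (\<lambda>z. 0) = 0"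
  by (auto simp: mLp_def nLp_def)

lemma powr_convex_combination:
  fixes x y :: real
  assumes p: "p > 1" and xy: "x \<ge> 0" "y \<ge> 0" and uv: "u \<ge> 0" "v \<ge> 0" "u + v = 1"
  shows "(u * x + v * y) powr p \<le> u * x powr p + v * y powr p"
proof -
  consider "x = 0" | "y = 0" | "x > 0" "y > 0" using xy by linarith
  then show ?thesis
  proof cases
    case 1
    have "v powr p \<le> v powr 1" using uv p by (intro powr_mono') auto
    then have "v powr p * y powr p \<le> v * y powr p" using uv by (intro mult_right_mono) auto
    then show ?thesis using 1 p uv xy by (simp add: powr_mult)
  next
    case 2
    have "u powr p \<le> u powr 1" using uv p by (intro powr_mono') auto
    then have "u powr p * x powr p \<le> u * x powr p" using uv by (intro mult_right_mono) auto
    then show ?thesis using 2 p uv xy by (simp add: powr_mult)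
  next
    case 3
    have "convex_on {0<..} (\<lambda>x. x powr p)" using p by (intro powr_convex) auto
    then show ?thesis using 3 uv unfolding convex_on_def by auto
  qed
qed

text \<open>Minkowski's inequality from convexity of the power: \<open>f / A\<close> and
  \<open>g / B\<close> are combined with weights \<open>A / (A + B)\<close> and
  \<open>B / (A + B)\<close>. Here \<open>A\<close> and \<open>B\<close> exceed the norms by
  \<open>e / 2\<close>, so that they may be divided by even when a norm vanishes; \<open>e\<close>
  tends to 0 at the end.\<close>

lemma mLp_add:
  assumes f: "mLp p f" and g: "mLp p g" and p: "p > 1"
  shows "mLp p (\<lambda>z. f z + g z)" and "nLp p (\<lambda>z. f z + g z) \<le> nLp p f + nLp p g"
proof -
  have [measurable]: "f \<in> borel_measurable borel" "g \<in> borel_measurable borel"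
    using f g by (auto simp: mLp_def)
  have main: "(\<integral>\<^sup>+z. ennreal (norm (f z + g z) powr p) \<partial>lborel) \<le> ennreal ((nLp p f + nLp p g + e) powr p)"
    if "e > 0" for e
  proof -
    define A where "A = nLp p f + e / 2"
    define B where "B = nLp p g + e / 2"
    have AB: "A > 0" "B > 0" "nLp p f \<le> A" "nLp p g \<le> B"
      using that nLp_nonneg[of p f] nLp_nonneg[of p g] by (auto simp: A_def B_def)
    \<comment> \<open>The coefficients are normalised such that
      \<open>u * A powr p + v * B powr p = (A + B) powr p\<close>.\<close>
    define u where "u = (A + B) powr p * (A / (A + B)) * A powr - p"
    define v where "v = (A + B) powr p * (B / (A + B)) * B powr - p"
    have uv: "u \<ge> 0" "v \<ge> 0" using AB by (auto simp: u_def v_def)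
    have pt: "norm (f z + g z) powr p \<le> u * norm (f z) powr p + v * norm (g z) powr p" for z
    proof -
      let ?a = "norm (f z)" and ?b = "norm (g z)"
      have "norm (f z + g z) powr p \<le> (?a + ?b) powr p"
        using p by (intro powr_mono2 norm_triangle_ineq) auto
      also have "?a + ?b = (A + B) * (A / (A + B) * (?a / A) + B / (A + B) * (?b / B))"
      proof -
        have "A / (A + B) * (?a / A) = ?a / (A + B)" "B / (A + B) * (?b / B) = ?b / (A + B)"
          using AB by simp_all
        then show ?thesis using AB by (simp add: add_divide_distrib[symmetric])
      qed
      also have "\<dots> powr p = (A + B) powr p * (A / (A + B) * (?a / A) + B / (A + B) * (?b / B)) powr p"
        using AB by (intro powr_mult)
      also have "\<dots> \<le> (A + B) powr p * (A / (A + B) * (?a / A) powr p + B / (A + B) * (?b / B) powr p)"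
        using AB p by (intro mult_left_mono powr_convex_combination) (auto simp flip: add_divide_distrib)
      also have "\<dots> = u * ?a powr p + v * ?b powr p"
        using AB by (simp add: u_def v_def powr_divide powr_minus_divide distrib_left)
      finally show ?thesis .
    qed
    have "(\<integral>\<^sup>+z. ennreal (norm (f z + g z) powr p) \<partial>lborel)
        \<le> (\<integral>\<^sup>+z. ennreal u * ennreal (norm (f z) powr p) + ennreal v * ennreal (norm (g z) powr p) \<partial>lborel)"
      using pt uv by (intro nn_integral_mono)
        (simp add: ennreal_mult[symmetric] ennreal_plus[symmetric] del: ennreal_plus)
    also have "\<dots> = ennreal u * (\<integral>\<^sup>+z. ennreal (norm (f z) powr p) \<partial>lborel)
        + ennreal v * (\<integral>\<^sup>+z. ennreal (norm (g z) powr p) \<partial>lborel)"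
      by (simp add: nn_integral_add nn_integral_cmult)
    also have "\<dots> = ennreal (u * nLp p f powr p + v * nLp p g powr p)"
      using uv by (simp add: mLp_nn_integral[OF f p] mLp_nn_integral[OF g p] ennreal_mult)
    also have "\<dots> \<le> ennreal (u * A powr p + v * B powr p)"
      using AB uv p by (intro ennreal_leI add_mono mult_left_mono powr_mono2) (auto simp: nLp_nonneg)
    also have "u * A powr p + v * B powr p = (A + B) powr p * (A / (A + B) + B / (A + B))"
    proof -
      have "A powr - p * A powr p = 1" "B powr - p * B powr p = 1" using AB by (simp_all flip: powr_add)
      then show ?thesis unfolding u_def v_def by (simp add: mult.assoc distrib_left)
    qed
    also have "\<dots> = (A + B) powr p" using AB by (simp flip: add_divide_distrib)
    also have "A + B = nLp p f + nLp p g + e" by (simp add: A_def B_def)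
    finally show ?thesis .
  qed
  have nn: "0 \<le> nLp p f + nLp p g" by (simp add: nLp_nonneg)
  show "mLp p (\<lambda>z. f z + g z)"
    by (rule mLpI(1)[OF _ p _ main[of 1]]) (use nn in auto)
  show "nLp p (\<lambda>z. f z + g z) \<le> nLp p f + nLp p g"
  proof (rule field_le_epsilon)
    fix e :: real assume e: "e > 0"
    show "nLp p (\<lambda>z. f z + g z) \<le> nLp p f + nLp p g + e"
      by (rule mLpI(2)[OF _ p _ main[of e]]) (use nn e in auto)
  qed
qed

lemma mLp_cmult:
  fixes f :: "'a::euclidean_space \<Rightarrow> complex"
  assumes f: "mLp p f" and p: "p > 1"
  shows "mLp p (\<lambda>z. c * f z)" and "nLp p (\<lambda>z. c * f z) = norm c * nLp p f"
proof -
  have [measurable]: "f \<in> borel_measurable borel" using f by (simp add: mLp_def)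
  show "mLp p (\<lambda>z. c * f z)" using f by (simp add: mLp_def norm_mult powr_mult)
  show "nLp p (\<lambda>z. c * f z) = norm c * nLp p f"
    using p by (simp add: nLp_def norm_mult powr_mult powr_powr)
qed

lemma mLp_norm: "mLp p f \<Longrightarrow> mLp p (\<lambda>z. norm (f z))" "nLp p (\<lambda>z. norm (f z)) = nLp p f"
  by (auto simp: mLp_def nLp_def)

lemma mLp_minus:
  fixes f g :: "'a::euclidean_space \<Rightarrow> complex"
  assumes f: "mLp p f" and g: "mLp p g" and p: "p > 1"
  shows "mLp p (\<lambda>z. f z - g z)" and "nLp p (\<lambda>z. f z - g z) \<le> nLp p f + nLp p g"
  using mLp_add[OF f mLp_cmult(1)[OF g p, of "-1"] p] mLp_cmult(2)[OF g p, of "-1"] by auto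

lemma mLp_sum:
  fixes f :: "nat \<Rightarrow> 'a::euclidean_space \<Rightarrow> 'b::{banach, second_countable_topology}"
  assumes "\<And>k. k < n \<Longrightarrow> mLp p (f k)" and p: "p > 1"
  shows "mLp p (\<lambda>z. \<Sum>k<n. f k z) \<and> nLp p (\<lambda>z. \<Sum>k<n. f k z) \<le> (\<Sum>k<n. nLp p (f k))"
  using assms(1)
proof (induction n)
  case (Suc n)
  then have IH: "mLp p (\<lambda>z. \<Sum>k<n. f k z)" "nLp p (\<lambda>z. \<Sum>k<n. f k z) \<le> (\<Sum>k<n. nLp p (f k))" by auto
  show ?case using mLp_add[OF IH(1) Suc.prems[of n] p] IH(2) by auto
qed (use p mLp_0[of p] in \<open>auto simp: nLp_def\<close>)

lemma nLp_eq_0_imp_AE: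
  assumes f: "mLp p f" and p: "p > 1" and "nLp p f \<le> 0"
  shows "AE z in lborel. f z = 0"
proof -
  have [measurable]: "f \<in> borel_measurable borel" using f by (simp add: mLp_def)
  have "nLp p f = 0" using assms nLp_nonneg[of p f] by linarith
  then have "(\<integral>\<^sup>+z. ennreal (norm (f z) powr p) \<partial>lborel) = 0" using mLp_nn_integral[OF f p] by simp
  then have "AE z in lborel. ennreal (norm (f z) powr p) = 0"
    by (subst (asm) nn_integral_0_iff_AE) auto
  then show ?thesis by eventually_elim simp
qed

section \<open>Pairings and local integrability\<close>

lemma le_1_plus_powr: "p > 1 \<Longrightarrow> x \<ge> 0 \<Longrightarrow> x \<le> 1 + x powr p" for x :: real
proof (cases "x \<le> 1")
  case False
  assume "p > 1"
  then have "x powr 1 \<le> x powr p" using False by (intro powr_mono) auto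
  then show ?thesis using False by simp
next
  case True
  then show ?thesis using powr_ge_zero[of x p] by linarith
qed

text \<open>In place of Hoelder's inequality, \<open>norm (f z) \<le> 1 + norm (f z) powr p\<close>
  splits the product: the first part is controlled by integrability of \<open>g\<close>, the second
  by its boundedness. Kernels and test functions have both properties.\<close>

lemma mLp_integrable_mult:
  fixes f :: "'a::euclidean_space \<Rightarrow> complex" and g :: "'a \<Rightarrow> complex"
  assumes f: "mLp p f" and p: "p > 1" and g: "integrable lborel g" and B: "\<And>z. norm (g z) \<le> B"
  shows "integrable lborel (\<lambda>z. f z * g z)"
proof -
  have [measurable]: "f \<in> borel_measurable borel" "g \<in> borel_measurable borel"
    using f borel_measurable_integrable[OF g] by (auto simp: mLp_def)
  have "integrable lborel (\<lambda>z. norm (g z) + B * norm (f z) powr p)"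
    using f g by (intro Bochner_Integration.integrable_add integrable_mult_right integrable_norm) (auto simp: mLp_def)
  then show ?thesis
  proof (rule Bochner_Integration.integrable_bound)
    have "norm (f z * g z) \<le> norm (g z) + B * norm (f z) powr p" for z
    proof -
      have "norm (f z) * norm (g z) \<le> (1 + norm (f z) powr p) * norm (g z)"
        using p by (intro mult_right_mono le_1_plus_powr) auto
      also have "\<dots> = norm (g z) + norm (g z) * norm (f z) powr p" by (simp add: algebra_simps)
      also have "\<dots> \<le> norm (g z) + B * norm (f z) powr p"
        using B[of z] by (intro add_left_mono mult_right_mono) auto
      finally show ?thesis by (simp add: norm_mult)
    qed
    then show "AE z in lborel. norm (f z * g z) \<le> norm (norm (g z) + B * norm (f z) powr p)"
      by (intro AE_I2) (metis abs_ge_self order_trans real_norm_def)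
  qed measurable
qed

lemma integrable_indicator_cball:
  "integrable lborel (\<lambda>z::'a::euclidean_space. C * indicat_real (cball 0 R) z)"
  by (intro integrable_mult_right integrable_real_indicator)
     (auto intro: emeasure_lborel_cball_finite[unfolded infinity_ennreal_def])

lemma mLp_locally_integrable:
  assumes f: "mLp p f" and p: "p > 1" shows "locally_integrable f"
  unfolding locally_integrable_def
proof (intro conjI allI)
  show "f \<in> borel_measurable borel" using f by (simp add: mLp_def)
  fix R
  have "integrable lborel (\<lambda>z. f z * complex_of_real (1 * indicator (cball 0 R) z))"
    by (rule mLp_integrable_mult[OF f p integrable_of_real[OF integrable_indicator_cball], where B=1])
       (auto simp: indicator_def)
  then show "integrable lborel (\<lambda>z. indicator (cball 0 R) z *\<^sub>R f z)"
    by (simp add: scaleR_conv_of_real mult.commute)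
qed

lemma mLp_compact_support:
  fixes g :: "'a::euclidean_space \<Rightarrow> complex"
  assumes [measurable]: "g \<in> borel_measurable borel" and "p > 1"
    and C: "\<And>z. norm (g z) \<le> C * indicator (cball 0 R) z"
  shows "mLp p g"
  unfolding mLp_def
proof
  have "integrable lborel (\<lambda>z::'a. \<bar>C\<bar> powr p * indicat_real (cball 0 R) z)"
    by (rule integrable_indicator_cball)
  then show "integrable lborel (\<lambda>z. norm (g z) powr p)"
  proof (rule Bochner_Integration.integrable_bound)
    have "norm (g z) powr p \<le> \<bar>C\<bar> powr p * indicator (cball 0 R) z" for z
    proof (cases "z \<in> cball 0 R")
      case True
      have "norm (g z) powr p \<le> \<bar>C\<bar> powr p"
        using C[of z] True \<open>p > 1\<close> by (intro powr_mono2) auto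
      then show ?thesis using True by simp
    next
      case False
      then have "norm (g z) = 0" using C[of z] by auto
      then show ?thesis using False by simp
    qed
    then show "AE z in lborel. norm (norm (g z) powr p) \<le> norm (\<bar>C\<bar> powr p * indicat_real (cball 0 R) z)"
      by auto
  qed measurable
qed fact

text \<open>The subtracted \<open>(1/2) ^ (n + k)\<close> is the tail of the geometric series that
  has not yet been used; keeping it makes the bound inductive in \<open>k\<close>.\<close>

lemma nLp_geometric_increments:
  fixes s :: "nat \<Rightarrow> 'a::euclidean_space \<Rightarrow> complex"
  assumes s: "\<And>n. mLp p (s n)" and p: "p > 1"
    and d: "\<And>n. nLp p (\<lambda>z. s (Suc n) z - s n z) \<le> c * (1/2) ^ n"
  shows "nLp p (\<lambda>z. s (n + k) z - s n z) \<le> 2 * c * ((1/2) ^ n - (1/2) ^ (n + k))"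
proof (induction k)
  case 0
  then show ?case using p by (simp add: mLp_0)
next
  case (Suc k)
  have "nLp p (\<lambda>z. (s (Suc (n + k)) z - s (n + k) z) + (s (n + k) z - s n z))
      \<le> nLp p (\<lambda>z. s (Suc (n + k)) z - s (n + k) z) + nLp p (\<lambda>z. s (n + k) z - s n z)"
    by (intro mLp_add mLp_minus s p)
  also have "\<dots> \<le> c * (1/2) ^ (n + k) + 2 * c * ((1/2) ^ n - (1/2) ^ (n + k))"
    by (intro add_mono d Suc.IH)
  also have "\<dots> = 2 * c * ((1/2) ^ n - (1/2) ^ (n + Suc k))" by (simp add: algebra_simps)
  finally show ?case by simp
qed

text \<open>The Riesz-Fischer argument for sequences with geometric increments, which is the form
  that fixed point iterations produce. The partial sums \<open>D\<close> of the increments are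
  bounded in the seminorm, so by monotone convergence they are finite almost everywhere and
  \<open>s\<close> converges pointwise; Fatou's lemma in \<open>k\<close> carries the bound for
  \<open>s (n + k) - s n\<close> over to the limit.\<close>

lemma Lp_complete_geometric:
  fixes s :: "nat \<Rightarrow> 'a::euclidean_space \<Rightarrow> complex"
  assumes s: "\<And>n. mLp p (s n)" and p: "p > 1" and c: "c \<ge> 0"
    and d: "\<And>n. nLp p (\<lambda>z. s (Suc n) z - s n z) \<le> c * (1/2) ^ n"
  shows "\<exists>f. mLp p f \<and> (\<forall>n. nLp p (\<lambda>z. s n z - f z) \<le> 2 * c * (1/2) ^ n)"
proof -
  have [measurable]: "s n \<in> borel_measurable borel" for n using s by (simp add: mLp_def)
  define D where "D n z = (\<Sum>k<n. norm (s (Suc k) z - s k z))" for n z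
  have [measurable]: "D n \<in> borel_measurable borel" for n unfolding D_def[abs_def] by measurable
  have Dmono: "D m z \<le> D n z" if "m \<le> n" for m n z
    unfolding D_def using that by (intro sum_mono2) auto
  have D0: "D n z \<ge> 0" for n z by (simp add: D_def sum_nonneg)
  have D: "mLp p (D n)" "nLp p (D n) \<le> 2 * c" for n
  proof -
    have 1: "mLp p (\<lambda>z. norm (s (Suc k) z - s k z))" for k by (intro mLp_norm mLp_minus s p)
    note sm = mLp_sum[where f="\<lambda>k z. norm (s (Suc k) z - s k z)", OF 1 p, where n=n]
    show "mLp p (D n)" unfolding D_def[abs_def] using sm by blast
    have "nLp p (D n) \<le> (\<Sum>k<n. nLp p (\<lambda>z. norm (s (Suc k) z - s k z)))"
      unfolding D_def[abs_def] using sm by blast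
    also have "\<dots> \<le> (\<Sum>k<n. c * (1/2) ^ k)" by (intro sum_mono) (simp add: mLp_norm d)
    also have "\<dots> \<le> (\<Sum>k. c * (1/2) ^ k)"
      using c by (intro sum_le_suminf summable_mult summable_geometric) auto
    also have "\<dots> = 2 * c"
      using suminf_mult[OF summable_geometric, of "1/2::real" c] suminf_geometric[of "1/2::real"] by simp
    finally show "nLp p (D n) \<le> 2 * c" .
  qed
  have "(\<integral>\<^sup>+z. (SUP n. ennreal (D n z powr p)) \<partial>lborel) = (SUP n. \<integral>\<^sup>+z. ennreal (D n z powr p) \<partial>lborel)"
    using p by (intro nn_integral_monotone_convergence_SUP)
      (auto simp: incseq_def le_fun_def D0 intro!: ennreal_leI powr_mono2 Dmono)
  also have "\<dots> \<le> ennreal ((2 * c) powr p)"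
  proof (rule SUP_least)
    fix n
    have "(\<integral>\<^sup>+z. ennreal (D n z powr p) \<partial>lborel) = ennreal (nLp p (D n) powr p)"
      using mLp_nn_integral[OF D(1)[of n] p] by (simp add: D0)
    also have "\<dots> \<le> ennreal ((2 * c) powr p)"
      using p D(2)[of n] by (intro ennreal_leI powr_mono2) (auto simp: nLp_nonneg)
    finally show "(\<integral>\<^sup>+z. ennreal (D n z powr p) \<partial>lborel) \<le> ennreal ((2 * c) powr p)" .
  qed
  finally have "(\<integral>\<^sup>+z. (SUP n. ennreal (D n z powr p)) \<partial>lborel) \<noteq> \<infinity>"
    by (auto simp: top_unique)
  then have fin: "AE z in lborel. (SUP n. ennreal (D n z powr p)) \<noteq> \<infinity>"
    by (intro nn_integral_noteq_infinite) auto
  have conv: "AE z in lborel. convergent (\<lambda>n. s n z)"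
    using fin
  proof eventually_elim
    case (elim z)
    then obtain B where B: "B \<ge> 0" "(SUP n. ennreal (D n z powr p)) = ennreal B"
      by (cases "SUP n. ennreal (D n z powr p)") auto
    have "D n z \<le> B powr (1 / p)" for n
    proof -
      have "ennreal (D n z powr p) \<le> ennreal B" unfolding B(2)[symmetric] by (rule SUP_upper) simp
      then have "D n z powr p \<le> B" using B(1) by (simp add: ennreal_le_iff)
      then have "(D n z powr p) powr (1 / p) \<le> B powr (1 / p)" using p by (intro powr_mono2) auto
      then show ?thesis using p D0[of n z] by (simp add: powr_powr)
    qed
    then have "summable (\<lambda>k. norm (s (Suc k) z - s k z))"
      unfolding D_def
      by (intro bounded_imp_summable[where B="B powr (1 / p)"]) (simp_all add: lessThan_Suc_atMost[symmetric] del: sum.lessThan_Suc)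
    then have "summable (\<lambda>k. s (Suc k) z - s k z)" by (rule summable_norm_cancel)
    then have "convergent (\<lambda>n. \<Sum>k<n. s (Suc k) z - s k z)" by (simp add: summable_iff_convergent)
    then have "convergent (\<lambda>n. s n z - s 0 z)" by (simp only: sum_lessThan_telescope[where f="\<lambda>k. s k z"])
    from convergent_add[OF this convergent_const[of "s 0 z"]]
    show "convergent (\<lambda>n. s n z)" by simp
  qed
  define f where "f z = lim (\<lambda>n. s n z)" for z
  have [measurable]: "f \<in> borel_measurable borel" unfolding f_def[abs_def] by measurable
  have lim: "AE z in lborel. (\<lambda>n. s n z) \<longlonglongrightarrow> f z"
    using conv by eventually_elim (simp add: f_def convergent_LIMSEQ_iff)
  have est: "(\<integral>\<^sup>+z. ennreal (norm (s n z - f z) powr p) \<partial>lborel) \<le> ennreal ((2 * c * (1/2) ^ n) powr p)" for n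
  proof -
    have "(\<integral>\<^sup>+z. ennreal (norm (s n z - f z) powr p) \<partial>lborel)
       = (\<integral>\<^sup>+z. liminf (\<lambda>k. ennreal (norm (s (n + k) z - s n z) powr p)) \<partial>lborel)"
    proof (rule nn_integral_cong_AE, use lim in eventually_elim)
      case (elim z)
      have "(\<lambda>k. s (k + n) z) \<longlonglongrightarrow> f z" using elim by (rule LIMSEQ_ignore_initial_segment)
      then have "(\<lambda>k. norm (s (n + k) z - s n z)) \<longlonglongrightarrow> norm (f z - s n z)"
        by (intro tendsto_intros) (simp add: add.commute)
      then have "(\<lambda>k. norm (s (n + k) z - s n z) powr p) \<longlonglongrightarrow> norm (f z - s n z) powr p"
        using p by (intro tendsto_powr' tendsto_const) auto
      then have "(\<lambda>k. ennreal (norm (s (n + k) z - s n z) powr p)) \<longlonglongrightarrow> ennreal (norm (f z - s n z) powr p)"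
        by (rule tendsto_ennrealI)
      from lim_imp_Liminf[OF sequentially_bot this]
      show ?case by (simp add: norm_minus_commute)
    qed
    also have "\<dots> \<le> liminf (\<lambda>k. \<integral>\<^sup>+z. ennreal (norm (s (n + k) z - s n z) powr p) \<partial>lborel)"
      by (rule nn_integral_liminf) measurable
    also have "\<dots> \<le> liminf (\<lambda>k. ennreal ((2 * c * (1/2) ^ n) powr p))"
    proof (intro Liminf_mono always_eventually allI)
      fix k
      have "(\<integral>\<^sup>+z. ennreal (norm (s (n + k) z - s n z) powr p) \<partial>lborel)
         = ennreal (nLp p (\<lambda>z. s (n + k) z - s n z) powr p)"
        by (rule mLp_nn_integral[OF mLp_minus(1)[OF s s p] p])
      also have "nLp p (\<lambda>z. s (n + k) z - s n z) \<le> 2 * c * ((1/2) ^ n - (1/2) ^ (n + k))"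
        by (rule nLp_geometric_increments[OF s p d])
      then have "nLp p (\<lambda>z. s (n + k) z - s n z) powr p \<le> (2 * c * (1/2) ^ n) powr p"
      proof (intro powr_mono2)
        assume "nLp p (\<lambda>z. s (n + k) z - s n z) \<le> 2 * c * ((1/2) ^ n - (1/2) ^ (n + k))"
        also have "\<dots> \<le> 2 * c * (1/2) ^ n" using c by (intro mult_left_mono) auto
        finally show "nLp p (\<lambda>z. s (n + k) z - s n z) \<le> 2 * c * (1/2) ^ n" .
      qed (use p nLp_nonneg in auto)
      then have "ennreal (nLp p (\<lambda>z. s (n + k) z - s n z) powr p) \<le> ennreal ((2 * c * (1/2) ^ n) powr p)"
        by (rule ennreal_leI)
      finally show "(\<integral>\<^sup>+z. ennreal (norm (s (n + k) z - s n z) powr p) \<partial>lborel)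
          \<le> ennreal ((2 * c * (1/2) ^ n) powr p)" .
    qed
    also have "\<dots> = ennreal ((2 * c * (1/2) ^ n) powr p)" by (simp add: Liminf_const)
    finally show ?thesis .
  qed
  have b: "2 * c * (1/2) ^ n \<ge> 0" for n using c by simp
  have "mLp p (\<lambda>z. s n z - f z)" "nLp p (\<lambda>z. s n z - f z) \<le> 2 * c * (1/2) ^ n" for n
    by (rule mLpI[OF _ p b est], measurable)+
  moreover from this(1) have "mLp p (\<lambda>z. s 0 z - (s 0 z - f z))" by (rule mLp_minus(1)[OF s[of 0] _ p])
  then have "mLp p f" by simp
  ultimately show ?thesis by blast
qed

subsection \<open>The Schur test\<close>

text \<open>It holds without integrability because a divergent Bochner integral has the default
  value 0. Kernel operators can thus be estimated before their integrals are known to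
  converge.\<close>

lemma norm_integral_le_nn_integral:
  fixes f :: "'a \<Rightarrow> 'b::{banach, second_countable_topology}"
  shows "ennreal (norm (integral\<^sup>L M f)) \<le> (\<integral>\<^sup>+x. ennreal (norm (f x)) \<partial>M)"
  by (cases "integrable M f") (auto simp: integral_norm_bound_ennreal not_integrable_integral_eq)

text \<open>Equality holds at \<open>s = c\<close>. Integrated against a kernel with
  \<open>c\<close> still free, it replaces Hoelder's inequality: the optimal \<open>c\<close> is
  chosen after the integration.\<close>

lemma Young_tangent:
  fixes s c p :: real
  assumes "p > 1" "c > 0" "s \<ge> 0"
  shows "s \<le> c powr (1 - p) / p * s powr p + (1 - 1 / p) * c"
proof -
  define q where "q = p / (p - 1)"
  have q: "q > 1" "1 / p + 1 / q = 1" using assms by (auto simp: q_def field_simps)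
  have "s / c * 1 \<le> (s / c) powr p / p + 1 powr q / q"
    using assms q by (intro Youngs_inequality) auto
  then have "s \<le> c * ((s / c) powr p / p + 1 / q)" using assms by (simp add: field_simps)
  also have "\<dots> = c powr (1 - p) / p * s powr p + (1 / q) * c"
    using assms by (simp add: powr_divide powr_diff distrib_left)
  also have "1 / q = 1 - 1 / p" using q by simp
  finally show ?thesis .
qed

context
  fixes K :: "'a::euclidean_space \<Rightarrow> 'a \<Rightarrow> complex" and C p :: real
  assumes K_meas [measurable]: "case_prod K \<in> borel_measurable (borel \<Otimes>\<^sub>M borel)"
    and C: "C > 0" and p: "p > 1"
    and K1: "\<And>q. (\<integral>\<^sup>+y. ennreal (norm (K q y)) \<partial>lborel) \<le> ennreal C"
    and K2: "\<And>y. (\<integral>\<^sup>+q. ennreal (norm (K q y)) \<partial>lborel) \<le> ennreal C"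
begin

text \<open>Jensen's inequality for the measure \<open>norm (K q y)\<close>, whose mass is at most
  \<open>C\<close>. If the right-hand integral diverges there is nothing to show; otherwise the
  tangent inequality is integrated and \<open>c\<close> optimised.\<close>

lemma schur_pointwise:
  fixes f :: "'a \<Rightarrow> complex"
  assumes [measurable]: "f \<in> borel_measurable borel"
  shows "ennreal (norm (\<integral>y. K q y * f y \<partial>lborel) powr p)
     \<le> ennreal (C powr (p - 1)) * (\<integral>\<^sup>+y. ennreal (norm (K q y)) * ennreal (norm (f y) powr p) \<partial>lborel)"
    (is "_ \<le> _ * ?S")
proof (cases ?S)
  case top
  then show ?thesis using C by (simp add: ennreal_mult_top)
next
  case (real s)
  let ?g = "norm (\<integral>y. K q y * f y \<partial>lborel)"
  have bound: "?g \<le> c powr (1 - p) / p * s + (1 - 1 / p) * c * C" if c: "c > 0" for c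
  proof -
    define a where "a = c powr (1 - p) / p"
    define b where "b = (1 - 1 / p) * c"
    have ab: "a \<ge> 0" "b \<ge> 0" using p c by (auto simp: a_def b_def)
    have "ennreal ?g \<le> (\<integral>\<^sup>+y. ennreal (norm (K q y * f y)) \<partial>lborel)"
      by (rule norm_integral_le_nn_integral)
    also have "\<dots> \<le> (\<integral>\<^sup>+y. ennreal a * (ennreal (norm (K q y)) * ennreal (norm (f y) powr p))
        + ennreal b * ennreal (norm (K q y)) \<partial>lborel)"
    proof (rule nn_integral_mono)
      fix y
      have "norm (K q y) * norm (f y) \<le> norm (K q y) * (a * norm (f y) powr p + b)"
        unfolding a_def b_def using p c by (intro mult_left_mono Young_tangent) auto
      then show "ennreal (norm (K q y * f y)) \<le> ennreal a * (ennreal (norm (K q y)) * ennreal (norm (f y) powr p))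
        + ennreal b * ennreal (norm (K q y))"
        using ab by (simp add: norm_mult ennreal_mult[symmetric] ennreal_plus[symmetric] algebra_simps del: ennreal_plus)
    qed
    also have "\<dots> = ennreal a * ?S + ennreal b * (\<integral>\<^sup>+y. ennreal (norm (K q y)) \<partial>lborel)"
      by (simp add: nn_integral_add nn_integral_cmult)
    also have "\<dots> \<le> ennreal a * ennreal s + ennreal b * ennreal C"
      unfolding real by (intro add_left_mono mult_left_mono K1) auto
    also have "\<dots> = ennreal (a * s + b * C)"
      using ab real C by (simp add: ennreal_mult)
    finally have "?g \<le> a * s + b * C" using ab real C by (subst (asm) ennreal_le_iff) auto
    then show ?thesis by (simp add: a_def b_def)
  qed
  have "?g powr p \<le> C powr (p - 1) * s"
  \<comment> \<open>For \<open>s = 0\<close> the infimum over \<open>c\<close> is not attained;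
    \<open>c = e / C\<close> with \<open>e\<close> tending to 0 is used instead.\<close>
  proof (cases "s = 0")
    case True
    have "?g \<le> 0"
    proof (rule field_le_epsilon)
      fix e :: real assume e: "e > 0"
      have "?g \<le> (1 - 1 / p) * (e / C) * C" using bound[of "e / C"] e C True by simp
      also have "\<dots> = (1 - 1 / p) * e" using C by simp
      also have "\<dots> \<le> 1 * e" using e p by (intro mult_right_mono) auto
      finally show "?g \<le> 0 + e" by simp
    qed
    then show ?thesis using True by simp
  next
    case False
    then have s: "s > 0" using real by simp
    \<comment> \<open>The minimiser: it balances the two terms,
      \<open>c powr (1 - p) * s = c * C\<close>.\<close>
    define c where "c = (s / C) powr (1 / p)"
    have c: "c > 0" "c powr p = s / C" using s C p by (auto simp: c_def powr_powr)
    have "c powr (1 - p) * s = c * C"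
      using c s C by (simp add: powr_diff)
    then have "?g \<le> c * C" using bound[OF c(1)] p by (simp add: field_simps)
    then have "?g powr p \<le> (c * C) powr p" using p by (intro powr_mono2) auto
    also have "\<dots> = C powr p * (s / C)" using c C by (simp add: powr_mult)
    also have "\<dots> = C powr (p - 1) * s" using C by (simp add: powr_diff)
    finally show ?thesis .
  qed
  then have "ennreal (?g powr p) \<le> ennreal (C powr (p - 1) * s)" by (rule ennreal_leI)
  then show ?thesis using real C by (simp add: ennreal_mult)
qed

lemma schur_test:
  fixes f :: "'a \<Rightarrow> complex"
  assumes f: "mLp p f"
  shows "mLp p (\<lambda>q. \<integral>y. K q y * f y \<partial>lborel)"
    and "nLp p (\<lambda>q. \<integral>y. K q y * f y \<partial>lborel) \<le> C * nLp p f"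
proof -
  have [measurable]: "f \<in> borel_measurable borel" using f by (simp add: mLp_def)
  have le: "(\<integral>\<^sup>+q. ennreal (norm (\<integral>y. K q y * f y \<partial>lborel) powr p) \<partial>lborel)
      \<le> ennreal ((C * nLp p f) powr p)"
  proof -
    have "(\<integral>\<^sup>+q. ennreal (norm (\<integral>y. K q y * f y \<partial>lborel) powr p) \<partial>lborel)
      \<le> (\<integral>\<^sup>+q. ennreal (C powr (p - 1)) *
          (\<integral>\<^sup>+y. ennreal (norm (K q y)) * ennreal (norm (f y) powr p) \<partial>lborel) \<partial>lborel)"
      by (intro nn_integral_mono schur_pointwise) measurable
    also have "\<dots> = ennreal (C powr (p - 1)) *
          (\<integral>\<^sup>+q. (\<integral>\<^sup>+y. ennreal (norm (K q y)) * ennreal (norm (f y) powr p) \<partial>lborel) \<partial>lborel)"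
      by (rule nn_integral_cmult) measurable
    finally have 1: "(\<integral>\<^sup>+q. ennreal (norm (\<integral>y. K q y * f y \<partial>lborel) powr p) \<partial>lborel)
      \<le> ennreal (C powr (p - 1)) *
          (\<integral>\<^sup>+q. (\<integral>\<^sup>+y. ennreal (norm (K q y)) * ennreal (norm (f y) powr p) \<partial>lborel) \<partial>lborel)" .
    have "(\<integral>\<^sup>+q. (\<integral>\<^sup>+y. ennreal (norm (K q y)) * ennreal (norm (f y) powr p) \<partial>lborel) \<partial>lborel)
       = (\<integral>\<^sup>+y. (\<integral>\<^sup>+q. ennreal (norm (K q y)) * ennreal (norm (f y) powr p) \<partial>lborel) \<partial>lborel)"
      by (rule lborel_pair.Fubini'[symmetric]) measurable
    also have "\<dots> = (\<integral>\<^sup>+y. (\<integral>\<^sup>+q. ennreal (norm (K q y)) \<partial>lborel) * ennreal (norm (f y) powr p) \<partial>lborel)"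
      by (intro nn_integral_cong nn_integral_multc) measurable
    also have "\<dots> \<le> (\<integral>\<^sup>+y. ennreal C * ennreal (norm (f y) powr p) \<partial>lborel)"
      by (intro nn_integral_mono mult_right_mono K2) auto
    also have "\<dots> = ennreal C * ennreal (nLp p f powr p)"
      by (simp add: nn_integral_cmult mLp_nn_integral[OF f p])
    finally have "ennreal (C powr (p - 1)) *
          (\<integral>\<^sup>+q. (\<integral>\<^sup>+y. ennreal (norm (K q y)) * ennreal (norm (f y) powr p) \<partial>lborel) \<partial>lborel)
       \<le> ennreal (C powr (p - 1)) * (ennreal C * ennreal (nLp p f powr p))"
      by (intro mult_left_mono) auto
    with 1 have "(\<integral>\<^sup>+q. ennreal (norm (\<integral>y. K q y * f y \<partial>lborel) powr p) \<partial>lborel)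
       \<le> ennreal (C powr (p - 1)) * (ennreal C * ennreal (nLp p f powr p))"
      by (rule order_trans)
    also have "\<dots> = ennreal (C powr (p - 1) * C * nLp p f powr p)"
      using C by (simp add: ennreal_mult mult.assoc)
    also have "C powr (p - 1) * C * nLp p f powr p = (C * nLp p f) powr p"
      using C by (simp add: powr_mult powr_diff nLp_nonneg)
    finally show ?thesis .
  qed
  have nn: "C * nLp p f \<ge> 0" using C by (simp add: nLp_nonneg)
  show "mLp p (\<lambda>q. \<integral>y. K q y * f y \<partial>lborel)" by (rule mLpI(1)[OF _ p nn le]) measurable
  show "nLp p (\<lambda>q. \<integral>y. K q y * f y \<partial>lborel) \<le> C * nLp p f" by (rule mLpI(2)[OF _ p nn le]) measurable
qed

text \<open>Joint integrability, needed to interchange the kernel with a test function. After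
  \<open>norm (f y) \<le> 1 + norm (f y) powr p\<close> the first part is finite by the compact
  support of \<open>\<phi>\<close> and the integral over \<open>y\<close>, the second by the
  integral over \<open>q\<close>.\<close>

lemma schur_integrable:
  fixes f \<phi> :: "'a \<Rightarrow> complex"
  assumes f: "mLp p f" and [measurable]: "\<phi> \<in> borel_measurable borel"
    and B: "\<And>z. norm (\<phi> z) \<le> B * indicator (cball 0 R) z"
  shows "integrable (lborel \<Otimes>\<^sub>M lborel) (\<lambda>(q, y). \<phi> q * (K q y * f y))"
proof (rule integrableI_bounded)
  have [measurable]: "f \<in> borel_measurable borel" using f by (simp add: mLp_def)
  show "(\<lambda>(q, y). \<phi> q * (K q y * f y)) \<in> borel_measurable (lborel \<Otimes>\<^sub>M lborel)" by measurable
  have [measurable]: "(\<lambda>x. K (fst x) (snd x)) \<in> borel_measurable (lborel \<Otimes>\<^sub>M lborel)"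
    using K_meas by (simp add: case_prod_beta')
  let ?B = "\<bar>B\<bar>"
  have "(\<integral>\<^sup>+x. ennreal (norm (case x of (q, y) \<Rightarrow> \<phi> q * (K q y * f y))) \<partial>(lborel \<Otimes>\<^sub>M lborel))
     \<le> (\<integral>\<^sup>+x. (case x of (q, y) \<Rightarrow> ennreal (?B * indicator (cball 0 R) q) * ennreal (norm (K q y)))
          + (case x of (q, y) \<Rightarrow> ennreal ?B * ennreal (norm (K q y)) * ennreal (norm (f y) powr p)) \<partial>(lborel \<Otimes>\<^sub>M lborel))"
  proof (rule nn_integral_mono)
    fix x :: "'a \<times> 'a"
    obtain q y where x: "x = (q, y)" by force
    have b: "norm (\<phi> q) \<le> ?B * indicator (cball 0 R) q" "norm (\<phi> q) \<le> ?B"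
      using B[of q] by (cases "norm q \<le> R"; auto)+
    have "norm (\<phi> q) * (norm (K q y) * norm (f y)) \<le> norm (\<phi> q) * (norm (K q y) * (1 + norm (f y) powr p))"
      using p by (intro mult_left_mono le_1_plus_powr) auto
    also have "\<dots> = norm (\<phi> q) * norm (K q y) + norm (\<phi> q) * (norm (K q y) * norm (f y) powr p)"
      by (simp add: algebra_simps)
    also have "\<dots> \<le> ?B * indicator (cball 0 R) q * norm (K q y) + ?B * (norm (K q y) * norm (f y) powr p)"
      using b by (intro add_mono mult_right_mono) auto
    finally have "ennreal (norm (\<phi> q) * (norm (K q y) * norm (f y))) \<le> ennreal (?B * indicator (cball 0 R) q * norm (K q y) + ?B * (norm (K q y) * norm (f y) powr p))"
      by (rule ennreal_leI)
    also have "\<dots> = ennreal (?B * indicator (cball 0 R) q) * ennreal (norm (K q y)) + ennreal ?B * ennreal (norm (K q y)) * ennreal (norm (f y) powr p)"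
      by (simp add: ennreal_mult mult.assoc)
    finally show "ennreal (norm (case x of (q, y) \<Rightarrow> \<phi> q * (K q y * f y)))
      \<le> (case x of (q, y) \<Rightarrow> ennreal (?B * indicator (cball 0 R) q) * ennreal (norm (K q y)))
          + (case x of (q, y) \<Rightarrow> ennreal ?B * ennreal (norm (K q y)) * ennreal (norm (f y) powr p))"
      by (simp add: x norm_mult)
  qed
  also have "\<dots> = (\<integral>\<^sup>+q. \<integral>\<^sup>+y. ennreal (?B * indicator (cball 0 R) q) * ennreal (norm (K q y)) \<partial>lborel \<partial>lborel)
      + (\<integral>\<^sup>+y. \<integral>\<^sup>+q. ennreal ?B * ennreal (norm (K q y)) * ennreal (norm (f y) powr p) \<partial>lborel \<partial>lborel)"
  proof (subst nn_integral_add)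
    have "(\<integral>\<^sup>+x. (case x of (q, y) \<Rightarrow> ennreal (?B * indicator (cball 0 R) q) * ennreal (norm (K q y))) \<partial>(lborel \<Otimes>\<^sub>M lborel))
      = (\<integral>\<^sup>+q. \<integral>\<^sup>+y. ennreal (?B * indicator (cball 0 R) q) * ennreal (norm (K q y)) \<partial>lborel \<partial>lborel)"
      unfolding case_prod_beta' by (subst lborel.nn_integral_fst[symmetric], measurable) simp_all
    moreover have "(\<integral>\<^sup>+x. (case x of (q, y) \<Rightarrow> ennreal ?B * ennreal (norm (K q y)) * ennreal (norm (f y) powr p)) \<partial>(lborel \<Otimes>\<^sub>M lborel))
      = (\<integral>\<^sup>+y. \<integral>\<^sup>+q. ennreal ?B * ennreal (norm (K q y)) * ennreal (norm (f y) powr p) \<partial>lborel \<partial>lborel)"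
      unfolding case_prod_beta' by (subst lborel_pair.nn_integral_snd[symmetric], measurable)
    ultimately show "(\<integral>\<^sup>+x. (case x of (q, y) \<Rightarrow> ennreal (?B * indicator (cball 0 R) q) * ennreal (norm (K q y))) \<partial>(lborel \<Otimes>\<^sub>M lborel))
      + (\<integral>\<^sup>+x. (case x of (q, y) \<Rightarrow> ennreal ?B * ennreal (norm (K q y)) * ennreal (norm (f y) powr p)) \<partial>(lborel \<Otimes>\<^sub>M lborel))
      = (\<integral>\<^sup>+q. \<integral>\<^sup>+y. ennreal (?B * indicator (cball 0 R) q) * ennreal (norm (K q y)) \<partial>lborel \<partial>lborel)
      + (\<integral>\<^sup>+y. \<integral>\<^sup>+q. ennreal ?B * ennreal (norm (K q y)) * ennreal (norm (f y) powr p) \<partial>lborel \<partial>lborel)"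
      by simp
    have [measurable]: "(\<lambda>x::'a \<times> 'a. indicat_real (cball 0 R) (fst x)) \<in> borel_measurable (lborel \<Otimes>\<^sub>M lborel)"
      by (rule measurable_compose[OF measurable_fst]) (simp add: borel_measurable_indicator borel_closed)
    show "(\<lambda>(q, y). ennreal (?B * indicator (cball 0 R) q) * ennreal (norm (K q y))) \<in> borel_measurable (lborel \<Otimes>\<^sub>M lborel)"
      unfolding case_prod_beta'
      by simp
    have [measurable]: "(\<lambda>x::'a \<times> 'a. norm (f (snd x)) powr p) \<in> borel_measurable (lborel \<Otimes>\<^sub>M lborel)"
      by (rule measurable_compose[OF measurable_snd]) simp
    show "(\<lambda>(q, y). ennreal ?B * ennreal (norm (K q y)) * ennreal (norm (f y) powr p)) \<in> borel_measurable (lborel \<Otimes>\<^sub>M lborel)"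
      unfolding case_prod_beta'
      by simp
  qed
  finally have 1: "(\<integral>\<^sup>+x. ennreal (norm (case x of (q, y) \<Rightarrow> \<phi> q * (K q y * f y))) \<partial>(lborel \<Otimes>\<^sub>M lborel))
     \<le> (\<integral>\<^sup>+q. \<integral>\<^sup>+y. ennreal (?B * indicator (cball 0 R) q) * ennreal (norm (K q y)) \<partial>lborel \<partial>lborel)
      + (\<integral>\<^sup>+y. \<integral>\<^sup>+q. ennreal ?B * ennreal (norm (K q y)) * ennreal (norm (f y) powr p) \<partial>lborel \<partial>lborel)" .
  have "(\<integral>\<^sup>+q. \<integral>\<^sup>+y. ennreal (?B * indicator (cball 0 R) q) * ennreal (norm (K q y)) \<partial>lborel \<partial>lborel)
      \<le> (\<integral>\<^sup>+q. ennreal (?B * indicator (cball (0::'a) R) q) * ennreal C \<partial>lborel)"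
  proof (rule nn_integral_mono)
    fix q
    have "(\<integral>\<^sup>+y. ennreal (?B * indicator (cball 0 R) q) * ennreal (norm (K q y)) \<partial>lborel)
       = ennreal (?B * indicator (cball 0 R) q) * (\<integral>\<^sup>+y. ennreal (norm (K q y)) \<partial>lborel)"
      by (rule nn_integral_cmult) measurable
    also have "\<dots> \<le> ennreal (?B * indicator (cball 0 R) q) * ennreal C" by (intro mult_left_mono K1) auto
    finally show "(\<integral>\<^sup>+y. ennreal (?B * indicator (cball 0 R) q) * ennreal (norm (K q y)) \<partial>lborel)
       \<le> ennreal (?B * indicator (cball 0 R) q) * ennreal C" .
  qed
  also have "\<dots> = (\<integral>\<^sup>+q. ennreal (norm (?B * indicat_real (cball (0::'a) R) q)) \<partial>lborel) * ennreal C"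
    using borel_measurable_integrable[OF integrable_indicator_cball[of ?B R, where 'a='a]] by (subst nn_integral_multc) simp_all
  also have "\<dots> < \<infinity>"
    using integrable_indicator_cball[of ?B R, where 'a='a] unfolding integrable_iff_bounded
    by (simp add: ennreal_mult_less_top)
  finally have 2: "(\<integral>\<^sup>+q. \<integral>\<^sup>+y. ennreal (?B * indicator (cball 0 R) q) * ennreal (norm (K q y)) \<partial>lborel \<partial>lborel) < \<infinity>" .
  have "(\<integral>\<^sup>+y. \<integral>\<^sup>+q. ennreal ?B * ennreal (norm (K q y)) * ennreal (norm (f y) powr p) \<partial>lborel \<partial>lborel)
      \<le> (\<integral>\<^sup>+y. ennreal ?B * ennreal C * ennreal (norm (f y) powr p) \<partial>lborel)"
  proof (rule nn_integral_mono)
    fix y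
    have "(\<integral>\<^sup>+q. ennreal ?B * ennreal (norm (K q y)) * ennreal (norm (f y) powr p) \<partial>lborel)
       = (\<integral>\<^sup>+q. ennreal ?B * ennreal (norm (K q y)) \<partial>lborel) * ennreal (norm (f y) powr p)"
      by (rule nn_integral_multc) measurable
    also have "(\<integral>\<^sup>+q. ennreal ?B * ennreal (norm (K q y)) \<partial>lborel) = ennreal ?B * (\<integral>\<^sup>+q. ennreal (norm (K q y)) \<partial>lborel)"
      by (rule nn_integral_cmult) measurable
    also have "ennreal ?B * (\<integral>\<^sup>+q. ennreal (norm (K q y)) \<partial>lborel) * ennreal (norm (f y) powr p)
       \<le> ennreal ?B * ennreal C * ennreal (norm (f y) powr p)"
      by (intro mult_left_mono mult_right_mono K2) auto
    finally show "(\<integral>\<^sup>+q. ennreal ?B * ennreal (norm (K q y)) * ennreal (norm (f y) powr p) \<partial>lborel)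
       \<le> ennreal ?B * ennreal C * ennreal (norm (f y) powr p)" .
  qed
  also have "\<dots> = ennreal ?B * ennreal C * ennreal (nLp p f powr p)"
    by (simp add: nn_integral_cmult mLp_nn_integral[OF f p])
  also have "\<dots> < \<infinity>" by (simp add: ennreal_mult_less_top)
  finally have "(\<integral>\<^sup>+y. \<integral>\<^sup>+q. ennreal ?B * ennreal (norm (K q y)) * ennreal (norm (f y) powr p) \<partial>lborel \<partial>lborel) < \<infinity>" .
  with 1 2 show "(\<integral>\<^sup>+x. ennreal (norm (case x of (q, y) \<Rightarrow> \<phi> q * (K q y * f y))) \<partial>(lborel \<Otimes>\<^sub>M lborel)) < \<infinity>"
    by (auto intro: le_less_trans)
qed

end

section \<open>Gaussian integrals\<close>

lemma nn_integral_gauss_real: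
  assumes "c > 0" shows "(\<integral>\<^sup>+x. ennreal (exp (- c * x\<^sup>2)) \<partial>lborel) < \<infinity>"
proof -
  define s where "s = sqrt (1 / (2 * c))"
  have s: "s > 0" "2 * s\<^sup>2 = 1 / c" using assms by (auto simp: s_def field_simps)
  have eq: "exp (- c * x\<^sup>2) = sqrt (2 * pi * s\<^sup>2) * normal_density 0 s x" for x
    using s assms by (simp add: normal_density_def)
  have "integrable lborel (\<lambda>x. exp (- c * x\<^sup>2))"
    unfolding eq using s by (intro integrable_mult_right integrable_normal_density) auto
  then show ?thesis unfolding integrable_iff_bounded by simp
qed

lemma nn_integral_gauss:
  assumes "c > 0"
  shows "(\<integral>\<^sup>+z. ennreal (exp (- (c * (norm (z::'a::euclidean_space))\<^sup>2))) \<partial>lborel) < \<infinity>"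
proof -
  have "exp (- (c * (norm z)\<^sup>2)) = (\<Prod>b\<in>Basis. exp (- c * (z \<bullet> b)\<^sup>2))" for z :: 'a
    unfolding power2_norm_eq_inner euclidean_inner[of z z]
    by (simp add: exp_sum[symmetric] sum_distrib_left sum_negf power2_eq_square)
  then have "(\<integral>\<^sup>+z. ennreal (exp (- (c * (norm (z::'a))\<^sup>2))) \<partial>lborel)
     = (\<integral>\<^sup>+z. (\<Prod>b\<in>Basis. ennreal (exp (- c * ((z::'a) \<bullet> b)\<^sup>2))) \<partial>lborel)"
    by (simp add: prod_ennreal)
  also have "\<dots> = (\<Prod>b\<in>(Basis::'a set). (\<integral>\<^sup>+x. ennreal (exp (- c * x\<^sup>2)) \<partial>lborel))"
    by (rule nn_integral_lborel_prod[where f="\<lambda>b x. ennreal (exp (- c * x\<^sup>2))"]) auto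
  also have "\<dots> < \<infinity>"
    using nn_integral_gauss_real[OF assms] by (auto simp: less_top[symmetric] power_eq_top_ennreal)
  finally show ?thesis .
qed

lemma integrable_gauss:
  assumes "c > 0"
  shows "integrable lborel (\<lambda>z::'a::euclidean_space. exp (- (c * (norm z)\<^sup>2)))"
  using nn_integral_gauss[OF assms, where 'a='a] by (intro integrableI_bounded) auto

lemma nn_integral_affine:
  fixes f :: "'a::euclidean_space \<Rightarrow> ennreal"
  assumes [measurable]: "f \<in> borel_measurable borel" and c: "c \<noteq> 0"
  shows "(\<integral>\<^sup>+x. f x \<partial>lborel) = ennreal (\<bar>c\<bar> ^ DIM('a)) * (\<integral>\<^sup>+x. f (p + c *\<^sub>R x) \<partial>lborel)"
  by (subst lborel_affine[OF c, of p])
     (simp add: nn_integral_density nn_integral_distr nn_integral_cmult)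

text \<open>The substitution is triangular, so it splits into two affine ones and the shear
  \<open>d\<close> does not enter the Jacobian. With \<open>c1\<close> of size
  \<open>t^(3/2)\<close> and \<open>c2\<close> of size \<open>t^(1/2)\<close> it is the scaling
  under which the kernel becomes a fixed Gaussian.\<close>

lemma nn_integral_shear:
  fixes f :: "'a::euclidean_space \<times> 'a \<Rightarrow> ennreal"
  assumes [measurable]: "f \<in> borel_measurable borel" and c: "c1 \<noteq> 0" "c2 \<noteq> 0"
  shows "(\<integral>\<^sup>+z. f z \<partial>lborel) = ennreal (\<bar>c1 * c2\<bar> ^ DIM('a))
    * (\<integral>\<^sup>+z. f (p1 + d *\<^sub>R snd z + c1 *\<^sub>R fst z, p2 + c2 *\<^sub>R snd z) \<partial>lborel)"
proof -
  have [measurable]: "f \<in> borel_measurable (borel \<Otimes>\<^sub>M borel)" by (simp add: borel_prod)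
  have "(\<integral>\<^sup>+z. f z \<partial>lborel) = (\<integral>\<^sup>+v. \<integral>\<^sup>+x. f (x, v) \<partial>lborel \<partial>lborel)"
    unfolding lborel_prod[symmetric] by (subst lborel_pair.nn_integral_snd) auto
  also have "\<dots> = ennreal (\<bar>c2\<bar> ^ DIM('a)) * (\<integral>\<^sup>+v. \<integral>\<^sup>+x. f (x, p2 + c2 *\<^sub>R v) \<partial>lborel \<partial>lborel)"
    by (rule nn_integral_affine[OF _ c(2)]) measurable
  also have "\<dots> = ennreal (\<bar>c2\<bar> ^ DIM('a)) * (\<integral>\<^sup>+v. ennreal (\<bar>c1\<bar> ^ DIM('a)) *
      (\<integral>\<^sup>+x. f (p1 + d *\<^sub>R v + c1 *\<^sub>R x, p2 + c2 *\<^sub>R v) \<partial>lborel) \<partial>lborel)"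
    by (intro arg_cong2[where f="(*)"] refl nn_integral_cong nn_integral_affine[OF _ c(1)]) measurable
  also have "\<dots> = ennreal (\<bar>c2\<bar> ^ DIM('a)) * (ennreal (\<bar>c1\<bar> ^ DIM('a)) * (\<integral>\<^sup>+v.
      \<integral>\<^sup>+x. f (p1 + d *\<^sub>R v + c1 *\<^sub>R x, p2 + c2 *\<^sub>R v) \<partial>lborel \<partial>lborel))"
    by (subst nn_integral_cmult) auto
  also have "(\<integral>\<^sup>+v. \<integral>\<^sup>+x. f (p1 + d *\<^sub>R v + c1 *\<^sub>R x, p2 + c2 *\<^sub>R v) \<partial>lborel \<partial>lborel)
     = (\<integral>\<^sup>+z. f (p1 + d *\<^sub>R snd z + c1 *\<^sub>R fst z, p2 + c2 *\<^sub>R snd z) \<partial>lborel)"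
    unfolding lborel_prod[symmetric] by (subst lborel_pair.nn_integral_snd[symmetric]) auto
  finally show ?thesis
    by (simp add: abs_mult power_mult_distrib ennreal_mult mult_ac)
qed

lemma lborel_shear:
  fixes p1 p2 :: "'a::euclidean_space"
  assumes c: "c1 \<noteq> 0" "c2 \<noteq> 0"
  shows "lborel = density (distr lborel borel
     (\<lambda>z. (p1 + d *\<^sub>R snd z + c1 *\<^sub>R fst z, p2 + c2 *\<^sub>R snd z))) (\<lambda>_. ennreal (\<bar>c1 * c2\<bar> ^ DIM('a)))"
    (is "_ = density (distr _ _ ?T) _")
proof (rule measure_eqI)
  fix X :: "('a \<times> 'a) set" assume "X \<in> sets lborel"
  then have X [measurable]: "X \<in> sets borel" by simp
  have T [measurable]: "?T \<in> borel \<rightarrow>\<^sub>M borel"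
    by (intro borel_measurable_continuous_onI continuous_intros)
  have "emeasure lborel X = (\<integral>\<^sup>+z. indicator X z \<partial>lborel)" by simp
  also have "\<dots> = ennreal (\<bar>c1 * c2\<bar> ^ DIM('a)) * (\<integral>\<^sup>+z. indicator X (?T z) \<partial>lborel)"
    by (rule nn_integral_shear[OF _ c]) simp
  also have "\<dots> = emeasure (density (distr lborel borel ?T) (\<lambda>_. ennreal (\<bar>c1 * c2\<bar> ^ DIM('a)))) X"
    by (simp add: emeasure_density nn_integral_distr nn_integral_cmult del: nn_integral_indicator)
  finally show "emeasure lborel X = emeasure (density (distr lborel borel ?T) (\<lambda>_. ennreal (\<bar>c1 * c2\<bar> ^ DIM('a)))) X" .
qed simp

lemma integral_shear:
  fixes f :: "'a::euclidean_space \<times> 'a \<Rightarrow> 'b::{banach, second_countable_topology}"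
  assumes [measurable]: "f \<in> borel_measurable borel" and c: "c1 \<noteq> 0" "c2 \<noteq> 0"
  shows "(\<integral>z. f z \<partial>lborel) = (\<bar>c1 * c2\<bar> ^ DIM('a))
    *\<^sub>R (\<integral>z. f (p1 + d *\<^sub>R snd z + c1 *\<^sub>R fst z, p2 + c2 *\<^sub>R snd z) \<partial>lborel)"
proof -
  have T [measurable]: "(\<lambda>z. (p1 + d *\<^sub>R snd z + c1 *\<^sub>R fst z, p2 + c2 *\<^sub>R snd z)) \<in> borel \<rightarrow>\<^sub>M borel"
    by (intro borel_measurable_continuous_onI continuous_intros)
  show ?thesis
    by (subst lborel_shear[OF c, of p1 d p2]) (simp add: integral_density integral_distr)
qed

section \<open>The parametrix\<close>

type_synonym 'n phase = "(real^'n) \<times> (real^'n)"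

text \<open>The velocity coefficient \<open>m\<close> may have either sign: the formal transpose of the operator
  \<open>Pop\<close> is the same operator for \<open>- m\<close> and \<open>- F\<close>.  Since the operator of the theorem is defined by
  testing against its transpose, the theorem is about the instance with parameters \<open>- m\<close> and
  \<open>F = \<nabla>V\<close>.\<close>

locale kfp =
  fixes m a b d0 :: real and F :: "real^'n::finite \<Rightarrow> real^'n" and L :: real
  assumes m: "m \<noteq> 0" and a: "a > 0" and b: "b > 0" and L: "L \<ge> 0"
    and lip: "\<And>x y. norm (F x - F y) \<le> L * norm (x - y)"
begin

text \<open>In \<open>k t q y\<close> the force is frozen at the pole \<open>q\<close>, and \<open>A\<close>, \<open>B\<close> measure the deviation of \<open>y\<close> from
  the frozen trajectory; the Gaussian in \<open>A\<close>, \<open>B\<close> is Kolmogorov's fundamental solution, \<open>W\<close> is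
  the integral of \<open>|v + s F|\<^sup>2\<close> over \<open>0 \<le> s \<le> t\<close> along that trajectory, and \<open>Z\<close> normalises the mass.\<close>

definition A :: "real \<Rightarrow> 'n phase \<Rightarrow> 'n phase \<Rightarrow> real^'n" where
  "A t q y = snd y - snd q - t *\<^sub>R F (fst q)"

definition B :: "real \<Rightarrow> 'n phase \<Rightarrow> 'n phase \<Rightarrow> real^'n" where
  "B t q y = fst y - fst q - (m * t / 2) *\<^sub>R (snd y + snd q)"

definition W :: "real \<Rightarrow> 'n phase \<Rightarrow> real" where
  "W t q = t * (norm (snd q))\<^sup>2 + t\<^sup>2 * (snd q \<bullet> F (fst q)) + t ^ 3 / 3 * (norm (F (fst q)))\<^sup>2"

definition Q :: "real \<Rightarrow> 'n phase \<Rightarrow> 'n phase \<Rightarrow> real" where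
  "Q t q y = (norm (A t q y))\<^sup>2 / (4 * a * t) + 3 * (norm (B t q y))\<^sup>2 / (a * m\<^sup>2 * t ^ 3) + b * W t q"

definition Z :: real where
  "Z = (\<integral>z. exp (- ((norm (snd z))\<^sup>2 / (4 * a) + 3 * (norm (fst z))\<^sup>2 / (a * m\<^sup>2)))
     \<partial>(lborel :: 'n phase measure))"

definition k :: "real \<Rightarrow> 'n phase \<Rightarrow> 'n phase \<Rightarrow> real" where
  "k t q y = exp (- Q t q y) / (Z * t ^ (2 * CARD('n)))"

text \<open>Logarithmic derivatives of \<open>k\<close> in \<open>x\<close>, \<open>v\<close> and \<open>t\<close>; \<open>err\<close> is the factor with
  \<open>(\<partial>\<^sub>t + Pop) k = err k\<close>, in which the terms singular in \<open>t\<close> cancel up to the variation of \<open>F\<close>.\<close>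

definition lx :: "real \<Rightarrow> 'n phase \<Rightarrow> 'n phase \<Rightarrow> real^'n" where
  "lx t q y = (- 6 / (a * m\<^sup>2 * t ^ 3)) *\<^sub>R B t q y"

definition lv :: "real \<Rightarrow> 'n phase \<Rightarrow> 'n phase \<Rightarrow> real^'n" where
  "lv t q y = (- 1 / (2 * a * t)) *\<^sub>R A t q y + (3 / (a * m * t\<^sup>2)) *\<^sub>R B t q y"

definition lt :: "real \<Rightarrow> 'n phase \<Rightarrow> 'n phase \<Rightarrow> real" where
  "lt t q y = - 2 * real CARD('n) / t + (A t q y \<bullet> F (fst q)) / (2 * a * t) + (norm (A t q y))\<^sup>2 / (4 * a * t\<^sup>2)
     + 3 * (B t q y \<bullet> (snd y + snd q)) / (a * m * t ^ 3) + 9 * (norm (B t q y))\<^sup>2 / (a * m\<^sup>2 * t ^ 4)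
     - b * (norm (snd q + t *\<^sub>R F (fst q)))\<^sup>2"

definition err :: "real \<Rightarrow> 'n phase \<Rightarrow> 'n phase \<Rightarrow> real" where
  "err t q y = b * ((norm (snd y))\<^sup>2 - (norm (snd q + t *\<^sub>R F (fst q)))\<^sup>2) - d0
     + (F (fst y) - F (fst q)) \<bullet> lv t q y"

definition Pop :: "('n phase \<Rightarrow> 'b::real_normed_vector) \<Rightarrow> 'n phase \<Rightarrow> 'b" where
  "Pop \<psi> y = (\<Sum>i\<in>UNIV. (m * snd y $ i) *\<^sub>R dir_deriv (basis_x i) \<psi> y)
     + (\<Sum>i\<in>UNIV. (F (fst y) $ i) *\<^sub>R dir_deriv (basis_v i) \<psi> y)
     - (\<Sum>i\<in>UNIV. a *\<^sub>R dir_deriv (basis_v i) (dir_deriv (basis_v i) \<psi>) y)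
     + (b * (norm (snd y))\<^sup>2 - d0) *\<^sub>R \<psi> y"

lemma F_continuous: "continuous_on S F"
proof -
  have "L-lipschitz_on S F" using L lip by (auto simp: lipschitz_on_def dist_norm)
  then show ?thesis by (rule lipschitz_on_continuous_on)
qed

lemma F_measurable [measurable]: "F \<in> borel_measurable borel"
  by (rule borel_measurable_continuous_onI[OF F_continuous])

lemma k_integrable_Z:
  "integrable lborel (\<lambda>z::'n phase. exp (- ((norm (snd z))\<^sup>2 / (4 * a) + 3 * (norm (fst z))\<^sup>2 / (a * m\<^sup>2))))"
proof -
  define c where "c = min (1 / (4 * a)) (3 / (a * m\<^sup>2))"
  have c: "c > 0" using a m by (simp add: c_def)
  show ?thesis
  proof (rule Bochner_Integration.integrable_bound[OF integrable_gauss[OF c]])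
    have "c * (norm z)\<^sup>2 \<le> (norm (snd z))\<^sup>2 / (4 * a) + 3 * (norm (fst z))\<^sup>2 / (a * m\<^sup>2)" for z :: "'n phase"
    proof -
      have "c * (norm z)\<^sup>2 = c * (norm (fst z))\<^sup>2 + c * (norm (snd z))\<^sup>2"
        by (simp add: norm_prod_def distrib_left)
      also have "\<dots> \<le> 3 / (a * m\<^sup>2) * (norm (fst z))\<^sup>2 + 1 / (4 * a) * (norm (snd z))\<^sup>2"
        by (intro add_mono mult_right_mono) (auto simp: c_def)
      finally show ?thesis by simp
    qed
    then show "AE z in lborel. norm (exp (- ((norm (snd z))\<^sup>2 / (4 * a) + 3 * (norm (fst z))\<^sup>2 / (a * m\<^sup>2))))
        \<le> norm (exp (- (c * (norm (z::'n phase))\<^sup>2)))"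
      unfolding real_norm_def abs_exp_cancel exp_le_cancel_iff neg_le_iff_le by (intro AE_I2)
    show "(\<lambda>z::'n phase. exp (- ((norm (snd z))\<^sup>2 / (4 * a) + 3 * (norm (fst z))\<^sup>2 / (a * m\<^sup>2)))) \<in> borel_measurable lborel"
      using a m by (simp, intro borel_measurable_continuous_onI continuous_intros) auto
  qed
qed

lemma Z_pos: "Z > 0"
proof -
  have "Z \<ge> 0" unfolding Z_def by (rule integral_nonneg_AE) simp
  moreover have "Z \<noteq> 0"
  proof
    assume "Z = 0"
    then have "AE z::'n phase in lborel. exp (- ((norm (snd z))\<^sup>2 / (4 * a) + 3 * (norm (fst z))\<^sup>2 / (a * m\<^sup>2))) = 0"
      unfolding Z_def by (subst (asm) integral_nonneg_eq_0_iff_AE[OF k_integrable_Z]) auto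
    then have "AE z::'n phase in lborel. False" by simp
    then show False by (simp add: AE_iff_measurable[OF _ refl] flip: ex_in_conv)
  qed
  ultimately show ?thesis by simp
qed

lemma k_has_derivative_t:
  assumes t: "t > 0"
  shows "((\<lambda>t. k t q y) has_real_derivative k t q y * lt t q y) (at t)"
proof -
  have dA: "((\<lambda>t. (norm (A t q y))\<^sup>2) has_real_derivative - 2 * (A t q y \<bullet> F (fst q))) (at t)" for t
    unfolding power2_norm_eq_inner A_def
    by (auto intro!: derivative_eq_intros simp: has_field_derivative_def inner_commute algebra_simps)
  have dB: "((\<lambda>t. (norm (B t q y))\<^sup>2) has_real_derivative - m * (B t q y \<bullet> (snd y + snd q))) (at t)" for t
    unfolding power2_norm_eq_inner B_def
    by (auto intro!: derivative_eq_intros simp: has_field_derivative_def inner_commute algebra_simps)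
  have dW: "((\<lambda>t. W t q) has_real_derivative (norm (snd q + t *\<^sub>R F (fst q)))\<^sup>2) (at t)" for t
  proof -
    have "(norm (snd q + t *\<^sub>R F (fst q)))\<^sup>2
       = 1 * (norm (snd q))\<^sup>2 + 2 * t * (snd q \<bullet> F (fst q)) + t\<^sup>2 * (norm (F (fst q)))\<^sup>2"
      unfolding power2_norm_eq_inner
      by (simp add: inner_add_left inner_add_right inner_commute power2_eq_square algebra_simps)
    moreover have "((\<lambda>t. W t q) has_real_derivative
       1 * (norm (snd q))\<^sup>2 + 2 * t * (snd q \<bullet> F (fst q)) + t\<^sup>2 * (norm (F (fst q)))\<^sup>2) (at t)"
      unfolding W_def by (auto intro!: derivative_eq_intros)
    ultimately show ?thesis by simp
  qed
  define Q' where "Q' = (- 2 * (A t q y \<bullet> F (fst q))) / (4 * a * t) - (norm (A t q y))\<^sup>2 / (4 * a * t\<^sup>2)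
    + 3 * (- m * (B t q y \<bullet> (snd y + snd q))) / (a * m\<^sup>2 * t ^ 3) - 9 * (norm (B t q y))\<^sup>2 / (a * m\<^sup>2 * t ^ 4)
    + b * (norm (snd q + t *\<^sub>R F (fst q)))\<^sup>2"
  have dQ: "((\<lambda>t. Q t q y) has_real_derivative Q') (at t)"
  proof -
    have "((\<lambda>t. f t / (4 * a * t) + 3 * g t / (a * m\<^sup>2 * t ^ 3) + b * w t) has_real_derivative
      f' / (4 * a * t) - f t / (4 * a * t\<^sup>2) + 3 * g' / (a * m\<^sup>2 * t ^ 3) - 9 * g t / (a * m\<^sup>2 * t ^ 4) + b * w') (at t)"
      if [derivative_intros]: "(f has_real_derivative f') (at t)" "(g has_real_derivative g') (at t)"
        "(w has_real_derivative w') (at t)" for f g w f' g' w'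
    proof -
      have 1: "((\<lambda>t. f t / (4 * a * t)) has_real_derivative f' / (4 * a * t) - f t / (4 * a * t\<^sup>2)) (at t)"
        using t a by (auto intro!: derivative_eq_intros that simp: field_simps power2_eq_square)
      have 2: "((\<lambda>t. 3 * g t / (a * m\<^sup>2 * t ^ 3)) has_real_derivative 3 * g' / (a * m\<^sup>2 * t ^ 3) - 9 * g t / (a * m\<^sup>2 * t ^ 4)) (at t)"
      proof -
        have "((\<lambda>t. (3 / (a * m\<^sup>2)) * (g t * inverse t ^ 3)) has_real_derivative
          (3 / (a * m\<^sup>2)) * (g' * inverse t ^ 3 + g t * (3 * inverse t ^ 2 * (- (inverse t * inverse t))))) (at t)"
          using t a m by (auto intro!: derivative_eq_intros that)
        moreover have "(3 / (a * m\<^sup>2)) * (g' * inverse t ^ 3 + g t * (3 * inverse t ^ 2 * (- (inverse t * inverse t))))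
           = 3 * g' / (a * m\<^sup>2 * t ^ 3) - 9 * g t / (a * m\<^sup>2 * t ^ 4)"
          using t a m by (simp add: field_simps power2_eq_square power3_eq_cube power4_eq_xxxx)
        moreover have "(3 / (a * m\<^sup>2)) * (g t * inverse t ^ 3) = 3 * g t / (a * m\<^sup>2 * t ^ 3)" for t
          by (simp add: divide_inverse power_inverse)
        ultimately show ?thesis by simp
      qed
      show ?thesis
        by (rule DERIV_cong[OF DERIV_add[OF DERIV_add[OF 1 2] DERIV_cmult[OF that(3), of b]]]) simp
    qed
    from this[OF dA dB dW] show ?thesis unfolding Q_def Q'_def by simp
  qed
  have "((\<lambda>t. exp (- Q t q y) * (inverse Z * inverse t ^ (2 * CARD('n)))) has_real_derivative
     exp (- Q t q y) * (inverse Z * inverse t ^ (2 * CARD('n))) * (- Q' - 2 * real CARD('n) / t)) (at t)"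
  proof -
    have "((\<lambda>t. exp (- Q t q y) * (inverse Z * inverse t ^ (2 * CARD('n)))) has_real_derivative
      exp (- Q t q y) * (inverse Z * (real (2 * CARD('n)) * inverse t ^ (2 * CARD('n) - 1) * (- (inverse t * inverse t))))
      + exp (- Q t q y) * (- Q') * (inverse Z * inverse t ^ (2 * CARD('n)))) (at t)"
      using t by (auto intro!: derivative_eq_intros dQ)
    moreover have "real (2 * CARD('n)) * inverse t ^ (2 * CARD('n) - 1) * (- (inverse t * inverse t))
        = inverse t ^ (2 * CARD('n)) * (- 2 * real CARD('n) / t)"
      by (simp add: power_eq_if divide_inverse)
    then have "exp (- Q t q y) * (inverse Z * (real (2 * CARD('n)) * inverse t ^ (2 * CARD('n) - 1) * (- (inverse t * inverse t))))
      + exp (- Q t q y) * (- Q') * (inverse Z * inverse t ^ (2 * CARD('n)))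
      = exp (- Q t q y) * (inverse Z * inverse t ^ (2 * CARD('n))) * (- Q' - 2 * real CARD('n) / t)"
      by (simp only:) (simp add: algebra_simps)
    ultimately show ?thesis by simp
  qed
  moreover have "- Q' - 2 * real CARD('n) / t = lt t q y"
    using m by (simp add: Q'_def lt_def field_simps power2_eq_square)
  moreover have "exp (- Q t q y) * (inverse Z * inverse t ^ (2 * CARD('n))) = k t q y" for t
    by (simp add: k_def divide_inverse power_inverse)
  ultimately show ?thesis by simp
qed

lemma k_has_derivative:
  assumes t: "t > 0"
  shows "(k t q has_derivative (\<lambda>h. k t q y * (lx t q y \<bullet> fst h + lv t q y \<bullet> snd h))) (at y)"
proof -
  have dA: "(A t q has_derivative (\<lambda>h. snd h)) (at y)"
    unfolding A_def[abs_def] by (auto intro!: derivative_eq_intros)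
  have dB: "(B t q has_derivative (\<lambda>h. fst h - (m * t / 2) *\<^sub>R snd h)) (at y)"
    unfolding B_def[abs_def] by (auto intro!: derivative_eq_intros)
  define Q' where "Q' h = (2 * (A t q y \<bullet> snd h)) / (4 * a * t)
    + 3 * (2 * (B t q y \<bullet> (fst h - (m * t / 2) *\<^sub>R snd h))) / (a * m\<^sup>2 * t ^ 3)" for h
  have "((\<lambda>y. (norm (A t q y))\<^sup>2) has_derivative (\<lambda>h. 2 * (A t q y \<bullet> snd h))) (at y)"
    unfolding power2_norm_eq_inner by (auto intro!: derivative_eq_intros dA simp: inner_commute)
  moreover have "((\<lambda>y. (norm (B t q y))\<^sup>2) has_derivative (\<lambda>h. 2 * (B t q y \<bullet> (fst h - (m * t / 2) *\<^sub>R snd h)))) (at y)"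
    unfolding power2_norm_eq_inner by (auto intro!: derivative_eq_intros dB simp: inner_commute)
  moreover have lin: "((\<lambda>y. f y / c1 + 3 * g y / c2 + c3) has_derivative (\<lambda>h. f' h / c1 + 3 * g' h / c2)) (at y)"
    if "(f has_derivative f') (at y)" "(g has_derivative g') (at y)"
    for f g f' g' :: "'n phase \<Rightarrow> real" and c1 c2 c3
    unfolding divide_inverse
    by (rule has_derivative_eq_rhs, (rule derivative_intros that)+) (simp add: fun_eq_iff)
  ultimately have "(Q t q has_derivative Q') (at y)"
    unfolding Q_def[abs_def] Q'_def[abs_def] by blast
  then have "((\<lambda>y. exp (- Q t q y) / (Z * t ^ (2 * CARD('n)))) has_derivative
      (\<lambda>h. exp (- Q t q y) * (- Q' h) / (Z * t ^ (2 * CARD('n))))) (at y)"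
    using t Z_pos by (auto intro!: derivative_eq_intros)
  moreover have "- Q' h = lx t q y \<bullet> fst h + lv t q y \<bullet> snd h" for h
    using t a m unfolding Q'_def lx_def lv_def
    by (simp add: inner_simps) (simp add: field_simps power2_eq_square power3_eq_cube)
  ultimately show ?thesis by (simp add: k_def[abs_def])
qed

lemma lv_has_derivative:
  "((\<lambda>y. lv t q y $ i) has_derivative (\<lambda>h. - (1 / (2 * a * t)) * snd h $ i
     + 3 / (a * m * t\<^sup>2) * (fst h $ i - m * t / 2 * snd h $ i))) (at y)"
proof -
  have "(lv t q has_derivative (\<lambda>h. (- 1 / (2 * a * t)) *\<^sub>R snd h
      + (3 / (a * m * t\<^sup>2)) *\<^sub>R (fst h - (m * t / 2) *\<^sub>R snd h))) (at y)"
    unfolding lv_def[abs_def] A_def B_def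
    by (rule has_derivative_eq_rhs, (rule derivative_intros)+) (simp add: fun_eq_iff)
  from bounded_linear.has_derivative[OF bounded_linear_vec_nth this, of i]
  show ?thesis by simp
qed

lemma k_dir_deriv:
  assumes "t > 0"
  shows "dir_deriv (basis_x i) (k t q) y = k t q y * lx t q y $ i"
    and "dir_deriv (basis_v i) (k t q) y = k t q y * lv t q y $ i"
  by (simp_all add: dir_deriv_eq[OF k_has_derivative[OF assms]] inner_axis)

text \<open>The constant is \<open>1 / (2 * a * t) + 3 / (2 * a * t)\<close>, from the
  \<open>A\<close> part and the \<open>B\<close> part of \<open>lv\<close>. Multiplied by
  \<open>a\<close> and summed over all components it gives \<open>2 * CARD('n) / t\<close>, which
  the factor \<open>t ^ (2 * CARD('n))\<close> in the denominator of \<open>k\<close>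
  cancels.\<close>

lemma k_dir_deriv2:
  assumes t: "t > 0"
  shows "dir_deriv (basis_v i) (dir_deriv (basis_v i) (k t q)) y = k t q y * ((lv t q y $ i)\<^sup>2 - 2 / (a * t))"
proof -
  have 1: "dir_deriv (basis_v i) (k t q) = (\<lambda>y. k t q y * lv t q y $ i)"
    using k_dir_deriv(2)[OF t] by blast
  show ?thesis unfolding 1
    by (subst dir_deriv_eq[OF has_derivative_mult[OF k_has_derivative[OF t] lv_has_derivative]])
       (use t a m in \<open>simp add: inner_axis field_simps power2_eq_square\<close>)
qed

text \<open>Together with the time derivative \<open>k * lt\<close> this is the defining property of
  the parametrix: applying the time derivative plus \<open>Pop\<close> to \<open>k\<close> leaves
  \<open>err * k\<close>.\<close>

lemma Pop_k:
  assumes t: "t > 0"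
  shows "Pop (k t q) y = k t q y * (err t q y - lt t q y)"
proof -
  have "Pop (k t q) y = k t q y * (m * (snd y \<bullet> lx t q y) + F (fst y) \<bullet> lv t q y
     - a * (lv t q y \<bullet> lv t q y - real CARD('n) * (2 / (a * t))) + b * (norm (snd y))\<^sup>2 - d0)"
    unfolding Pop_def k_dir_deriv[OF t] k_dir_deriv2[OF t] inner_vec_def
    by (simp add: sum_distrib_left sum_subtractf algebra_simps power2_eq_square)
  also have "m * (snd y \<bullet> lx t q y) + F (fst y) \<bullet> lv t q y
     - a * (lv t q y \<bullet> lv t q y - real CARD('n) * (2 / (a * t))) + b * (norm (snd y))\<^sup>2 - d0
     = err t q y - lt t q y"
  proof -
    \<comment> \<open>Once the velocity of the pole is eliminated through \<open>A\<close>, all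
      terms are polynomial in \<open>A'\<close>, \<open>B'\<close>, \<open>f\<close>,
      \<open>v\<close> and the varying force, and the cancellation is an algebraic identity.\<close>
    define A' B' f v where defs: "A' = A t q y" "B' = B t q y" "f = F (fst q)" "v = snd y"
    have q: "snd q = v - A' - t *\<^sub>R f" by (simp add: defs A_def)
    have vq: "B' \<bullet> (v + (v - A' - t *\<^sub>R f)) = 2 * (B' \<bullet> v) - B' \<bullet> A' - t * (B' \<bullet> f)"
      by (simp only: inner_simps)
    show ?thesis
      unfolding err_def lt_def lx_def lv_def defs(1-4)[symmetric] q power2_norm_eq_inner vq
      using t a m
      by (simp add: inner_simps field_simps power2_eq_square power3_eq_cube power4_eq_xxxx inner_commute)
  qed
  finally show ?thesis .
qed

end

lemma pair_measurable [measurable (raw)]: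
  fixes g :: "'x \<Rightarrow> 'a::euclidean_space \<times> 'b::euclidean_space"
  assumes "g \<in> borel_measurable M"
  shows "(\<lambda>x. fst (g x)) \<in> borel_measurable M" and "(\<lambda>x. snd (g x)) \<in> borel_measurable M"
proof -
  have "continuous_on UNIV (\<lambda>z::'a \<times> 'b. fst z)" "continuous_on UNIV (\<lambda>z::'a \<times> 'b. snd z)"
    by (intro continuous_intros)+
  then show "(\<lambda>x. fst (g x)) \<in> borel_measurable M" "(\<lambda>x. snd (g x)) \<in> borel_measurable M"
    using borel_measurable_continuous_on assms by blast+
qed

context kfp begin

context
  fixes M :: "'x measure" and f :: "'x \<Rightarrow> real" and g h :: "'x \<Rightarrow> 'n phase"
  assumes [measurable]: "f \<in> borel_measurable M" "g \<in> borel_measurable M" "h \<in> borel_measurable M"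
begin

lemma A_measurable [measurable (raw)]: "(\<lambda>x. A (f x) (g x) (h x)) \<in> borel_measurable M"
  unfolding A_def by measurable

lemma B_measurable [measurable (raw)]: "(\<lambda>x. B (f x) (g x) (h x)) \<in> borel_measurable M"
  unfolding B_def by measurable

lemma W_measurable [measurable (raw)]: "(\<lambda>x. W (f x) (g x)) \<in> borel_measurable M"
  unfolding W_def by measurable

lemma k_measurable [measurable (raw)]: "(\<lambda>x. k (f x) (g x) (h x)) \<in> borel_measurable M"
  unfolding k_def Q_def by measurable

lemma lv_measurable [measurable (raw)]: "(\<lambda>x. lv (f x) (g x) (h x)) \<in> borel_measurable M"
  unfolding lv_def by measurable

lemma lt_measurable [measurable (raw)]: "(\<lambda>x. lt (f x) (g x) (h x)) \<in> borel_measurable M"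
  unfolding lt_def by measurable

lemma err_measurable [measurable (raw)]: "(\<lambda>x. err (f x) (g x) (h x)) \<in> borel_measurable M"
  unfolding err_def by measurable

end

section \<open>The Gaussian majorant and pointwise bounds\<close>

text \<open>The sum of the squares of the four quantities that the exponent controls, each scaled to
  order one: \<open>A\<close> has size \<open>t^(1/2)\<close>, \<open>B\<close> size
  \<open>t^(3/2)\<close>, the velocity of the pole size \<open>t^(-1/2)\<close> and the force there
  size \<open>t^(-3/2)\<close>.\<close>

definition S :: "real \<Rightarrow> 'n phase \<Rightarrow> 'n phase \<Rightarrow> real" where
  "S t q y = (norm (A t q y))\<^sup>2 / t + (norm (B t q y))\<^sup>2 / t ^ 3 + t * (norm (snd q))\<^sup>2 + t ^ 3 * (norm (F (fst q)))\<^sup>2"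

text \<open>The three entries are lower bounds for the coefficients of \<open>Q\<close> against the
  terms of \<open>S\<close>, with \<open>b / 16\<close> coming from \<open>W_lower\<close>. The
  final halving leaves half of the exponent free to absorb polynomial factors.\<close>

definition \<sigma> :: real where
  "\<sigma> = min (min (1 / (4 * a)) (3 / (a * m\<^sup>2))) (b / 16) / 2"

definition M :: "real \<Rightarrow> 'n phase \<Rightarrow> 'n phase \<Rightarrow> real" where
  "M t q y = exp (- (\<sigma> * S t q y)) / t ^ (2 * CARD('n))"

lemma M_measurable [measurable (raw)]:
  assumes [measurable]: "f \<in> borel_measurable N" "g \<in> borel_measurable N" "h \<in> borel_measurable N"
  shows "(\<lambda>x. M (f x) (g x) (h x)) \<in> borel_measurable N"
  unfolding M_def S_def by measurable

lemma \<sigma>_pos: "\<sigma> > 0"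
  using a b m by (simp add: \<sigma>_def)

lemma M_nonneg: "t > 0 \<Longrightarrow> M t q y \<ge> 0"
  by (simp add: M_def)

lemma k_nonneg: "t > 0 \<Longrightarrow> k t q y \<ge> 0"
  using Z_pos by (simp add: k_def)

lemma S_nonneg: "t > 0 \<Longrightarrow> S t q y \<ge> 0"
  by (simp add: S_def)

text \<open>With \<open>x = norm (snd q)\<close> and \<open>f = t * norm (F (fst q))\<close>
  Cauchy-Schwarz leaves the form \<open>x^2 - x f + f^2 / 3\<close>, which is positive definite
  because its discriminant is \<open>1 - 4 / 3\<close>; the constant 1/16 is small enough to be
  subtracted from both squares.\<close>

lemma W_lower:
  assumes t: "t > 0"
  shows "(t * (norm (snd q))\<^sup>2 + t ^ 3 * (norm (F (fst q)))\<^sup>2) / 16 \<le> W t q"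
proof -
  define x where "x = norm (snd q)"
  define f where "f = t * norm (F (fst q))"
  have "snd q \<bullet> F (fst q) \<ge> - (norm (snd q) * norm (F (fst q)))"
    using Cauchy_Schwarz_ineq2[of "snd q" "F (fst q)"] by linarith
  then have "t * (t * (snd q \<bullet> F (fst q))) \<ge> t * (t * (- (norm (snd q) * norm (F (fst q)))))"
    using t by (intro mult_left_mono) auto
  then have 1: "t\<^sup>2 * (snd q \<bullet> F (fst q)) \<ge> - (t * (x * f))"
    by (simp add: x_def f_def power2_eq_square algebra_simps)
  \<comment> \<open>Completed square of the form after subtraction:
    \<open>13/48 = 1/3 - 1/16\<close>, and this still exceeds \<open>4/15\<close>, the least
    coefficient for which the form is nonnegative.\<close>
  have "0 \<le> 15/16 * (x - 8/15 * f)\<^sup>2 + (13/48 - 4/15) * f\<^sup>2" by (intro add_nonneg_nonneg mult_nonneg_nonneg) auto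
  also have "\<dots> = 15/16 * x\<^sup>2 - x * f + 13/48 * f\<^sup>2" by (simp add: power2_eq_square algebra_simps)
  finally have "0 \<le> t * (15/16 * x\<^sup>2 - x * f + 13/48 * f\<^sup>2)" using t by simp
  moreover have "t ^ 3 * (norm (F (fst q)))\<^sup>2 = t * f\<^sup>2" by (simp add: f_def power2_eq_square power3_eq_cube)
  ultimately show ?thesis using 1 unfolding W_def x_def[symmetric] by (simp add: algebra_simps)
qed

lemma Q_lower:
  assumes t: "t > 0"
  shows "2 * \<sigma> * S t q y \<le> Q t q y"
proof -
  have s: "2 * \<sigma> \<le> 1 / (4 * a)" "2 * \<sigma> \<le> 3 / (a * m\<^sup>2)" "2 * \<sigma> \<le> b / 16" by (auto simp: \<sigma>_def)
  have "2 * \<sigma> * S t q y = 2 * \<sigma> * ((norm (A t q y))\<^sup>2 / t) + 2 * \<sigma> * ((norm (B t q y))\<^sup>2 / t ^ 3)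
      + 2 * \<sigma> * (t * (norm (snd q))\<^sup>2 + t ^ 3 * (norm (F (fst q)))\<^sup>2)"
    by (simp add: S_def distrib_left)
  also have "\<dots> \<le> 1 / (4 * a) * ((norm (A t q y))\<^sup>2 / t) + 3 / (a * m\<^sup>2) * ((norm (B t q y))\<^sup>2 / t ^ 3)
      + b / 16 * (t * (norm (snd q))\<^sup>2 + t ^ 3 * (norm (F (fst q)))\<^sup>2)"
    using t by (intro add_mono mult_right_mono s) auto
  also have "\<dots> \<le> 1 / (4 * a) * ((norm (A t q y))\<^sup>2 / t) + 3 / (a * m\<^sup>2) * ((norm (B t q y))\<^sup>2 / t ^ 3) + b * W t q"
    using mult_left_mono[OF W_lower[OF t, of q], of b] b by simp
  also have "\<dots> = Q t q y" by (simp add: Q_def)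
  finally show ?thesis .
qed

lemma exp_absorb:
  fixes x :: real
  assumes "x \<ge> 0" shows "(1 + x) * exp (- (2 * \<sigma> * x)) \<le> (1 + 1 / \<sigma>) * exp (- (\<sigma> * x))"
proof -
  have "\<sigma> * x \<le> exp (\<sigma> * x)" using exp_ge_add_one_self[of "\<sigma> * x"] by linarith
  then have "x * exp (- (\<sigma> * x)) \<le> 1 / \<sigma>" using \<sigma>_pos by (simp add: exp_minus field_simps)
  moreover have "exp (- (\<sigma> * x)) \<le> 1" using assms \<sigma>_pos by simp
  ultimately have "(1 + x) * exp (- (\<sigma> * x)) \<le> 1 + 1 / \<sigma>"
    unfolding distrib_right mult_1 by (rule add_mono[rotated])
  then have "(1 + x) * exp (- (\<sigma> * x)) * exp (- (\<sigma> * x)) \<le> (1 + 1 / \<sigma>) * exp (- (\<sigma> * x))"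
    by (rule mult_right_mono) simp
  moreover have "exp (- (2 * \<sigma> * x)) = exp (- (\<sigma> * x)) * exp (- (\<sigma> * x))" by (simp flip: exp_add)
  ultimately show ?thesis by (simp add: mult.assoc)
qed

text \<open>By \<open>Q_lower\<close> the exponent of \<open>k\<close> is twice that of the
  majorant, so a factor of size \<open>1 + S\<close> is absorbed by the spare half. Every bound of
  \<open>k\<close> times a coefficient goes through this lemma.\<close>

lemma k_times_poly:
  assumes t: "t > 0" and p: "\<bar>r\<bar> \<le> c * (1 + S t q y)" and c: "c \<ge> 0"
  shows "\<bar>k t q y * r\<bar> \<le> c * (1 + 1 / \<sigma>) / Z * M t q y"
proof -
  have S: "S t q y \<ge> 0" using t by (rule S_nonneg)
  have "\<bar>k t q y * r\<bar> = exp (- Q t q y) * \<bar>r\<bar> / (Z * t ^ (2 * CARD('n)))"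
    using t Z_pos by (simp add: k_def abs_mult)
  also have "\<dots> \<le> exp (- (2 * \<sigma> * S t q y)) * (c * (1 + S t q y)) / (Z * t ^ (2 * CARD('n)))"
    using t Z_pos p Q_lower[OF t, of q y] by (intro divide_right_mono mult_mono) auto
  also have "\<dots> = c * ((1 + S t q y) * exp (- (2 * \<sigma> * S t q y))) / (Z * t ^ (2 * CARD('n)))" by (simp add: mult_ac)
  also have "\<dots> \<le> c * ((1 + 1 / \<sigma>) * exp (- (\<sigma> * S t q y))) / (Z * t ^ (2 * CARD('n)))"
    using t Z_pos c S by (intro divide_right_mono mult_left_mono exp_absorb) auto
  also have "\<dots> = c * (1 + 1 / \<sigma>) / Z * M t q y" by (simp add: M_def)
  finally show ?thesis .
qed

text \<open>With \<open>s = sqrt t\<close> and \<open>\<rho> = sqrt S\<close> the four quantities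
  carry the weights 1, 3, -1, -3 in \<open>s\<close>, and the following estimates are a count of
  powers of \<open>s\<close>.\<close>

lemma component_bounds:
  fixes t :: real and q y :: "'n phase"
  assumes t: "t > 0" and s_def: "s = sqrt t" and \<rho>_def: "\<rho> = sqrt (S t q y)"
  shows "norm (A t q y) \<le> s * \<rho>" "norm (B t q y) \<le> s ^ 3 * \<rho>"
    "norm (snd q) \<le> \<rho> / s" "norm (F (fst q)) \<le> \<rho> / s ^ 3" "s > 0" "s\<^sup>2 = t" "\<rho> \<ge> 0" "\<rho>\<^sup>2 = S t q y"
proof -
  show s: "s > 0" and s2: "s\<^sup>2 = t" using t by (auto simp: s_def)
  show r: "\<rho> \<ge> 0" and r2: "\<rho>\<^sup>2 = S t q y" using S_nonneg[OF t] by (auto simp: \<rho>_def)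
  have s3: "t ^ 3 = (s ^ 3)\<^sup>2" unfolding s2[symmetric] by (simp flip: power_mult)
  have "(norm (A t q y))\<^sup>2 / t \<le> S t q y" "(norm (B t q y))\<^sup>2 / t ^ 3 \<le> S t q y"
    "t * (norm (snd q))\<^sup>2 \<le> S t q y" "t ^ 3 * (norm (F (fst q)))\<^sup>2 \<le> S t q y"
    using t by (auto simp: S_def)
  then have "(norm (A t q y))\<^sup>2 \<le> (s * \<rho>)\<^sup>2" "(norm (B t q y))\<^sup>2 \<le> (s ^ 3 * \<rho>)\<^sup>2"
    "(s * norm (snd q))\<^sup>2 \<le> \<rho>\<^sup>2" "(s ^ 3 * norm (F (fst q)))\<^sup>2 \<le> \<rho>\<^sup>2"
    using t unfolding power_mult_distrib r2 s2 s3[symmetric] by (simp_all add: pos_divide_le_eq mult.commute)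
  then have "norm (A t q y) \<le> s * \<rho>" "norm (B t q y) \<le> s ^ 3 * \<rho>"
    "s * norm (snd q) \<le> \<rho>" "s ^ 3 * norm (F (fst q)) \<le> \<rho>"
    using s r by (auto intro: power2_le_imp_le)
  then show "norm (A t q y) \<le> s * \<rho>" "norm (B t q y) \<le> s ^ 3 * \<rho>"
    "norm (snd q) \<le> \<rho> / s" "norm (F (fst q)) \<le> \<rho> / s ^ 3"
    using s by (simp_all add: pos_le_divide_eq mult.commute)
qed

lemma norm_lv:
  assumes t: "t > 0"
  shows "norm (lv t q y) \<le> (1 / (2 * a) + 3 / (a * \<bar>m\<bar>)) * (sqrt (S t q y) / sqrt t)"
proof -
  define s where "s = sqrt t"
  define r where "r = sqrt (S t q y)"
  note cb = component_bounds[OF t s_def r_def]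
  have "norm (lv t q y) \<le> 1 / (2 * a * t) * norm (A t q y) + 3 / (a * \<bar>m\<bar> * t\<^sup>2) * norm (B t q y)"
    unfolding lv_def using a t
    by (intro order_trans[OF norm_triangle_ineq]) (simp add: abs_mult)
  also have "\<dots> \<le> 1 / (2 * a * t) * (s * r) + 3 / (a * \<bar>m\<bar> * t\<^sup>2) * (s ^ 3 * r)"
    using a t by (intro add_mono mult_left_mono cb) auto
  also have "\<dots> = (1 / (2 * a) + 3 / (a * \<bar>m\<bar>)) * (r / s)"
    unfolding cb(6)[symmetric] using cb(5) a m
    by (simp add: field_simps power2_eq_square power3_eq_cube)
  finally show ?thesis by (simp add: s_def r_def)
qed

text \<open>No negative power of \<open>t\<close> survives. The difference of the squared velocities
  is \<open>(norm A)\<^sup>2\<close> plus twice the product of \<open>A\<close>, of weight 1, with a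
  velocity of weight -1. The force varies by at most \<open>L\<close> times the displacement of
  \<open>y\<close> from the pole, which has weight 1, and this is multiplied by \<open>lv\<close> of
  weight -1.\<close>

lemma err_bound: "\<exists>c\<ge>0. \<forall>t q y. 0 < t \<longrightarrow> t \<le> 1 \<longrightarrow> \<bar>err t q y\<bar> \<le> c * (1 + S t q y)"
proof -
  define g where "g = 1 / (2 * a) + 3 / (a * \<bar>m\<bar>)"
  have g: "g \<ge> 0" using a by (simp add: g_def)
  define c where "c = b * 5 + \<bar>d0\<bar> + L * (1 + 2 * \<bar>m\<bar>) * g"
  have "\<bar>err t q y\<bar> \<le> c * (1 + S t q y)" if t: "0 < t" "t \<le> 1" for t q y
  proof -
    define s where "s = sqrt t"
    define r where "r = sqrt (S t q y)"
    note cb = component_bounds[OF t(1) s_def r_def]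
    have s: "s \<le> 1" using t by (simp add: s_def)
    let ?A = "A t q y" and ?B = "B t q y" and ?v = "snd q" and ?f = "F (fst q)"
    have sf: "norm (t *\<^sub>R ?f) \<le> r / s"
    proof -
      have "norm (t *\<^sub>R ?f) = t * norm ?f" using t by simp
      also have "\<dots> \<le> t * (r / s ^ 3)" using t by (intro mult_left_mono cb) auto
      also have "\<dots> = r / s" unfolding cb(6)[symmetric] using cb(5) by (simp add: power2_eq_square power3_eq_cube)
      finally show ?thesis .
    qed
    have vy: "snd y = ?A + (?v + t *\<^sub>R ?f)" by (simp add: A_def)
    have e1: "(norm (snd y))\<^sup>2 - (norm (?v + t *\<^sub>R ?f))\<^sup>2 = (norm ?A)\<^sup>2 + 2 * (?A \<bullet> (?v + t *\<^sub>R ?f))"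
      unfolding vy power2_norm_eq_inner by (simp add: inner_add_left inner_add_right inner_commute)
    have nA2: "(norm ?A)\<^sup>2 \<le> r\<^sup>2"
    proof (rule power_mono)
      have "s * r \<le> 1 * r" using s cb(7) by (intro mult_right_mono)
      then show "norm ?A \<le> r" using cb(1) by simp
    qed simp
    have nv: "norm (?v + t *\<^sub>R ?f) \<le> 2 * r / s"
      using norm_triangle_ineq[of ?v "t *\<^sub>R ?f"] cb(3) sf by simp
    have "\<bar>?A \<bullet> (?v + t *\<^sub>R ?f)\<bar> \<le> norm ?A * norm (?v + t *\<^sub>R ?f)" by (rule Cauchy_Schwarz_ineq2)
    also have "\<dots> \<le> (s * r) * (2 * r / s)" using cb nv by (intro mult_mono) auto
    also have "\<dots> = 2 * r\<^sup>2" using cb(5) by (simp add: power2_eq_square)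
    finally have e2: "\<bar>(norm (snd y))\<^sup>2 - (norm (?v + t *\<^sub>R ?f))\<^sup>2\<bar> \<le> 5 * r\<^sup>2"
      unfolding e1 using nA2 zero_le_power2[of "norm ?A"] by linarith
    \<comment> \<open>The displacement is \<open>B\<close>, of weight 3, plus \<open>t\<close> times
      velocities of weight -1, hence of total weight 1 for \<open>t \<le> 1\<close>.\<close>
    have dx: "fst y - fst q = ?B + (m * t / 2) *\<^sub>R (?A + (?v + (?v + t *\<^sub>R ?f)))"
      unfolding B_def by (simp add: vy[symmetric] algebra_simps) (simp add: vy algebra_simps)
    have nAs: "norm ?A \<le> r / s"
    proof -
      have "s * r \<le> 1 * r" using s cb(7) by (intro mult_right_mono)
      also have "\<dots> \<le> r / s" using s cb(5,7) by (simp add: pos_le_divide_eq mult_left_le)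
      finally show ?thesis using cb(1) by simp
    qed
    have "norm (fst y - fst q) \<le> norm ?B + \<bar>m\<bar> * t / 2 * norm (?A + (?v + (?v + t *\<^sub>R ?f)))"
      unfolding dx using t by (intro order_trans[OF norm_triangle_ineq]) (simp add: abs_mult)
    also have "\<dots> \<le> s ^ 3 * r + \<bar>m\<bar> * t / 2 * (r / s + (r / s + 2 * r / s))"
    proof -
      have "norm (?A + (?v + (?v + t *\<^sub>R ?f))) \<le> norm ?A + (norm ?v + norm (?v + t *\<^sub>R ?f))"
        by (rule order_trans[OF norm_triangle_ineq add_left_mono[OF norm_triangle_ineq]])
      then have "norm (?A + (?v + (?v + t *\<^sub>R ?f))) \<le> r / s + (r / s + 2 * r / s)"
        using nAs cb(3) nv by linarith
      then show ?thesis using t cb(2) by (intro add_mono mult_left_mono) auto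
    qed
    also have "\<dots> = s ^ 3 * r + 2 * \<bar>m\<bar> * (s * r)"
      unfolding cb(6)[symmetric] using cb(5) by (simp add: power2_eq_square field_simps)
    also have "\<dots> \<le> (1 + 2 * \<bar>m\<bar>) * (s * r)"
    proof -
      have "s ^ 3 \<le> s ^ 1" using s cb(5) by (intro power_decreasing) auto
      then have "s ^ 3 * r \<le> s * r" using cb(7) by (intro mult_right_mono) auto
      then show ?thesis by (simp add: algebra_simps)
    qed
    finally have nx: "norm (fst y - fst q) \<le> (1 + 2 * \<bar>m\<bar>) * (s * r)" .
    have "norm (F (fst y) - ?f) \<le> L * ((1 + 2 * \<bar>m\<bar>) * (s * r))"
      using lip[of "fst y" "fst q"] mult_left_mono[OF nx L] by linarith
    moreover have "norm (lv t q y) \<le> g * (r / s)"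
      using norm_lv[OF t(1), of q y] by (simp add: g_def s_def r_def)
    ultimately have "norm (F (fst y) - ?f) * norm (lv t q y) \<le> (L * ((1 + 2 * \<bar>m\<bar>) * (s * r))) * (g * (r / s))"
      using L cb(5,7) by (intro mult_mono) auto
    also have "\<dots> = L * (1 + 2 * \<bar>m\<bar>) * g * r\<^sup>2" using cb(5) by (simp add: power2_eq_square)
    finally have e3: "\<bar>(F (fst y) - ?f) \<bullet> lv t q y\<bar> \<le> L * (1 + 2 * \<bar>m\<bar>) * g * r\<^sup>2"
      using Cauchy_Schwarz_ineq2[of "F (fst y) - ?f" "lv t q y"] by linarith
    have "\<bar>b * ((norm (snd y))\<^sup>2 - (norm (?v + t *\<^sub>R ?f))\<^sup>2)\<bar> \<le> b * (5 * r\<^sup>2)"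
      using e2 b by (simp add: abs_mult)
    then have "\<bar>err t q y\<bar> \<le> b * (5 * r\<^sup>2) + \<bar>d0\<bar> + L * (1 + 2 * \<bar>m\<bar>) * g * r\<^sup>2"
      unfolding err_def using e3 by linarith
    also have "\<dots> \<le> c * (1 + r\<^sup>2)"
    proof -
      have "0 \<le> b * 5 + L * (1 + 2 * \<bar>m\<bar>) * g + \<bar>d0\<bar> * r\<^sup>2" using b L g by simp
      then show ?thesis by (simp add: c_def algebra_simps)
    qed
    finally show ?thesis using cb(8) by simp
  qed
  moreover have "c \<ge> 0" using b L g by (simp add: c_def)
  ultimately show ?thesis by blast
qed

text \<open>Two terms reach the order \<open>t^(-2)\<close>: the product of \<open>A\<close> with
  the force, divided by \<open>t\<close>, and the product of \<open>B\<close> with the velocities,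
  divided by \<open>t^3\<close>. Both come from motion along the trajectory; the purely diffusive
  terms are of order \<open>t^(-1)\<close>. This loss determines the exponent 1/2 in the resolvent
  estimate.\<close>

lemma lt_bound: "\<exists>c\<ge>0. \<forall>t q y. 0 < t \<longrightarrow> t \<le> 1 \<longrightarrow> \<bar>lt t q y\<bar> \<le> c / t\<^sup>2 * (1 + S t q y)"
proof -
  define c where "c = 2 * real CARD('n) + 1 / (2 * a) + 1 / (4 * a) + 12 / (a * \<bar>m\<bar>) + 9 / (a * m\<^sup>2) + b * 4"
  have "\<bar>lt t q y\<bar> \<le> c / t\<^sup>2 * (1 + S t q y)" if t: "0 < t" "t \<le> 1" for t q y
  proof -
    define s where "s = sqrt t"
    define r where "r = sqrt (S t q y)"
    note cb = component_bounds[OF t(1) s_def r_def]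
    have s: "s \<le> 1" using t by (simp add: s_def)
    let ?A = "A t q y" and ?B = "B t q y" and ?v = "snd q" and ?f = "F (fst q)"
    have it: "1 / t \<le> 1 / t\<^sup>2" using t by (simp add: power2_eq_square field_simps)
    have sf: "norm (t *\<^sub>R ?f) \<le> r / s"
    proof -
      have "norm (t *\<^sub>R ?f) = t * norm ?f" using t by simp
      also have "\<dots> \<le> t * (r / s ^ 3)" using t by (intro mult_left_mono cb) auto
      also have "\<dots> = r / s" unfolding cb(6)[symmetric] using cb(5) by (simp add: power2_eq_square power3_eq_cube)
      finally show ?thesis .
    qed
    have nAs: "norm ?A \<le> r / s"
    proof -
      have "s * r \<le> 1 * r" using s cb(7) by (intro mult_right_mono)
      also have "\<dots> \<le> r / s" using s cb(5,7) by (simp add: pos_le_divide_eq mult_left_le)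
      finally show ?thesis using cb(1) by simp
    qed
    have nv: "norm (?v + t *\<^sub>R ?f) \<le> 2 * r / s"
      using norm_triangle_ineq[of ?v "t *\<^sub>R ?f"] cb(3) sf by simp
    have vv: "norm (snd y + snd q) \<le> 4 * r / s"
    proof -
      have "snd y + snd q = ?A + ((?v + t *\<^sub>R ?f) + ?v)" by (simp add: A_def)
      then have "norm (snd y + snd q) \<le> norm ?A + (norm (?v + t *\<^sub>R ?f) + norm ?v)"
        by (simp only:) (rule order_trans[OF norm_triangle_ineq add_left_mono[OF norm_triangle_ineq]])
      then show ?thesis using nAs nv cb(3) by simp
    qed
    have t2: "t\<^sup>2 = s ^ 4" unfolding cb(6)[symmetric] by (simp flip: power_mult)
    have T1: "2 * real CARD('n) / t \<le> 2 * real CARD('n) / t\<^sup>2 * (1 + r\<^sup>2)"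
    proof -
      have "2 * real CARD('n) / t \<le> 2 * real CARD('n) / t\<^sup>2"
        using mult_left_mono[OF it, of "2 * real CARD('n)"] by simp
      also have "\<dots> = 2 * real CARD('n) / t\<^sup>2 * 1" by simp
      also have "\<dots> \<le> 2 * real CARD('n) / t\<^sup>2 * (1 + r\<^sup>2)" by (rule mult_left_mono) auto
      finally show ?thesis .
    qed
    have T2: "\<bar>(?A \<bullet> ?f) / (2 * a * t)\<bar> \<le> 1 / (2 * a) / t\<^sup>2 * r\<^sup>2"
    proof -
      have "\<bar>?A \<bullet> ?f\<bar> \<le> (s * r) * (r / s ^ 3)"
      proof -
        have "norm ?A * norm ?f \<le> (s * r) * (r / s ^ 3)" using cb(5,7) by (intro mult_mono cb(1,4)) auto
        then show ?thesis using Cauchy_Schwarz_ineq2[of ?A ?f] by linarith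
      qed
      then have "\<bar>?A \<bullet> ?f\<bar> / (2 * a * t) \<le> (s * r) * (r / s ^ 3) / (2 * a * t)"
        using a t by (intro divide_right_mono) auto
      also have "\<dots> = 1 / (2 * a) / t\<^sup>2 * r\<^sup>2" unfolding cb(6)[symmetric] using cb(5) a
        by (simp add: field_simps power2_eq_square power3_eq_cube)
      finally show ?thesis using a t by (simp add: abs_mult)
    qed
    have T3: "(norm ?A)\<^sup>2 / (4 * a * t\<^sup>2) \<le> 1 / (4 * a) / t\<^sup>2 * r\<^sup>2"
    proof -
      have "s * r \<le> 1 * r" using s cb(7) by (intro mult_right_mono)
      then have "norm ?A \<le> r" using cb(1) by simp
      then have "(norm ?A)\<^sup>2 / (4 * a * t\<^sup>2) \<le> r\<^sup>2 / (4 * a * t\<^sup>2)" using a by (intro divide_right_mono power_mono) auto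
      then show ?thesis by simp
    qed
    have T4: "\<bar>3 * (?B \<bullet> (snd y + snd q)) / (a * m * t ^ 3)\<bar> \<le> 12 / (a * \<bar>m\<bar>) / t\<^sup>2 * r\<^sup>2"
    proof -
      have "\<bar>?B \<bullet> (snd y + snd q)\<bar> \<le> norm ?B * norm (snd y + snd q)" by (rule Cauchy_Schwarz_ineq2)
      also have "\<dots> \<le> (s ^ 3 * r) * (4 * r / s)" using cb vv by (intro mult_mono) auto
      finally have "3 * \<bar>?B \<bullet> (snd y + snd q)\<bar> / (a * \<bar>m\<bar> * t ^ 3) \<le> 3 * ((s ^ 3 * r) * (4 * r / s)) / (a * \<bar>m\<bar> * t ^ 3)"
        using a t by (intro divide_right_mono mult_left_mono) auto
      also have "\<dots> = 12 / (a * \<bar>m\<bar>) / t\<^sup>2 * r\<^sup>2" unfolding cb(6)[symmetric] using cb(5) a m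
        by (simp add: field_simps power2_eq_square power3_eq_cube)
      finally show ?thesis using a t by (simp add: abs_mult)
    qed
    have T5: "9 * (norm ?B)\<^sup>2 / (a * m\<^sup>2 * t ^ 4) \<le> 9 / (a * m\<^sup>2) / t\<^sup>2 * r\<^sup>2"
    proof -
      have "s ^ 3 \<le> s ^ 2" using s cb(5) by (intro power_decreasing) auto
      then have "norm ?B \<le> t * r" using cb(2,6,7) mult_right_mono[of "s ^ 3" t r] by simp
      then have "9 * (norm ?B)\<^sup>2 / (a * m\<^sup>2 * t ^ 4) \<le> 9 * (t * r)\<^sup>2 / (a * m\<^sup>2 * t ^ 4)"
        using a t by (intro divide_right_mono mult_left_mono power_mono) auto
      also have "\<dots> = 9 / (a * m\<^sup>2) / t\<^sup>2 * r\<^sup>2" using t a m by (simp add: field_simps power2_eq_square power4_eq_xxxx)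
      finally show ?thesis .
    qed
    have T6: "b * (norm (?v + t *\<^sub>R ?f))\<^sup>2 \<le> b * 4 / t\<^sup>2 * r\<^sup>2"
    proof -
      have "(norm (?v + t *\<^sub>R ?f))\<^sup>2 \<le> (2 * r / s)\<^sup>2" using nv by (intro power_mono) auto
      also have "\<dots> = 4 * r\<^sup>2 * (1 / t)" unfolding cb(6)[symmetric] by (simp add: power_divide power_mult_distrib)
      also have "\<dots> \<le> 4 * r\<^sup>2 * (1 / t\<^sup>2)" using it by (intro mult_left_mono) auto
      finally have "b * (norm (?v + t *\<^sub>R ?f))\<^sup>2 \<le> b * (4 * r\<^sup>2 * (1 / t\<^sup>2))" using b by (intro mult_left_mono) auto
      then show ?thesis by simp
    qed
    define c' where "c' = 1 / (2 * a) + 1 / (4 * a) + 12 / (a * \<bar>m\<bar>) + 9 / (a * m\<^sup>2) + b * 4"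
    have c': "c' \<ge> 0" using a b by (simp add: c'_def)
    have nn: "0 \<le> (norm ?A)\<^sup>2 / (4 * a * t\<^sup>2)" "0 \<le> 9 * (norm ?B)\<^sup>2 / (a * m\<^sup>2 * t ^ 4)" "0 \<le> b * (norm (?v + t *\<^sub>R ?f))\<^sup>2"
      "0 \<le> 2 * real CARD('n) / t" using a b t by auto
    have "\<bar>lt t q y\<bar> \<le> 2 * real CARD('n) / t\<^sup>2 * (1 + r\<^sup>2) + (1 / (2 * a) / t\<^sup>2 * r\<^sup>2 + 1 / (4 * a) / t\<^sup>2 * r\<^sup>2
        + 12 / (a * \<bar>m\<bar>) / t\<^sup>2 * r\<^sup>2 + 9 / (a * m\<^sup>2) / t\<^sup>2 * r\<^sup>2 + b * 4 / t\<^sup>2 * r\<^sup>2)"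
    proof -
      have gen: "\<bar>- x1 + x2 + x3 + x4 + x5 - x6\<bar> \<le> y1 + (y2 + y3 + y4 + y5 + y6)"
        if "x1 \<le> y1" "\<bar>x2\<bar> \<le> y2" "x3 \<le> y3" "\<bar>x4\<bar> \<le> y4" "x5 \<le> y5" "x6 \<le> y6" "0 \<le> x3" "0 \<le> x5" "0 \<le> x6" "0 \<le> x1"
        for x1 x2 x3 x4 x5 x6 y1 y2 y3 y4 y5 y6 :: real using that by linarith
      have "lt t q y = - (2 * real CARD('n) / t) + (?A \<bullet> ?f) / (2 * a * t) + (norm ?A)\<^sup>2 / (4 * a * t\<^sup>2)
        + 3 * (?B \<bullet> (snd y + snd q)) / (a * m * t ^ 3) + 9 * (norm ?B)\<^sup>2 / (a * m\<^sup>2 * t ^ 4)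
        - b * (norm (?v + t *\<^sub>R ?f))\<^sup>2" by (simp add: lt_def)
      then show ?thesis by (simp only:) (rule gen[OF T1 T2 T3 T4 T5 T6 nn])
    qed
    also have "\<dots> = 2 * real CARD('n) / t\<^sup>2 * (1 + r\<^sup>2) + c' / t\<^sup>2 * r\<^sup>2"
      by (simp add: c'_def add_divide_distrib distrib_right)
    also have "\<dots> \<le> 2 * real CARD('n) / t\<^sup>2 * (1 + r\<^sup>2) + c' / t\<^sup>2 * (1 + r\<^sup>2)"
      using c' by (intro add_left_mono mult_left_mono) auto
    also have "\<dots> = c / t\<^sup>2 * (1 + r\<^sup>2)" by (simp add: c_def c'_def add_divide_distrib distrib_right)
    finally show ?thesis using cb(8) by simp
  qed
  moreover have "c \<ge> 0" using a b by (simp add: c_def)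
  ultimately show ?thesis by blast
qed

lemma kernel_bounds:
  obtains KM where "KM > 0"
    "\<And>t q y. 0 < t \<Longrightarrow> t \<le> 1 \<Longrightarrow> \<bar>k t q y\<bar> \<le> KM * M t q y"
    "\<And>t q y. 0 < t \<Longrightarrow> t \<le> 1 \<Longrightarrow> \<bar>k t q y * err t q y\<bar> \<le> KM * M t q y"
    "\<And>t q y. 0 < t \<Longrightarrow> t \<le> 1 \<Longrightarrow> \<bar>k t q y * lt t q y\<bar> \<le> KM / t\<^sup>2 * M t q y"
proof -
  obtain c1 where c1: "c1 \<ge> 0" "\<And>t q y. 0 < t \<Longrightarrow> t \<le> 1 \<Longrightarrow> \<bar>err t q y\<bar> \<le> c1 * (1 + S t q y)" using err_bound by blast
  obtain c2 where c2: "c2 \<ge> 0" "\<And>t q y. 0 < t \<Longrightarrow> t \<le> 1 \<Longrightarrow> \<bar>lt t q y\<bar> \<le> c2 / t\<^sup>2 * (1 + S t q y)" using lt_bound by blast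
  define G where "G = (1 + 1 / \<sigma>) / Z"
  have G: "G > 0" using \<sigma>_pos Z_pos by (simp add: G_def add_pos_pos)
  define KM where "KM = (1 + c1 + c2) * G"
  have KM: "G \<le> KM" "c1 * G \<le> KM" "c2 * G \<le> KM" using c1 c2 G by (auto simp: KM_def distrib_right)
  show thesis
  proof (rule that[of KM])
    show "KM > 0" using KM(1) G by linarith
    fix t q y assume t: "0 < t" "(t::real) \<le> 1"
    have Mn: "M t q y \<ge> 0" using M_nonneg[OF t(1)] .
    have "\<bar>k t q y * 1\<bar> \<le> 1 * (1 + 1 / \<sigma>) / Z * M t q y"
      by (rule k_times_poly[OF t(1)]) (use S_nonneg[OF t(1)] in auto)
    also have "\<dots> = G * M t q y" by (simp add: G_def)
    also have "\<dots> \<le> KM * M t q y" by (intro mult_right_mono KM Mn)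
    finally show "\<bar>k t q y\<bar> \<le> KM * M t q y" by simp
    have "\<bar>k t q y * err t q y\<bar> \<le> c1 * (1 + 1 / \<sigma>) / Z * M t q y"
      by (rule k_times_poly[OF t(1) c1(2)[OF t] c1(1)])
    also have "\<dots> = c1 * G * M t q y" by (simp add: G_def)
    also have "\<dots> \<le> KM * M t q y" by (intro mult_right_mono KM Mn)
    finally show "\<bar>k t q y * err t q y\<bar> \<le> KM * M t q y" .
    have "\<bar>k t q y * lt t q y\<bar> \<le> c2 / t\<^sup>2 * (1 + 1 / \<sigma>) / Z * M t q y"
      by (rule k_times_poly[OF t(1) c2(2)[OF t]]) (use c2(1) in auto)
    also have "\<dots> = c2 * G / t\<^sup>2 * M t q y" by (simp add: G_def)
    also have "\<dots> \<le> KM / t\<^sup>2 * M t q y" by (intro mult_right_mono divide_right_mono KM Mn) auto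
    finally show "\<bar>k t q y * lt t q y\<bar> \<le> KM / t\<^sup>2 * M t q y" .
  qed
qed

section \<open>Mass of the majorant in each of its two variables\<close>

text \<open>Up to this time the freezing point hardly moves the trajectories, which makes \<open>M\<close> integrable
  in the pole with a uniform bound.\<close>

definition t0 :: real where "t0 = 1 / (1 + \<bar>m\<bar> * L)"

lemma t0: "0 < t0" "t0 \<le> 1" "0 < t \<Longrightarrow> t \<le> t0 \<Longrightarrow> t \<le> 1 \<and> \<bar>m\<bar> * L * t\<^sup>2 \<le> 1"
proof -
  have p: "0 \<le> \<bar>m\<bar> * L" using L by simp
  show t0: "0 < t0" "t0 \<le> 1" using p by (auto simp: t0_def)
  assume t: "0 < t" "t \<le> t0"
  then have t1: "t \<le> 1" using t0 by simp
  have "\<bar>m\<bar> * L * t\<^sup>2 \<le> \<bar>m\<bar> * L * t"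
    using t t1 p by (intro mult_left_mono) (auto simp: power2_eq_square mult_left_le)
  also have "\<dots> \<le> \<bar>m\<bar> * L * t0" using t p by (intro mult_left_mono)
  also have "\<dots> \<le> 1" using p by (simp add: t0_def)
  finally show "t \<le> 1 \<and> \<bar>m\<bar> * L * t\<^sup>2 \<le> 1" using t1 by simp
qed

lemma norm_prod_sq: "(norm (z :: 'n phase))\<^sup>2 = (norm (fst z))\<^sup>2 + (norm (snd z))\<^sup>2"
  by (simp add: norm_prod_def)

text \<open>The Jacobian of the scaling \<open>(t^(3/2), t^(1/2))\<close> is exactly the power of
  \<open>t\<close> in the denominators of \<open>k\<close> and \<open>M\<close>, so their masses
  have no power of \<open>t\<close> left.\<close>

lemma shear_factor:
  assumes "t > 0"
  shows "\<bar>sqrt t ^ 3 * sqrt t\<bar> ^ DIM(real^'n) = t ^ (2 * CARD('n))"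
proof -
  have "sqrt t ^ 3 * sqrt t = t\<^sup>2"
    using assms by (simp add: power3_eq_cube power2_eq_square mult.assoc)
  then show ?thesis by (simp add: power_mult)
qed

definition G :: "real \<Rightarrow> ennreal" where
  "G c = (\<integral>\<^sup>+z. ennreal (exp (- (c * (norm (z :: 'n phase))\<^sup>2))) \<partial>lborel)"

lemma M_int_y:
  assumes t: "t > 0"
  shows "(\<integral>\<^sup>+y. ennreal (M t q y) \<partial>lborel) \<le> G \<sigma>"
proof -
  define s where "s = sqrt t"
  have s: "s > 0" "s\<^sup>2 = t" using t by (auto simp: s_def)
  define T where "T z = ((fst q + (m * t / 2) *\<^sub>R (2 *\<^sub>R snd q + t *\<^sub>R F (fst q))) + (m * t / 2 * s) *\<^sub>R snd z + (s ^ 3) *\<^sub>R fst z,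
     (snd q + t *\<^sub>R F (fst q)) + s *\<^sub>R snd z)" for z
  have A: "A t q (T z) = s *\<^sub>R snd z" for z by (simp add: A_def T_def)
  have B: "B t q (T z) = (s ^ 3) *\<^sub>R fst z" for z
    by (simp add: B_def T_def algebra_simps scaleR_2)
  have t3: "t ^ 3 = (s ^ 3)\<^sup>2" unfolding s(2)[symmetric] by (simp flip: power_mult)
  have le: "M t q (T z) \<le> exp (- (\<sigma> * (norm z)\<^sup>2)) / t ^ (2 * CARD('n))" for z
  proof -
    have "(norm z)\<^sup>2 \<le> S t q (T z)"
      unfolding S_def A B norm_prod_sq t3 using s t by (simp add: power_mult_distrib)
    then show ?thesis unfolding M_def using t \<sigma>_pos by (intro divide_right_mono) auto
  qed
  have "(\<integral>\<^sup>+y. ennreal (M t q y) \<partial>lborel) = ennreal (\<bar>s ^ 3 * s\<bar> ^ DIM(real^'n)) * (\<integral>\<^sup>+z. ennreal (M t q (T z)) \<partial>lborel)"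
    unfolding T_def by (rule nn_integral_shear) (use s in auto)
  also have "\<dots> \<le> ennreal (\<bar>s ^ 3 * s\<bar> ^ DIM(real^'n)) *
      (\<integral>\<^sup>+z. ennreal (1 / t ^ (2 * CARD('n))) * ennreal (exp (- (\<sigma> * (norm (z :: 'n phase))\<^sup>2))) \<partial>lborel)"
    using le t by (intro mult_left_mono nn_integral_mono) (auto simp flip: ennreal_mult)
  also have "\<dots> = ennreal (t ^ (2 * CARD('n))) * (ennreal (1 / t ^ (2 * CARD('n))) * G \<sigma>)"
    unfolding s_def shear_factor[OF t] G_def by (subst nn_integral_cmult) auto
  also have "\<dots> = G \<sigma>" using t by (simp add: mult.assoc[symmetric] flip: ennreal_mult)
  finally show ?thesis .
qed

text \<open>A true minimiser would require coercivity in the pole. One up to an error of 1 exists by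
  the definition of the infimum and costs only a factor \<open>exp 1\<close>.\<close>

lemma approx_minimum:
  fixes f :: "'x \<Rightarrow> real"
  assumes "\<And>x. f x \<ge> 0"
  obtains z where "\<And>x. f z \<le> f x + 1"
proof -
  have b: "bdd_below (range f)" using assms by (auto intro: bdd_belowI[of _ 0])
  have "Inf (range f) < Inf (range f) + 1" by simp
  then obtain z where z: "f z < Inf (range f) + 1"
    using cInf_less_iff[OF _ b, of "Inf (range f) + 1"] by auto
  show thesis
  proof (rule that[of z])
    fix x show "f z \<le> f x + 1" using z cInf_lower[OF _ b, of "f x"] by auto
  qed
qed

text \<open>The map from the pole to the pair \<open>(A, B)\<close> is bi-Lipschitz in the parabolic scaling, so
  around an approximate minimiser of the exponent the majorant is again Gaussian in the pole.\<close>

lemma A_B_expansive: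
  fixes \<alpha> \<beta> :: "real^'n"
  assumes t: "0 < t" "t \<le> t0" and s: "s = sqrt t"
    and q: "q = (fst z + (- (m * t / 2 * s)) *\<^sub>R \<beta> + (s ^ 3) *\<^sub>R \<alpha>, snd z + s *\<^sub>R \<beta>)"
  shows "(norm \<alpha>)\<^sup>2 + (norm \<beta>)\<^sup>2 \<le> (9 + 8 * L\<^sup>2) *
    ((norm (A t q y - A t z y))\<^sup>2 / t + (norm (B t q y - B t z y))\<^sup>2 / t ^ 3)"
proof -
  have s': "s > 0" "s\<^sup>2 = t" "s \<le> 1" using t t0(3)[OF t] by (auto simp: s)
  let ?dA = "A t q y - A t z y" and ?dB = "B t q y - B t z y"
  \<comment> \<open>The position of \<open>q\<close> is shifted along \<open>\<beta>\<close> just so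
    that \<open>B\<close> does not notice \<open>\<beta>\<close>. Hence \<open>\<alpha>\<close> is
    read off from \<open>B\<close> and \<open>\<beta>\<close> afterwards from
    \<open>A\<close>.\<close>
  have dB: "?dB = - ((s ^ 3) *\<^sub>R \<alpha>)"
    by (simp add: B_def q algebra_simps)
  have dA: "?dA = - (s *\<^sub>R \<beta>) - t *\<^sub>R (F (fst q) - F (fst z))"
    by (simp add: A_def q algebra_simps)
  have "norm (F (fst q) - F (fst z)) \<le> L * norm (fst q - fst z)" by (rule lip)
  also have "fst q - fst z = (- (m * t / 2 * s)) *\<^sub>R \<beta> + (s ^ 3) *\<^sub>R \<alpha>" by (simp add: q)
  also have "norm \<dots> \<le> \<bar>m\<bar> * t / 2 * s * norm \<beta> + s ^ 3 * norm \<alpha>"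
    using s' t by (intro order_trans[OF norm_triangle_ineq]) (simp add: abs_mult)
  finally have dF: "norm (F (fst q) - F (fst z)) \<le> L * (\<bar>m\<bar> * t / 2 * s * norm \<beta> + s ^ 3 * norm \<alpha>)"
    using L by (simp add: mult_left_mono)
  have "s *\<^sub>R \<beta> = - ?dA - t *\<^sub>R (F (fst q) - F (fst z))" by (simp add: dA)
  moreover have "norm (- u - w) \<le> norm u + norm w" for u w :: "real^'n"
    using norm_triangle_ineq4[of "- u" w] by simp
  ultimately have "norm (s *\<^sub>R \<beta>) \<le> norm ?dA + norm (t *\<^sub>R (F (fst q) - F (fst z)))" by (simp only:)
  then have "norm (s *\<^sub>R \<beta>) \<le> norm ?dA + t * norm (F (fst q) - F (fst z))" using t by simp
  also have "\<dots> \<le> norm ?dA + t * (L * (\<bar>m\<bar> * t / 2 * s * norm \<beta> + s ^ 3 * norm \<alpha>))"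
    using dF t by (intro add_left_mono mult_left_mono) auto
  also have "\<dots> = norm ?dA + (\<bar>m\<bar> * L * t\<^sup>2) * (s * norm \<beta>) / 2 + L * (t * s ^ 3) * norm \<alpha>"
    by (simp add: algebra_simps power2_eq_square)
  \<comment> \<open>Here \<open>t \<le> t0\<close> enters: the nonlinear feedback of
    \<open>\<beta>\<close> through the force gets a coefficient at most 1/2 and is absorbed on the
    left.\<close>
  also have "\<dots> \<le> norm ?dA + 1 * (s * norm \<beta>) / 2 + L * (1 * s) * norm \<alpha>"
  proof -
    have "t * s ^ 3 \<le> 1 * s ^ 1"
      using s' t t0(3)[OF t] by (intro mult_mono power_decreasing) auto
    then show ?thesis using L s' t0(3)[OF t]
      by (intro add_mono divide_right_mono mult_right_mono mult_left_mono) auto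
  qed
  finally have "s * norm \<beta> \<le> 2 * norm ?dA + 2 * L * s * norm \<alpha>" using s' by (simp add: algebra_simps)
  then have "norm \<beta> \<le> 2 * (norm ?dA / s) + 2 * L * norm \<alpha>" using s' by (simp add: field_simps)
  then have "(norm \<beta>)\<^sup>2 \<le> (2 * (norm ?dA / s) + 2 * L * norm \<alpha>)\<^sup>2" by (intro power_mono) auto
  also have "\<dots> \<le> 2 * (2 * (norm ?dA / s))\<^sup>2 + 2 * (2 * L * norm \<alpha>)\<^sup>2"
    using zero_le_power2[of "2 * (norm ?dA / s) - 2 * L * norm \<alpha>"] by (simp add: power2_diff power2_sum)
  also have "\<dots> = 8 * ((norm ?dA)\<^sup>2 / t) + 8 * L\<^sup>2 * (norm \<alpha>)\<^sup>2"
    by (simp add: power_mult_distrib power_divide s'(2))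
  finally have 1: "(norm \<beta>)\<^sup>2 \<le> 8 * ((norm ?dA)\<^sup>2 / t) + 8 * L\<^sup>2 * (norm \<alpha>)\<^sup>2" .
  have t3: "t ^ 3 = (s ^ 3)\<^sup>2" unfolding s'(2)[symmetric] by (simp flip: power_mult)
  have 2: "(norm ?dB)\<^sup>2 / t ^ 3 = (norm \<alpha>)\<^sup>2" unfolding dB t3 using s' by (simp add: power_mult_distrib)
  define X where "X = (norm ?dA)\<^sup>2 / t"
  have "X \<ge> 0" using t by (simp add: X_def)
  then have "0 \<le> (1 + 8 * L\<^sup>2) * X + 8 * (norm \<alpha>)\<^sup>2" by simp
  then show ?thesis using 1 unfolding 2 X_def[symmetric] by (simp add: algebra_simps)
qed

text \<open>As a function of the pole the exponent contains \<open>F (fst q)\<close>, so no explicit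
  substitution straightens it. Coordinates are centred at an approximate minimiser \<open>z\<close>
  of the exponent: expansiveness bounds the squared distance to \<open>z\<close> by the differences
  of \<open>A\<close> and \<open>B\<close>, and these by the exponent itself.\<close>

lemma M_int_q:
  assumes t: "0 < t" "t \<le> t0"
  shows "(\<integral>\<^sup>+q. ennreal (M t q y) \<partial>lborel) \<le> ennreal (exp 1) * G (\<sigma> / (4 * (9 + 8 * L\<^sup>2)))"
proof -
  define s where "s = sqrt t"
  have s: "s > 0" "s\<^sup>2 = t" using t by (auto simp: s_def)
  define q0 where "q0 q = \<sigma> * ((norm (A t q y))\<^sup>2 / t + (norm (B t q y))\<^sup>2 / t ^ 3)" for q
  have "q0 q \<ge> 0" for q using t \<sigma>_pos by (auto simp: q0_def intro!: mult_nonneg_nonneg add_nonneg_nonneg)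
  then obtain z where z: "\<And>q. q0 z \<le> q0 q + 1" using approx_minimum[of q0] by blast
  \<comment> \<open>The 4 is one factor 2 from the parallelogram inequality and another from
    replacing the exponent at \<open>z\<close> by the one at \<open>q\<close>;
    \<open>9 + 8 * L\<^sup>2\<close> is the expansion constant.\<close>
  define c where "c = \<sigma> / (4 * (9 + 8 * L\<^sup>2))"
  have pos: "9 + 8 * L\<^sup>2 > 0" by (simp add: add_pos_nonneg)
  define T where "T w = (fst z + (- (m * t / 2 * s)) *\<^sub>R snd w + (s ^ 3) *\<^sub>R fst w, snd z + s *\<^sub>R snd w)" for w
  have par: "(norm (u - w))\<^sup>2 \<le> 2 * ((norm u)\<^sup>2 + (norm w)\<^sup>2)" for u w :: "real^'n"
  proof -
    have "(norm (u - w))\<^sup>2 + (norm (u + w))\<^sup>2 = 2 * ((norm u)\<^sup>2 + (norm w)\<^sup>2)"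
      unfolding power2_norm_eq_inner by (simp add: inner_simps inner_commute)
    then show ?thesis using zero_le_power2[of "norm (u + w)"] by linarith
  qed
  have le: "M t (T w) y \<le> exp 1 * exp (- (c * (norm w)\<^sup>2)) / t ^ (2 * CARD('n))" for w
  proof -
    let ?q = "T w"
    let ?D = "(norm (A t ?q y - A t z y))\<^sup>2 / t + (norm (B t ?q y - B t z y))\<^sup>2 / t ^ 3"
    have "?D \<le> 2 * ((norm (A t ?q y))\<^sup>2 + (norm (A t z y))\<^sup>2) / t + 2 * ((norm (B t ?q y))\<^sup>2 + (norm (B t z y))\<^sup>2) / t ^ 3"
      using t by (intro add_mono divide_right_mono par) auto
    then have "\<sigma> * ?D \<le> \<sigma> * (2 * ((norm (A t ?q y))\<^sup>2 + (norm (A t z y))\<^sup>2) / t + 2 * ((norm (B t ?q y))\<^sup>2 + (norm (B t z y))\<^sup>2) / t ^ 3)"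
      using \<sigma>_pos by (intro mult_left_mono) auto
    also have "\<dots> = 2 * (q0 ?q + q0 z)" by (simp add: q0_def algebra_simps add_divide_distrib)
    also have "\<dots> \<le> 4 * q0 ?q + 2" using z[of ?q] by simp
    finally have sD: "\<sigma> * ?D \<le> 4 * q0 ?q + 2" .
    have "(norm w)\<^sup>2 \<le> (9 + 8 * L\<^sup>2) * ?D"
      using A_B_expansive[OF t s_def, of ?q z "snd w" "fst w" y] unfolding norm_prod_sq T_def by simp
    then have "c * (norm w)\<^sup>2 \<le> c * ((9 + 8 * L\<^sup>2) * ?D)"
      using \<sigma>_pos pos by (intro mult_left_mono) (auto simp: c_def)
    also have "c * ((9 + 8 * L\<^sup>2) * ?D) = \<sigma> * ?D / 4"
    proof -
      have "\<sigma> / (4 * x) * (x * d) = \<sigma> * d / 4" if "x > 0" for x d :: real using that by simp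
      from this[OF pos] show ?thesis unfolding c_def .
    qed
    also have "\<sigma> * ?D / 4 \<le> (4 * q0 ?q + 2) / 4" using sD by (intro divide_right_mono) auto
    also have "\<dots> \<le> q0 ?q + 1" by simp
    finally have "c * (norm w)\<^sup>2 \<le> q0 ?q + 1" .
    moreover have "q0 ?q \<le> \<sigma> * S t ?q y"
      unfolding q0_def S_def using t \<sigma>_pos by (intro mult_left_mono) auto
    ultimately have "- (\<sigma> * S t ?q y) \<le> 1 + - (c * (norm w)\<^sup>2)" by linarith
    then have "exp (- (\<sigma> * S t ?q y)) \<le> exp 1 * exp (- (c * (norm w)\<^sup>2))" by (simp flip: exp_add)
    then show ?thesis unfolding M_def using t by (intro divide_right_mono) auto
  qed
  have "(\<integral>\<^sup>+q. ennreal (M t q y) \<partial>lborel) = ennreal (\<bar>s ^ 3 * s\<bar> ^ DIM(real^'n)) * (\<integral>\<^sup>+w. ennreal (M t (T w) y) \<partial>lborel)"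
    unfolding T_def by (rule nn_integral_shear) (use s in auto)
  also have "\<dots> \<le> ennreal (\<bar>s ^ 3 * s\<bar> ^ DIM(real^'n)) *
      (\<integral>\<^sup>+z. ennreal (exp 1 / t ^ (2 * CARD('n))) * ennreal (exp (- (c * (norm (z :: 'n phase))\<^sup>2))) \<partial>lborel)"
    using le t by (intro mult_left_mono nn_integral_mono) (auto simp flip: ennreal_mult)
  also have "\<dots> = ennreal (t ^ (2 * CARD('n))) * (ennreal (exp 1 / t ^ (2 * CARD('n))) * G c)"
    unfolding s_def shear_factor[OF t(1)] G_def by (subst nn_integral_cmult) auto
  also have "\<dots> = ennreal (exp 1) * G c" using t by (simp add: mult.assoc[symmetric] flip: ennreal_mult)
  finally show ?thesis by (simp add: c_def)
qed

lemma schur_M: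
  obtains CM where "CM > 0" "\<And>t q. 0 < t \<Longrightarrow> t \<le> t0 \<Longrightarrow> (\<integral>\<^sup>+y. ennreal (M t q y) \<partial>lborel) \<le> ennreal CM"
    "\<And>t y. 0 < t \<Longrightarrow> t \<le> t0 \<Longrightarrow> (\<integral>\<^sup>+q. ennreal (M t q y) \<partial>lborel) \<le> ennreal CM"
proof -
  define c where "c = \<sigma> / (4 * (9 + 8 * L\<^sup>2))"
  have c: "c > 0" using \<sigma>_pos by (simp add: c_def add_pos_nonneg)
  define X where "X = G \<sigma> + ennreal (exp 1) * G c"
  have "X < \<infinity>" unfolding X_def G_def
    using nn_integral_gauss[OF \<sigma>_pos, where 'a="'n phase"] nn_integral_gauss[OF c, where 'a="'n phase"]
    by (simp add: ennreal_mult_less_top)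
  then obtain x where x: "x \<ge> 0" "X = ennreal x" by (cases X) auto
  show thesis
  proof (rule that[of "x + 1"])
    show "x + 1 > 0" using x by simp
    have "X \<le> ennreal (x + 1)" unfolding x(2) by (intro ennreal_leI) simp
    moreover have "G \<sigma> \<le> X" "ennreal (exp 1) * G c \<le> X" by (simp_all add: X_def)
    ultimately have le: "G \<sigma> \<le> ennreal (x + 1)" "ennreal (exp 1) * G c \<le> ennreal (x + 1)"
      by (meson order_trans)+
    fix t q y assume t: "0 < t" "t \<le> t0"
    show "(\<integral>\<^sup>+y. ennreal (M t q y) \<partial>lborel) \<le> ennreal (x + 1)"
      using M_int_y[OF t(1), of q] le(1) by (rule order_trans)
    show "(\<integral>\<^sup>+q. ennreal (M t q y) \<partial>lborel) \<le> ennreal (x + 1)"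
      using M_int_q[OF t, of y] le(2) unfolding c_def by (rule order_trans)
  qed
qed

subsection \<open>The approximate identity\<close>

text \<open>The substitution for integrals over the pole with \<open>y\<close> fixed. It makes
  \<open>B\<close> equal to \<open>sqrt s ^ 3\<close> times the first coordinate and
  \<open>A\<close> equal to \<open>sqrt s\<close> times the second one up to the force term; the
  pole tends to \<open>y\<close> as \<open>s\<close> tends to 0.\<close>

definition pole :: "real \<Rightarrow> 'n phase \<Rightarrow> 'n phase \<Rightarrow> 'n phase" where
  "pole s y z = ((fst y - (m * s) *\<^sub>R snd y) + (m * s / 2 * sqrt s) *\<^sub>R snd z + (- (sqrt s ^ 3)) *\<^sub>R fst z,
     snd y + (- sqrt s) *\<^sub>R snd z)"

text \<open>The kernel times the Jacobian of \<open>pole\<close>. For \<open>s\<close> tending to 0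
  the force term and \<open>W\<close> disappear, and what remains is the Gaussian that
  \<open>Z\<close> normalises to mass 1.\<close>

definition dens :: "real \<Rightarrow> 'n phase \<Rightarrow> 'n phase \<Rightarrow> real" where
  "dens s y z = exp (- ((norm (snd z - sqrt s *\<^sub>R F (fst (pole s y z))))\<^sup>2 / (4 * a)
      + 3 * (norm (fst z))\<^sup>2 / (a * m\<^sup>2) + b * W s (pole s y z))) / Z"

lemma pole_measurable [measurable]: "pole s y \<in> borel_measurable borel"
  unfolding pole_def[abs_def] by (intro borel_measurable_continuous_onI continuous_intros)

lemma k_pole:
  assumes s: "s > 0"
  shows "k s (pole s y z) y = dens s y z / s ^ (2 * CARD('n))"
proof -
  define r where "r = sqrt s"
  have r: "r > 0" "s = r\<^sup>2" using s by (auto simp: r_def)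
  let ?q = "pole s y z"
  have "A s ?q y = r *\<^sub>R (snd z - r *\<^sub>R F (fst ?q))"
    unfolding A_def by (simp add: pole_def r_def[symmetric] scaleR_diff_right) (simp add: r(2) power2_eq_square)
  then have A: "(norm (A s ?q y))\<^sup>2 = s * (norm (snd z - r *\<^sub>R F (fst ?q)))\<^sup>2"
    by (simp add: power_mult_distrib r(2))
  have "B s ?q y = (r ^ 3) *\<^sub>R fst z"
    unfolding B_def pole_def r_def[symmetric] by (simp add: vec_eq_iff field_simps)
  then have B: "(norm (B s ?q y))\<^sup>2 = s ^ 3 * (norm (fst z))\<^sup>2"
    by (simp add: power_mult_distrib r(2) flip: power_mult)
  have "Q s ?q y = (norm (snd z - r *\<^sub>R F (fst ?q)))\<^sup>2 / (4 * a) + 3 * (norm (fst z))\<^sup>2 / (a * m\<^sup>2) + b * W s ?q"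
    unfolding Q_def A B using s by simp
  then show ?thesis by (simp add: k_def dens_def r_def)
qed

lemma integral_k_pole:
  fixes \<phi> :: "'n phase \<Rightarrow> complex"
  assumes s: "s > 0" and [measurable]: "\<phi> \<in> borel_measurable borel"
  shows "(\<integral>q. k s q y *\<^sub>R \<phi> q \<partial>lborel) = (\<integral>z. dens s y z *\<^sub>R \<phi> (pole s y z) \<partial>lborel)"
    and "(\<integral>\<^sup>+q. ennreal (k s q y * norm (\<phi> q)) \<partial>lborel) = (\<integral>\<^sup>+z. ennreal (dens s y z * norm (\<phi> (pole s y z))) \<partial>lborel)"
proof -
  have c: "- (sqrt s ^ 3) \<noteq> 0" "- sqrt s \<noteq> 0" using s by auto
  have f: "\<bar>- (sqrt s ^ 3) * - sqrt s\<bar> ^ DIM(real^'n) = s ^ (2 * CARD('n))" using shear_factor[OF s] by simp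
  have sn: "s ^ (2 * CARD('n)) > 0" using s by simp
  have "(\<integral>q. k s q y *\<^sub>R \<phi> q \<partial>lborel) = s ^ (2 * CARD('n)) *\<^sub>R (\<integral>z. k s (pole s y z) y *\<^sub>R \<phi> (pole s y z) \<partial>lborel)"
    unfolding f[symmetric] pole_def by (rule integral_shear[OF _ c]) measurable
  also have "\<dots> = (\<integral>z. s ^ (2 * CARD('n)) *\<^sub>R (k s (pole s y z) y *\<^sub>R \<phi> (pole s y z)) \<partial>lborel)"
    by (rule integral_scaleR_right[symmetric])
  also have "\<dots> = (\<integral>z. dens s y z *\<^sub>R \<phi> (pole s y z) \<partial>lborel)" using s by (simp add: k_pole[OF s])
  finally show "(\<integral>q. k s q y *\<^sub>R \<phi> q \<partial>lborel) = (\<integral>z. dens s y z *\<^sub>R \<phi> (pole s y z) \<partial>lborel)" .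
  have "(\<integral>\<^sup>+q. ennreal (k s q y * norm (\<phi> q)) \<partial>lborel) = ennreal (s ^ (2 * CARD('n))) * (\<integral>\<^sup>+z. ennreal (k s (pole s y z) y * norm (\<phi> (pole s y z))) \<partial>lborel)"
    unfolding f[symmetric] pole_def by (rule nn_integral_shear[OF _ c]) measurable
  also have "\<dots> = (\<integral>\<^sup>+z. ennreal (s ^ (2 * CARD('n))) * ennreal (k s (pole s y z) y * norm (\<phi> (pole s y z))) \<partial>lborel)"
    by (rule nn_integral_cmult[symmetric]) measurable
  also have "\<dots> = (\<integral>\<^sup>+z. ennreal (dens s y z * norm (\<phi> (pole s y z))) \<partial>lborel)"
    using s by (intro nn_integral_cong) (simp add: k_pole[OF s] flip: ennreal_mult')
  finally show "(\<integral>\<^sup>+q. ennreal (k s q y * norm (\<phi> q)) \<partial>lborel) = (\<integral>\<^sup>+z. ennreal (dens s y z * norm (\<phi> (pole s y z))) \<partial>lborel)" .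
qed

text \<open>Decay in \<open>z\<close> dominates the limit \<open>s\<close> to 0, decay in
  \<open>y\<close> makes the result integrable against an arbitrary \<open>f\<close> in
  \<open>L^p\<close>. The latter is bought from the former: as the pole stays in a ball, a large
  \<open>y\<close> forces a large \<open>z\<close>. In the ball the force is bounded by
  \<open>CR\<close>, so its shift costs only a constant.\<close>

lemma dens_bound:
  assumes R: "R \<ge> 0"
  shows "\<exists>C c c'. C > 0 \<and> c > 0 \<and> c' > 0 \<and> (\<forall>s y z. 0 < s \<longrightarrow> s \<le> 1 \<longrightarrow> norm (pole s y z) \<le> R
     \<longrightarrow> dens s y z \<le> C * exp (- (c * (norm y)\<^sup>2)) * exp (- (c' * (norm z)\<^sup>2)))"
proof -
  define CR where "CR = norm (F 0) + L * R"
  have CR: "CR \<ge> 0" using L R by (simp add: CR_def)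
  \<comment> \<open>Removing the force from
    \<open>norm (snd z - sqrt s *\<^sub>R F (fst (pole s y z)))\<close> halves the coefficient
    \<open>1 / (4 * a)\<close>.\<close>
  define e where "e = min (1 / (8 * a)) (3 / (a * m\<^sup>2))"
  have e: "e > 0" using a m by (simp add: e_def)
  define R1 where "R1 = (2 + \<bar>m\<bar>) * R"
  define C1 where "C1 = 2 + \<bar>m\<bar>"
  have C1: "C1 > 0" by (simp add: C1_def)
  \<comment> \<open>Chosen for \<open>norm y \<le> R1 + C1 * norm z\<close>: then
    \<open>c * (norm y)\<^sup>2\<close> is at most a constant plus
    \<open>e / 2 * (norm z)\<^sup>2\<close>, which is one half of the available exponent.\<close>
  define c where "c = e / 2 / (2 * C1\<^sup>2)"
  have c: "c > 0" using e C1 by (simp add: c_def)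
  define C where "C = exp (CR\<^sup>2 / (4 * a)) * exp (c * (2 * R1\<^sup>2)) / Z"
  have C: "C > 0" using Z_pos by (simp add: C_def)
  have "dens s y z \<le> C * exp (- (c * (norm y)\<^sup>2)) * exp (- (e / 2 * (norm z)\<^sup>2))"
    if s: "0 < s" "s \<le> 1" and q: "norm (pole s y z) \<le> R" for s y z
  proof -
    define r where "r = sqrt s"
    have r: "r > 0" "r \<le> 1" "s = r\<^sup>2" using s by (auto simp: r_def)
    let ?q = "pole s y z"
    have nz: "norm (fst z) \<le> norm z" "norm (snd z) \<le> norm z"       using norm_fst_le[of "fst z" "snd z"] norm_snd_le[of "snd z" "fst z"] by auto
    have nq: "norm (fst ?q) \<le> R" "norm (snd ?q) \<le> R"
      using q norm_fst_le[of "fst ?q" "snd ?q"] norm_snd_le[of "snd ?q" "fst ?q"] by auto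
    have nF: "norm (F (fst ?q)) \<le> CR"
    proof -
      have "norm (F (fst ?q)) \<le> norm (F 0) + norm (F (fst ?q) - F 0)" by (rule norm_triangle_sub)
      also have "norm (F (fst ?q) - F 0) \<le> L * norm (fst ?q - 0)" by (rule lip)
      also have "\<dots> \<le> L * R" using nq L by (intro mult_left_mono) auto
      finally show ?thesis by (simp add: CR_def)
    qed
    have "\<bar>r\<bar> * norm (F (fst ?q)) \<le> 1 * CR" using r nF CR by (intro mult_mono) auto
    then have "norm (r *\<^sub>R F (fst ?q)) \<le> CR" by simp
    then have nF2: "(norm (r *\<^sub>R F (fst ?q)))\<^sup>2 \<le> CR\<^sup>2" by (intro power_mono) auto
    have "norm (snd z) \<le> norm (snd z - r *\<^sub>R F (fst ?q)) + norm (r *\<^sub>R F (fst ?q))"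
      using norm_triangle_ineq[of "snd z - r *\<^sub>R F (fst ?q)" "r *\<^sub>R F (fst ?q)"] by simp
    then have "(norm (snd z))\<^sup>2 \<le> (norm (snd z - r *\<^sub>R F (fst ?q)) + norm (r *\<^sub>R F (fst ?q)))\<^sup>2" by (intro power_mono) auto
    also have "\<dots> \<le> 2 * (norm (snd z - r *\<^sub>R F (fst ?q)))\<^sup>2 + 2 * (norm (r *\<^sub>R F (fst ?q)))\<^sup>2"
      using zero_le_power2[of "norm (snd z - r *\<^sub>R F (fst ?q)) - norm (r *\<^sub>R F (fst ?q))"] by (simp add: power2_diff power2_sum)
    finally have b2: "(norm (snd z))\<^sup>2 / 2 - CR\<^sup>2 \<le> (norm (snd z - r *\<^sub>R F (fst ?q)))\<^sup>2" using nF2 by linarith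
    have W0: "W s ?q \<ge> 0"       by (rule order_trans[OF _ W_lower[OF s(1)]]) (use s in auto)
    have "e * (norm z)\<^sup>2 - CR\<^sup>2 / (4 * a) \<le> ((norm (snd z))\<^sup>2 / 2 - CR\<^sup>2) / (4 * a) + 3 * (norm (fst z))\<^sup>2 / (a * m\<^sup>2)"
    proof -
      have "e * (norm z)\<^sup>2 = e * (norm (fst z))\<^sup>2 + e * (norm (snd z))\<^sup>2" by (simp add: norm_prod_sq distrib_left)
      also have "\<dots> \<le> 3 / (a * m\<^sup>2) * (norm (fst z))\<^sup>2 + 1 / (8 * a) * (norm (snd z))\<^sup>2"
        by (intro add_mono mult_right_mono) (auto simp: e_def)
      finally show ?thesis by (simp add: diff_divide_distrib)
    qed
    also have "\<dots> \<le> (norm (snd z - r *\<^sub>R F (fst ?q)))\<^sup>2 / (4 * a) + 3 * (norm (fst z))\<^sup>2 / (a * m\<^sup>2) + b * W s ?q"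
      using b2 a b W0 by (intro add_increasing2 add_mono divide_right_mono) auto
    finally have "dens s y z \<le> exp (CR\<^sup>2 / (4 * a) + - (e * (norm z)\<^sup>2)) / Z"
      unfolding dens_def r_def using Z_pos by (intro divide_right_mono) auto
    also have "\<dots> = exp (CR\<^sup>2 / (4 * a)) * exp (- (e / 2 * (norm z)\<^sup>2)) * exp (- (e / 2 * (norm z)\<^sup>2)) / Z"
      by (simp flip: exp_add)
    also have "\<dots> \<le> exp (CR\<^sup>2 / (4 * a)) * exp (- (e / 2 * (norm z)\<^sup>2)) * exp (c * (2 * R1\<^sup>2) + - (c * (norm y)\<^sup>2)) / Z"
    proof -
      have sy: "snd y = snd ?q + r *\<^sub>R snd z" by (simp add: pole_def r_def)
      have fy: "fst y = fst ?q + (m * s / 2) *\<^sub>R (snd y + snd ?q) + (r ^ 3) *\<^sub>R fst z"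
        by (simp add: pole_def r_def vec_eq_iff field_simps)
      have "norm (snd y) \<le> norm (snd ?q) + norm (r *\<^sub>R snd z)" unfolding sy by (rule norm_triangle_ineq)
      also have "\<dots> \<le> R + norm z" using nq nz r mult_left_le_one_le[of "norm (snd z)" r] by simp
      finally have ny2: "norm (snd y) \<le> R + norm z" .
      have "norm (fst y) \<le> norm (fst ?q) + norm ((m * s / 2) *\<^sub>R (snd y + snd ?q)) + norm ((r ^ 3) *\<^sub>R fst z)"
        by (subst fy, intro order_trans[OF norm_triangle_ineq] add_right_mono norm_triangle_ineq)
      also have "norm ((m * s / 2) *\<^sub>R (snd y + snd ?q)) \<le> \<bar>m\<bar> / 2 * ((R + norm z) + R)"
      proof -
        have "norm ((m * s / 2) *\<^sub>R (snd y + snd ?q)) = (\<bar>m\<bar> * s / 2) * norm (snd y + snd ?q)" using s by (simp add: abs_mult)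
        also have "\<dots> \<le> (\<bar>m\<bar> / 2) * ((R + norm z) + R)"
          using s ny2 nq norm_triangle_ineq[of "snd y" "snd ?q"] by (intro mult_mono) (auto simp: mult_left_le)
        finally show ?thesis .
      qed
      also have "norm ((r ^ 3) *\<^sub>R fst z) \<le> norm z"
        using r nz power_le_one[of r 3] mult_left_le_one_le[of "norm (fst z)" "r ^ 3"] by simp
      finally have ny1: "norm (fst y) \<le> R + \<bar>m\<bar> / 2 * (2 * R + norm z) + norm z" using nq by (simp add: algebra_simps)
      have "norm y \<le> norm (fst y) + norm (snd y)" using norm_Pair_le[of "fst y" "snd y"] by simp
      also have "\<dots> \<le> R1 + C1 * norm z"
      proof -
        define w where "w = \<bar>m\<bar> * norm z"
        have "w \<ge> 0" by (simp add: w_def)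
        moreover have "\<bar>m\<bar> / 2 * (2 * R + norm z) = \<bar>m\<bar> * R + w / 2" by (simp add: w_def algebra_simps)
        moreover have "R1 + C1 * norm z = 2 * R + \<bar>m\<bar> * R + 2 * norm z + w"
          by (simp add: R1_def C1_def w_def algebra_simps)
        ultimately show ?thesis using ny1 ny2 by linarith
      qed
      finally have "(norm y)\<^sup>2 \<le> (R1 + C1 * norm z)\<^sup>2" by (intro power_mono) auto
      also have "\<dots> \<le> 2 * R1\<^sup>2 + 2 * (C1 * norm z)\<^sup>2"
        using zero_le_power2[of "R1 - C1 * norm z"] by (simp add: power2_diff power2_sum)
      finally have "c * (norm y)\<^sup>2 \<le> c * (2 * R1\<^sup>2 + 2 * (C1 * norm z)\<^sup>2)" using c by (intro mult_left_mono) auto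
      also have "\<dots> = c * (2 * R1\<^sup>2) + e / 2 * (norm z)\<^sup>2" using C1 by (simp add: c_def distrib_left power_mult_distrib)
      finally have "exp (- (e / 2 * (norm z)\<^sup>2)) \<le> exp (c * (2 * R1\<^sup>2) + - (c * (norm y)\<^sup>2))" by simp
      then show ?thesis using Z_pos by (intro divide_right_mono mult_left_mono) auto
    qed
    also have "\<dots> = C * exp (- (c * (norm y)\<^sup>2)) * exp (- (e / 2 * (norm z)\<^sup>2))"
      unfolding C_def exp_add by simp
    finally show ?thesis .
  qed
  then show ?thesis using C c e by (intro exI[of _ C] exI[of _ c] exI[of _ "e / 2"]) auto
qed

text \<open>A majorant in \<open>y\<close> that is independent of \<open>s\<close>; it dominates the
  pairing with \<open>f\<close> when the initial time tends to 0.\<close>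

lemma approximate_identity_dominated:
  fixes \<phi> :: "'n phase \<Rightarrow> complex"
  assumes [measurable]: "\<phi> \<in> borel_measurable borel"
    and \<phi>: "\<And>z. norm (\<phi> z) \<le> C * indicator (cball 0 R) z" and C: "C > 0"
  shows "\<exists>C' c. C' > 0 \<and> c > 0 \<and> (\<forall>s y. 0 < s \<longrightarrow> s \<le> 1 \<longrightarrow>
     (\<integral>\<^sup>+q. ennreal (k s q y * norm (\<phi> q)) \<partial>lborel) \<le> ennreal (C' * exp (- (c * (norm y)\<^sup>2))))"
proof -
  obtain D c c' where D: "D > 0" "c > 0" "c' > 0"
    "\<And>s y z. 0 < s \<Longrightarrow> s \<le> 1 \<Longrightarrow> norm (pole s y z) \<le> max R 0
     \<Longrightarrow> dens s y z \<le> D * exp (- (c * (norm y)\<^sup>2)) * exp (- (c' * (norm z)\<^sup>2))"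
    using dens_bound[of "max R 0"] by auto
  have "G c' < \<infinity>" unfolding G_def by (rule nn_integral_gauss[OF D(3)])
  then obtain g where g: "g \<ge> 0" "G c' = ennreal g" by (cases "G c'") auto
  have "(\<integral>\<^sup>+q. ennreal (k s q y * norm (\<phi> q)) \<partial>lborel) \<le> ennreal ((D * C * (g + 1)) * exp (- (c * (norm y)\<^sup>2)))"
    if s: "0 < s" "s \<le> 1" for s y
  proof -
    have pt: "dens s y z * norm (\<phi> (pole s y z)) \<le> D * C * exp (- (c * (norm y)\<^sup>2)) * exp (- (c' * (norm z)\<^sup>2))" for z
    proof (cases "norm (pole s y z) \<le> R")
      case True
      then have "norm (\<phi> (pole s y z)) \<le> C" using \<phi>[of "pole s y z"] C by simp
      moreover have "dens s y z \<le> D * exp (- (c * (norm y)\<^sup>2)) * exp (- (c' * (norm z)\<^sup>2))"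
        using D(4)[OF s] True by simp
      ultimately have "dens s y z * norm (\<phi> (pole s y z)) \<le> (D * exp (- (c * (norm y)\<^sup>2)) * exp (- (c' * (norm z)\<^sup>2))) * C"
        using D by (intro mult_mono) auto
      then show ?thesis by (simp add: mult_ac)
    next
      case False
      then have "norm (\<phi> (pole s y z)) = 0" using \<phi>[of "pole s y z"] by simp
      then show ?thesis using D C by simp
    qed
    have "(\<integral>\<^sup>+q. ennreal (k s q y * norm (\<phi> q)) \<partial>lborel) = (\<integral>\<^sup>+z. ennreal (dens s y z * norm (\<phi> (pole s y z))) \<partial>lborel)"
      by (rule integral_k_pole(2)[OF s(1)]) measurable
    also have "\<dots> \<le> (\<integral>\<^sup>+z. ennreal (D * C * exp (- (c * (norm y)\<^sup>2))) * ennreal (exp (- (c' * (norm (z::'n phase))\<^sup>2))) \<partial>lborel)"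
      using pt D C by (intro nn_integral_mono) (simp flip: ennreal_mult)
    also have "\<dots> = ennreal (D * C * exp (- (c * (norm y)\<^sup>2))) * G c'"
      unfolding G_def by (rule nn_integral_cmult) auto
    also have "\<dots> = ennreal (D * C * g * exp (- (c * (norm y)\<^sup>2)))"
      using D C g by (simp add: mult_ac flip: ennreal_mult)
    also have "\<dots> \<le> ennreal ((D * C * (g + 1)) * exp (- (c * (norm y)\<^sup>2)))"
      using D C by (intro ennreal_leI mult_right_mono mult_left_mono) auto
    finally show ?thesis .
  qed
  moreover have "D * C * (g + 1) > 0" using D C g by (simp add: add_nonneg_pos)
  ultimately show ?thesis using D(2) by blast
qed

text \<open>The kernel concentrates in its pole: \<open>\<phi>\<close> is integrated over
  \<open>q\<close> while \<open>y\<close> is fixed. After the substitution \<open>pole\<close> the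
  integrand converges pointwise, by continuity of \<open>\<phi>\<close> and of the force, to
  \<open>\<phi> y\<close> times a probability density.\<close>

lemma approximate_identity:
  fixes \<phi> :: "'n phase \<Rightarrow> complex"
  assumes \<phi>: "continuous_on UNIV \<phi>" "\<And>z. norm (\<phi> z) \<le> C * indicator (cball 0 R) z" and C: "C > 0"
    and s: "\<And>j. 0 < s j" "\<And>j. s j \<le> 1" "s \<longlonglongrightarrow> 0"
  shows "(\<lambda>j. \<integral>q. k (s j) q y *\<^sub>R \<phi> q \<partial>lborel) \<longlonglongrightarrow> \<phi> y"
proof -
  have [measurable]: "\<phi> \<in> borel_measurable borel" by (rule borel_measurable_continuous_onI[OF \<phi>(1)])
  obtain D c c' where D: "D > 0" "c > 0" "c' > 0"
    "\<And>s y z. 0 < s \<Longrightarrow> s \<le> 1 \<Longrightarrow> norm (pole s y z) \<le> max R 0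
     \<Longrightarrow> dens s y z \<le> D * exp (- (c * (norm y)\<^sup>2)) * exp (- (c' * (norm z)\<^sup>2))"
    using dens_bound[of "max R 0"] by auto
  have dens0: "dens s y z \<ge> 0" for s z using Z_pos by (simp add: dens_def)
  let ?lim = "\<lambda>z::'n phase. (exp (- ((norm (snd z))\<^sup>2 / (4 * a) + 3 * (norm (fst z))\<^sup>2 / (a * m\<^sup>2))) / Z) *\<^sub>R \<phi> y"
  have "(\<lambda>j. \<integral>z. dens (s j) y z *\<^sub>R \<phi> (pole (s j) y z) \<partial>lborel) \<longlonglongrightarrow> (\<integral>z. ?lim z \<partial>lborel)"
  proof (rule integral_dominated_convergence)
    show "integrable lborel (\<lambda>z::'n phase. D * C * exp (- (c' * (norm z)\<^sup>2)))"
      by (intro integrable_mult_right integrable_gauss D)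
    show "AE z in lborel. norm (dens (s j) y z *\<^sub>R \<phi> (pole (s j) y z)) \<le> D * C * exp (- (c' * (norm z)\<^sup>2))" for j
    proof (rule AE_I2)
      fix z
      show "norm (dens (s j) y z *\<^sub>R \<phi> (pole (s j) y z)) \<le> D * C * exp (- (c' * (norm z)\<^sup>2))"
      proof (cases "norm (pole (s j) y z) \<le> R")
        case True
        then have 1: "norm (\<phi> (pole (s j) y z)) \<le> C" using \<phi>(2)[of "pole (s j) y z"] C by simp
        have "dens (s j) y z \<le> D * exp (- (c * (norm y)\<^sup>2)) * exp (- (c' * (norm z)\<^sup>2))"
          using D(4)[OF s(1,2)] True by simp
        also have "\<dots> \<le> D * 1 * exp (- (c' * (norm z)\<^sup>2))"
          using D by (intro mult_right_mono mult_left_mono) auto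
        finally have "dens (s j) y z * norm (\<phi> (pole (s j) y z)) \<le> (D * 1 * exp (- (c' * (norm z)\<^sup>2))) * C"
          using 1 D by (intro mult_mono) auto
        then show ?thesis using dens0[of "s j" z] by (simp add: mult_ac)
      next
        case False
        then have "norm (\<phi> (pole (s j) y z)) = 0" using \<phi>(2)[of "pole (s j) y z"] by simp
        then show ?thesis using D C by simp
      qed
    qed
    show "AE z in lborel. (\<lambda>j. dens (s j) y z *\<^sub>R \<phi> (pole (s j) y z)) \<longlonglongrightarrow> ?lim z"
    proof (rule AE_I2)
      fix z :: "'n phase"
      have sq: "(\<lambda>j. sqrt (s j)) \<longlonglongrightarrow> 0" using tendsto_real_sqrt[OF s(3)] by simp
      have pq: "(\<lambda>j. pole (s j) y z) \<longlonglongrightarrow> y"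
      proof -
        have "(\<lambda>j. pole (s j) y z) \<longlonglongrightarrow> ((fst y - (m * 0) *\<^sub>R snd y) + (m * 0 / 2 * 0) *\<^sub>R snd z + (- (0 ^ 3)) *\<^sub>R fst z,
          snd y + (- 0) *\<^sub>R snd z)"
          unfolding pole_def by (intro tendsto_intros s(3) sq) auto
        then show ?thesis by simp
      qed
      have c1: "(\<lambda>j. \<phi> (pole (s j) y z)) \<longlonglongrightarrow> \<phi> y"
        using continuous_on_tendsto_compose[OF \<phi>(1) pq] by simp
      have c2: "(\<lambda>j. F (fst (pole (s j) y z))) \<longlonglongrightarrow> F (fst y)"
        using continuous_on_tendsto_compose[OF F_continuous[of UNIV] tendsto_fst[OF pq]] by simp
      have cW: "(\<lambda>j. W (s j) (pole (s j) y z)) \<longlonglongrightarrow> 0 * (norm (snd y))\<^sup>2 + 0\<^sup>2 * (snd y \<bullet> F (fst y)) + 0 ^ 3 / 3 * (norm (F (fst y)))\<^sup>2"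
        unfolding W_def by (intro tendsto_intros s(3) c2 pq) auto
      have "(\<lambda>j. dens (s j) y z *\<^sub>R \<phi> (pole (s j) y z)) \<longlonglongrightarrow>
         (exp (- ((norm (snd z - 0 *\<^sub>R F (fst y)))\<^sup>2 / (4 * a) + 3 * (norm (fst z))\<^sup>2 / (a * m\<^sup>2)
           + b * (0 * (norm (snd y))\<^sup>2 + 0\<^sup>2 * (snd y \<bullet> F (fst y)) + 0 ^ 3 / 3 * (norm (F (fst y)))\<^sup>2))) / Z) *\<^sub>R \<phi> y"
        unfolding dens_def by (intro tendsto_intros sq c1 c2 cW) (use Z_pos a in auto)
      then show "(\<lambda>j. dens (s j) y z *\<^sub>R \<phi> (pole (s j) y z)) \<longlonglongrightarrow> ?lim z" by simp
    qed
    show "(\<lambda>z. dens (s j) y z *\<^sub>R \<phi> (pole (s j) y z)) \<in> borel_measurable lborel" for j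
      unfolding dens_def by measurable
    show "?lim \<in> borel_measurable lborel" by measurable
  qed
  moreover have "(\<integral>z. ?lim z \<partial>lborel) = \<phi> y"
  proof -
    have "(\<integral>z. ?lim z \<partial>lborel) = (\<integral>z. exp (- ((norm (snd z))\<^sup>2 / (4 * a) + 3 * (norm (fst z))\<^sup>2 / (a * m\<^sup>2))) / Z \<partial>(lborel :: 'n phase measure)) *\<^sub>R \<phi> y"
      by (rule integral_scaleR_left) (use k_integrable_Z in auto)
    also have "(\<integral>z. exp (- ((norm (snd z))\<^sup>2 / (4 * a) + 3 * (norm (fst z))\<^sup>2 / (a * m\<^sup>2))) / Z \<partial>(lborel :: 'n phase measure)) = Z / Z"
    proof -
      have "(\<integral>z. exp (- ((norm (snd z))\<^sup>2 / (4 * a) + 3 * (norm (fst z))\<^sup>2 / (a * m\<^sup>2))) / Z' \<partial>(lborel :: 'n phase measure)) = Z / Z'" for Z'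
        unfolding Z_def by simp
      then show ?thesis by blast
    qed
    finally show ?thesis using Z_pos by simp
  qed
  ultimately show ?thesis using integral_k_pole(1)[OF s(1)] by simp
qed

end

subsection \<open>Cut-off functions\<close>

text \<open>Normalised to 1 at the origin and supported in the unit ball. A plateau is unnecessary
  for the purpose: \<open>cut (e *\<^sub>R z)\<close> tends to \<open>cut 0 = 1\<close> by
  continuity as \<open>e\<close> tends to 0.\<close>

definition cut :: "'a::euclidean_space \<Rightarrow> real" where
  "cut z = exp 1 * flat 0 (1 - (norm z)\<^sup>2)"

lemma cut_smooth: "smooth cut"
proof -
  have "smooth (\<lambda>z::'a. 1 + (- 1) * (norm z)\<^sup>2)"
    by (intro smooth_add smooth_mult smooth_const smooth_norm_sq smooth_bounded_linear bounded_linear_ident)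
  then have "smooth (\<lambda>z::'a. flat 0 (1 + (- 1) * (norm z)\<^sup>2))" by (rule smooth_compose[OF smooth_flat])
  then have "smooth (\<lambda>z::'a. exp 1 * flat 0 (1 + (- 1) * (norm z)\<^sup>2))" by (intro smooth_mult smooth_const)
  then show ?thesis by (simp add: cut_def[abs_def])
qed

lemma cut_bounds: "0 \<le> cut z" "cut z \<le> 1" "cut 0 = 1" "1 < norm z \<Longrightarrow> cut z = 0"
proof -
  show "0 \<le> cut z" by (simp add: cut_def flat_0_bounds)
  show "cut z \<le> 1"
  proof (cases "1 - (norm z)\<^sup>2 > 0")
    case True
    then have "1 \<le> inverse (1 - (norm z)\<^sup>2)" by (simp add: one_le_inverse_iff)
    then have "exp (- inverse (1 - (norm z)\<^sup>2)) \<le> exp (- 1)" by simp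
    then have "exp 1 * exp (- inverse (1 - (norm z)\<^sup>2)) \<le> exp 1 * exp (- 1::real)" by (intro mult_left_mono) auto
    also have "\<dots> = 1" by (simp flip: exp_add)
    finally show ?thesis using True by (simp add: cut_def flat_def)
  qed (simp add: cut_def flat_def)
  show "cut 0 = 1" by (simp add: cut_def flat_def flip: exp_add)
  assume "1 < norm z"
  then have "1 < (norm z)\<^sup>2" by (simp add: one_less_power)
  then show "cut z = 0" by (simp add: cut_def flat_def)
qed

lemma dir_deriv_of_real:
  assumes "\<And>z. f differentiable (at z)"
  shows "dir_deriv w (\<lambda>z. complex_of_real (f z)) = (\<lambda>z. complex_of_real (dir_deriv w f z))"
  by (rule ext, rule dir_deriv_eq, rule has_derivative_of_real, rule has_derivative_dir_deriv, rule assms)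

lemma dir_deriv_mult_real:
  fixes f g :: "'a::euclidean_space \<Rightarrow> real"
  assumes "\<And>z. f differentiable (at z)" "\<And>z. g differentiable (at z)"
  shows "dir_deriv w (\<lambda>z. f z * g z) = (\<lambda>z. f z * dir_deriv w g z + dir_deriv w f z * g z)"
  by (rule ext, rule dir_deriv_eq, rule has_derivative_mult; rule has_derivative_dir_deriv, rule assms)

lemma dir_deriv_add:
  assumes "\<And>z. f differentiable (at z)" "\<And>z. g differentiable (at z)"
  shows "dir_deriv w (\<lambda>z. f z + g z) = (\<lambda>z. dir_deriv w f z + dir_deriv w g z)"
  by (rule ext, rule dir_deriv_eq, rule has_derivative_add; rule has_derivative_dir_deriv, rule assms)

lemma dir_deriv_scaled_arg:
  fixes f :: "'a::euclidean_space \<Rightarrow> real"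
  assumes "\<And>z. f differentiable (at z)"
  shows "dir_deriv w (\<lambda>z. f (e *\<^sub>R z)) = (\<lambda>z. e *\<^sub>R dir_deriv w f (e *\<^sub>R z))"
proof (rule ext, rule dir_deriv_eq[THEN trans])
  fix z :: 'a
  have "((\<lambda>z. e *\<^sub>R z) has_derivative (\<lambda>h. e *\<^sub>R h)) (at z)" by (auto intro!: derivative_eq_intros)
  from has_derivative_compose[OF this has_derivative_dir_deriv[OF assms[of "e *\<^sub>R z"]]]
  show "((\<lambda>z. f (e *\<^sub>R z)) has_derivative (\<lambda>h. dir_deriv (e *\<^sub>R h) f (e *\<^sub>R z))) (at z)" .
  show "dir_deriv (e *\<^sub>R w) f (e *\<^sub>R z) = e *\<^sub>R dir_deriv w f (e *\<^sub>R z)"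
    using linear_scale[OF has_derivative_linear[OF has_derivative_dir_deriv[OF assms[of "e *\<^sub>R z"]]]] .
qed

lemma cut_test: "(\<lambda>z. complex_of_real (cut z)) \<in> test_functions"
  using smooth_of_real[OF cut_smooth] cut_bounds(4) by (auto simp: test_functions_iff)

lemma cut_deriv_bounded:
  shows "\<exists>C\<ge>0. \<forall>b\<in>Basis. \<forall>z::'a::euclidean_space. \<bar>dir_deriv b cut z\<bar> \<le> C \<and> \<bar>dir_deriv b (dir_deriv b cut) z\<bar> \<le> C"
proof -
  have d: "cut differentiable (at z)" for z :: 'a by (rule smooth_differentiable[OF cut_smooth])
  have "\<exists>C\<ge>0. \<forall>z::'a. \<bar>dir_deriv b cut z\<bar> \<le> C \<and> \<bar>dir_deriv b (dir_deriv b cut) z\<bar> \<le> C" if b: "b \<in> Basis" for b :: 'a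
  proof -
    have d2: "dir_deriv b cut differentiable (at z)" for z
      by (rule smooth_differentiable[OF smooth_dir_deriv[OF cut_smooth b]])
    have 1: "(\<lambda>z. complex_of_real (dir_deriv b cut z)) \<in> test_functions"
      using test_function_dir_deriv[OF cut_test b] by (simp add: dir_deriv_of_real[OF d])
    have 2: "(\<lambda>z. complex_of_real (dir_deriv b (dir_deriv b cut) z)) \<in> test_functions"
      using test_function_dir_deriv[OF 1 b] by (simp add: dir_deriv_of_real[OF d2])
    obtain C R where C: "C > 0" "\<And>z. norm (complex_of_real (dir_deriv b cut z)) \<le> C * indicator (cball 0 R) z"
      by (rule test_function_bounded[OF 1]) blast
    obtain C' R' where C': "C' > 0" "\<And>z. norm (complex_of_real (dir_deriv b (dir_deriv b cut) z)) \<le> C' * indicator (cball 0 R') z"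
      by (rule test_function_bounded[OF 2]) blast
    have i: "c * indicator X z \<le> c" if "c > 0" for c :: real and X and z :: 'a
      using that by (simp add: indicator_def)
    show ?thesis
    proof (intro exI[of _ "C + C'"] conjI allI)
      show "0 \<le> C + C'" using C C' by simp
      show "\<bar>dir_deriv b cut z\<bar> \<le> C + C'" for z
        using order_trans[OF C(2)[of z] i[OF C(1)]] C'(1) by simp
      show "\<bar>dir_deriv b (dir_deriv b cut) z\<bar> \<le> C + C'" for z
        using order_trans[OF C'(2)[of z] i[OF C'(1)]] C(1) by simp
    qed
  qed
  then obtain C where C: "\<And>b. b \<in> Basis \<Longrightarrow> C b \<ge> 0 \<and> (\<forall>z::'a. \<bar>dir_deriv b cut z\<bar> \<le> C b \<and> \<bar>dir_deriv b (dir_deriv b cut) z\<bar> \<le> C b)"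
    by metis
  have le: "C b \<le> sum C Basis" if "b \<in> Basis" for b using that C by (intro member_le_sum) auto
  show ?thesis
  proof (intro exI[of _ "sum C Basis"] conjI ballI allI)
    show "0 \<le> sum C Basis" using C by (auto intro: sum_nonneg)
    fix b z :: 'a assume b: "b \<in> Basis"
    show "\<bar>dir_deriv b cut z\<bar> \<le> sum C Basis" "\<bar>dir_deriv b (dir_deriv b cut) z\<bar> \<le> sum C Basis"
      using C[OF b] le[OF b] order_trans by blast+
  qed
qed

context kfp begin

lemma basis_x_v_in_Basis: "(basis_x i :: 'n phase) \<in> Basis" "(basis_v i :: 'n phase) \<in> Basis"
  by (auto simp: Basis_prod_def Basis_vec_def)

lemma k_smooth: assumes t: "t > 0" shows "smooth (k t q)"
proof -
  have A: "smooth (A t q)"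
  proof -
    have "smooth (\<lambda>y::'n phase. snd y + (- snd q - t *\<^sub>R F (fst q)))"
      by (intro smooth_add smooth_const smooth_bounded_linear bounded_linear_snd)
    then show ?thesis by (simp add: A_def[abs_def] algebra_simps)
  qed
  have B: "smooth (B t q)"
  proof -
    have "smooth (\<lambda>y::'n phase. (fst y + - (m * t / 2) *\<^sub>R snd y) + (- fst q - (m * t / 2) *\<^sub>R snd q))"
      by (intro smooth_add smooth_const smooth_bounded_linear bounded_linear_fst
          bounded_linear_const_scaleR bounded_linear_snd)
    then show ?thesis by (simp add: B_def[abs_def] algebra_simps)
  qed
  have "smooth (\<lambda>y. (- 1 / (4 * a * t)) * (norm (A t q y))\<^sup>2 + (- 3 / (a * m\<^sup>2 * t ^ 3)) * (norm (B t q y))\<^sup>2 + (- b * W t q))"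
    by (intro smooth_add smooth_mult smooth_const smooth_norm_sq A B)
  then have "smooth (\<lambda>y. - Q t q y)" by (simp add: Q_def algebra_simps)
  then have "smooth (\<lambda>y. inverse (Z * t ^ (2 * CARD('n))) * exp (- Q t q y))"
    by (intro smooth_mult smooth_const smooth_compose[OF smooth_exp])
  then show ?thesis by (simp add: k_def[abs_def] divide_inverse mult.commute)
qed

lemma Pop_of_real:
  assumes h: "smooth h"
  shows "Pop (\<lambda>z. complex_of_real (h z)) y = complex_of_real (Pop h y)"
proof -
  have 1: "dir_deriv w (\<lambda>z. complex_of_real (h z)) = (\<lambda>z. complex_of_real (dir_deriv w h z))" for w
    by (intro dir_deriv_of_real smooth_differentiable h)
  have 2: "dir_deriv (basis_v i) (\<lambda>z. complex_of_real (dir_deriv (basis_v i) h z)) = (\<lambda>z. complex_of_real (dir_deriv (basis_v i) (dir_deriv (basis_v i) h) z))" for i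
    by (intro dir_deriv_of_real smooth_differentiable smooth_dir_deriv h basis_x_v_in_Basis)
  show ?thesis unfolding Pop_def 1 2 by (simp add: scaleR_conv_of_real)
qed

text \<open>All terms besides \<open>g * Pop h\<close> contain a derivative of \<open>g\<close>, so
  a slowly varying cut-off \<open>g\<close> disturbs \<open>Pop\<close> only slightly.\<close>

lemma Pop_product:
  assumes g: "smooth g" and h: "smooth h"
  shows "Pop (\<lambda>z. g z * h z) y = g y * Pop h y
    + h y * ((\<Sum>i\<in>UNIV. (m * snd y $ i) * dir_deriv (basis_x i) g y) + (\<Sum>i\<in>UNIV. F (fst y) $ i * dir_deriv (basis_v i) g y)
        - (\<Sum>i\<in>UNIV. a * dir_deriv (basis_v i) (dir_deriv (basis_v i) g) y))
    - (\<Sum>i\<in>UNIV. 2 * a * dir_deriv (basis_v i) g y * dir_deriv (basis_v i) h y)"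
proof -
  note d = smooth_differentiable
  have 1: "dir_deriv w (\<lambda>z. g z * h z) = (\<lambda>z. g z * dir_deriv w h z + dir_deriv w g z * h z)" for w
    by (intro dir_deriv_mult_real d g h)
  have 2: "dir_deriv w (\<lambda>z. g z * dir_deriv w h z + dir_deriv w g z * h z) = (\<lambda>z. (g z * dir_deriv w (dir_deriv w h) z + dir_deriv w g z * dir_deriv w h z)
      + (dir_deriv w g z * dir_deriv w h z + dir_deriv w (dir_deriv w g) z * h z))" if w: "w \<in> Basis" for w
  proof -
    note s = smooth_dir_deriv[OF g w] smooth_dir_deriv[OF h w] g h
    show ?thesis
      by (subst dir_deriv_add) (auto intro!: d smooth_mult s simp: dir_deriv_mult_real[OF d d] s)
  qed
  show ?thesis unfolding Pop_def 1 2[OF basis_x_v_in_Basis(2)]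
    by (simp add: sum.distrib sum_distrib_left sum_subtractf algebra_simps)
qed

lemma M_integrable:
  assumes t: "t > 0" shows "integrable lborel (M t q)" and "M t q y \<le> 1 / t ^ (2 * CARD('n))"
proof -
  have "(\<integral>\<^sup>+y. ennreal (norm (M t q y)) \<partial>lborel) \<le> G \<sigma>"
    using M_int_y[OF t, of q] M_nonneg[OF t] by simp
  also have "\<dots> < \<infinity>" unfolding G_def by (rule nn_integral_gauss[OF \<sigma>_pos])
  finally show "integrable lborel (M t q)" by (intro integrableI_bounded) measurable
  have "exp (- (\<sigma> * S t q y)) \<le> 1" using \<sigma>_pos S_nonneg[OF t, of q y] by simp
  then show "M t q y \<le> 1 / t ^ (2 * CARD('n))" unfolding M_def using t by (intro divide_right_mono) auto
qed

text \<open>At a fixed time and pole the coefficients of \<open>Pop\<close> and the logarithmic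
  gradient grow at most like \<open>1 + S\<close> in \<open>y\<close>, which the Gaussian absorbs.
  The constant may depend on \<open>t\<close> and \<open>q\<close>, since it only serves to remove a
  cut-off.\<close>

lemma growth:
  assumes t: "0 < t" "t \<le> 1"
  shows "\<exists>c\<ge>0. \<forall>y. norm (snd y) \<le> c * (1 + S t q y) \<and> norm (F (fst y)) \<le> c * (1 + S t q y)
    \<and> norm (lv t q y) \<le> c * (1 + S t q y)"
proof -
  define s where "s = sqrt t"
  define cq where "cq = norm (snd q) + t * norm (F (fst q))"
  define c2 where "c2 = 1 + \<bar>m\<bar> * (1 + cq + norm (snd q))"
  define c3 where "c3 = norm (F (fst q)) + L * c2"
  define c4 where "c4 = (1 / (2 * a) + 3 / (a * \<bar>m\<bar>)) / s"
  have nn: "cq \<ge> 0" "c2 \<ge> 0" "c3 \<ge> 0" "c4 \<ge> 0" using t a L by (auto simp: cq_def c2_def c3_def c4_def s_def)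
  have "norm (snd y) \<le> (1 + cq) * (1 + S t q y) \<and> norm (F (fst y)) \<le> c3 * (1 + S t q y)
    \<and> norm (lv t q y) \<le> c4 * (1 + S t q y)" for y
  proof -
    define r where "r = sqrt (S t q y)"
    note cb = component_bounds[OF t(1) s_def r_def]
    define T where "T = 1 + S t q y"
    have T1: "T \<ge> 1" using S_nonneg[OF t(1), of q y] by (simp add: T_def)
    have rT: "r \<le> T"
    proof -
      have "2 * r \<le> 1 + r\<^sup>2" using zero_le_power2[of "r - 1"] by (simp add: power2_diff)
      then show ?thesis using cb(7,8) by (simp add: T_def)
    qed
    have s1: "s \<le> 1" "s ^ 3 \<le> 1" using t cb(5) by (auto simp: s_def intro: power_le_one)
    have "s * r \<le> 1 * r" "s ^ 3 * r \<le> 1 * r" by (intro mult_right_mono s1 cb(7))+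
    then have AB: "norm (A t q y) \<le> T" "norm (B t q y) \<le> T" using cb(1,2) rT by auto
    have "snd y = A t q y + (snd q + t *\<^sub>R F (fst q))" by (simp add: A_def)
    then have "norm (snd y) \<le> norm (A t q y) + norm (snd q + t *\<^sub>R F (fst q))" using norm_triangle_ineq by metis
    also have "norm (snd q + t *\<^sub>R F (fst q)) \<le> cq" unfolding cq_def using norm_triangle_ineq[of "snd q" "t *\<^sub>R F (fst q)"] t by simp
    finally have "norm (snd y) \<le> T + cq" using AB by simp
    also have "\<dots> \<le> T + cq * T" using T1 nn(1) mult_left_mono[of 1 T cq] by simp
    finally have v: "norm (snd y) \<le> (1 + cq) * T" by (simp add: distrib_right)
    have "fst y - fst q = B t q y + (m * t / 2) *\<^sub>R (snd y + snd q)" by (simp add: B_def)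
    then have "norm (fst y - fst q) \<le> norm (B t q y) + norm ((m * t / 2) *\<^sub>R (snd y + snd q))" using norm_triangle_ineq by metis
    also have "norm ((m * t / 2) *\<^sub>R (snd y + snd q)) \<le> \<bar>m\<bar> * (norm (snd y) + norm (snd q))"
    proof -
      have "norm ((m * t / 2) *\<^sub>R (snd y + snd q)) = \<bar>m\<bar> * (t / 2 * norm (snd y + snd q))" using t by (simp add: abs_mult)
      also have "\<dots> \<le> \<bar>m\<bar> * (1 * (norm (snd y) + norm (snd q)))"
        using t by (intro mult_left_mono mult_mono norm_triangle_ineq) auto
      finally show ?thesis by simp
    qed
    also have "\<dots> \<le> \<bar>m\<bar> * ((1 + cq) * T + norm (snd q) * T)"
      using v T1 mult_left_mono[of 1 T "norm (snd q)"] by (intro mult_left_mono add_mono) auto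
    finally have "norm (fst y - fst q) \<le> c2 * T" using AB(2) by (simp add: c2_def algebra_simps)
    then have "L * norm (fst y - fst q) \<le> L * (c2 * T)" using L by (rule mult_left_mono)
    then have "norm (F (fst y) - F (fst q)) \<le> L * (c2 * T)" using lip order_trans by blast
    moreover have "norm (F (fst y)) \<le> norm (F (fst q)) + norm (F (fst y) - F (fst q))" by (rule norm_triangle_sub)
    moreover have "norm (F (fst q)) \<le> norm (F (fst q)) * T" using T1 mult_left_mono[of 1 T "norm (F (fst q))"] by simp
    ultimately have f: "norm (F (fst y)) \<le> c3 * T" by (simp add: c3_def algebra_simps)
    have "norm (lv t q y) \<le> (1 / (2 * a) + 3 / (a * \<bar>m\<bar>)) * (r / s)"
      using norm_lv[OF t(1), of q y] by (simp add: s_def r_def)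
    also have "\<dots> = c4 * r" by (simp add: c4_def)
    also have "\<dots> \<le> c4 * T" using rT nn(4) by (rule mult_left_mono)
    finally show ?thesis using v f unfolding T_def by blast
  qed
  note * = this
  define c where "c = 1 + cq + c3 + c4"
  have "norm (snd y) \<le> c * (1 + S t q y) \<and> norm (F (fst y)) \<le> c * (1 + S t q y) \<and> norm (lv t q y) \<le> c * (1 + S t q y)" for y
  proof -
    have "(1 + cq) * (1 + S t q y) \<le> c * (1 + S t q y)" "c3 * (1 + S t q y) \<le> c * (1 + S t q y)" "c4 * (1 + S t q y) \<le> c * (1 + S t q y)"
      using nn S_nonneg[OF t(1), of q y] by (auto simp: c_def intro!: mult_right_mono)
    then show ?thesis using *[of y] by (meson order_trans)
  qed
  moreover have "c \<ge> 0" using nn by (simp add: c_def)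
  ultimately show ?thesis by blast
qed

lemma cut_scaled_smooth: "smooth (\<lambda>z::'b::euclidean_space. cut (e *\<^sub>R z))"
proof -
  have "smooth (\<lambda>z::'b. 1 + (- e\<^sup>2) * (norm z)\<^sup>2)"
    by (intro smooth_add smooth_mult smooth_const smooth_norm_sq smooth_bounded_linear bounded_linear_ident)
  then have "smooth (\<lambda>z::'b. flat 0 (1 + (- e\<^sup>2) * (norm z)\<^sup>2))" by (rule smooth_compose[OF smooth_flat])
  then have "smooth (\<lambda>z::'b. exp 1 * flat 0 (1 + (- e\<^sup>2) * (norm z)\<^sup>2))" by (intro smooth_mult smooth_const)
  then show ?thesis by (simp add: cut_def[abs_def] power_mult_distrib)
qed

lemma Pop_test_measurable [measurable]:
  assumes "\<psi> \<in> test_functions" shows "Pop \<psi> \<in> borel_measurable borel"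
proof -
  have [measurable]: "\<psi> \<in> borel_measurable borel" "dir_deriv (basis_x i) \<psi> \<in> borel_measurable borel"
    "dir_deriv (basis_v i) \<psi> \<in> borel_measurable borel" "dir_deriv (basis_v i) (dir_deriv (basis_v i) \<psi>) \<in> borel_measurable borel" for i
    using assms test_function_dir_deriv[OF assms basis_x_v_in_Basis(1)] test_function_dir_deriv[OF assms basis_x_v_in_Basis(2)]
      test_function_dir_deriv[OF test_function_dir_deriv[OF assms basis_x_v_in_Basis(2)] basis_x_v_in_Basis(2)]
    by (auto intro: test_function_measurable)
  have [measurable]: "(\<lambda>y::'n phase. snd y $ i) \<in> borel_measurable borel" "(\<lambda>y. F (fst y) $ i) \<in> borel_measurable borel" for i
    by (auto intro!: borel_measurable_continuous_onI continuous_intros continuous_on_compose2[OF F_continuous[of UNIV]])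
  show ?thesis unfolding Pop_def[abs_def] by measurable
qed

text \<open>Each term of the remainder contains a derivative of the scaled cut-off and thereby a
  factor \<open>e\<close>; the growing coefficients in front are absorbed by half of the
  Gaussian.\<close>

lemma Pop_cut_remainder:
  assumes t: "0 < t" "t \<le> 1"
  shows "\<exists>H\<ge>0. \<forall>e y. 0 < e \<longrightarrow> e \<le> 1 \<longrightarrow>
    \<bar>Pop (\<lambda>z. cut (e *\<^sub>R z) * k t q z) y - cut (e *\<^sub>R y) * Pop (k t q) y\<bar> \<le> e * (H * M t q y)"
proof -
  obtain c where c: "c \<ge> 0" "\<And>y. norm (snd y) \<le> c * (1 + S t q y)" "\<And>y. norm (F (fst y)) \<le> c * (1 + S t q y)"
    "\<And>y. norm (lv t q y) \<le> c * (1 + S t q y)" using growth[OF t, of q] by blast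
  obtain C where C: "C \<ge> 0" "\<And>b z::'n phase. b \<in> Basis \<Longrightarrow> \<bar>dir_deriv b cut z\<bar> \<le> C"
     "\<And>b z::'n phase. b \<in> Basis \<Longrightarrow> \<bar>dir_deriv b (dir_deriv b cut) z\<bar> \<le> C"
    using cut_deriv_bounded[where 'a="'n phase"] by blast
  define n where "n = real CARD('n)"
  define K where "K = n * (\<bar>m\<bar> * c * C + c * C + a * C + 2 * a * C * c)"
  have K: "K \<ge> 0" using a c C by (simp add: K_def n_def)
  define H where "H = K * (1 + 1 / \<sigma>) / Z"
  have H: "H \<ge> 0" using K \<sigma>_pos Z_pos by (simp add: H_def)
  have "\<bar>Pop (\<lambda>z. cut (e *\<^sub>R z) * k t q z) y - cut (e *\<^sub>R y) * Pop (k t q) y\<bar> \<le> e * (H * M t q y)"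
    if e: "0 < e" "e \<le> 1" for e y
  proof -
    note bx = basis_x_v_in_Basis(1) and bv = basis_x_v_in_Basis(2)
    have d1: "dir_deriv w (\<lambda>z. cut (e *\<^sub>R z)) = (\<lambda>z. e *\<^sub>R dir_deriv w cut (e *\<^sub>R z))" for w :: "'n phase"
      by (intro dir_deriv_scaled_arg smooth_differentiable cut_smooth)
    have d2: "dir_deriv w (\<lambda>z. e *\<^sub>R dir_deriv w cut (e *\<^sub>R z)) = (\<lambda>z. e *\<^sub>R (e *\<^sub>R dir_deriv w (dir_deriv w cut) (e *\<^sub>R z)))"
      if w: "w \<in> Basis" for w :: "'n phase"
    proof (rule ext, rule dir_deriv_eq[THEN trans])
      fix z
      have dd: "(\<lambda>z. dir_deriv w cut (e *\<^sub>R z)) differentiable (at z)"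
      proof -
        have "((\<lambda>z. e *\<^sub>R z) has_derivative (\<lambda>h. e *\<^sub>R h)) (at z)" by (auto intro!: derivative_eq_intros)
        from has_derivative_compose[OF this has_derivative_dir_deriv[OF smooth_differentiable[OF smooth_dir_deriv[OF cut_smooth w], of "e *\<^sub>R z"]]]
        show ?thesis by (auto simp: differentiable_def)
      qed
      show "((\<lambda>z. e *\<^sub>R dir_deriv w cut (e *\<^sub>R z)) has_derivative (\<lambda>h. e *\<^sub>R dir_deriv h (\<lambda>z. dir_deriv w cut (e *\<^sub>R z)) z)) (at z)"
        by (intro has_derivative_scaleR_right has_derivative_dir_deriv dd)
      have "dir_deriv w (\<lambda>z. dir_deriv w cut (e *\<^sub>R z)) = (\<lambda>z. e *\<^sub>R dir_deriv w (dir_deriv w cut) (e *\<^sub>R z))"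
        by (intro dir_deriv_scaled_arg smooth_differentiable smooth_dir_deriv cut_smooth w)
      then show "e *\<^sub>R dir_deriv w (\<lambda>z. dir_deriv w cut (e *\<^sub>R z)) z = e *\<^sub>R (e *\<^sub>R dir_deriv w (dir_deriv w cut) (e *\<^sub>R z))" by simp
    qed
    define T where "T = 1 + S t q y"
    have T: "T \<ge> 1" using S_nonneg[OF t(1), of q y] by (simp add: T_def)
    have sb: "\<bar>\<Sum>i\<in>(UNIV::'n set). f i\<bar> \<le> e * (n * X)" if "\<And>i. \<bar>f i\<bar> \<le> e * X" for f X
    proof -
      have "\<bar>\<Sum>i\<in>(UNIV::'n set). f i\<bar> \<le> (\<Sum>i\<in>(UNIV::'n set). \<bar>f i\<bar>)" by (rule sum_abs)
      also have "\<dots> \<le> of_nat (card (UNIV::'n set)) * (e * X)" by (rule sum_bounded_above) (use that in auto)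
      finally show ?thesis by (simp add: n_def mult_ac)
    qed
    have s1: "\<bar>\<Sum>i\<in>UNIV. (m * snd y $ i) * dir_deriv (basis_x i) (\<lambda>z. cut (e *\<^sub>R z)) y\<bar> \<le> e * (n * (\<bar>m\<bar> * (c * T) * C))"
    proof (rule sb)
      fix i
      have "\<bar>snd y $ i\<bar> \<le> c * T" using component_le_norm_cart[of "snd y" i] c(2)[of y] by (simp add: T_def)
      then have "\<bar>m\<bar> * \<bar>snd y $ i\<bar> * \<bar>dir_deriv (basis_x i) cut (e *\<^sub>R y)\<bar> \<le> \<bar>m\<bar> * (c * T) * C"
        using C(2)[OF bx] C(1) c(1) T by (intro mult_mono) auto
      then have "e * (\<bar>m\<bar> * \<bar>snd y $ i\<bar> * \<bar>dir_deriv (basis_x i) cut (e *\<^sub>R y)\<bar>) \<le> e * (\<bar>m\<bar> * (c * T) * C)"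
        using e by (intro mult_left_mono) auto
      then show "\<bar>(m * snd y $ i) * dir_deriv (basis_x i) (\<lambda>z. cut (e *\<^sub>R z)) y\<bar> \<le> e * (\<bar>m\<bar> * (c * T) * C)"
        unfolding d1 using e by (simp add: abs_mult mult_ac)
    qed
    have s2: "\<bar>\<Sum>i\<in>UNIV. F (fst y) $ i * dir_deriv (basis_v i) (\<lambda>z. cut (e *\<^sub>R z)) y\<bar> \<le> e * (n * ((c * T) * C))"
    proof (rule sb)
      fix i
      have "\<bar>F (fst y) $ i\<bar> \<le> c * T" using component_le_norm_cart[of "F (fst y)" i] c(3)[of y] by (simp add: T_def)
      then have "\<bar>F (fst y) $ i\<bar> * \<bar>dir_deriv (basis_v i) cut (e *\<^sub>R y)\<bar> \<le> (c * T) * C"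
        using C(2)[OF bv] C(1) c(1) T by (intro mult_mono) auto
      then have "e * (\<bar>F (fst y) $ i\<bar> * \<bar>dir_deriv (basis_v i) cut (e *\<^sub>R y)\<bar>) \<le> e * ((c * T) * C)"
        using e by (intro mult_left_mono) auto
      then show "\<bar>F (fst y) $ i * dir_deriv (basis_v i) (\<lambda>z. cut (e *\<^sub>R z)) y\<bar> \<le> e * ((c * T) * C)"
        unfolding d1 using e by (simp add: abs_mult mult_ac)
    qed
    have s3: "\<bar>\<Sum>i\<in>UNIV. a * dir_deriv (basis_v i) (dir_deriv (basis_v i) (\<lambda>z. cut (e *\<^sub>R z))) y\<bar> \<le> e * (n * (a * C * T))"
    proof (rule sb)
      fix i :: 'n
      have "e * \<bar>dir_deriv (basis_v i) (dir_deriv (basis_v i) cut) (e *\<^sub>R y)\<bar> \<le> 1 * C"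
        using C(3)[OF bv] C(1) e by (intro mult_mono) auto
      also have "\<dots> \<le> C * T" using C(1) T mult_left_mono[of 1 T C] by simp
      finally have "(e * a) * (e * \<bar>dir_deriv (basis_v i) (dir_deriv (basis_v i) cut) (e *\<^sub>R y)\<bar>) \<le> (e * a) * (C * T)"
        using e a by (intro mult_left_mono) auto
      then show "\<bar>a * dir_deriv (basis_v i) (dir_deriv (basis_v i) (\<lambda>z. cut (e *\<^sub>R z))) y\<bar> \<le> e * (a * C * T)"
        unfolding d1 d2[OF bv] using e a by (simp add: abs_mult mult_ac)
    qed
    have s4: "\<bar>\<Sum>i\<in>UNIV. 2 * a * dir_deriv (basis_v i) (\<lambda>z. cut (e *\<^sub>R z)) y * lv t q y $ i\<bar> \<le> e * (n * (2 * a * C * (c * T)))"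
    proof (rule sb)
      fix i
      have "\<bar>lv t q y $ i\<bar> \<le> c * T" using component_le_norm_cart[of "lv t q y" i] c(4)[of y] by (simp add: T_def)
      then have "\<bar>dir_deriv (basis_v i) cut (e *\<^sub>R y)\<bar> * \<bar>lv t q y $ i\<bar> \<le> C * (c * T)"
        using C(2)[OF bv] C(1) c(1) T by (intro mult_mono) auto
      then have "(e * (2 * a)) * (\<bar>dir_deriv (basis_v i) cut (e *\<^sub>R y)\<bar> * \<bar>lv t q y $ i\<bar>) \<le> (e * (2 * a)) * (C * (c * T))"
        using e a by (intro mult_left_mono) auto
      then show "\<bar>2 * a * dir_deriv (basis_v i) (\<lambda>z. cut (e *\<^sub>R z)) y * lv t q y $ i\<bar> \<le> e * (2 * a * C * (c * T))"
        unfolding d1 using e a by (simp add: abs_mult mult_ac)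
    qed
    \<comment> \<open>The remainder divided by \<open>k t q y\<close>: the cross term contains the
      gradient of \<open>k\<close>, which is \<open>k\<close> times \<open>lv\<close>.\<close>
    define X where "X = ((\<Sum>i\<in>UNIV. (m * snd y $ i) * dir_deriv (basis_x i) (\<lambda>z. cut (e *\<^sub>R z)) y) + (\<Sum>i\<in>UNIV. F (fst y) $ i * dir_deriv (basis_v i) (\<lambda>z. cut (e *\<^sub>R z)) y)
        - (\<Sum>i\<in>UNIV. a * dir_deriv (basis_v i) (dir_deriv (basis_v i) (\<lambda>z. cut (e *\<^sub>R z))) y))
        - (\<Sum>i\<in>UNIV. 2 * a * dir_deriv (basis_v i) (\<lambda>z. cut (e *\<^sub>R z)) y * lv t q y $ i)"
    have "\<bar>X\<bar> \<le> e * (n * (\<bar>m\<bar> * (c * T) * C)) + e * (n * ((c * T) * C)) + e * (n * (a * C * T)) + e * (n * (2 * a * C * (c * T)))"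
      unfolding X_def using s1 s2 s3 s4 by linarith
    also have "\<dots> = e * (K * T)" by (simp add: K_def algebra_simps)
    finally have "\<bar>X / e\<bar> \<le> K * (1 + S t q y)" using e by (simp add: T_def field_simps)
    then have "\<bar>k t q y * (X / e)\<bar> \<le> H * M t q y" unfolding H_def by (rule k_times_poly[OF t(1) _ K])
    then have "e * \<bar>k t q y * (X / e)\<bar> \<le> e * (H * M t q y)" using e by (intro mult_left_mono) auto
    moreover have "e * \<bar>k t q y * (X / e)\<bar> = \<bar>k t q y * X\<bar>" using e by (simp add: abs_mult)
    moreover have "Pop (\<lambda>z. cut (e *\<^sub>R z) * k t q z) y - cut (e *\<^sub>R y) * Pop (k t q) y = k t q y * X"
      unfolding Pop_product[OF cut_scaled_smooth k_smooth[OF t(1)]] X_def k_dir_deriv[OF t(1)]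
      by (simp add: algebra_simps sum_distrib_left)
    ultimately show ?thesis by simp
  qed
  then show ?thesis using H by blast
qed

end

section \<open>Iterated integrals on product spaces\<close>

lemma integral_pair_fst:
  fixes f :: "'a::euclidean_space \<times> 'b::euclidean_space \<Rightarrow> complex"
  assumes "integrable lborel f"
  shows "(\<integral>z. f z \<partial>lborel) = (\<integral>x. \<integral>y. f (x, y) \<partial>lborel \<partial>lborel)"
  using lborel_pair.integral_fst'[of f] assms unfolding lborel_prod by simp

lemma integral_pair_snd:
  fixes f :: "'a::euclidean_space \<times> 'b::euclidean_space \<Rightarrow> complex"
  assumes "integrable lborel f"
  shows "(\<integral>z. f z \<partial>lborel) = (\<integral>y. \<integral>x. f (x, y) \<partial>lborel \<partial>lborel)"
  using lborel_pair.integral_snd[of "\<lambda>x y. f (x, y)"] assms unfolding lborel_prod by simp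

lemma nn_integral_pair_fst:
  fixes f :: "'a::euclidean_space \<times> 'b::euclidean_space \<Rightarrow> ennreal"
  assumes "f \<in> borel_measurable borel"
  shows "(\<integral>\<^sup>+z. f z \<partial>lborel) = (\<integral>\<^sup>+x. \<integral>\<^sup>+y. f (x, y) \<partial>lborel \<partial>lborel)"
proof -
  have "f \<in> borel_measurable (lborel \<Otimes>\<^sub>M lborel)" using assms by (simp add: lborel_prod)
  from lborel.nn_integral_fst[OF this] show ?thesis by (simp add: lborel_prod)
qed

lemma nn_integral_pair_snd:
  fixes f :: "'a::euclidean_space \<times> 'b::euclidean_space \<Rightarrow> ennreal"
  assumes "f \<in> borel_measurable borel"
  shows "(\<integral>\<^sup>+z. f z \<partial>lborel) = (\<integral>\<^sup>+y. \<integral>\<^sup>+x. f (x, y) \<partial>lborel \<partial>lborel)"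
proof -
  have "f \<in> borel_measurable (lborel \<Otimes>\<^sub>M lborel)" using assms by (simp add: lborel_prod)
  from lborel_pair.nn_integral_snd[OF this] show ?thesis by (simp add: lborel_prod)
qed

lemma integral_triple:
  fixes f :: "'a::euclidean_space \<times> ('b::euclidean_space \<times> 'c::euclidean_space) \<Rightarrow> complex"
  assumes f: "integrable lborel f"
  shows "(\<integral>z. f z \<partial>lborel) = (\<integral>x. \<integral>y. \<integral>w. f (x, (y, w)) \<partial>lborel \<partial>lborel \<partial>lborel)"
proof -
  have f': "integrable (lborel \<Otimes>\<^sub>M lborel) f" using f by (simp add: lborel_prod)
  have [measurable]: "f \<in> borel_measurable borel" using borel_measurable_integrable[OF f] by simp
  have ae: "AE x in lborel. integrable lborel (\<lambda>z. f (x, z))"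
    using lborel_pair.AE_integrable_fst'[OF f'] .
  have "(\<integral>z. f z \<partial>lborel) = (\<integral>x. \<integral>z. f (x, z) \<partial>lborel \<partial>lborel)" by (rule integral_pair_fst[OF f])
  also have "\<dots> = (\<integral>x. \<integral>y. \<integral>w. f (x, (y, w)) \<partial>lborel \<partial>lborel \<partial>lborel)"
  proof (rule integral_cong_AE)
    show "AE x in lborel. (\<integral>z. f (x, z) \<partial>lborel) = (\<integral>y. \<integral>w. f (x, (y, w)) \<partial>lborel \<partial>lborel)"
      using ae by eventually_elim (rule integral_pair_fst)
    have "case_prod (\<lambda>x z. f (x, z)) \<in> borel_measurable (lborel \<Otimes>\<^sub>M lborel)" by (simp add: lborel_prod)
    then show "(\<lambda>x. \<integral>z. f (x, z) \<partial>lborel) \<in> borel_measurable lborel"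
      by (rule lborel.borel_measurable_lebesgue_integral)
    have 1: "(\<lambda>xy. \<integral>w. f (fst xy, (snd xy, w)) \<partial>lborel) \<in> borel_measurable (lborel \<Otimes>\<^sub>M lborel)"
    proof (rule lborel.borel_measurable_lebesgue_integral)
      have "(\<lambda>z. f (fst (fst z), (snd (fst z), snd z))) \<in> borel_measurable borel" by measurable
      then show "case_prod (\<lambda>xy w. f (fst xy, (snd xy, w))) \<in> borel_measurable ((lborel \<Otimes>\<^sub>M lborel) \<Otimes>\<^sub>M lborel)"
        by (simp add: lborel_prod case_prod_beta')
    qed
    have "case_prod (\<lambda>x y. \<integral>w. f (x, (y, w)) \<partial>lborel) \<in> borel_measurable (lborel \<Otimes>\<^sub>M lborel)"
      using 1 by (simp add: case_prod_beta')
    then show "(\<lambda>x. \<integral>y. \<integral>w. f (x, (y, w)) \<partial>lborel \<partial>lborel) \<in> borel_measurable lborel"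
      by (rule lborel.borel_measurable_lebesgue_integral)
  qed
  finally show ?thesis .
qed

context kfp begin

text \<open>The kernel is smooth but not compactly supported in \<open>y\<close>. It is multiplied
  by cut-offs of growing radius; the remainder tends to 0, and a fixed multiple of
  \<open>M t q\<close>, which is integrable against \<open>L^p\<close> functions, dominates
  everything.\<close>

lemma Pop_duality:
  fixes f g :: "'n phase \<Rightarrow> complex"
  assumes f: "mLp p f" and g: "mLp p g" and p: "p > 1" and t: "0 < t" "t \<le> 1"
    and dual: "\<And>\<psi>. \<psi> \<in> test_functions \<Longrightarrow> (\<integral>y. f y * Pop \<psi> y \<partial>lborel) = (\<integral>y. g y * \<psi> y \<partial>lborel)"
  shows "(\<integral>y. f y * complex_of_real (Pop (k t q) y) \<partial>lborel) = (\<integral>y. g y * complex_of_real (k t q y) \<partial>lborel)"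
proof -
  have [measurable]: "f \<in> borel_measurable borel" "g \<in> borel_measurable borel" using f g by (auto simp: mLp_def)
  define e where "e j = 1 / real (Suc j)" for j
  have e: "0 < e j" "e j \<le> 1" for j by (auto simp: e_def)
  have elim: "e \<longlonglongrightarrow> 0" unfolding e_def using LIMSEQ_Suc[OF lim_1_over_n] by simp
  define \<psi> where "\<psi> j y = complex_of_real (cut (e j *\<^sub>R y) * k t q y)" for j y
  have sm: "smooth (\<lambda>y. cut (e j *\<^sub>R y) * k t q y)" for j
    by (intro smooth_mult cut_scaled_smooth k_smooth t)
  have \<psi>: "\<psi> j \<in> test_functions" for j
    unfolding test_functions_iff
  proof (intro conjI exI[of _ "real (Suc j)"] allI impI)
    show "smooth (\<psi> j)" unfolding \<psi>_def[abs_def] by (intro smooth_of_real sm)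
    fix z :: "'n phase" assume "real (Suc j) < norm z"
    then have "1 < norm (e j *\<^sub>R z)" by (simp add: e_def del: of_nat_Suc)
    then show "\<psi> j z = 0" by (simp add: \<psi>_def cut_bounds(4))
  qed
  note [measurable] = Pop_test_measurable[OF \<psi>] test_function_measurable[OF \<psi>]
  have PopPsi: "Pop (\<psi> j) y = complex_of_real (Pop (\<lambda>y. cut (e j *\<^sub>R y) * k t q y) y)" for j y
    unfolding \<psi>_def[abs_def] by (rule Pop_of_real[OF sm])
  obtain H where H: "H \<ge> 0" "\<And>e y. 0 < e \<Longrightarrow> e \<le> 1 \<Longrightarrow>
    \<bar>Pop (\<lambda>z. cut (e *\<^sub>R z) * k t q z) y - cut (e *\<^sub>R y) * Pop (k t q) y\<bar> \<le> e * (H * M t q y)"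
    using Pop_cut_remainder[OF t, of q] by blast
  obtain KM where KM: "KM > 0" "\<And>t q y. 0 < t \<Longrightarrow> t \<le> 1 \<Longrightarrow> \<bar>k t q y\<bar> \<le> KM * M t q y"
    "\<And>t q y. 0 < t \<Longrightarrow> t \<le> 1 \<Longrightarrow> \<bar>k t q y * err t q y\<bar> \<le> KM * M t q y"
    "\<And>t q y. 0 < t \<Longrightarrow> t \<le> 1 \<Longrightarrow> \<bar>k t q y * lt t q y\<bar> \<le> KM / t\<^sup>2 * M t q y"
    using kernel_bounds by metis
  have PkM: "\<bar>Pop (k t q) y\<bar> \<le> (KM + KM / t\<^sup>2) * M t q y" for y
    unfolding Pop_k[OF t(1)] right_diff_distrib using KM(3,4)[OF t, of q y] by (simp add: distrib_right)
  define c where "c = KM + KM / t\<^sup>2 + H"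
  have c: "c \<ge> 0" "KM \<le> c" using KM H by (auto simp: c_def)
  have Mn: "M t q y \<ge> 0" for y by (rule M_nonneg[OF t(1)])
  have cutle: "\<bar>cut (e j *\<^sub>R y) * x\<bar> \<le> \<bar>x\<bar>" for j x and y :: "'n phase"
    using cut_bounds(1,2)[of "e j *\<^sub>R y"] by (simp add: abs_mult mult_left_le_one_le)
  have b1: "norm (Pop (\<psi> j) y) \<le> c * M t q y" for j y
  proof -
    have "\<bar>Pop (\<lambda>z. cut (e j *\<^sub>R z) * k t q z) y\<bar> \<le> e j * (H * M t q y) + \<bar>cut (e j *\<^sub>R y) * Pop (k t q) y\<bar>"
      using H(2)[OF e, of j y] by linarith
    also have "e j * (H * M t q y) \<le> 1 * (H * M t q y)" using e H(1) Mn by (intro mult_right_mono) auto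
    also have "\<bar>cut (e j *\<^sub>R y) * Pop (k t q) y\<bar> \<le> (KM + KM / t\<^sup>2) * M t q y" using cutle PkM order_trans by blast
    finally show ?thesis unfolding PopPsi by (simp add: c_def algebra_simps)
  qed
  have b2: "norm (\<psi> j y) \<le> c * M t q y" for j y
  proof -
    have "norm (\<psi> j y) \<le> \<bar>k t q y\<bar>" unfolding \<psi>_def norm_of_real by (rule cutle)
    also have "\<dots> \<le> KM * M t q y" by (rule KM(2)[OF t])
    also have "\<dots> \<le> c * M t q y" using c Mn by (intro mult_right_mono)
    finally show ?thesis .
  qed
  have int: "integrable lborel (\<lambda>y. h y * complex_of_real (c * M t q y))" if h: "mLp p h" for h
  proof (rule mLp_integrable_mult[OF h p])
    show "integrable lborel (\<lambda>y. complex_of_real (c * M t q y))"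
      by (intro integrable_of_real integrable_mult_right M_integrable t)
    show "norm (complex_of_real (c * M t q y)) \<le> c * (1 / t ^ (2 * CARD('n)))" for y
      using c(1) Mn[of y] mult_left_mono[OF M_integrable(2)[OF t(1), of q y] c(1)]
      by (simp add: abs_mult del: of_real_mult)
  qed
  have conv_cut: "(\<lambda>j. cut (e j *\<^sub>R y)) \<longlonglongrightarrow> 1" for y :: "'n phase"
  proof -
    have "(\<lambda>j. e j *\<^sub>R y) \<longlonglongrightarrow> 0" using tendsto_scaleR[OF elim tendsto_const[of y]] by simp
    from continuous_on_tendsto_compose[OF smooth_continuous_on[OF cut_smooth, of UNIV] this]
    show ?thesis by (simp add: cut_bounds(3))
  qed
  have "(\<lambda>j. \<integral>y. f y * Pop (\<psi> j) y \<partial>lborel) \<longlonglongrightarrow> (\<integral>y. f y * complex_of_real (Pop (k t q) y) \<partial>lborel)"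
  proof (rule integral_dominated_convergence)
    show "integrable lborel (\<lambda>y. norm (f y * complex_of_real (c * M t q y)))" by (rule integrable_norm[OF int[OF f]])
    show "AE y in lborel. norm (f y * Pop (\<psi> j) y) \<le> norm (f y * complex_of_real (c * M t q y))" for j
      using b1 c Mn by (intro AE_I2) (simp add: norm_mult mult_left_mono del: of_real_mult)
    show "AE y in lborel. (\<lambda>j. f y * Pop (\<psi> j) y) \<longlonglongrightarrow> f y * complex_of_real (Pop (k t q) y)"
    proof (rule AE_I2)
      fix y
      have "(\<lambda>j. Pop (\<lambda>z. cut (e j *\<^sub>R z) * k t q z) y - cut (e j *\<^sub>R y) * Pop (k t q) y) \<longlonglongrightarrow> 0"
      proof (rule Lim_null_comparison)
        show "\<forall>\<^sub>F j in sequentially. norm (Pop (\<lambda>z. cut (e j *\<^sub>R z) * k t q z) y - cut (e j *\<^sub>R y) * Pop (k t q) y) \<le> e j * (H * M t q y)"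
          using H(2)[OF e] by (intro always_eventually) auto
        show "(\<lambda>j. e j * (H * M t q y)) \<longlonglongrightarrow> 0" using tendsto_mult_right[OF elim, of "H * M t q y"] by simp
      qed
      from tendsto_add[OF this tendsto_mult_right[OF conv_cut[of y], of "Pop (k t q) y"]]
      have "(\<lambda>j. Pop (\<lambda>z. cut (e j *\<^sub>R z) * k t q z) y) \<longlonglongrightarrow> Pop (k t q) y" by simp
      then show "(\<lambda>j. f y * Pop (\<psi> j) y) \<longlonglongrightarrow> f y * complex_of_real (Pop (k t q) y)"
        unfolding PopPsi by (intro tendsto_intros)
    qed
    show "(\<lambda>y. f y * complex_of_real (Pop (k t q) y)) \<in> borel_measurable lborel"
      unfolding Pop_k[OF t(1)] by measurable
  qed measurable
  moreover have "(\<lambda>j. \<integral>y. g y * \<psi> j y \<partial>lborel) \<longlonglongrightarrow> (\<integral>y. g y * complex_of_real (k t q y) \<partial>lborel)"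
  proof (rule integral_dominated_convergence)
    show "integrable lborel (\<lambda>y. norm (g y * complex_of_real (c * M t q y)))" by (rule integrable_norm[OF int[OF g]])
    show "AE y in lborel. norm (g y * \<psi> j y) \<le> norm (g y * complex_of_real (c * M t q y))" for j
      using b2 c Mn by (intro AE_I2) (simp add: norm_mult mult_left_mono del: of_real_mult)
    show "AE y in lborel. (\<lambda>j. g y * \<psi> j y) \<longlonglongrightarrow> g y * complex_of_real (k t q y)"
    proof (rule AE_I2)
      fix y
      have "(\<lambda>j. cut (e j *\<^sub>R y) * k t q y) \<longlonglongrightarrow> k t q y"
        using tendsto_mult_right[OF conv_cut[of y], of "k t q y"] by simp
      then show "(\<lambda>j. g y * \<psi> j y) \<longlonglongrightarrow> g y * complex_of_real (k t q y)"
        unfolding \<psi>_def by (intro tendsto_intros)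
    qed
  qed measurable
  ultimately show ?thesis using LIMSEQ_unique by (simp add: dual[OF \<psi>])
qed

text \<open>The bound is uniform in \<open>t\<close>, so that integration over a bounded time
  interval gives joint integrability in time, pole and \<open>y\<close>. The two parts of
  \<open>norm f \<le> 1 + norm f powr p\<close> are integrated in opposite orders, each using one of
  the two masses of \<open>M\<close>.\<close>

lemma schur_pairing:
  fixes f \<phi> :: "'n phase \<Rightarrow> complex"
  assumes f: "mLp p f" and p: "p > 1" and [measurable]: "\<phi> \<in> borel_measurable borel"
    and \<phi>: "\<And>z. norm (\<phi> z) \<le> BB * indicator (cball 0 R) z" and BB: "BB > 0"
  shows "\<exists>X\<ge>0. \<forall>t. 0 < t \<longrightarrow> t \<le> t0 \<longrightarrow>
    (\<integral>\<^sup>+w. ennreal (norm (\<phi> (fst w)) * norm (f (snd w)) * M t (fst w) (snd w)) \<partial>lborel) \<le> ennreal X"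
proof -
  have [measurable]: "f \<in> borel_measurable borel" using f by (simp add: mLp_def)
  obtain CM where CM: "CM > 0" "\<And>t q. 0 < t \<Longrightarrow> t \<le> t0 \<Longrightarrow> (\<integral>\<^sup>+y. ennreal (M t q y) \<partial>lborel) \<le> ennreal CM"
    "\<And>t y. 0 < t \<Longrightarrow> t \<le> t0 \<Longrightarrow> (\<integral>\<^sup>+q. ennreal (M t q y) \<partial>lborel) \<le> ennreal CM"
    using schur_M by metis
  have "integrable lborel \<phi>"
    by (rule Bochner_Integration.integrable_bound[OF integrable_indicator_cball[of BB R]]) (use \<phi> BB in \<open>auto intro!: AE_I2 simp: abs_mult\<close>)
  then have "(\<integral>\<^sup>+q. ennreal (norm (\<phi> q)) \<partial>lborel) < \<infinity>" by (simp add: integrable_iff_bounded)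
  then obtain x where x: "x \<ge> 0" "(\<integral>\<^sup>+q. ennreal (norm (\<phi> q)) \<partial>lborel) = ennreal x"
    by (cases "\<integral>\<^sup>+q. ennreal (norm (\<phi> q)) \<partial>lborel") auto
  have phiB: "norm (\<phi> q) \<le> BB" for q using \<phi>[of q] BB by (cases "norm q \<le> R") auto
  define n where "n = nLp p f powr p"
  have "(\<integral>\<^sup>+w. ennreal (norm (\<phi> (fst w)) * norm (f (snd w)) * M t (fst w) (snd w)) \<partial>lborel) \<le> ennreal (x * CM + BB * n * CM)"
    if t: "0 < t" "t \<le> t0" for t
  proof -
    have Mn: "M t q y \<ge> 0" for q y by (rule M_nonneg[OF t(1)])
    have "(\<integral>\<^sup>+w. ennreal (norm (\<phi> (fst w)) * norm (f (snd w)) * M t (fst w) (snd w)) \<partial>lborel)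
      \<le> (\<integral>\<^sup>+w. ennreal (norm (\<phi> (fst w))) * ennreal (M t (fst w) (snd w))
          + ennreal (norm (f (snd w)) powr p) * (ennreal BB * ennreal (M t (fst w) (snd w))) \<partial>lborel)"
    proof (rule nn_integral_mono)
      fix w :: "'n phase \<times> 'n phase"
      let ?M = "M t (fst w) (snd w)" and ?f = "norm (f (snd w))" and ?p = "norm (\<phi> (fst w))"
      have "?p * ?f * ?M \<le> ?p * (1 + ?f powr p) * ?M"
        using p Mn by (intro mult_right_mono mult_left_mono le_1_plus_powr) auto
      also have "\<dots> = ?p * ?M + ?p * (?f powr p * ?M)" by (simp add: algebra_simps)
      also have "\<dots> \<le> ?p * ?M + BB * (?f powr p * ?M)"
        using phiB Mn by (intro add_left_mono mult_right_mono) auto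
      finally have "ennreal (?p * ?f * ?M) \<le> ennreal (?p * ?M + ?f powr p * (BB * ?M))" by (intro ennreal_leI) (simp add: mult_ac)
      also have "\<dots> = ennreal ?p * ennreal ?M + ennreal (?f powr p) * (ennreal BB * ennreal ?M)"
        using Mn BB by (simp add: ennreal_mult)
      finally show "ennreal (?p * ?f * ?M) \<le> ennreal ?p * ennreal ?M + ennreal (?f powr p) * (ennreal BB * ennreal ?M)" .
    qed
    also have "\<dots> = (\<integral>\<^sup>+w. ennreal (norm (\<phi> (fst w))) * ennreal (M t (fst w) (snd w)) \<partial>lborel)
       + (\<integral>\<^sup>+w. ennreal (norm (f (snd w)) powr p) * (ennreal BB * ennreal (M t (fst w) (snd w))) \<partial>lborel)"
      by (rule nn_integral_add) measurable
    also have "\<dots> \<le> ennreal (x * CM) + ennreal (BB * n * CM)"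
    proof (rule add_mono)
      have "(\<integral>\<^sup>+w. ennreal (norm (\<phi> (fst w))) * ennreal (M t (fst w) (snd w)) \<partial>lborel)
        = (\<integral>\<^sup>+q. \<integral>\<^sup>+y. ennreal (norm (\<phi> q)) * ennreal (M t q y) \<partial>lborel \<partial>lborel)"
      proof -
        have m1: "(\<lambda>w. ennreal (norm (\<phi> (fst w))) * ennreal (M t (fst w) (snd w))) \<in> borel_measurable borel" by measurable
        show ?thesis by (subst nn_integral_pair_fst[OF m1]) simp
      qed
      also have "\<dots> = (\<integral>\<^sup>+q. ennreal (norm (\<phi> q)) * (\<integral>\<^sup>+y. ennreal (M t q y) \<partial>lborel) \<partial>lborel)"
        by (intro nn_integral_cong nn_integral_cmult) measurable
      also have "\<dots> \<le> (\<integral>\<^sup>+q. ennreal (norm (\<phi> q)) * ennreal CM \<partial>lborel)"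
        by (intro nn_integral_mono mult_left_mono CM t) auto
      also have "\<dots> = ennreal x * ennreal CM" by (subst nn_integral_multc) (auto simp: x)
      also have "\<dots> = ennreal (x * CM)" using x CM by (simp add: ennreal_mult)
      finally show "(\<integral>\<^sup>+w. ennreal (norm (\<phi> (fst w))) * ennreal (M t (fst w) (snd w)) \<partial>lborel) \<le> ennreal (x * CM)" .
      have "(\<integral>\<^sup>+w. ennreal (norm (f (snd w)) powr p) * (ennreal BB * ennreal (M t (fst w) (snd w))) \<partial>lborel)
        = (\<integral>\<^sup>+y. \<integral>\<^sup>+q. ennreal (norm (f y) powr p) * (ennreal BB * ennreal (M t q y)) \<partial>lborel \<partial>lborel)"
      proof -
        have m2: "(\<lambda>w. ennreal (norm (f (snd w)) powr p) * (ennreal BB * ennreal (M t (fst w) (snd w)))) \<in> borel_measurable borel" by measurable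
        show ?thesis by (subst nn_integral_pair_snd[OF m2]) simp
      qed
      also have "\<dots> = (\<integral>\<^sup>+y. ennreal (norm (f y) powr p) * (ennreal BB * (\<integral>\<^sup>+q. ennreal (M t q y) \<partial>lborel)) \<partial>lborel)"
      proof (rule nn_integral_cong)
        fix y
        have "(\<integral>\<^sup>+q. ennreal (norm (f y) powr p) * (ennreal BB * ennreal (M t q y)) \<partial>lborel)
          = ennreal (norm (f y) powr p) * (\<integral>\<^sup>+q. ennreal BB * ennreal (M t q y) \<partial>lborel)" by (rule nn_integral_cmult) measurable
        also have "(\<integral>\<^sup>+q. ennreal BB * ennreal (M t q y) \<partial>lborel) = ennreal BB * (\<integral>\<^sup>+q. ennreal (M t q y) \<partial>lborel)" by (rule nn_integral_cmult) measurable
        finally show "(\<integral>\<^sup>+q. ennreal (norm (f y) powr p) * (ennreal BB * ennreal (M t q y)) \<partial>lborel)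
          = ennreal (norm (f y) powr p) * (ennreal BB * (\<integral>\<^sup>+q. ennreal (M t q y) \<partial>lborel))" .
      qed
      also have "\<dots> \<le> (\<integral>\<^sup>+y. ennreal (norm (f y) powr p) * (ennreal BB * ennreal CM) \<partial>lborel)"
        by (intro nn_integral_mono mult_left_mono CM t) auto
      also have "\<dots> = ennreal n * (ennreal BB * ennreal CM)"
        by (subst nn_integral_multc) (auto simp: mLp_nn_integral[OF f p] n_def)
      also have "\<dots> = ennreal (BB * n * CM)" using BB CM by (simp add: n_def ennreal_mult mult_ac)
      finally show "(\<integral>\<^sup>+w. ennreal (norm (f (snd w)) powr p) * (ennreal BB * ennreal (M t (fst w) (snd w))) \<partial>lborel) \<le> ennreal (BB * n * CM)" .
    qed
    also have "\<dots> = ennreal (x * CM + BB * n * CM)" using x BB CM by (simp add: n_def)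
    finally show ?thesis .
  qed
  moreover have "x * CM + BB * n * CM \<ge> 0" using x BB CM by (simp add: n_def)
  ultimately show ?thesis by blast
qed

lemma triple_integrable:
  fixes f \<phi> :: "'n phase \<Rightarrow> complex" and \<theta> :: "real \<times> ('n phase \<times> 'n phase) \<Rightarrow> complex"
  assumes f: "mLp p f" and p: "p > 1" and [measurable]: "\<phi> \<in> borel_measurable borel"
    and \<phi>: "\<And>z. norm (\<phi> z) \<le> BB * indicator (cball 0 R) z" and BB: "BB > 0"
    and [measurable]: "\<theta> \<in> borel_measurable borel" and c: "c \<ge> 0"
    and \<theta>: "\<And>t w. norm (\<theta> (t, w)) \<le> indicator {0<..t0} t * (c * (norm (\<phi> (fst w)) * norm (f (snd w)) * M t (fst w) (snd w)))"
  shows "integrable lborel \<theta>"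
proof (rule integrableI_bounded)
  have [measurable]: "f \<in> borel_measurable borel" using f by (simp add: mLp_def)
  obtain X where X: "X \<ge> 0" "\<And>t. 0 < t \<Longrightarrow> t \<le> t0 \<Longrightarrow>
    (\<integral>\<^sup>+w. ennreal (norm (\<phi> (fst w)) * norm (f (snd w)) * M t (fst w) (snd w)) \<partial>lborel) \<le> ennreal X"
    using schur_pairing[OF f p assms(3) \<phi> BB] by blast
  have "(\<integral>\<^sup>+x. ennreal (norm (\<theta> x)) \<partial>lborel) = (\<integral>\<^sup>+t. \<integral>\<^sup>+w. ennreal (norm (\<theta> (t, w))) \<partial>lborel \<partial>lborel)"
    by (rule nn_integral_pair_fst) measurable
  also have "\<dots> \<le> (\<integral>\<^sup>+t. ennreal (c * X) * indicator {0<..t0} t \<partial>lborel)"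
  proof (rule nn_integral_mono)
    fix t :: real
    show "(\<integral>\<^sup>+w. ennreal (norm (\<theta> (t, w))) \<partial>lborel) \<le> ennreal (c * X) * indicator {0<..t0} t"
    proof (cases "0 < t \<and> t \<le> t0")
      case True
      have "(\<integral>\<^sup>+w. ennreal (norm (\<theta> (t, w))) \<partial>lborel) \<le> (\<integral>\<^sup>+w. ennreal c * ennreal (norm (\<phi> (fst w)) * norm (f (snd w)) * M t (fst w) (snd w)) \<partial>lborel)"
        using \<theta>[of t] True c M_nonneg[of t] by (intro nn_integral_mono) (auto simp flip: ennreal_mult)
      also have "\<dots> = ennreal c * (\<integral>\<^sup>+w. ennreal (norm (\<phi> (fst w)) * norm (f (snd w)) * M t (fst w) (snd w)) \<partial>lborel)"
        by (rule nn_integral_cmult) measurable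
      also have "\<dots> \<le> ennreal c * ennreal X" using True by (intro mult_left_mono X) auto
      finally show ?thesis using True c X by (simp add: ennreal_mult)
    next
      case False
      then have "norm (\<theta> (t, w)) = 0" for w using \<theta>[of t w] by auto
      then show ?thesis by simp
    qed
  qed
  also have "\<dots> = ennreal (c * X) * emeasure lborel {0<..t0}" by (rule nn_integral_cmult_indicator) simp
  also have "\<dots> < \<infinity>" using t0 by (simp add: ennreal_mult_less_top)
  finally show "(\<integral>\<^sup>+x. ennreal (norm (\<theta> x)) \<partial>lborel) < \<infinity>" .
qed measurable

section \<open>Time-integrated kernels and the weak parametrix identity\<close>

text \<open>The time cut-off \<open>chi\<close> vanishes at \<open>t0\<close>, so integrating \<open>\<partial>\<^sub>t (e\<^sup>z\<^sup>t chi k)\<close> leaves no boundary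
  term there; the price is the regular term \<open>- k / t0\<close> in \<open>Eint\<close>.\<close>

definition chi :: "real \<Rightarrow> real" where "chi \<tau> = 1 - \<tau> / t0"

definition Gint :: "complex \<Rightarrow> real \<Rightarrow> 'n phase \<Rightarrow> 'n phase \<Rightarrow> complex" where
  "Gint z \<tau> q y = exp (z * complex_of_real \<tau>) * complex_of_real (chi \<tau> * k \<tau> q y)"

definition Eint :: "complex \<Rightarrow> real \<Rightarrow> 'n phase \<Rightarrow> 'n phase \<Rightarrow> complex" where
  "Eint z \<tau> q y = exp (z * complex_of_real \<tau>) * complex_of_real (chi \<tau> * (k \<tau> q y * err \<tau> q y) - k \<tau> q y / t0)"

definition Gk :: "complex \<Rightarrow> 'n phase \<Rightarrow> 'n phase \<Rightarrow> complex" where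
  "Gk z q y = (\<integral>\<tau>. indicator {0<..t0} \<tau> *\<^sub>R Gint z \<tau> q y \<partial>lborel)"

definition Ek :: "complex \<Rightarrow> 'n phase \<Rightarrow> 'n phase \<Rightarrow> complex" where
  "Ek z q y = (\<integral>\<tau>. indicator {0<..t0} \<tau> *\<^sub>R Eint z \<tau> q y \<partial>lborel)"

lemma chi_bounds: "0 < \<tau> \<Longrightarrow> \<tau> \<le> t0 \<Longrightarrow> 0 \<le> chi \<tau> \<and> chi \<tau> \<le> 1" "chi t0 = 0"
  using t0(1) by (auto simp: chi_def)

lemma Gint_measurable [measurable (raw)]:
  assumes [measurable]: "u \<in> borel_measurable N" "g \<in> borel_measurable N" "h \<in> borel_measurable N"
  shows "(\<lambda>x. Gint z (u x) (g x) (h x)) \<in> borel_measurable N"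
  unfolding Gint_def chi_def by measurable

lemma Eint_measurable [measurable (raw)]:
  assumes [measurable]: "u \<in> borel_measurable N" "g \<in> borel_measurable N" "h \<in> borel_measurable N"
  shows "(\<lambda>x. Eint z (u x) (g x) (h x)) \<in> borel_measurable N"
  unfolding Eint_def chi_def by measurable

lemma time_integral_measurable:
  fixes K :: "real \<Rightarrow> 'n phase \<Rightarrow> 'n phase \<Rightarrow> complex"
  assumes [measurable]: "T \<in> sets borel"
    and K: "(\<lambda>x. K (fst x) (fst (snd x)) (snd (snd x))) \<in> borel_measurable borel"
  shows "case_prod (\<lambda>q y. \<integral>\<tau>. indicator T \<tau> *\<^sub>R K \<tau> q y \<partial>lborel) \<in> borel_measurable (borel \<Otimes>\<^sub>M borel)"
proof -
  have "(\<lambda>w. \<integral>\<tau>. indicator T \<tau> *\<^sub>R K \<tau> (fst w) (snd w) \<partial>lborel) \<in> borel_measurable lborel"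
  proof (rule lborel.borel_measurable_lebesgue_integral)
    have "(\<lambda>x. (\<lambda>x. K (fst x) (fst (snd x)) (snd (snd x))) (snd x, fst x)) \<in> borel_measurable borel"
      by (rule measurable_compose[OF _ K]) (intro borel_measurable_continuous_onI continuous_intros)
    then have [measurable]: "(\<lambda>x. K (snd x) (fst (fst x)) (snd (fst x))) \<in> borel_measurable borel" by simp
    have "(\<lambda>x. indicat_real T (snd x) *\<^sub>R K (snd x) (fst (fst x)) (snd (fst x))) \<in> borel_measurable borel"
      by measurable
    then show "case_prod (\<lambda>w \<tau>. indicator T \<tau> *\<^sub>R K \<tau> (fst w) (snd w)) \<in> borel_measurable (lborel \<Otimes>\<^sub>M lborel)"
      by (simp add: lborel_prod case_prod_beta')
  qed
  then show ?thesis by (simp add: case_prod_beta' borel_prod)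
qed

lemma Gk_measurable: "case_prod (Gk z) \<in> borel_measurable (borel \<Otimes>\<^sub>M borel)"
  unfolding Gk_def[abs_def] by (rule time_integral_measurable) measurable

lemma Ek_measurable: "case_prod (Ek z) \<in> borel_measurable (borel \<Otimes>\<^sub>M borel)"
  unfolding Ek_def[abs_def] by (rule time_integral_measurable) measurable

lemma norm_exp_le: "Re z \<le> 0 \<Longrightarrow> 0 \<le> \<tau> \<Longrightarrow> norm (exp (z * complex_of_real \<tau>)) = exp (Re z * \<tau>) \<and> exp (Re z * \<tau>) \<le> 1"
  by (simp add: mult_nonpos_nonneg)

lemma Gint_Eint_bound:
  assumes KM: "\<bar>k \<tau> q y\<bar> \<le> KM * M \<tau> q y" "\<bar>k \<tau> q y * err \<tau> q y\<bar> \<le> KM * M \<tau> q y"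
    and \<tau>: "0 < \<tau>" "\<tau> \<le> t0" and z: "Re z \<le> 0"
  shows "norm (Gint z \<tau> q y) \<le> exp (Re z * \<tau>) * (KM * M \<tau> q y)"
    and "norm (Eint z \<tau> q y) \<le> exp (Re z * \<tau>) * ((KM + KM / t0) * M \<tau> q y)"
proof -
  have ch: "\<bar>chi \<tau> * x\<bar> \<le> \<bar>x\<bar>" for x using chi_bounds(1)[OF \<tau>] by (simp add: abs_mult mult_left_le_one_le)
  have "\<bar>chi \<tau> * k \<tau> q y\<bar> \<le> KM * M \<tau> q y" using ch KM(1) by (rule order_trans)
  then show "norm (Gint z \<tau> q y) \<le> exp (Re z * \<tau>) * (KM * M \<tau> q y)"
    unfolding Gint_def norm_mult norm_of_real using norm_exp_le[OF z, of \<tau>] \<tau> by simp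
  have "\<bar>chi \<tau> * (k \<tau> q y * err \<tau> q y)\<bar> \<le> KM * M \<tau> q y" using ch KM(2) by (rule order_trans)
  moreover have "\<bar>k \<tau> q y / t0\<bar> \<le> KM / t0 * M \<tau> q y"
    using divide_right_mono[OF KM(1), of t0] t0 by (simp add: abs_divide)
  ultimately have "\<bar>chi \<tau> * (k \<tau> q y * err \<tau> q y) - k \<tau> q y / t0\<bar> \<le> (KM + KM / t0) * M \<tau> q y"
    unfolding distrib_right by linarith
  then show "norm (Eint z \<tau> q y) \<le> exp (Re z * \<tau>) * ((KM + KM / t0) * M \<tau> q y)"
    unfolding Eint_def norm_mult norm_of_real using norm_exp_le[OF z, of \<tau>] \<tau> by simp
qed

lemma time_derivative_integral:
  assumes s: "0 < s" "s \<le> t0"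
  shows "(\<integral>\<tau>. indicator {s..t0} \<tau> *\<^sub>R (exp (z * complex_of_real \<tau>) * ((z * chi \<tau> - 1 / t0) * k \<tau> q y + chi \<tau> * (k \<tau> q y * lt \<tau> q y))) \<partial>lborel)
      = - (exp (z * complex_of_real s) * complex_of_real (chi s * k s q y))"
proof -
  have dexp: "((\<lambda>\<tau>. exp (z * complex_of_real \<tau>)) has_vector_derivative z * exp (z * complex_of_real \<tau>)) (at \<tau> within T)" for \<tau> T
  proof -
    have "((\<lambda>x. exp (z * x)) has_field_derivative z * exp (z * complex_of_real \<tau>)) (at (complex_of_real \<tau>))"
      by (auto intro!: derivative_eq_intros)
    from has_vector_derivative_real_field[OF this] show ?thesis by (rule has_vector_derivative_at_within)
  qed
  have dk: "((\<lambda>\<tau>. chi \<tau> * k \<tau> q y) has_real_derivative (chi \<tau> * (k \<tau> q y * lt \<tau> q y) + (- 1 / t0) * k \<tau> q y)) (at \<tau> within T)" if "\<tau> > 0" for \<tau> T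
  proof -
    have "(chi has_real_derivative (- 1 / t0)) (at \<tau>)"
      unfolding chi_def[abs_def] using t0 by (auto intro!: derivative_eq_intros)
    from DERIV_mult[OF this k_has_derivative_t[OF that, of q y]]
    have "((\<lambda>\<tau>. chi \<tau> * k \<tau> q y) has_real_derivative (chi \<tau> * (k \<tau> q y * lt \<tau> q y) + (- 1 / t0) * k \<tau> q y)) (at \<tau>)"
      by (rule DERIV_cong) simp
    then show ?thesis by (rule has_field_derivative_at_within)
  qed
  let ?J = "\<lambda>\<tau>. exp (z * complex_of_real \<tau>) * ((z * chi \<tau> - 1 / t0) * k \<tau> q y + chi \<tau> * (k \<tau> q y * lt \<tau> q y))"
  have "has_bochner_integral lborel (\<lambda>\<tau>. indicator {s..t0} \<tau> *\<^sub>R ?J \<tau>)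
     (exp (z * complex_of_real t0) * complex_of_real (chi t0 * k t0 q y) - exp (z * complex_of_real s) * complex_of_real (chi s * k s q y))"
  proof (rule has_bochner_integral_FTC_Icc)
    show "s \<le> t0" by fact
    fix \<tau> assume "s \<le> \<tau>" "\<tau> \<le> t0"
    then have "\<tau> > 0" using s by simp
    have "((\<lambda>\<tau>. complex_of_real (chi \<tau> * k \<tau> q y)) has_vector_derivative complex_of_real (chi \<tau> * (k \<tau> q y * lt \<tau> q y) + (- 1 / t0) * k \<tau> q y)) (at \<tau> within {s..t0})"
      using dk[OF \<open>\<tau> > 0\<close>] by (intro has_vector_derivative_of_real) (simp add: has_real_derivative_iff_has_vector_derivative)
    from has_vector_derivative_mult[OF dexp this]
    show "((\<lambda>\<tau>. exp (z * complex_of_real \<tau>) * complex_of_real (chi \<tau> * k \<tau> q y)) has_vector_derivative ?J \<tau>) (at \<tau> within {s..t0})"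
      by (rule has_vector_derivative_eq_rhs) (simp add: algebra_simps)
  next
    have ck: "continuous_on {s..t0} (\<lambda>\<tau>. k \<tau> q y)"
      using s by (intro continuous_at_imp_continuous_on ballI DERIV_isCont[OF k_has_derivative_t]) auto
    have cA: "continuous_on {s..t0} (\<lambda>\<tau>. A \<tau> q y)" "continuous_on {s..t0} (\<lambda>\<tau>. B \<tau> q y)"
      unfolding A_def B_def by (intro continuous_intros; simp)+
    have cl: "continuous_on {s..t0} (\<lambda>\<tau>. lt \<tau> q y)"
      unfolding lt_def using s a m by (intro continuous_intros cA) auto
    show "continuous_on {s..t0} ?J"
      unfolding chi_def using t0 by (intro continuous_intros ck cl) auto
  qed
  then show ?thesis by (simp add: has_bochner_integral_integral_eq chi_bounds(2))
qed

lemma weighted_integrable: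
  fixes f :: "'n phase \<Rightarrow> complex" and r :: "'n phase \<Rightarrow> complex"
  assumes f: "mLp p f" and p: "p > 1" and t: "0 < t" and r [measurable]: "r \<in> borel_measurable borel"
    and c: "\<And>y. norm (r y) \<le> c * M t q y"
  shows "integrable lborel (\<lambda>y. f y * r y)"
proof (rule mLp_integrable_mult[OF f p])
  have Mn: "M t q y \<ge> 0" for y by (rule M_nonneg[OF t])
  have c': "norm (r y) \<le> \<bar>c\<bar> * M t q y" for y
    using c[of y] mult_right_mono[OF abs_ge_self Mn[of y], of c] by linarith
  show "integrable lborel r"
    by (rule Bochner_Integration.integrable_bound[OF integrable_mult_right[OF M_integrable(1)[OF t, of q], of "\<bar>c\<bar>"]])
       (use c' Mn in \<open>auto simp: abs_mult\<close>)
  show "norm (r y) \<le> \<bar>c\<bar> * (1 / t ^ (2 * CARD('n)))" for y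
    by (rule order_trans[OF c' mult_left_mono[OF M_integrable(2)[OF t]]]) simp
qed

text \<open>The time derivative of \<open>exp (z * \<tau>) * chi \<tau> * k\<close> contains
  \<open>k * lt\<close>, which equals \<open>k * err - Pop k\<close>. Paired with \<open>f\<close>,
  the term \<open>Pop k\<close> turns into \<open>g * k\<close> by the weak equation, and what
  remains is \<open>Eint\<close> against \<open>f\<close> minus \<open>Gint\<close> against
  \<open>h\<close>. The boundary value at small time becomes \<open>- f\<close> after integration
  against a test function of the pole, which is why the identity is first obtained in weak
  form.\<close>

lemma left_parametrix_weak:
  fixes f g \<phi> :: "'n phase \<Rightarrow> complex"
  assumes f: "mLp p f" and g: "mLp p g" and p: "p > 1" and z: "Re z \<le> 0"
    and dual: "\<And>\<psi>. \<psi> \<in> test_functions \<Longrightarrow> (\<integral>y. f y * Pop \<psi> y \<partial>lborel) = (\<integral>y. g y * \<psi> y \<partial>lborel)"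
    and \<phi>: "\<phi> \<in> test_functions"
  defines "h \<equiv> \<lambda>y. g y - z * f y"
  defines "\<Psi>E \<equiv> \<lambda>x. indicator {0<..t0} (fst x) *\<^sub>R (\<phi> (fst (snd x)) * (f (snd (snd x)) * Eint z (fst x) (fst (snd x)) (snd (snd x))))"
    and "\<Psi>G \<equiv> \<lambda>x. indicator {0<..t0} (fst x) *\<^sub>R (\<phi> (fst (snd x)) * (h (snd (snd x)) * Gint z (fst x) (fst (snd x)) (snd (snd x))))"
  shows "integrable lborel \<Psi>E" "integrable lborel \<Psi>G"
    "- (\<integral>y. f y * \<phi> y \<partial>lborel) = (\<integral>x. \<Psi>E x \<partial>lborel) - (\<integral>x. \<Psi>G x \<partial>lborel)"
proof -
  have h: "mLp p h" unfolding h_def by (intro mLp_minus mLp_cmult f g p)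
  have [measurable]: "f \<in> borel_measurable borel" "g \<in> borel_measurable borel" "h \<in> borel_measurable borel"
    using f g h by (auto simp: mLp_def)
  note [measurable] = test_function_measurable[OF \<phi>]
  obtain C R where C: "C > 0" "\<And>z. norm (\<phi> z) \<le> C * indicator (cball 0 R) z"
    by (rule test_function_bounded[OF \<phi>]) blast
  obtain KM where KM: "KM > 0" "\<And>t q y. 0 < t \<Longrightarrow> t \<le> 1 \<Longrightarrow> \<bar>k t q y\<bar> \<le> KM * M t q y"
    "\<And>t q y. 0 < t \<Longrightarrow> t \<le> 1 \<Longrightarrow> \<bar>k t q y * err t q y\<bar> \<le> KM * M t q y"
    "\<And>t q y. 0 < t \<Longrightarrow> t \<le> 1 \<Longrightarrow> \<bar>k t q y * lt t q y\<bar> \<le> KM / t\<^sup>2 * M t q y"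
    using kernel_bounds by metis
  have GE: "norm (Gint z \<tau> q y) \<le> exp (Re z * \<tau>) * (KM * M \<tau> q y)"
      "norm (Eint z \<tau> q y) \<le> exp (Re z * \<tau>) * ((KM + KM / t0) * M \<tau> q y)" if "0 < \<tau>" "\<tau> \<le> t0" for \<tau> q y
    using Gint_Eint_bound[OF KM(2) KM(3) that z, of q y] that t0 by auto
  have GE': "norm (Gint z \<tau> q y) \<le> KM * M \<tau> q y" "norm (Eint z \<tau> q y) \<le> (KM + KM / t0) * M \<tau> q y"
    if "0 < \<tau>" "\<tau> \<le> t0" for \<tau> q y
  proof -
    have "exp (Re z * \<tau>) \<le> 1" using norm_exp_le[OF z, of \<tau>] that by simp
    then have le: "exp (Re z * \<tau>) * (c * M \<tau> q y) \<le> c * M \<tau> q y" if "c \<ge> 0" for c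
      using that M_nonneg[OF \<open>0 < \<tau>\<close>, of q y] by (intro mult_left_le_one_le) auto
    show "norm (Gint z \<tau> q y) \<le> KM * M \<tau> q y" by (rule order_trans[OF GE(1)[OF that] le[OF less_imp_le[OF KM(1)]]])
    have "KM + KM / t0 \<ge> 0" using KM(1) t0 by simp
    then show "norm (Eint z \<tau> q y) \<le> (KM + KM / t0) * M \<tau> q y" by (intro order_trans[OF GE(2)[OF that]] le)
  qed
  show iE: "integrable lborel \<Psi>E"
  proof (rule triple_integrable[OF f p _ C(2) C(1), where c="KM + KM / t0"])
    show "norm (\<Psi>E (t, w)) \<le> indicator {0<..t0} t * ((KM + KM / t0) * (norm (\<phi> (fst w)) * norm (f (snd w)) * M t (fst w) (snd w)))" for t w
    proof (cases "t \<in> {0<..t0}")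
      case True
      then have "norm (\<phi> (fst w)) * norm (f (snd w)) * norm (Eint z t (fst w) (snd w)) \<le> norm (\<phi> (fst w)) * norm (f (snd w)) * ((KM + KM / t0) * M t (fst w) (snd w))"
        by (intro mult_left_mono GE') auto
      then show ?thesis using True by (simp add: \<Psi>E_def norm_mult mult_ac)
    qed (simp add: \<Psi>E_def)
    show "\<Psi>E \<in> borel_measurable borel" unfolding \<Psi>E_def by measurable
  qed (use KM t0 in auto)
  show iG: "integrable lborel \<Psi>G"
  proof (rule triple_integrable[OF h p _ C(2) C(1), where c=KM])
    show "norm (\<Psi>G (t, w)) \<le> indicator {0<..t0} t * (KM * (norm (\<phi> (fst w)) * norm (h (snd w)) * M t (fst w) (snd w)))" for t w
    proof (cases "t \<in> {0<..t0}")
      case True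
      then have "norm (\<phi> (fst w)) * norm (h (snd w)) * norm (Gint z t (fst w) (snd w)) \<le> norm (\<phi> (fst w)) * norm (h (snd w)) * (KM * M t (fst w) (snd w))"
        by (intro mult_left_mono GE') auto
      then show ?thesis using True by (simp add: \<Psi>G_def norm_mult mult_ac)
    qed (simp add: \<Psi>G_def)
    show "\<Psi>G \<in> borel_measurable borel" unfolding \<Psi>G_def by measurable
  qed (use KM t0 in auto)
  define J where "J \<tau> q y = exp (z * complex_of_real \<tau>) * ((z * chi \<tau> - 1 / t0) * k \<tau> q y + chi \<tau> * (k \<tau> q y * lt \<tau> q y))" for \<tau> q y
  have J_meas [measurable (raw)]: "(\<lambda>x. J (u x) (v x) (w x)) \<in> borel_measurable N"
    if [measurable]: "u \<in> borel_measurable N" "v \<in> borel_measurable N" "w \<in> borel_measurable N" for N :: "'y measure" and u v w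
    unfolding J_def chi_def by measurable
  have J_bound: "norm (J \<tau> q y) \<le> KM * (norm z + 1 / t0 + 1 / s\<^sup>2) * M \<tau> q y" if "0 < s" "s \<le> \<tau>" "\<tau> \<le> t0" for s \<tau> q y
  proof -
    have \<tau>: "0 < \<tau>" "\<tau> \<le> 1" using that t0 by auto
    note ch = chi_bounds(1)[OF \<tau>(1) that(3)]
    have Mn: "M \<tau> q y \<ge> 0" by (rule M_nonneg[OF \<tau>(1)])
    have zz: "norm (z * complex_of_real (chi \<tau>) - 1 / complex_of_real t0) \<le> norm z + 1 / t0"
    proof -
      have "norm (z * complex_of_real (chi \<tau>) - 1 / complex_of_real t0) \<le> norm (z * complex_of_real (chi \<tau>)) + norm (1 / complex_of_real t0)" by (rule norm_triangle_ineq4)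
      also have "norm (z * complex_of_real (chi \<tau>)) \<le> norm z" using ch by (simp add: norm_mult mult_left_le)
      also have "norm (1 / complex_of_real t0) = 1 / t0" using t0 by (simp add: norm_divide)
      finally show ?thesis by simp
    qed
    have a1: "norm ((z * complex_of_real (chi \<tau>) - 1 / complex_of_real t0) * complex_of_real (k \<tau> q y)) \<le> (norm z + 1 / t0) * (KM * M \<tau> q y)"
      unfolding norm_mult norm_of_real using zz KM(2)[OF \<tau>, of q y] t0 by (intro mult_mono) auto
    have a2: "norm (complex_of_real (chi \<tau> * (k \<tau> q y * lt \<tau> q y))) \<le> KM / s\<^sup>2 * M \<tau> q y"
    proof -
      have "norm (complex_of_real (chi \<tau> * (k \<tau> q y * lt \<tau> q y))) \<le> 1 * (KM / \<tau>\<^sup>2 * M \<tau> q y)"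
        unfolding norm_of_real abs_mult[of "chi \<tau>"] using ch KM(4)[OF \<tau>, of q y] by (intro mult_mono) auto
      also have "\<dots> \<le> KM / s\<^sup>2 * M \<tau> q y"
        using that KM(1) Mn \<tau> by (simp, intro mult_right_mono divide_left_mono power_mono) auto
      finally show ?thesis .
    qed
    have "norm (J \<tau> q y) = norm (exp (z * complex_of_real \<tau>)) * norm ((z * complex_of_real (chi \<tau>) - 1 / complex_of_real t0) * complex_of_real (k \<tau> q y) + complex_of_real (chi \<tau> * (k \<tau> q y * lt \<tau> q y)))"
      unfolding J_def norm_mult by simp
    also have "\<dots> \<le> 1 * ((norm z + 1 / t0) * (KM * M \<tau> q y) + KM / s\<^sup>2 * M \<tau> q y)"
      using norm_exp_le[OF z, of \<tau>] \<tau> by (intro mult_mono order_trans[OF norm_triangle_ineq add_mono[OF a1 a2]]) auto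
    also have "\<dots> = KM * (norm z + 1 / t0 + 1 / s\<^sup>2) * M \<tau> q y" by (simp add: algebra_simps)
    finally show ?thesis .
  qed
  \<comment> \<open>Times below \<open>s\<close> are cut off: \<open>J\<close> contains
    \<open>lt\<close>, whose bound of order \<open>t^(-2)\<close> is not integrable at 0, while the
    bounds for \<open>Eint\<close> and \<open>Gint\<close> are integrable down to time 0.\<close>
  define \<Phi> where "\<Phi> s x = indicator {s..t0} (fst x) *\<^sub>R (\<phi> (fst (snd x)) * (f (snd (snd x)) * J (fst x) (fst (snd x)) (snd (snd x))))" for s x
  have i\<Phi>: "integrable lborel (\<Phi> s)" if s: "0 < s" "s \<le> t0" for s
  proof (rule triple_integrable[OF f p _ C(2) C(1), where c="KM * (norm z + 1 / t0 + 1 / s\<^sup>2)"])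
    show "norm (\<Phi> s (t, w)) \<le> indicator {0<..t0} t * (KM * (norm z + 1 / t0 + 1 / s\<^sup>2) * (norm (\<phi> (fst w)) * norm (f (snd w)) * M t (fst w) (snd w)))" for t w
    proof (cases "t \<in> {s..t0}")
      case True
      then have "norm (\<phi> (fst w)) * norm (f (snd w)) * norm (J t (fst w) (snd w)) \<le> norm (\<phi> (fst w)) * norm (f (snd w)) * (KM * (norm z + 1 / t0 + 1 / s\<^sup>2) * M t (fst w) (snd w))"
        using s by (intro mult_left_mono J_bound) auto
      then show ?thesis using True s by (simp add: \<Phi>_def norm_mult mult_ac)
    next
      case False
      then show ?thesis using KM(1) t0 M_nonneg[of t "fst w" "snd w"] by (auto simp: \<Phi>_def indicator_def)
    qed
    show "\<Phi> s \<in> borel_measurable borel" unfolding \<Phi>_def[abs_def] by measurable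
  qed (use KM t0 in auto)
  define \<Psi> where "\<Psi> s x = indicator {s..t0} (fst x) *\<^sub>R (\<Psi>E x - \<Psi>G x)" for s x
  have i\<Psi>: "integrable lborel (\<Psi> s)" for s
  proof (rule Bochner_Integration.integrable_bound[OF Bochner_Integration.integrable_diff[OF iE iG]])
    have [measurable]: "\<Psi>E \<in> borel_measurable borel" "\<Psi>G \<in> borel_measurable borel"
      using borel_measurable_integrable[OF iE] borel_measurable_integrable[OF iG] by auto
    show "\<Psi> s \<in> borel_measurable lborel" unfolding \<Psi>_def[abs_def] by measurable
    show "AE x in lborel. norm (\<Psi> s x) \<le> norm (\<Psi>E x - \<Psi>G x)" by (intro AE_I2) (auto simp: \<Psi>_def indicator_def)
  qed
  \<comment> \<open>First order of integration: with \<open>y\<close> innermost the weak equation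
    can be inserted.\<close>
  have inner: "(\<integral>y. \<Phi> s (\<tau>, (q, y)) \<partial>lborel) = (\<integral>y. \<Psi> s (\<tau>, (q, y)) \<partial>lborel)" if s: "0 < s" for s \<tau> q
  proof (cases "\<tau> \<in> {s..t0}")
    case False
    then show ?thesis by (simp add: \<Phi>_def \<Psi>_def)
  next
    case True
    then have \<tau>: "0 < \<tau>" "\<tau> \<le> t0" "\<tau> \<le> 1" using s t0 by auto
    let ?e = "exp (z * complex_of_real \<tau>) * complex_of_real (chi \<tau>)"
    have i1: "integrable lborel (\<lambda>y. f y * Eint z \<tau> q y)"
      by (rule weighted_integrable[OF f p \<tau>(1) _ GE'(2)[OF \<tau>(1,2)]]) measurable
    have i2: "integrable lborel (\<lambda>y. h y * Gint z \<tau> q y)"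
      by (rule weighted_integrable[OF h p \<tau>(1) _ GE'(1)[OF \<tau>(1,2)]]) measurable
    have i3: "integrable lborel (\<lambda>y. f y * complex_of_real (Pop (k \<tau> q) y))"
    proof (rule weighted_integrable[OF f p \<tau>(1)])
      show "(\<lambda>y. complex_of_real (Pop (k \<tau> q) y)) \<in> borel_measurable borel" unfolding Pop_k[OF \<tau>(1)] by measurable
      show "norm (complex_of_real (Pop (k \<tau> q) y)) \<le> (KM + KM / \<tau>\<^sup>2) * M \<tau> q y" for y
        unfolding Pop_k[OF \<tau>(1)] right_diff_distrib norm_of_real
        using KM(3,4)[OF \<tau>(1,3), of q y] by (simp add: distrib_right)
    qed
    have i4: "integrable lborel (\<lambda>y. g y * complex_of_real (k \<tau> q y))"
    proof (rule weighted_integrable[OF g p \<tau>(1), where c=KM and q=q])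
      show "norm (complex_of_real (k \<tau> q y)) \<le> KM * M \<tau> q y" for y using KM(2)[OF \<tau>(1,3)] by simp
    qed measurable
    have pt: "f y * J \<tau> q y = (f y * Eint z \<tau> q y - h y * Gint z \<tau> q y) + ?e * (g y * complex_of_real (k \<tau> q y) - f y * complex_of_real (Pop (k \<tau> q) y))" for y
      unfolding Pop_k[OF \<tau>(1)] J_def Eint_def Gint_def h_def by (simp add: algebra_simps)
    have "(\<integral>y. f y * J \<tau> q y \<partial>lborel) = (\<integral>y. f y * Eint z \<tau> q y - h y * Gint z \<tau> q y \<partial>lborel)
       + ?e * ((\<integral>y. g y * complex_of_real (k \<tau> q y) \<partial>lborel) - (\<integral>y. f y * complex_of_real (Pop (k \<tau> q) y) \<partial>lborel))"
      unfolding pt using i1 i2 i3 i4 by simp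
    also have "(\<integral>y. f y * complex_of_real (Pop (k \<tau> q) y) \<partial>lborel) = (\<integral>y. g y * complex_of_real (k \<tau> q y) \<partial>lborel)"
      by (rule Pop_duality[OF f g p \<tau>(1,3) dual])
    finally have eq: "(\<integral>y. f y * J \<tau> q y \<partial>lborel) = (\<integral>y. f y * Eint z \<tau> q y - h y * Gint z \<tau> q y \<partial>lborel)" by simp
    have "(\<integral>y. \<Phi> s (\<tau>, (q, y)) \<partial>lborel) = \<phi> q * (\<integral>y. f y * J \<tau> q y \<partial>lborel)"
      using True by (simp add: \<Phi>_def)
    also have "\<dots> = (\<integral>y. \<phi> q * (f y * Eint z \<tau> q y - h y * Gint z \<tau> q y) \<partial>lborel)" unfolding eq by simp
    also have "\<dots> = (\<integral>y. \<Psi> s (\<tau>, (q, y)) \<partial>lborel)"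
      using True \<tau> by (simp add: \<Psi>_def \<Psi>E_def \<Psi>G_def right_diff_distrib)
    finally show ?thesis .
  qed
  have \<Phi>\<Psi>: "(\<integral>x. \<Phi> s x \<partial>lborel) = (\<integral>x. \<Psi> s x \<partial>lborel)" if s: "0 < s" "s \<le> t0" for s
    unfolding integral_triple[OF i\<Phi>[OF s]] integral_triple[OF i\<Psi>] by (simp add: inner[OF s(1)])
  \<comment> \<open>Second order of integration: with time innermost the same integral collapses to
    the boundary term at \<open>s\<close>, the one at \<open>t0\<close> being removed by
    \<open>chi\<close>.\<close>
  have \<Phi>k: "(\<integral>x. \<Phi> s x \<partial>lborel) = - (exp (z * complex_of_real s) * complex_of_real (chi s)) * (\<integral>y. f y * (\<integral>q. k s q y *\<^sub>R \<phi> q \<partial>lborel) \<partial>lborel)"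
    if s: "0 < s" "s \<le> t0" for s
  proof -
    let ?e = "exp (z * complex_of_real s) * complex_of_real (chi s)"
    define \<kappa> where "\<kappa> w = \<phi> (fst w) * (f (snd w) * complex_of_real (k s (fst w) (snd w)))" for w
    have [measurable]: "\<kappa> \<in> borel_measurable borel" unfolding \<kappa>_def[abs_def] by measurable
    have s1: "s \<le> 1" using s t0 by simp
    obtain X where X: "(\<integral>\<^sup>+w. ennreal (norm (\<phi> (fst w)) * norm (f (snd w)) * M s (fst w) (snd w)) \<partial>lborel) \<le> ennreal X"
      using schur_pairing[OF f p _ C(2) C(1)] s by force
    have i\<kappa>: "integrable lborel \<kappa>"
    proof (rule integrableI_bounded)
      have "(\<integral>\<^sup>+w. ennreal (norm (\<kappa> w)) \<partial>lborel) \<le> (\<integral>\<^sup>+w. ennreal KM * ennreal (norm (\<phi> (fst w)) * norm (f (snd w)) * M s (fst w) (snd w)) \<partial>lborel)"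
      proof (rule nn_integral_mono)
        fix w
        have "norm (\<phi> (fst w)) * norm (f (snd w)) * \<bar>k s (fst w) (snd w)\<bar> \<le> norm (\<phi> (fst w)) * norm (f (snd w)) * (KM * M s (fst w) (snd w))"
          by (intro mult_left_mono KM(2) s(1) s1) auto
        then show "ennreal (norm (\<kappa> w)) \<le> ennreal KM * ennreal (norm (\<phi> (fst w)) * norm (f (snd w)) * M s (fst w) (snd w))"
          using KM(1) M_nonneg[OF s(1)] by (simp add: \<kappa>_def norm_mult mult_ac flip: ennreal_mult)
      qed
      also have "\<dots> = ennreal KM * (\<integral>\<^sup>+w. ennreal (norm (\<phi> (fst w)) * norm (f (snd w)) * M s (fst w) (snd w)) \<partial>lborel)"
        by (rule nn_integral_cmult) measurable
      also have "\<dots> \<le> ennreal KM * ennreal X" by (intro mult_left_mono X) auto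
      also have "\<dots> < \<infinity>" by (simp add: ennreal_mult_less_top)
      finally show "(\<integral>\<^sup>+w. ennreal (norm (\<kappa> w)) \<partial>lborel) < \<infinity>" .
    qed measurable
    have "(\<integral>x. \<Phi> s x \<partial>lborel) = (\<integral>w. \<integral>\<tau>. \<Phi> s (\<tau>, w) \<partial>lborel \<partial>lborel)"
      by (rule integral_pair_snd[OF i\<Phi>[OF s]])
    also have "\<dots> = (\<integral>w. - ?e * \<kappa> w \<partial>lborel)"
    proof (rule Bochner_Integration.integral_cong[OF refl])
      fix w :: "'n phase \<times> 'n phase"
      have "(\<integral>\<tau>. \<Phi> s (\<tau>, w) \<partial>lborel) = (\<integral>\<tau>. (\<phi> (fst w) * f (snd w)) * (indicator {s..t0} \<tau> *\<^sub>R J \<tau> (fst w) (snd w)) \<partial>lborel)"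
        by (simp add: \<Phi>_def mult_ac)
      also have "\<dots> = (\<phi> (fst w) * f (snd w)) * (\<integral>\<tau>. indicator {s..t0} \<tau> *\<^sub>R J \<tau> (fst w) (snd w) \<partial>lborel)"
        by (rule integral_mult_right_zero)
      also have "(\<integral>\<tau>. indicator {s..t0} \<tau> *\<^sub>R J \<tau> (fst w) (snd w) \<partial>lborel) = - (exp (z * complex_of_real s) * complex_of_real (chi s * k s (fst w) (snd w)))"
        unfolding J_def by (rule time_derivative_integral[OF s])
      finally show "(\<integral>\<tau>. \<Phi> s (\<tau>, w) \<partial>lborel) = - ?e * \<kappa> w" by (simp add: \<kappa>_def mult_ac)
    qed
    also have "\<dots> = - ?e * (\<integral>w. \<kappa> w \<partial>lborel)" by (rule integral_mult_right_zero)
    also have "(\<integral>w. \<kappa> w \<partial>lborel) = (\<integral>y. \<integral>q. \<kappa> (q, y) \<partial>lborel \<partial>lborel)" by (rule integral_pair_snd[OF i\<kappa>])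
    also have "\<dots> = (\<integral>y. f y * (\<integral>q. k s q y *\<^sub>R \<phi> q \<partial>lborel) \<partial>lborel)"
    proof (rule Bochner_Integration.integral_cong[OF refl])
      fix y
      have "\<kappa> (q, y) = f y * (k s q y *\<^sub>R \<phi> q)" for q by (simp add: \<kappa>_def scaleR_conv_of_real)
      then show "(\<integral>q. \<kappa> (q, y) \<partial>lborel) = f y * (\<integral>q. k s q y *\<^sub>R \<phi> q \<partial>lborel)"
        by (simp only: integral_mult_right_zero)
    qed
    finally show ?thesis .
  qed
  define s where "s j = t0 / real (Suc j)" for j
  have s: "0 < s j" "s j \<le> t0" "s j \<le> 1" for j
  proof -
    show "0 < s j" using t0 by (simp add: s_def)
    have "t0 / real (Suc j) \<le> t0 / 1" using t0 by (intro divide_left_mono) auto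
    then show "s j \<le> t0" by (simp add: s_def)
    then show "s j \<le> 1" using t0(2) by linarith
  qed
  have slim: "s \<longlonglongrightarrow> 0" unfolding s_def using LIMSEQ_Suc[OF lim_const_over_n[of t0]] by simp
  have L1: "(\<lambda>j. \<integral>y. f y * (\<integral>q. k (s j) q y *\<^sub>R \<phi> q \<partial>lborel) \<partial>lborel) \<longlonglongrightarrow> (\<integral>y. f y * \<phi> y \<partial>lborel)"
  proof -
    obtain D c where D: "D > 0" "c > 0" "\<And>s y. 0 < s \<Longrightarrow> s \<le> 1 \<Longrightarrow>
       (\<integral>\<^sup>+q. ennreal (k s q y * norm (\<phi> q)) \<partial>lborel) \<le> ennreal (D * exp (- (c * (norm y)\<^sup>2)))"
      using approximate_identity_dominated[OF test_function_measurable[OF \<phi>] C(2) C(1)] by blast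
    have bd: "norm (\<integral>q. k (s j) q y *\<^sub>R \<phi> q \<partial>lborel) \<le> D * exp (- (c * (norm y)\<^sup>2))" for j y
    proof -
      have "ennreal (norm (\<integral>q. k (s j) q y *\<^sub>R \<phi> q \<partial>lborel)) \<le> (\<integral>\<^sup>+q. ennreal (norm (k (s j) q y *\<^sub>R \<phi> q)) \<partial>lborel)"
        by (rule norm_integral_le_nn_integral)
      also have "\<dots> = (\<integral>\<^sup>+q. ennreal (k (s j) q y * norm (\<phi> q)) \<partial>lborel)"
        using k_nonneg[OF s(1)] by simp
      also have "\<dots> \<le> ennreal (D * exp (- (c * (norm y)\<^sup>2)))" by (rule D(3)[OF s(1,3)])
      finally show ?thesis using D by (simp add: ennreal_le_iff)
    qed
    show ?thesis
    proof (rule integral_dominated_convergence)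
      show "integrable lborel (\<lambda>y. norm (f y * complex_of_real (D * exp (- (c * (norm y)\<^sup>2)))))"
      proof (rule integrable_norm, rule mLp_integrable_mult[OF f p])
        show "integrable lborel (\<lambda>y::'n phase. complex_of_real (D * exp (- (c * (norm y)\<^sup>2))))"
          by (intro integrable_of_real integrable_mult_right integrable_gauss D)
        show "norm (complex_of_real (D * exp (- (c * (norm y)\<^sup>2)))) \<le> D" for y :: "'n phase"
          using D by (simp add: abs_mult mult_left_le del: of_real_mult)
      qed
      show "AE y in lborel. norm (f y * (\<integral>q. k (s j) q y *\<^sub>R \<phi> q \<partial>lborel)) \<le> norm (f y * complex_of_real (D * exp (- (c * (norm y)\<^sup>2))))" for j
        using bd D(1) by (intro AE_I2) (simp add: norm_mult mult_left_mono abs_mult del: of_real_mult)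
      show "AE y in lborel. (\<lambda>j. f y * (\<integral>q. k (s j) q y *\<^sub>R \<phi> q \<partial>lborel)) \<longlonglongrightarrow> f y * \<phi> y"
        by (intro AE_I2 tendsto_mult tendsto_const approximate_identity[OF test_function_continuous[OF \<phi>] C(2) C(1) s(1) s(3) slim])
      show "(\<lambda>y. f y * (\<integral>q. k (s j) q y *\<^sub>R \<phi> q \<partial>lborel)) \<in> borel_measurable lborel" for j
      proof -
        have "(\<lambda>x. k (s j) (snd x) (fst x) *\<^sub>R \<phi> (snd x)) \<in> borel_measurable borel" by measurable
        then have "case_prod (\<lambda>y q. k (s j) q y *\<^sub>R \<phi> q) \<in> borel_measurable (lborel \<Otimes>\<^sub>M lborel)"
          by (simp add: lborel_prod case_prod_beta')
        from lborel.borel_measurable_lebesgue_integral[OF this]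
        have [measurable]: "(\<lambda>y. \<integral>q. k (s j) q y *\<^sub>R \<phi> q \<partial>lborel) \<in> borel_measurable borel" by simp
        show ?thesis by measurable
      qed
    qed measurable
  qed
  have "(\<lambda>j. - (exp (z * complex_of_real (s j)) * complex_of_real (chi (s j)))) \<longlonglongrightarrow> - (exp (z * complex_of_real 0) * complex_of_real (1 - 0 / t0))"
    unfolding chi_def by (intro tendsto_intros slim) (use t0 in auto)
  from tendsto_mult[OF this L1]
  have "(\<lambda>j. \<integral>x. \<Phi> (s j) x \<partial>lborel) \<longlonglongrightarrow> - (\<integral>y. f y * \<phi> y \<partial>lborel)"
    unfolding \<Phi>k[OF s(1,2)] by simp
  moreover have "(\<lambda>j. \<integral>x. \<Psi> (s j) x \<partial>lborel) \<longlonglongrightarrow> (\<integral>x. \<Psi>E x - \<Psi>G x \<partial>lborel)"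
  proof (rule integral_dominated_convergence)
    show "integrable lborel (\<lambda>x. norm (\<Psi>E x - \<Psi>G x))" using iE iG by simp
    show "AE x in lborel. norm (\<Psi> (s j) x) \<le> norm (\<Psi>E x - \<Psi>G x)" for j by (intro AE_I2) (auto simp: \<Psi>_def indicator_def)
    show "AE x in lborel. (\<lambda>j. \<Psi> (s j) x) \<longlonglongrightarrow> \<Psi>E x - \<Psi>G x"
    proof (rule AE_I2)
      fix x
      show "(\<lambda>j. \<Psi> (s j) x) \<longlonglongrightarrow> \<Psi>E x - \<Psi>G x"
      proof (cases "0 < fst x \<and> fst x \<le> t0")
        case True
        then have "\<forall>\<^sub>F j in sequentially. s j < fst x" using order_tendstoD(2)[OF slim, of "fst x"] by simp
        then have "\<forall>\<^sub>F j in sequentially. \<Psi>E x - \<Psi>G x = \<Psi> (s j) x"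
          by eventually_elim (use True in \<open>auto simp: \<Psi>_def\<close>)
        then show ?thesis by (rule Lim_transform_eventually[OF tendsto_const])
      next
        case False
        then have "\<Psi>E x = 0" "\<Psi>G x = 0" by (auto simp: \<Psi>E_def \<Psi>G_def)
        then show ?thesis by (simp add: \<Psi>_def)
      qed
    qed
    show "\<Psi> (s j) \<in> borel_measurable lborel" for j by (rule borel_measurable_integrable[OF i\<Psi>])
    show "(\<lambda>x. \<Psi>E x - \<Psi>G x) \<in> borel_measurable lborel"
      by (rule borel_measurable_integrable[OF Bochner_Integration.integrable_diff[OF iE iG]])
  qed
  ultimately show "- (\<integral>y. f y * \<phi> y \<partial>lborel) = (\<integral>x. \<Psi>E x \<partial>lborel) - (\<integral>x. \<Psi>G x \<partial>lborel)"
    using LIMSEQ_unique iE iG by (simp add: \<Phi>\<Psi>[OF s(1,2)])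
qed

end

section \<open>Resolvent estimates\<close>

lemma nn_integral_exp_decay:
  assumes "r > 0"
  shows "(\<integral>\<^sup>+\<tau>. ennreal (exp (- r * \<tau>)) * indicator {0<..c} \<tau> \<partial>lborel) \<le> ennreal (1 / r)"
proof -
  have "(\<integral>\<^sup>+\<tau>. ennreal (exp (- r * \<tau>)) * indicator {0<..c} \<tau> \<partial>lborel)
     \<le> (\<integral>\<^sup>+\<tau>. ennreal (exp (- r * \<tau>)) * indicator {0..} \<tau> \<partial>lborel)"
    by (intro nn_integral_mono) (auto simp: indicator_def)
  also have "\<dots> = ennreal (0 - (- exp (- r * 0) / r))"
  proof (rule nn_integral_FTC_atLeast)
    show "((\<lambda>\<tau>. - exp (- r * \<tau>) / r) \<longlongrightarrow> 0) at_top"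
      using assms by real_asymp
    show "((\<lambda>\<tau>. - exp (- r * \<tau>) / r) has_real_derivative exp (- r * x)) (at x)" for x
      using assms by (auto intro!: derivative_eq_intros)
  qed auto
  finally show ?thesis by simp
qed

lemma nn_integral_inverse_square:
  assumes "d > 0"
  shows "(\<integral>\<^sup>+\<tau>. ennreal (1 / \<tau>\<^sup>2) * indicator {d..c} \<tau> \<partial>lborel) \<le> ennreal (1 / d)"
proof -
  have "(\<integral>\<^sup>+\<tau>. ennreal (1 / \<tau>\<^sup>2) * indicator {d..c} \<tau> \<partial>lborel)
     \<le> (\<integral>\<^sup>+\<tau>. ennreal (1 / \<tau>\<^sup>2) * indicator {d..} \<tau> \<partial>lborel)"
    by (intro nn_integral_mono) (auto simp: indicator_def)
  also have "\<dots> = ennreal (0 - (- 1 / d))"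
  proof (rule nn_integral_FTC_atLeast)
    show "((\<lambda>\<tau>::real. - 1 / \<tau>) \<longlongrightarrow> 0) at_top" by real_asymp
    show "((\<lambda>\<tau>. - 1 / \<tau>) has_real_derivative 1 / x\<^sup>2) (at x)" if "d \<le> x" for x
      using that assms by (auto intro!: derivative_eq_intros simp: power2_eq_square)
  qed auto
  finally show ?thesis by simp
qed

text \<open>One constant bounds both one-sided integrals, so the condition passes unchanged to the
  transposed kernel, which acts in the duality argument.\<close>

definition schur_le :: "('a::euclidean_space \<Rightarrow> 'a \<Rightarrow> complex) \<Rightarrow> real \<Rightarrow> bool" where
  "schur_le K C \<longleftrightarrow> (\<forall>q. (\<integral>\<^sup>+y. ennreal (norm (K q y)) \<partial>lborel) \<le> ennreal C)
     \<and> (\<forall>y. (\<integral>\<^sup>+q. ennreal (norm (K q y)) \<partial>lborel) \<le> ennreal C)"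

context kfp begin

lemma time_schur:
  fixes K :: "real \<Rightarrow> 'n phase \<Rightarrow> 'n phase \<Rightarrow> complex" and w :: "real \<Rightarrow> real"
  assumes K: "(\<lambda>x. K (fst x) (fst (snd x)) (snd (snd x))) \<in> borel_measurable borel"
    and [measurable]: "w \<in> borel_measurable borel" "T \<in> sets borel"
    and T: "\<And>\<tau>. \<tau> \<in> T \<Longrightarrow> 0 < \<tau> \<and> \<tau> \<le> t0"
    and le: "\<And>\<tau> q y. \<tau> \<in> T \<Longrightarrow> norm (K \<tau> q y) \<le> w \<tau> * M \<tau> q y" and w: "\<And>\<tau>. \<tau> \<in> T \<Longrightarrow> w \<tau> \<ge> 0"
    and CM: "\<And>t q. 0 < t \<Longrightarrow> t \<le> t0 \<Longrightarrow> (\<integral>\<^sup>+y. ennreal (M t q y) \<partial>lborel) \<le> ennreal CM"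
      "\<And>t y. 0 < t \<Longrightarrow> t \<le> t0 \<Longrightarrow> (\<integral>\<^sup>+q. ennreal (M t q y) \<partial>lborel) \<le> ennreal CM"
    and X: "(\<integral>\<^sup>+\<tau>. ennreal (w \<tau>) * indicator T \<tau> \<partial>lborel) \<le> ennreal X"
  shows "(\<integral>\<^sup>+y. ennreal (norm (\<integral>\<tau>. indicator T \<tau> *\<^sub>R K \<tau> q y \<partial>lborel)) \<partial>lborel) \<le> ennreal CM * ennreal X"
    and "(\<integral>\<^sup>+q. ennreal (norm (\<integral>\<tau>. indicator T \<tau> *\<^sub>R K \<tau> q y \<partial>lborel)) \<partial>lborel) \<le> ennreal CM * ennreal X"
proof -
  \<comment> \<open>One computation serves both one-sided integrals: \<open>H\<close> stands for
    \<open>K\<close>, and \<open>Maj\<close> for \<open>M\<close>, with one of the two space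
    variables fixed.\<close>
  have gen: "(\<integral>\<^sup>+y. ennreal (norm (\<integral>\<tau>. indicator T \<tau> *\<^sub>R H \<tau> y \<partial>lborel)) \<partial>lborel) \<le> ennreal CM * ennreal X"
    if Hm: "(\<lambda>x. H (fst x) (snd x)) \<in> borel_measurable borel"
    and [measurable]: "(\<lambda>x. Maj (fst x) (snd x)) \<in> borel_measurable borel"
    and HML: "\<And>\<tau> y. \<tau> \<in> T \<Longrightarrow> norm (H \<tau> y) \<le> w \<tau> * Maj \<tau> y" and L0: "\<And>\<tau> y. \<tau> \<in> T \<Longrightarrow> Maj \<tau> y \<ge> 0"
    and Maj: "\<And>\<tau>. \<tau> \<in> T \<Longrightarrow> (\<integral>\<^sup>+y. ennreal (Maj \<tau> y) \<partial>lborel) \<le> ennreal CM"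
    for H :: "real \<Rightarrow> 'n phase \<Rightarrow> complex" and Maj :: "real \<Rightarrow> 'n phase \<Rightarrow> real"
  proof -
    have MLm: "(\<lambda>y. Maj \<tau> y) \<in> borel_measurable borel" for \<tau>
    proof -
      have "(\<lambda>y. (\<lambda>x. Maj (fst x) (snd x)) (\<tau>, y)) \<in> borel_measurable borel"
        by (rule measurable_compose[OF _ that(2)]) (intro borel_measurable_continuous_onI continuous_intros)
      then show ?thesis by simp
    qed
    have wm: "(\<lambda>x::real \<times> 'n phase. w (fst x)) \<in> borel_measurable borel"
      by (rule measurable_compose[OF _ assms(2)]) (intro borel_measurable_continuous_onI continuous_intros)
    have im: "(\<lambda>x::real \<times> 'n phase. indicator T (fst x) :: ennreal) \<in> borel_measurable borel"
      by (rule measurable_compose[of fst borel borel "indicator T"]) (auto intro!: borel_measurable_continuous_onI continuous_intros)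
    have "(\<integral>\<^sup>+y. ennreal (norm (\<integral>\<tau>. indicator T \<tau> *\<^sub>R H \<tau> y \<partial>lborel)) \<partial>lborel)
      \<le> (\<integral>\<^sup>+y. \<integral>\<^sup>+\<tau>. ennreal (w \<tau>) * indicator T \<tau> * ennreal (Maj \<tau> y) \<partial>lborel \<partial>lborel)"
    proof (rule nn_integral_mono)
      fix y
      have "ennreal (norm (\<integral>\<tau>. indicator T \<tau> *\<^sub>R H \<tau> y \<partial>lborel)) \<le> (\<integral>\<^sup>+\<tau>. ennreal (norm (indicator T \<tau> *\<^sub>R H \<tau> y)) \<partial>lborel)"
        by (rule norm_integral_le_nn_integral)
      also have "\<dots> \<le> (\<integral>\<^sup>+\<tau>. ennreal (w \<tau>) * indicator T \<tau> * ennreal (Maj \<tau> y) \<partial>lborel)"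
        using HML w L0 by (intro nn_integral_mono) (auto simp: indicator_def simp flip: ennreal_mult)
      finally show "ennreal (norm (\<integral>\<tau>. indicator T \<tau> *\<^sub>R H \<tau> y \<partial>lborel)) \<le> (\<integral>\<^sup>+\<tau>. ennreal (w \<tau>) * indicator T \<tau> * ennreal (Maj \<tau> y) \<partial>lborel)" .
    qed
    also have "\<dots> = (\<integral>\<^sup>+\<tau>. \<integral>\<^sup>+y. ennreal (w \<tau>) * indicator T \<tau> * ennreal (Maj \<tau> y) \<partial>lborel \<partial>lborel)"
    proof -
      have m: "(\<lambda>x. ennreal (w (fst x)) * indicator T (fst x) * ennreal (Maj (fst x) (snd x))) \<in> borel_measurable borel"
        by (intro borel_measurable_times_ennreal measurable_compose[OF wm measurable_ennreal] im measurable_compose[OF that(2) measurable_ennreal])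
      show ?thesis using nn_integral_pair_snd[OF m] nn_integral_pair_fst[OF m] by simp
    qed
    also have "\<dots> = (\<integral>\<^sup>+\<tau>. ennreal (w \<tau>) * indicator T \<tau> * (\<integral>\<^sup>+y. ennreal (Maj \<tau> y) \<partial>lborel) \<partial>lborel)"
      by (intro nn_integral_cong nn_integral_cmult) (simp add: measurable_compose[OF MLm measurable_ennreal])
    also have "\<dots> \<le> (\<integral>\<^sup>+\<tau>. (ennreal (w \<tau>) * indicator T \<tau>) * ennreal CM \<partial>lborel)"
      using Maj by (intro nn_integral_mono) (auto simp: indicator_def intro!: mult_left_mono)
    also have "\<dots> = (\<integral>\<^sup>+\<tau>. ennreal (w \<tau>) * indicator T \<tau> \<partial>lborel) * ennreal CM"
      by (rule nn_integral_multc) measurable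
    also have "\<dots> \<le> ennreal X * ennreal CM" by (intro mult_right_mono X) auto
    finally show ?thesis by (simp add: mult.commute)
  qed
  have c1: "(\<lambda>x. (fst x, (q, snd x))) \<in> borel_measurable borel" for q :: "'n phase"
    by (intro borel_measurable_continuous_onI continuous_intros)
  have c2: "(\<lambda>x. (fst x, (snd x, y))) \<in> borel_measurable borel" for y :: "'n phase"
    by (intro borel_measurable_continuous_onI continuous_intros)
  show "(\<integral>\<^sup>+y. ennreal (norm (\<integral>\<tau>. indicator T \<tau> *\<^sub>R K \<tau> q y \<partial>lborel)) \<partial>lborel) \<le> ennreal CM * ennreal X"
  proof (rule gen[of _ "\<lambda>\<tau> y. M \<tau> q y"])
    show "(\<lambda>x. K (fst x) q (snd x)) \<in> borel_measurable borel" using measurable_compose[OF c1 K] by simp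
    show "(\<lambda>x. M (fst x) q (snd x)) \<in> borel_measurable borel" by measurable
  qed (use le T M_nonneg CM in auto)
  show "(\<integral>\<^sup>+q. ennreal (norm (\<integral>\<tau>. indicator T \<tau> *\<^sub>R K \<tau> q y \<partial>lborel)) \<partial>lborel) \<le> ennreal CM * ennreal X"
  proof (rule gen[of _ "\<lambda>\<tau> q. M \<tau> q y"])
    show "(\<lambda>x. K (fst x) (snd x) y) \<in> borel_measurable borel" using measurable_compose[OF c2 K] by simp
    show "(\<lambda>x. M (fst x) (snd x) y) \<in> borel_measurable borel" by measurable
  qed (use le T M_nonneg CM in auto)
qed

text \<open>\<open>k\<close> and \<open>k * err\<close> have Schur masses that are bounded uniformly
  in time, so the only gain is the integral of \<open>exp (Re z * \<tau>)\<close>, which is at most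
  \<open>1 / (- Re z)\<close> whatever the imaginary part.\<close>

lemma kernels_decay_real:
  "\<exists>C>0. \<forall>z. Re z < 0 \<longrightarrow> schur_le (Gk z) (C / (- Re z)) \<and> schur_le (Ek z) (C / (- Re z))"
proof -
  obtain KM where KM: "KM > 0" "\<And>t q y. 0 < t \<Longrightarrow> t \<le> 1 \<Longrightarrow> \<bar>k t q y\<bar> \<le> KM * M t q y"
    "\<And>t q y. 0 < t \<Longrightarrow> t \<le> 1 \<Longrightarrow> \<bar>k t q y * err t q y\<bar> \<le> KM * M t q y"
    using kernel_bounds by metis
  obtain CM where CM: "CM > 0" "\<And>t q. 0 < t \<Longrightarrow> t \<le> t0 \<Longrightarrow> (\<integral>\<^sup>+y. ennreal (M t q y) \<partial>lborel) \<le> ennreal CM"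
    "\<And>t y. 0 < t \<Longrightarrow> t \<le> t0 \<Longrightarrow> (\<integral>\<^sup>+q. ennreal (M t q y) \<partial>lborel) \<le> ennreal CM"
    using schur_M by metis
  define c where "c = KM + KM / t0"
  have c: "c > 0" "KM \<le> c" using KM(1) t0 by (auto simp: c_def add_pos_nonneg)
  have "schur_le (Gk z) (CM * c / (- Re z)) \<and> schur_le (Ek z) (CM * c / (- Re z))" if z: "Re z < 0" for z
  proof -
    define w where "w \<tau> = c * exp (Re z * \<tau>)" for \<tau>
    have [measurable]: "w \<in> borel_measurable borel" unfolding w_def[abs_def] by measurable
    have X: "(\<integral>\<^sup>+\<tau>. ennreal (w \<tau>) * indicator {0<..t0} \<tau> \<partial>lborel) \<le> ennreal (c / (- Re z))"
    proof -
      have "(\<integral>\<^sup>+\<tau>. ennreal (w \<tau>) * indicator {0<..t0} \<tau> \<partial>lborel) = (\<integral>\<^sup>+\<tau>. ennreal c * (ennreal (exp (- (- Re z) * \<tau>)) * indicator {0<..t0} \<tau>) \<partial>lborel)"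
        using c by (intro nn_integral_cong) (simp add: w_def ennreal_mult mult.assoc)
      also have "\<dots> = ennreal c * (\<integral>\<^sup>+\<tau>. ennreal (exp (- (- Re z) * \<tau>)) * indicator {0<..t0} \<tau> \<partial>lborel)"
        by (rule nn_integral_cmult) measurable
      also have "\<dots> \<le> ennreal c * ennreal (1 / (- Re z))" using z by (intro mult_left_mono nn_integral_exp_decay) auto
      also have "\<dots> = ennreal (c * (1 / (- Re z)))" using c z by (intro ennreal_mult[symmetric]) auto
      finally show ?thesis by simp
    qed
    have G: "norm (Gint z \<tau> q y) \<le> w \<tau> * M \<tau> q y" "norm (Eint z \<tau> q y) \<le> w \<tau> * M \<tau> q y" if "\<tau> \<in> {0<..t0}" for \<tau> q y
    proof -
      have \<tau>: "0 < \<tau>" "\<tau> \<le> t0" "\<tau> \<le> 1" using that t0(1,2) by auto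
      note b = Gint_Eint_bound[OF KM(2)[OF \<tau>(1,3)] KM(3)[OF \<tau>(1,3)] \<tau>(1,2) less_imp_le[OF z]]
      have "exp (Re z * \<tau>) * (KM * M \<tau> q y) \<le> exp (Re z * \<tau>) * (c * M \<tau> q y)"
        using c M_nonneg[OF \<tau>(1)] by (intro mult_left_mono mult_right_mono) auto
      with b(1) have "norm (Gint z \<tau> q y) \<le> exp (Re z * \<tau>) * (c * M \<tau> q y)" by (rule order_trans)
      then show "norm (Gint z \<tau> q y) \<le> w \<tau> * M \<tau> q y" by (simp add: w_def mult_ac)
      show "norm (Eint z \<tau> q y) \<le> w \<tau> * M \<tau> q y" using b(2)[of q y] by (simp add: w_def c_def mult_ac)
    qed
    have fin: "ennreal CM * ennreal (c / (- Re z)) = ennreal (CM * c / (- Re z))"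
      using CM(1) c z by (simp add: ennreal_mult[symmetric] divide_nonneg_neg)
    have mG: "(\<lambda>x. Gint z (fst x) (fst (snd x)) (snd (snd x))) \<in> borel_measurable borel" by measurable
    have mE: "(\<lambda>x. Eint z (fst x) (fst (snd x)) (snd (snd x))) \<in> borel_measurable borel" by measurable
    have w0: "w \<tau> \<ge> 0" for \<tau> using c by (simp add: w_def)
    show ?thesis unfolding schur_le_def Gk_def Ek_def fin[symmetric]
      by (intro conjI allI time_schur[where w=w] mG mE G X w0 CM) auto
  qed
  then show ?thesis using CM(1) c by (intro exI[of _ "CM * c"]) auto
qed

text \<open>Below \<open>d = |z|\<^sup>-\<^sup>1\<^sup>/\<^sup>2\<close> the time integral is estimated trivially, above it by parts: one factor \<open>1/z\<close>
  is gained at the cost of \<open>\<partial>\<^sub>t k = O(t\<^sup>-\<^sup>2 M)\<close>.\<close>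

lemma Gk_decay:
  "\<exists>C>0. \<forall>z. Re z < 0 \<longrightarrow> norm z \<ge> 1 / t0\<^sup>2 \<longrightarrow> schur_le (Gk z) (C / sqrt (norm z))"
proof -
  obtain KM where KM: "KM > 0" "\<And>t q y. 0 < t \<Longrightarrow> t \<le> 1 \<Longrightarrow> \<bar>k t q y\<bar> \<le> KM * M t q y"
    "\<And>t q y. 0 < t \<Longrightarrow> t \<le> 1 \<Longrightarrow> \<bar>k t q y * err t q y\<bar> \<le> KM * M t q y"
    "\<And>t q y. 0 < t \<Longrightarrow> t \<le> 1 \<Longrightarrow> \<bar>k t q y * lt t q y\<bar> \<le> KM / t\<^sup>2 * M t q y"
    using kernel_bounds by metis
  obtain CM where CM: "CM > 0" "\<And>t q. 0 < t \<Longrightarrow> t \<le> t0 \<Longrightarrow> (\<integral>\<^sup>+y. ennreal (M t q y) \<partial>lborel) \<le> ennreal CM"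
    "\<And>t y. 0 < t \<Longrightarrow> t \<le> t0 \<Longrightarrow> (\<integral>\<^sup>+q. ennreal (M t q y) \<partial>lborel) \<le> ennreal CM"
    using schur_M by metis
  define c where "c = KM + KM / t0"
  have c: "c > 0" "KM \<le> c" using KM(1) t0 by (auto simp: c_def add_pos_nonneg)
  have "schur_le (Gk z) (3 * (CM * c) / sqrt (norm z))" if z: "Re z < 0" "norm z \<ge> 1 / t0\<^sup>2" for z
  proof -
    \<comment> \<open>This \<open>d\<close> balances the length \<open>d\<close> of the initial
      interval against the integrated part, \<open>1 / norm z = d\<^sup>2\<close> times the integral
      \<open>1 / d\<close> of \<open>1 / \<tau>\<^sup>2\<close>. The assumption on
      \<open>norm z\<close> says that \<open>d \<le> t0\<close>.\<close>
    define d where "d = 1 / sqrt (norm z)"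
    have nz: "norm z > 0" using z(1) by auto
    have d: "d > 0" "d \<le> t0" "d \<le> 1" "norm z * d = 1 / d"
    proof -
      show d0: "d > 0" using nz by (simp add: d_def)
      have "sqrt (1 / t0\<^sup>2) \<le> sqrt (norm z)" by (rule real_sqrt_le_mono[OF z(2)])
      then have "1 / t0 \<le> sqrt (norm z)" using t0 by (simp add: real_sqrt_divide)
      then have "1 / sqrt (norm z) \<le> 1 / (1 / t0)" using t0 nz by (intro divide_left_mono) auto
      then show "d \<le> t0" by (simp add: d_def)
      then show "d \<le> 1" using t0(2) by linarith
      show "norm z * d = 1 / d" using nz by (simp add: d_def real_div_sqrt)
    qed
    define H where "H \<tau> q y = exp (z * complex_of_real \<tau>) * complex_of_real (chi \<tau> * (k \<tau> q y * lt \<tau> q y) - k \<tau> q y / t0)" for \<tau> q y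
    have mG: "(\<lambda>x. Gint z (fst x) (fst (snd x)) (snd (snd x))) \<in> borel_measurable borel" by measurable
    have mH: "(\<lambda>x. H (fst x) (fst (snd x)) (snd (snd x))) \<in> borel_measurable borel" unfolding H_def chi_def by measurable
    have H_bound: "norm (H \<tau> q y) \<le> c / \<tau>\<^sup>2 * M \<tau> q y" if "\<tau> \<in> {d..t0}" for \<tau> q y
    proof -
      have \<tau>: "0 < \<tau>" "\<tau> \<le> t0" "\<tau> \<le> 1" using that t0(1,2) d by auto
      have "\<bar>chi \<tau> * (k \<tau> q y * lt \<tau> q y)\<bar> \<le> \<bar>k \<tau> q y * lt \<tau> q y\<bar>"
        using chi_bounds(1)[OF \<tau>(1,2)] by (simp add: abs_mult mult_left_le_one_le)
      also have "\<dots> \<le> KM / \<tau>\<^sup>2 * M \<tau> q y" by (rule KM(4)[OF \<tau>(1,3)])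
      finally have 1: "\<bar>chi \<tau> * (k \<tau> q y * lt \<tau> q y)\<bar> \<le> KM / \<tau>\<^sup>2 * M \<tau> q y" .
      have "\<bar>k \<tau> q y / t0\<bar> \<le> KM / t0 * M \<tau> q y"
        using divide_right_mono[OF KM(2)[OF \<tau>(1,3), of q y], of t0] t0 by (simp add: abs_divide)
      also have "\<dots> \<le> KM / t0 / \<tau>\<^sup>2 * M \<tau> q y"
      proof (rule mult_right_mono[OF _ M_nonneg[OF \<tau>(1)]])
        have "\<tau>\<^sup>2 \<le> 1" using \<tau> by (simp add: power_le_one)
        then show "KM / t0 \<le> KM / t0 / \<tau>\<^sup>2" using KM(1) t0 \<tau>(1) by (simp add: pos_le_divide_eq mult_left_le)
      qed
      finally have 2: "\<bar>k \<tau> q y / t0\<bar> \<le> KM / t0 / \<tau>\<^sup>2 * M \<tau> q y" .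
      have "\<bar>chi \<tau> * (k \<tau> q y * lt \<tau> q y) - k \<tau> q y / t0\<bar> \<le> KM / \<tau>\<^sup>2 * M \<tau> q y + KM / t0 / \<tau>\<^sup>2 * M \<tau> q y"
        using 1 2 by linarith
      also have "\<dots> = c / \<tau>\<^sup>2 * M \<tau> q y" by (simp add: c_def add_divide_distrib distrib_right)
      finally have 3: "\<bar>chi \<tau> * (k \<tau> q y * lt \<tau> q y) - k \<tau> q y / t0\<bar> \<le> c / \<tau>\<^sup>2 * M \<tau> q y" .
      have "norm (exp (z * complex_of_real \<tau>)) \<le> 1" using norm_exp_le[of z \<tau>] z \<tau> by simp
      then have "norm (H \<tau> q y) \<le> 1 * (c / \<tau>\<^sup>2 * M \<tau> q y)"
        unfolding H_def norm_mult norm_of_real using 3 by (intro mult_mono) auto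
      then show ?thesis by simp
    qed
    have G_bound: "norm (Gint z \<tau> q y) \<le> c * M \<tau> q y" if "0 < \<tau>" "\<tau> \<le> t0" for \<tau> q y
    proof -
      have \<tau>: "0 < \<tau>" "\<tau> \<le> t0" "\<tau> \<le> 1" using that t0(1,2) by auto
      have "norm (Gint z \<tau> q y) \<le> exp (Re z * \<tau>) * (KM * M \<tau> q y)"
        using Gint_Eint_bound(1)[OF KM(2)[OF \<tau>(1,3)] KM(3)[OF \<tau>(1,3)] \<tau>(1,2) less_imp_le[OF z(1)]] .
      also have "\<dots> \<le> 1 * (c * M \<tau> q y)"
        using norm_exp_le[of z \<tau>] z \<tau> c M_nonneg[OF \<tau>(1)] KM(1) by (intro mult_mono mult_right_mono) auto
      finally show ?thesis by simp
    qed
    have bdd_int: "integrable lborel (\<lambda>\<tau>. indicator {d..t0} \<tau> *\<^sub>R K \<tau>)"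
      if [measurable]: "K \<in> borel_measurable borel" and K: "\<And>\<tau>. \<tau> \<in> {d..t0} \<Longrightarrow> norm (K \<tau>) \<le> bnd" for K :: "real \<Rightarrow> complex" and bnd
    proof (rule Bochner_Integration.integrable_bound[of lborel "\<lambda>\<tau>. bnd * indicator {d..t0} \<tau>"])
      show "integrable lborel (\<lambda>\<tau>. bnd * indicat_real {d..t0} \<tau>)"
        by (intro integrable_mult_right integrable_real_indicator) (auto simp: emeasure_lborel_Icc_eq)
      show "AE \<tau> in lborel. norm (indicator {d..t0} \<tau> *\<^sub>R K \<tau>) \<le> norm (bnd * indicat_real {d..t0} \<tau>)"
        using K by (intro AE_I2) (auto simp: indicator_def intro: order_trans[OF _ abs_ge_self])
    qed measurable
    have Mle: "M \<tau> q y \<le> 1 / d ^ (2 * CARD('n))" if "\<tau> \<in> {d..t0}" for \<tau> q y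
    proof -
      have "M \<tau> q y \<le> 1 / \<tau> ^ (2 * CARD('n))" using that d by (intro M_integrable(2)) auto
      also have "\<dots> \<le> 1 / d ^ (2 * CARD('n))" using that d by (intro divide_left_mono power_mono) auto
      finally show ?thesis .
    qed
    define I1 where "I1 q y = (\<integral>\<tau>. indicator {0<..<d} \<tau> *\<^sub>R Gint z \<tau> q y \<partial>lborel)" for q y
    define I2 where "I2 q y = (\<integral>\<tau>. indicator {d..t0} \<tau> *\<^sub>R H \<tau> q y \<partial>lborel)" for q y
    have split: "norm (Gk z q y) \<le> norm (I1 q y) + d\<^sup>2 * (norm (Gint z d q y) + norm (I2 q y))" for q y
    proof -
      have mGq: "(\<lambda>\<tau>. Gint z \<tau> q y) \<in> borel_measurable borel" by measurable
      have mHq: "(\<lambda>\<tau>. H \<tau> q y) \<in> borel_measurable borel" unfolding H_def chi_def by measurable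
      have iG: "integrable lborel (\<lambda>\<tau>. indicator {d..t0} \<tau> *\<^sub>R Gint z \<tau> q y)"
      proof (rule bdd_int[of _ "c * (1 / d ^ (2 * CARD('n)))", OF mGq])
        fix \<tau> assume \<tau>: "\<tau> \<in> {d..t0}"
        have "norm (Gint z \<tau> q y) \<le> c * M \<tau> q y" using \<tau> d by (intro G_bound) auto
        also have "\<dots> \<le> c * (1 / d ^ (2 * CARD('n)))" using c \<tau> by (intro mult_left_mono Mle) auto
        finally show "norm (Gint z \<tau> q y) \<le> c * (1 / d ^ (2 * CARD('n)))" .
      qed
      have iH: "integrable lborel (\<lambda>\<tau>. indicator {d..t0} \<tau> *\<^sub>R H \<tau> q y)"
      proof (rule bdd_int[of _ "c / d\<^sup>2 * (1 / d ^ (2 * CARD('n)))", OF mHq])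
        fix \<tau> assume \<tau>: "\<tau> \<in> {d..t0}"
        have "c / \<tau>\<^sup>2 \<le> c / d\<^sup>2" using \<tau> d c by (intro divide_left_mono power_mono) auto
        then have "c / \<tau>\<^sup>2 * M \<tau> q y \<le> c / d\<^sup>2 * (1 / d ^ (2 * CARD('n)))"
          using \<tau> d c M_nonneg[of \<tau>] by (intro mult_mono Mle) auto
        then show "norm (H \<tau> q y) \<le> c / d\<^sup>2 * (1 / d ^ (2 * CARD('n)))" using H_bound[OF \<tau>, of q y] by linarith
      qed
      have "z * (\<integral>\<tau>. indicator {d..t0} \<tau> *\<^sub>R Gint z \<tau> q y \<partial>lborel) + I2 q y
         = (\<integral>\<tau>. z * (indicator {d..t0} \<tau> *\<^sub>R Gint z \<tau> q y) + indicator {d..t0} \<tau> *\<^sub>R H \<tau> q y \<partial>lborel)"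
        unfolding I2_def using iG iH by (simp del: mult_scaleR_right)
      also have "\<dots> = (\<integral>\<tau>. indicator {d..t0} \<tau> *\<^sub>R (exp (z * complex_of_real \<tau>) * ((z * chi \<tau> - 1 / t0) * k \<tau> q y + chi \<tau> * (k \<tau> q y * lt \<tau> q y))) \<partial>lborel)"
        by (intro Bochner_Integration.integral_cong) (auto simp: Gint_def H_def indicator_def algebra_simps)
      also have "\<dots> = - Gint z d q y"
        using time_derivative_integral[OF d(1,2), of z q y] by (simp add: Gint_def)
      finally have "z * (\<integral>\<tau>. indicator {d..t0} \<tau> *\<^sub>R Gint z \<tau> q y \<partial>lborel) = - Gint z d q y - I2 q y" by (simp add: algebra_simps)
      then have "norm z * norm (\<integral>\<tau>. indicator {d..t0} \<tau> *\<^sub>R Gint z \<tau> q y \<partial>lborel) = norm (- Gint z d q y - I2 q y)"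
        by (metis norm_mult)
      also have "\<dots> \<le> norm (Gint z d q y) + norm (I2 q y)" using norm_triangle_ineq4[of "- Gint z d q y" "I2 q y"] by simp
      finally have "d\<^sup>2 * (norm z * norm (\<integral>\<tau>. indicator {d..t0} \<tau> *\<^sub>R Gint z \<tau> q y \<partial>lborel)) \<le> d\<^sup>2 * (norm (Gint z d q y) + norm (I2 q y))"
        by (intro mult_left_mono) auto
      moreover have "d\<^sup>2 * norm z = 1" using nz by (simp add: d_def power_divide)
      then have "d\<^sup>2 * (norm z * x) = x" for x by (simp flip: mult.assoc)
      ultimately have b2: "norm (\<integral>\<tau>. indicator {d..t0} \<tau> *\<^sub>R Gint z \<tau> q y \<partial>lborel) \<le> d\<^sup>2 * (norm (Gint z d q y) + norm (I2 q y))" by simp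
      show ?thesis
      proof (cases "integrable lborel (\<lambda>\<tau>. indicator {0<..<d} \<tau> *\<^sub>R Gint z \<tau> q y)")
        case True
        have "Gk z q y = (\<integral>\<tau>. indicator {0<..<d} \<tau> *\<^sub>R Gint z \<tau> q y + indicator {d..t0} \<tau> *\<^sub>R Gint z \<tau> q y \<partial>lborel)"
          unfolding Gk_def using d by (intro Bochner_Integration.integral_cong) (auto simp: indicator_def)
        also have "\<dots> = I1 q y + (\<integral>\<tau>. indicator {d..t0} \<tau> *\<^sub>R Gint z \<tau> q y \<partial>lborel)"
          unfolding I1_def using True iG by simp
        finally have "norm (Gk z q y) \<le> norm (I1 q y) + norm (\<integral>\<tau>. indicator {d..t0} \<tau> *\<^sub>R Gint z \<tau> q y \<partial>lborel)"
          by (simp add: norm_triangle_ineq)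
        also note add_left_mono[OF b2]
        finally show ?thesis .
      next
        \<comment> \<open>For such a pair \<open>(q, y)\<close> the integral defining
          \<open>Gk\<close> diverges as well, so \<open>Gk\<close> has the default value 0 and the
          bound is trivial.\<close>
        case False
        have "\<not> integrable lborel (\<lambda>\<tau>. indicator {0<..t0} \<tau> *\<^sub>R Gint z \<tau> q y)"
        proof
          assume i: "integrable lborel (\<lambda>\<tau>. indicator {0<..t0} \<tau> *\<^sub>R Gint z \<tau> q y)"
          have "integrable lborel (\<lambda>\<tau>. indicator {0<..<d} \<tau> *\<^sub>R Gint z \<tau> q y)"
          proof (rule Bochner_Integration.integrable_bound[OF i])
            show "AE \<tau> in lborel. norm (indicator {0<..<d} \<tau> *\<^sub>R Gint z \<tau> q y) \<le> norm (indicator {0<..t0} \<tau> *\<^sub>R Gint z \<tau> q y)"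
              using d by (intro AE_I2) (auto simp: indicator_def)
          qed measurable
          with False show False ..
        qed
        then have "Gk z q y = 0" by (simp add: Gk_def not_integrable_integral_eq)
        then show ?thesis by simp
      qed
    qed
    have d2: "d\<^sup>2 \<le> d" using d by (simp add: power2_eq_square mult_left_le)
    have X1: "(\<integral>\<^sup>+\<tau>. ennreal c * indicator {0<..<d} \<tau> \<partial>lborel) \<le> ennreal (c * d)"
      using d c by (simp add: nn_integral_cmult_indicator ennreal_mult)
    have X2: "(\<integral>\<^sup>+\<tau>. ennreal (c / \<tau>\<^sup>2) * indicator {d..t0} \<tau> \<partial>lborel) \<le> ennreal (c / d)"
    proof -
      have "(\<integral>\<^sup>+\<tau>. ennreal (c / \<tau>\<^sup>2) * indicator {d..t0} \<tau> \<partial>lborel) = (\<integral>\<^sup>+\<tau>. ennreal c * (ennreal (1 / \<tau>\<^sup>2) * indicator {d..t0} \<tau>) \<partial>lborel)"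
        using c by (intro nn_integral_cong) (simp add: mult.assoc[symmetric] flip: ennreal_mult)
      also have "\<dots> = ennreal c * (\<integral>\<^sup>+\<tau>. ennreal (1 / \<tau>\<^sup>2) * indicator {d..t0} \<tau> \<partial>lborel)"
        by (rule nn_integral_cmult) measurable
      also have "\<dots> \<le> ennreal c * ennreal (1 / d)" by (intro mult_left_mono nn_integral_inverse_square d) auto
      also have "\<dots> = ennreal (c / d)" using c d by (simp flip: ennreal_mult)
      finally show ?thesis .
    qed
    have T1: "0 < \<tau> \<and> \<tau> \<le> t0" if "\<tau> \<in> {0<..<d}" for \<tau> using that d by auto
    have T2: "0 < \<tau> \<and> \<tau> \<le> t0" if "\<tau> \<in> {d..t0}" for \<tau> using that d by auto
    have b1: "norm (Gint z \<tau> q y) \<le> c * M \<tau> q y" if "\<tau> \<in> {0<..<d}" for \<tau> q y using T1[OF that] G_bound by simp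
    note S1 = time_schur[OF mG _ _ T1 b1 _ CM(2,3) X1, folded I1_def]
    note S2 = time_schur[OF mH _ _ T2 H_bound _ CM(2,3) X2, folded I2_def]
    have mI1: "case_prod I1 \<in> borel_measurable (borel \<Otimes>\<^sub>M borel)" unfolding I1_def[abs_def] by (rule time_integral_measurable[OF _ mG]) simp
    have mI2: "case_prod I2 \<in> borel_measurable (borel \<Otimes>\<^sub>M borel)" unfolding I2_def[abs_def] by (rule time_integral_measurable[OF _ mH]) simp
    \<comment> \<open>The 3 counts the initial interval, the boundary term at \<open>d\<close> and
      the integrated remainder; each is at most \<open>CM * c * d\<close>, the boundary term because
      \<open>d \<le> 1\<close>.\<close>
    have total: "ennreal CM * ennreal (c * d) + ennreal (d\<^sup>2) * (ennreal (c * CM) + ennreal CM * ennreal (c / d)) \<le> ennreal (3 * (CM * c) / sqrt (norm z))"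
    proof -
      have "CM * (c * d) + d\<^sup>2 * (c * CM + CM * (c / d)) \<le> 3 * (CM * c) * d"
      proof -
        have "d\<^sup>2 * (CM * (c / d)) = CM * c * d" using d by (simp add: power2_eq_square)
        moreover have "d\<^sup>2 * (c * CM) \<le> d * (c * CM)" using d2 c CM(1) by (intro mult_right_mono) auto
        ultimately show ?thesis by (simp add: algebra_simps)
      qed
      then have "ennreal (CM * (c * d) + d\<^sup>2 * (c * CM + CM * (c / d))) \<le> ennreal (3 * (CM * c) * d)" by (rule ennreal_leI)
      then have le: "ennreal (CM * (c * d) + d\<^sup>2 * (c * CM + CM * (c / d))) \<le> ennreal (3 * (CM * c) / sqrt (norm z))"
        by (simp add: d_def)
      have nn: "CM \<ge> 0" "c * d \<ge> 0" "c * CM \<ge> 0" "c / d \<ge> 0" "CM * (c / d) \<ge> 0" "d\<^sup>2 \<ge> 0" using c CM(1) d by auto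
      have "ennreal (CM * (c * d) + d\<^sup>2 * (c * CM + CM * (c / d))) = ennreal (CM * (c * d)) + ennreal (d\<^sup>2) * (ennreal (c * CM) + ennreal (CM * (c / d)))"
        using nn by (metis add_nonneg_nonneg ennreal_mult ennreal_plus mult_nonneg_nonneg)
      with le show ?thesis using nn by (metis ennreal_mult)
    qed
    have comb: "(\<integral>\<^sup>+y. ennreal (norm (g y)) \<partial>lborel) \<le> ennreal (3 * (CM * c) / sqrt (norm z))"
      if le: "\<And>y. norm (g y) \<le> norm (i1 y) + d\<^sup>2 * (norm (i0 y) + norm (i2 y))"
      and [measurable]: "i1 \<in> borel_measurable borel" "i2 \<in> borel_measurable borel" "i0 \<in> borel_measurable borel"
      and i1: "(\<integral>\<^sup>+y. ennreal (norm (i1 y)) \<partial>lborel) \<le> ennreal CM * ennreal (c * d)"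
      and i2: "(\<integral>\<^sup>+y. ennreal (norm (i2 y)) \<partial>lborel) \<le> ennreal CM * ennreal (c / d)"
      and i0: "(\<integral>\<^sup>+y. ennreal (norm (i0 y)) \<partial>lborel) \<le> ennreal (c * CM)"
      for g i0 i1 i2 :: "'n phase \<Rightarrow> complex"
    proof -
      have "(\<integral>\<^sup>+y. ennreal (norm (g y)) \<partial>lborel) \<le> (\<integral>\<^sup>+y. ennreal (norm (i1 y)) + ennreal (d\<^sup>2) * (ennreal (norm (i0 y)) + ennreal (norm (i2 y))) \<partial>lborel)"
        using le by (intro nn_integral_mono) (simp flip: ennreal_mult ennreal_plus)
      also have "\<dots> = (\<integral>\<^sup>+y. ennreal (norm (i1 y)) \<partial>lborel) + ennreal (d\<^sup>2) * ((\<integral>\<^sup>+y. ennreal (norm (i0 y)) \<partial>lborel) + (\<integral>\<^sup>+y. ennreal (norm (i2 y)) \<partial>lborel))"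
        by (simp add: nn_integral_add nn_integral_cmult)
      also have "\<dots> \<le> ennreal CM * ennreal (c * d) + ennreal (d\<^sup>2) * (ennreal (c * CM) + ennreal CM * ennreal (c / d))"
        by (intro add_mono mult_left_mono i0 i1 i2) auto
      also note total
      finally show ?thesis .
    qed
    have G0: "(\<integral>\<^sup>+y. ennreal (norm (Gint z d q y)) \<partial>lborel) \<le> ennreal (c * CM)" "(\<integral>\<^sup>+q. ennreal (norm (Gint z d q y)) \<partial>lborel) \<le> ennreal (c * CM)" for q y
    proof -
      have "(\<integral>\<^sup>+y. ennreal (norm (Gint z d q y)) \<partial>lborel) \<le> (\<integral>\<^sup>+y. ennreal c * ennreal (M d q y) \<partial>lborel)"
        using G_bound[OF d(1,2)] c M_nonneg[OF d(1)] by (intro nn_integral_mono) (simp flip: ennreal_mult)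
      also have "\<dots> = ennreal c * (\<integral>\<^sup>+y. ennreal (M d q y) \<partial>lborel)" by (rule nn_integral_cmult) measurable
      also have "\<dots> \<le> ennreal c * ennreal CM" by (intro mult_left_mono CM d) auto
      finally show "(\<integral>\<^sup>+y. ennreal (norm (Gint z d q y)) \<partial>lborel) \<le> ennreal (c * CM)" using c CM(1) by (simp add: ennreal_mult)
      have "(\<integral>\<^sup>+q. ennreal (norm (Gint z d q y)) \<partial>lborel) \<le> (\<integral>\<^sup>+q. ennreal c * ennreal (M d q y) \<partial>lborel)"
        using G_bound[OF d(1,2)] c M_nonneg[OF d(1)] by (intro nn_integral_mono) (simp flip: ennreal_mult)
      also have "\<dots> = ennreal c * (\<integral>\<^sup>+q. ennreal (M d q y) \<partial>lborel)" by (rule nn_integral_cmult) measurable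
      also have "\<dots> \<le> ennreal c * ennreal CM" by (intro mult_left_mono CM d) auto
      finally show "(\<integral>\<^sup>+q. ennreal (norm (Gint z d q y)) \<partial>lborel) \<le> ennreal (c * CM)" using c CM(1) by (simp add: ennreal_mult)
    qed
    have m1: "(\<lambda>y. I q y) \<in> borel_measurable borel" "(\<lambda>q. I q y) \<in> borel_measurable borel"
      if "case_prod I \<in> borel_measurable (borel \<Otimes>\<^sub>M borel)" for I :: "'n phase \<Rightarrow> 'n phase \<Rightarrow> complex" and q y
      using that by measurable
    have c0: "c \<ge> 0" "\<And>\<tau>. c / \<tau>\<^sup>2 \<ge> 0" using c by auto
    show ?thesis unfolding schur_le_def
    proof (intro conjI allI)
      show "(\<integral>\<^sup>+y. ennreal (norm (Gk z q y)) \<partial>lborel) \<le> ennreal (3 * (CM * c) / sqrt (norm z))" for q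
        by (rule comb[OF split[of q] m1(1)[OF mI1] m1(1)[OF mI2]]) (use c0 in \<open>auto intro!: S1(1) S2(1) G0(1)\<close>)
      show "(\<integral>\<^sup>+q. ennreal (norm (Gk z q y)) \<partial>lborel) \<le> ennreal (3 * (CM * c) / sqrt (norm z))" for y
        by (rule comb[OF split[of _ y] m1(2)[OF mI1] m1(2)[OF mI2]]) (use c0 in \<open>auto intro!: S1(2) S2(2) G0(2)\<close>)
    qed
  qed
  then show ?thesis using CM(1) c by (intro exI[of _ "3 * (CM * c)"]) auto
qed

end

section \<open>Integral operators with Schur bounds\<close>

context
  fixes K :: "'a::euclidean_space \<Rightarrow> 'a \<Rightarrow> complex" and C p :: real
  assumes Km [measurable]: "case_prod K \<in> borel_measurable (borel \<Otimes>\<^sub>M borel)"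
    and K: "schur_le K C" and C: "C > 0" and p: "p > 1"
begin

lemma schur_le_test:
  assumes "mLp p f"
  shows "mLp p (\<lambda>q. \<integral>y. K q y * f y \<partial>lborel)" "nLp p (\<lambda>q. \<integral>y. K q y * f y \<partial>lborel) \<le> C * nLp p f"
proof -
  have K': "(\<integral>\<^sup>+y. ennreal (norm (K q y)) \<partial>lborel) \<le> ennreal C" "(\<integral>\<^sup>+q. ennreal (norm (K q y)) \<partial>lborel) \<le> ennreal C" for q y
    using K by (auto simp: schur_le_def)
  show "mLp p (\<lambda>q. \<integral>y. K q y * f y \<partial>lborel)" by (rule schur_test(1)[OF Km C p K' assms])
  show "nLp p (\<lambda>q. \<integral>y. K q y * f y \<partial>lborel) \<le> C * nLp p f" by (rule schur_test(2)[OF Km C p K' assms])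
qed

text \<open>This makes the integral operator additive almost everywhere, which the default value 0
  of divergent integrals would otherwise spoil. The test function of \<open>schur_integrable\<close>
  is the indicator of a ball, and countably many balls exhaust the space.\<close>

lemma schur_AE_integrable:
  assumes f: "mLp p f"
  shows "AE q in lborel. integrable lborel (\<lambda>y. K q y * f y)"
proof -
  have "AE q in lborel. \<forall>R::nat. integrable lborel (\<lambda>y. indicator (cball 0 (real R)) q * (K q y * f y))"
  proof (subst AE_all_countable, rule)
    fix R :: nat
    have "integrable (lborel \<Otimes>\<^sub>M lborel) (\<lambda>(q, y). indicator (cball 0 (real R)) q * (K q y * f y))"
      using K by (intro schur_integrable[OF Km C p _ _ f, where B=1 and R=R]) (auto simp: schur_le_def indicator_def)
    from lborel_pair.AE_integrable_fst'[OF this]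
    show "AE q in lborel. integrable lborel (\<lambda>y. indicator (cball 0 (real R)) q * (K q y * f y))" by simp
  qed
  then show ?thesis
  proof (rule AE_mp, intro AE_I2 impI)
    fix q :: 'a assume i: "\<forall>R::nat. integrable lborel (\<lambda>y. indicator (cball 0 (real R)) q * (K q y * f y))"
    obtain R :: nat where "norm q \<le> real R" using real_arch_simple by blast
    with spec[OF i, of R] show "integrable lborel (\<lambda>y. K q y * f y)" by simp
  qed
qed

lemma schur_transpose:
  assumes h: "mLp p h" and [measurable]: "\<phi> \<in> borel_measurable borel"
    and \<phi>: "\<And>z. norm (\<phi> z) \<le> B * indicator (cball 0 R) z"
  shows "(\<integral>y. (\<integral>q. K q y * h q \<partial>lborel) * \<phi> y \<partial>lborel) = (\<integral>q. h q * (\<integral>y. K q y * \<phi> y \<partial>lborel) \<partial>lborel)"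
    and "integrable lborel (\<lambda>q. h q * (\<integral>y. K q y * \<phi> y \<partial>lborel))"
proof -
  have "case_prod (\<lambda>y q. K q y) \<in> borel_measurable (borel \<Otimes>\<^sub>M borel)" by measurable
  then have i: "integrable (lborel \<Otimes>\<^sub>M lborel) (\<lambda>(y, q). \<phi> y * (K q y * h q))"
    using K by (intro schur_integrable[OF _ C p _ _ h _ \<phi>]) (auto simp: schur_le_def)
  have "(\<integral>q. (\<integral>y. \<phi> y * (K q y * h q) \<partial>lborel) \<partial>lborel) = (\<integral>y. (\<integral>q. \<phi> y * (K q y * h q) \<partial>lborel) \<partial>lborel)"
    by (rule lborel_pair.Fubini_integral[OF i])
  moreover have e: "(\<integral>y. \<phi> y * (K q y * h q) \<partial>lborel) = h q * (\<integral>y. K q y * \<phi> y \<partial>lborel)" for q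
    by (simp add: mult_ac flip: integral_mult_right_zero)
  moreover have "(\<integral>q. \<phi> y * (K q y * h q) \<partial>lborel) = (\<integral>q. K q y * h q \<partial>lborel) * \<phi> y" for y
    by (simp add: mult_ac)
  ultimately show "(\<integral>y. (\<integral>q. K q y * h q \<partial>lborel) * \<phi> y \<partial>lborel) = (\<integral>q. h q * (\<integral>y. K q y * \<phi> y \<partial>lborel) \<partial>lborel)" by (simp only: mult.commute)
  show "integrable lborel (\<lambda>q. h q * (\<integral>y. K q y * \<phi> y \<partial>lborel))"
    using lborel_pair.integrable_snd[OF i] by (simp add: e)
qed

lemma schur_pair_integral:
  assumes f: "mLp p f" and \<phi>: "\<phi> \<in> test_functions"
  shows "(\<integral>w. \<phi> (fst w) * (K (fst w) (snd w) * f (snd w)) \<partial>lborel) = (\<integral>q. (\<integral>y. K q y * f y \<partial>lborel) * \<phi> q \<partial>lborel)"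
proof -
  obtain B R where "B > 0" and B: "\<And>z. norm (\<phi> z) \<le> B * indicator (cball 0 R) z"
    by (rule test_function_bounded[OF \<phi>]) blast
  have "integrable (lborel \<Otimes>\<^sub>M lborel) (\<lambda>(q, y). \<phi> q * (K q y * f y))"
    using K test_function_measurable[OF \<phi>] by (intro schur_integrable[OF Km C p _ _ f _ B]) (auto simp: schur_le_def)
  then have "integrable lborel (\<lambda>w. \<phi> (fst w) * (K (fst w) (snd w) * f (snd w)))"
    by (simp add: lborel_prod case_prod_beta')
  from integral_pair_fst[OF this] show ?thesis by (simp add: mult.commute)
qed

end

section \<open>The parametrix identity and the a priori estimate\<close>

context kfp begin

text \<open>Fubini rewrites the weak identity as the vanishing of all test integrals of one
  \<open>L^p\<close> function, to which the fundamental lemma applies.\<close>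

lemma left_parametrix:
  fixes f g :: "'n phase \<Rightarrow> complex"
  assumes f: "mLp p f" and g: "mLp p g" and p: "p > 1" and z: "Re z < 0"
    and dual: "\<And>\<psi>. \<psi> \<in> test_functions \<Longrightarrow> (\<integral>y. f y * Pop \<psi> y \<partial>lborel) = (\<integral>y. g y * \<psi> y \<partial>lborel)"
  shows "AE q in lborel. f q + (\<integral>y. Ek z q y * f y \<partial>lborel) = (\<integral>y. Gk z q y * (g y - z * f y) \<partial>lborel)"
proof -
  obtain C0 where "C0 > 0" and C0: "schur_le (Gk z) (C0 / (- Re z))" "schur_le (Ek z) (C0 / (- Re z))"
    using kernels_decay_real z by blast
  define C where "C = C0 / (- Re z)"
  have C: "C > 0" "schur_le (Gk z) C" "schur_le (Ek z) C" using C0 \<open>C0 > 0\<close> z by (auto simp: C_def divide_pos_neg)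
  note SG = schur_le_test[OF Gk_measurable C(2,1) p] and SE = schur_le_test[OF Ek_measurable C(3,1) p]
  define h where "h y = g y - z * f y" for y
  define Ef where "Ef q = (\<integral>y. Ek z q y * f y \<partial>lborel)" for q
  define Gh where "Gh q = (\<integral>y. Gk z q y * h y \<partial>lborel)" for q
  have h: "mLp p h" unfolding h_def by (intro mLp_minus mLp_cmult f g p)
  have Ef: "mLp p Ef" unfolding Ef_def by (rule SE(1)[OF f])
  have Gh: "mLp p Gh" unfolding Gh_def by (rule SG(1)[OF h])
  have u: "mLp p (\<lambda>q. (f q + Ef q) - Gh q)" by (intro mLp_minus mLp_add f Ef Gh p)
  have "AE q in lborel. (f q + Ef q) - Gh q = 0"
  proof (rule fundamental_lemma[OF mLp_locally_integrable[OF u p]])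
    fix \<phi> :: "'n phase \<Rightarrow> complex" assume \<phi>: "\<phi> \<in> test_functions"
    have pull: "(\<integral>\<tau>. indicator {0<..t0} \<tau> *\<^sub>R (c * (r * H \<tau>)) \<partial>lborel) = c * ((\<integral>\<tau>. indicator {0<..t0} \<tau> *\<^sub>R H \<tau> \<partial>lborel) * r)"
      for c r :: complex and H
    proof -
      have "(\<lambda>\<tau>. indicator {0<..t0} \<tau> *\<^sub>R (c * (r * H \<tau>))) = (\<lambda>\<tau>. (c * r) * (indicator {0<..t0} \<tau> *\<^sub>R H \<tau>))"
        by (simp add: fun_eq_iff mult_ac)
      then show ?thesis by (simp only: integral_mult_right_zero) (simp add: mult_ac)
    qed
    note lpw = left_parametrix_weak[OF f g p less_imp_le[OF z] dual \<phi>, folded h_def]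
    have "(\<integral>x. indicator {0<..t0} (fst x) *\<^sub>R (\<phi> (fst (snd x)) * (f (snd (snd x)) * Eint z (fst x) (fst (snd x)) (snd (snd x)))) \<partial>lborel)
       = (\<integral>w. \<phi> (fst w) * (Ek z (fst w) (snd w) * f (snd w)) \<partial>lborel)"
      unfolding Ek_def by (rule trans[OF integral_pair_snd[OF lpw(1)]], assumption, rule Bochner_Integration.integral_cong[OF refl], unfold fst_conv snd_conv, rule pull)
    also have "\<dots> = (\<integral>q. Ef q * \<phi> q \<partial>lborel)"
      unfolding Ef_def by (rule schur_pair_integral[OF Ek_measurable C(3,1) p f \<phi>])
    finally have e1: "(\<integral>x. indicator {0<..t0} (fst x) *\<^sub>R (\<phi> (fst (snd x)) * (f (snd (snd x)) * Eint z (fst x) (fst (snd x)) (snd (snd x)))) \<partial>lborel) = (\<integral>q. Ef q * \<phi> q \<partial>lborel)" .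
    have "(\<integral>x. indicator {0<..t0} (fst x) *\<^sub>R (\<phi> (fst (snd x)) * (h (snd (snd x)) * Gint z (fst x) (fst (snd x)) (snd (snd x)))) \<partial>lborel)
       = (\<integral>w. \<phi> (fst w) * (Gk z (fst w) (snd w) * h (snd w)) \<partial>lborel)"
      unfolding Gk_def by (rule trans[OF integral_pair_snd[OF lpw(2)]], assumption, rule Bochner_Integration.integral_cong[OF refl], unfold fst_conv snd_conv, rule pull)
    also have "\<dots> = (\<integral>q. Gh q * \<phi> q \<partial>lborel)"
      unfolding Gh_def by (rule schur_pair_integral[OF Gk_measurable C(2,1) p h \<phi>])
    finally have e2: "(\<integral>x. indicator {0<..t0} (fst x) *\<^sub>R (\<phi> (fst (snd x)) * (h (snd (snd x)) * Gint z (fst x) (fst (snd x)) (snd (snd x)))) \<partial>lborel) = (\<integral>q. Gh q * \<phi> q \<partial>lborel)" .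
    have i: "integrable lborel (\<lambda>q. u q * \<phi> q)" if "mLp p u" for u
      by (rule locally_integrable_test[OF mLp_locally_integrable[OF that p] \<phi>])
    have "(\<integral>q. ((f q + Ef q) - Gh q) * \<phi> q \<partial>lborel) = (\<integral>q. f q * \<phi> q + Ef q * \<phi> q - Gh q * \<phi> q \<partial>lborel)"
      by (simp add: algebra_simps)
    also have "\<dots> = (\<integral>q. f q * \<phi> q \<partial>lborel) + (\<integral>q. Ef q * \<phi> q \<partial>lborel) - (\<integral>q. Gh q * \<phi> q \<partial>lborel)"
      by (simp add: i f Ef Gh)
    also have "\<dots> = 0"
    proof -
      have "- (\<integral>q. f q * \<phi> q \<partial>lborel) = (\<integral>q. Ef q * \<phi> q \<partial>lborel) - (\<integral>q. Gh q * \<phi> q \<partial>lborel)"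
        unfolding e1[symmetric] e2[symmetric] by (rule lpw(3))
      then show ?thesis by (simp add: algebra_simps)
    qed
    finally show "(\<integral>q. ((f q + Ef q) - Gh q) * \<phi> q \<partial>lborel) = 0" .
  qed
  then show ?thesis by (simp add: Ef_def Gh_def h_def)
qed

text \<open>Two bounds for \<open>Gk\<close> are available, \<open>1 / norm (Re z)\<close> and
  \<open>1 / sqrt (norm z)\<close>; whichever is smaller is comparable to the inverse of the sum in
  the claim. For \<open>Ek\<close> the first kind of bound suffices, being small far to the
  left.\<close>

lemma apriori:
  "\<exists>C>0. \<exists>c>0. \<forall>z. Re z \<le> - c \<longrightarrow>
     schur_le (Gk z) (C / (1 + \<bar>Re z\<bar> + sqrt \<bar>Im z\<bar>)) \<and> schur_le (Ek z) (1 / 2)"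
proof -
  obtain C1 where C1: "C1 > 0" "\<And>z. Re z < 0 \<Longrightarrow> schur_le (Gk z) (C1 / (- Re z)) \<and> schur_le (Ek z) (C1 / (- Re z))"
    using kernels_decay_real by blast
  obtain C2 where C2: "C2 > 0" "\<And>z. Re z < 0 \<Longrightarrow> norm z \<ge> 1 / t0\<^sup>2 \<Longrightarrow> schur_le (Gk z) (C2 / sqrt (norm z))"
    using Gk_decay by blast
  have mono: "schur_le K D'" if "schur_le K D" "D \<le> D'" for K :: "'n phase \<Rightarrow> 'n phase \<Rightarrow> complex" and D D'
    using that order_trans[OF _ ennreal_leI[OF that(2)]] unfolding schur_le_def by blast
  \<comment> \<open>The summand 1 lets \<open>norm (Re z)\<close> dominate the 1 in the denominator,
    \<open>1 / t0\<^sup>2\<close> makes \<open>Gk_decay\<close> applicable, and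
    \<open>2 * C1\<close> brings the constant of \<open>Ek\<close> down to 1/2.\<close>
  define c where "c = 1 + 1 / t0\<^sup>2 + 2 * C1"
  define D where "D = C1 + C2"
  have c: "c \<ge> 1" "c \<ge> 1 / t0\<^sup>2" "c \<ge> 2 * C1" using C1(1) t0(1) by (auto simp: c_def)
  have "schur_le (Gk z) (3 * D / (1 + \<bar>Re z\<bar> + sqrt \<bar>Im z\<bar>)) \<and> schur_le (Ek z) (1 / 2)" if z: "Re z \<le> - c" for z
  proof
    have r: "Re z < 0" "1 \<le> \<bar>Re z\<bar>" "- Re z = \<bar>Re z\<bar>" using z c by auto
    have "2 * C1 \<le> - Re z" using z c by linarith
    then have "C1 / (- Re z) \<le> C1 / (2 * C1)" using C1(1) r(1) by (intro divide_left_mono mult_pos_pos) auto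
    then have "C1 / (- Re z) \<le> 1 / 2" using C1(1) by simp
    then show "schur_le (Ek z) (1 / 2)" using C1(2)[OF r(1)] mono by blast
    have nz: "norm z \<ge> 1 / t0\<^sup>2" "\<bar>Im z\<bar> \<le> norm z" "norm z > 0"
      using abs_Re_le_cmod[of z] abs_Im_le_cmod[of z] z c r by linarith+
    have si: "sqrt \<bar>Im z\<bar> \<le> sqrt (norm z)" by (rule real_sqrt_le_mono[OF nz(2)])
    \<comment> \<open>With \<open>Y\<close> the larger of \<open>norm (Re z)\<close> and
      \<open>sqrt (norm z)\<close>, each of the three summands of the denominator is at most
      \<open>Y\<close>.\<close>
    have fr: "X / Y \<le> 3 * D / u" if "X \<le> D" "0 < u" "u \<le> 3 * Y" for X Y u :: real
    proof -
      have "(3 * X) / (3 * Y) \<le> (3 * D) / u" using that C1(1) C2(1) by (intro frac_le) (auto simp: D_def)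
      then show ?thesis by simp
    qed
    have u: "0 < 1 + \<bar>Re z\<bar> + sqrt \<bar>Im z\<bar>" by (intro add_pos_nonneg) auto
    have D: "C1 \<le> D" "C2 \<le> D" using C1(1) C2(1) by (auto simp: D_def)
    show "schur_le (Gk z) (3 * D / (1 + \<bar>Re z\<bar> + sqrt \<bar>Im z\<bar>))"
    proof (cases "sqrt (norm z) \<le> \<bar>Re z\<bar>")
      case True
      then have "1 + \<bar>Re z\<bar> + sqrt \<bar>Im z\<bar> \<le> 3 * (- Re z)" using si r by linarith
      from mono[OF conjunct1[OF C1(2)[OF r(1)]] fr[OF D(1) u this]] show ?thesis .
    next
      case False
      then have "1 + \<bar>Re z\<bar> + sqrt \<bar>Im z\<bar> \<le> 3 * sqrt (norm z)" using si r by linarith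
      from mono[OF C2(2)[OF r(1) nz(1)] fr[OF D(2) u this]] show ?thesis .
    qed
  qed
  moreover have "3 * D > 0" "c > 0" using C1(1) C2(1) c by (auto simp: D_def)
  ultimately show ?thesis by blast
qed

text \<open>In \<open>f = G h - E f\<close> the last term has norm at most half that of
  \<open>f\<close>, which is finite because \<open>f\<close> lies in \<open>L^p\<close>, and is
  absorbed on the left.\<close>

lemma apriori_estimate:
  fixes f g :: "'n phase \<Rightarrow> complex"
  assumes f: "mLp p f" and g: "mLp p g" and p: "p > 1" and z: "Re z < 0"
    and dual: "\<And>\<psi>. \<psi> \<in> test_functions \<Longrightarrow> (\<integral>y. f y * Pop \<psi> y \<partial>lborel) = (\<integral>y. g y * \<psi> y \<partial>lborel)"
    and C: "C > 0" "schur_le (Gk z) C" "schur_le (Ek z) (1 / 2)"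
  shows "nLp p f \<le> 2 * C * nLp p (\<lambda>y. g y - z * f y)"
proof -
  note SG = schur_le_test[OF Gk_measurable C(2,1) p] and SE = schur_le_test[OF Ek_measurable C(3) _ p]
  define h where "h y = g y - z * f y" for y
  have h: "mLp p h" unfolding h_def by (intro mLp_minus mLp_cmult f g p)
  have lp: "AE q in lborel. f q + (\<integral>y. Ek z q y * f y \<partial>lborel) = (\<integral>y. Gk z q y * h y \<partial>lborel)"
    unfolding h_def by (rule left_parametrix[OF f g p z dual])
  have E: "mLp p (\<lambda>q. \<integral>y. Ek z q y * f y \<partial>lborel)" and G: "mLp p (\<lambda>q. \<integral>y. Gk z q y * h y \<partial>lborel)"
    using SE(1)[OF _ f] SG(1)[OF h] by auto
  have "AE q in lborel. (\<integral>y. Gk z q y * h y \<partial>lborel) - (\<integral>y. Ek z q y * f y \<partial>lborel) = f q"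
    using lp by eventually_elim (simp add: algebra_simps)
  from mLp_cong_AE(2)[OF mLp_minus(1)[OF G E p] _ this] f
  have "nLp p f = nLp p (\<lambda>q. (\<integral>y. Gk z q y * h y \<partial>lborel) - (\<integral>y. Ek z q y * f y \<partial>lborel))" by (simp add: mLp_def)
  also have "\<dots> \<le> nLp p (\<lambda>q. \<integral>y. Gk z q y * h y \<partial>lborel) + nLp p (\<lambda>q. \<integral>y. Ek z q y * f y \<partial>lborel)"
    by (rule mLp_minus(2)[OF G E p])
  also have "\<dots> \<le> C * nLp p h + 1 / 2 * nLp p f" using SG(2)[OF h] SE(2)[OF _ f] by (intro add_mono) auto
  finally have "nLp p f \<le> C * nLp p h + 1 / 2 * nLp p f" .
  then show ?thesis unfolding h_def[abs_def] by linarith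
qed

end

section \<open>The transposed operator on test functions\<close>

lemma smooth_fst:
  fixes f :: "'a::euclidean_space \<Rightarrow> 'b::real_normed_vector"
  assumes "smooth f"
  shows "smooth (\<lambda>z :: 'a \<times> 'c::euclidean_space. f (fst z))"
proof -
  have "Cn k f \<Longrightarrow> Cn k (\<lambda>z :: 'a \<times> 'c. f (fst z))" for k and f :: "'a \<Rightarrow> 'b"
  proof (induction k arbitrary: f)
    case (Suc k)
    have d: "((\<lambda>z :: 'a \<times> 'c. f (fst z)) has_derivative (\<lambda>w. dir_deriv (fst w) f (fst z))) (at z)" for z
      using has_derivative_compose[OF has_derivative_fst[OF has_derivative_ident] has_derivative_dir_deriv[of f "fst z"]] Suc.prems
      by simp
    have "Cn k (dir_deriv w (\<lambda>z :: 'a \<times> 'c. f (fst z)))" if w: "w \<in> Basis" for w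
    proof -
      have e: "dir_deriv w (\<lambda>z :: 'a \<times> 'c. f (fst z)) = (\<lambda>z. dir_deriv (fst w) f (fst z))"
        by (rule ext) (rule dir_deriv_eq[OF d])
      show ?thesis
      proof (cases "fst w \<in> Basis")
        case True
        then show ?thesis unfolding e using Suc by auto
      next
        case False
        then have "fst w = 0" using w by (auto simp: Basis_prod_def)
        moreover have "dir_deriv 0 f x = 0" for x
          using linear_0[OF has_derivative_linear[OF has_derivative_dir_deriv[of f x]]] Suc.prems by simp
        ultimately show ?thesis unfolding e by (simp add: Cn_const)
      qed
    qed
    then show ?case using differentiableI[OF d] by simp
  qed simp
  then show ?thesis using assms by (simp add: smooth_iff_Cn)
qed

lemma test_function_add:
  assumes "\<phi> \<in> test_functions" "\<psi> \<in> test_functions" shows "(\<lambda>z. \<phi> z + \<psi> z) \<in> test_functions"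
proof -
  obtain R R' where "\<forall>z. R < norm z \<longrightarrow> \<phi> z = 0" "\<forall>z. R' < norm z \<longrightarrow> \<psi> z = 0"
    using assms by (auto simp: test_functions_iff)
  then have "\<forall>z. max R R' < norm z \<longrightarrow> \<phi> z + \<psi> z = 0" by auto
  then show ?thesis using assms unfolding test_functions_iff by (blast intro: smooth_add)
qed

lemma test_function_zero: "(\<lambda>z. 0) \<in> test_functions"
  by (simp add: test_functions_iff smooth_const)

lemma test_function_cmult: "\<phi> \<in> test_functions \<Longrightarrow> (\<lambda>z. c * \<phi> z) \<in> test_functions"
  by (rule test_function_mult[OF _ smooth_const])

lemma test_function_of_real_mult: "\<phi> \<in> test_functions \<Longrightarrow> smooth g \<Longrightarrow> (\<lambda>z. complex_of_real (g z) * \<phi> z) \<in> test_functions"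
  by (rule test_function_mult[OF _ smooth_of_real])

lemma test_function_diff:
  assumes "\<phi> \<in> test_functions" "\<psi> \<in> test_functions" shows "(\<lambda>z. \<phi> z - \<psi> z) \<in> test_functions"
  using test_function_add[OF assms(1) test_function_cmult[OF assms(2), of "-1"]] by simp

lemma test_function_sum:
  "finite I \<Longrightarrow> (\<And>i. i \<in> I \<Longrightarrow> \<phi> i \<in> test_functions) \<Longrightarrow> (\<lambda>z. \<Sum>i\<in>I. \<phi> i z) \<in> test_functions"
  by (induction I rule: finite_induct) (auto intro: test_function_add test_function_zero)

lemma test_function_mLp: "\<phi> \<in> test_functions \<Longrightarrow> p > 1 \<Longrightarrow> mLp p \<phi>"
  by (metis mLp_compact_support test_function_bounded test_function_measurable)

lemma test_function_integrable:
  assumes "\<phi> \<in> test_functions" shows "integrable lborel \<phi>"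
proof -
  obtain C R where "C > 0" and C: "\<And>z. norm (\<phi> z) \<le> C * indicator (cball 0 R) z"
    by (rule test_function_bounded[OF assms]) blast
  show ?thesis
    by (rule Bochner_Integration.integrable_bound[OF integrable_indicator_cball[of C R]])
       (use C test_function_measurable[OF assms] \<open>C > 0\<close> in auto)
qed

lemma dir_deriv_mult:
  fixes f g :: "'a::euclidean_space \<Rightarrow> complex"
  assumes "f differentiable (at z)" "g differentiable (at z)"
  shows "dir_deriv w (\<lambda>z. f z * g z) z = f z * dir_deriv w g z + dir_deriv w f z * g z"
  by (rule dir_deriv_eq[OF has_derivative_mult[OF has_derivative_dir_deriv has_derivative_dir_deriv]]) fact+

context kfp begin

text \<open>The transport field is divergence free: the coefficient of an \<open>x\<close>
  derivative depends on \<open>v\<close> only, and the other way round. Transposition therefore only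
  changes the sign of the first-order terms.\<close>

lemma coefficient_derivatives:
  fixes \<phi> :: "'n phase \<Rightarrow> complex"
  assumes \<phi>: "\<And>z. \<phi> differentiable (at z)"
  shows "dir_deriv (basis_x i) (\<lambda>z. complex_of_real (c * snd z $ j) * \<phi> z) = (\<lambda>z. complex_of_real (c * snd z $ j) * dir_deriv (basis_x i) \<phi> z)"
    and "(\<And>x. r differentiable (at x)) \<Longrightarrow>
      dir_deriv (basis_v i) (\<lambda>z. complex_of_real (r (fst z)) * \<phi> z) = (\<lambda>z. complex_of_real (r (fst z)) * dir_deriv (basis_v i) \<phi> z)"
proof -
  have 1: "((\<lambda>z :: 'n phase. complex_of_real (c * snd z $ j)) has_derivative (\<lambda>w. complex_of_real (c * snd w $ j))) (at z)" for z
    by (rule bounded_linear_imp_has_derivative)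
       (intro bounded_linear_intros bounded_linear_compose[OF bounded_linear_of_real] bounded_linear_compose[OF bounded_linear_vec_nth])
  show "dir_deriv (basis_x i) (\<lambda>z. complex_of_real (c * snd z $ j) * \<phi> z) = (\<lambda>z. complex_of_real (c * snd z $ j) * dir_deriv (basis_x i) \<phi> z)"
    using dir_deriv_mult[OF differentiableI[OF 1] \<phi>] dir_deriv_eq[OF 1, of "basis_x i"] by (simp add: fun_eq_iff)
  assume r: "\<And>x. r differentiable (at x)"
  have 2: "((\<lambda>z :: 'n phase. complex_of_real (r (fst z))) has_derivative (\<lambda>w. complex_of_real (dir_deriv (fst w) r (fst z)))) (at z)" for z
    by (rule has_derivative_of_real, rule has_derivative_compose[OF has_derivative_fst[OF has_derivative_ident] has_derivative_dir_deriv[OF r, of "fst z"]])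
  have "dir_deriv 0 r x = 0" for x
    using linear_0[OF has_derivative_linear[OF has_derivative_dir_deriv[OF r, of x]]] .
  then show "dir_deriv (basis_v i) (\<lambda>z. complex_of_real (r (fst z)) * \<phi> z) = (\<lambda>z. complex_of_real (r (fst z)) * dir_deriv (basis_v i) \<phi> z)"
    using dir_deriv_mult[OF differentiableI[OF 2] \<phi>] dir_deriv_eq[OF 2, of "basis_v i"] by (simp add: fun_eq_iff)
qed

lemma smooth_velocity: "smooth (\<lambda>z :: 'n phase. c * snd z $ i)"
  by (intro smooth_bounded_linear bounded_linear_intros bounded_linear_compose[OF bounded_linear_vec_nth])

lemma test_terms:
  fixes \<phi> :: "'n phase \<Rightarrow> complex"
  assumes \<phi>: "\<phi> \<in> test_functions" and F: "\<And>i. smooth (\<lambda>x. F x $ i)"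
  shows "(\<lambda>z. complex_of_real (c * snd z $ i) * \<phi> z) \<in> test_functions"
    "(\<lambda>z. complex_of_real (F (fst z) $ i) * \<phi> z) \<in> test_functions"
    "(\<lambda>z. complex_of_real (b * (norm (snd z))\<^sup>2 - d0) * \<phi> z) \<in> test_functions"
    "dir_deriv (basis_x i) \<phi> \<in> test_functions" "dir_deriv (basis_v i) \<phi> \<in> test_functions"
    "dir_deriv (basis_v i) (dir_deriv (basis_v i) \<phi>) \<in> test_functions"
proof -
  have "smooth (\<lambda>z :: 'n phase. b * (norm (snd z))\<^sup>2 + (- d0))"
    by (intro smooth_add smooth_mult smooth_const smooth_norm_sq smooth_bounded_linear bounded_linear_snd)
  then show "(\<lambda>z. complex_of_real (b * (norm (snd z))\<^sup>2 - d0) * \<phi> z) \<in> test_functions"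
    using test_function_of_real_mult[OF \<phi>, of "\<lambda>z. b * (norm (snd z))\<^sup>2 - d0"] by simp
qed (intro test_function_of_real_mult test_function_dir_deriv basis_x_v_in_Basis \<phi> smooth_fst[OF F] smooth_velocity)+

lemma Pop_test:
  fixes \<phi> :: "'n phase \<Rightarrow> complex"
  assumes \<phi>: "\<phi> \<in> test_functions" and F: "\<And>i. smooth (\<lambda>x. F x $ i)"
  shows "Pop \<phi> \<in> test_functions"
proof -
  note t = test_terms[OF \<phi> F]
  have "Pop \<phi> = (\<lambda>z. (\<Sum>i\<in>UNIV. complex_of_real (m * snd z $ i) * dir_deriv (basis_x i) \<phi> z)
     + (\<Sum>i\<in>UNIV. complex_of_real (F (fst z) $ i) * dir_deriv (basis_v i) \<phi> z)
     - (\<Sum>i\<in>UNIV. complex_of_real a * dir_deriv (basis_v i) (dir_deriv (basis_v i) \<phi>) z)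
     + complex_of_real (b * (norm (snd z))\<^sup>2 - d0) * \<phi> z)"
    unfolding Pop_def[abs_def] by (simp only: scaleR_conv_of_real)
  also have "\<dots> \<in> test_functions"
    by (intro test_function_add test_function_diff test_function_sum finite t test_terms(1,2)[OF _ F] test_function_cmult)
  finally show ?thesis .
qed

text \<open>The difference of the two integrands is the divergence of compactly supported fields:
  \<open>X\<close> and \<open>Y\<close> come from the first-order terms by the product rule,
  \<open>U\<close> is Green's formula for the second derivatives, and the potential terms
  cancel.\<close>

lemma Pop_transpose:
  fixes \<phi> \<psi> :: "'n phase \<Rightarrow> complex"
  assumes \<phi>: "\<phi> \<in> test_functions" and \<psi>: "\<psi> \<in> test_functions" and F: "\<And>i. smooth (\<lambda>x. F x $ i)"
  shows "(\<integral>y. \<phi> y * Pop \<psi> y \<partial>lborel) = (\<integral>y. kfp.Pop (- m) a b d0 (\<lambda>x. - F x) \<phi> y * \<psi> y \<partial>lborel)"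
    and "kfp.Pop (- m) a b d0 (\<lambda>x. - F x) \<phi> \<in> test_functions"
proof -
  interpret T: kfp "- m" a b d0 "\<lambda>x. - F x" L
    using m a b L lip by unfold_locales (auto simp: norm_minus_commute)
  have F': "smooth (\<lambda>x. (- F x) $ i)" for i
    using smooth_mult[OF smooth_const[of "-1"] F[of i]] by simp
  show TP: "T.Pop \<phi> \<in> test_functions" by (rule T.Pop_test[OF \<phi> F'])
  note d\<phi> = smooth_differentiable[OF test_function_smooth[OF \<phi>]] and d\<psi> = smooth_differentiable[OF test_function_smooth[OF \<psi>]]
  note t\<phi> = test_terms[OF \<phi> F] and t\<psi> = test_terms[OF \<psi> F]
  note prod = test_function_mult[OF _ test_function_smooth]
  define X where "X i z = complex_of_real (m * snd z $ i) * (\<phi> z * \<psi> z)" for i z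
  define Y where "Y i z = complex_of_real (F (fst z) $ i) * (\<phi> z * \<psi> z)" for i z
  define U where "U i z = \<phi> z * dir_deriv (basis_v i) \<psi> z - dir_deriv (basis_v i) \<phi> z * \<psi> z" for i z
  have tt: "X i \<in> test_functions" "Y i \<in> test_functions" "U i \<in> test_functions" for i
    unfolding X_def Y_def U_def
    by (intro test_terms(1,2)[OF prod[OF \<psi> \<phi>] F] test_function_diff prod t\<phi> t\<psi> \<phi> \<psi>)+
  have d\<phi>\<psi>: "(\<lambda>z. \<phi> z * \<psi> z) differentiable (at z)" for z
    by (intro differentiable_mult d\<phi> d\<psi>)
  have eX: "dir_deriv (basis_x i) (X i) z = complex_of_real (m * snd z $ i) * (\<phi> z * dir_deriv (basis_x i) \<psi> z + dir_deriv (basis_x i) \<phi> z * \<psi> z)" for i z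
    unfolding X_def by (simp add: coefficient_derivatives(1)[OF d\<phi>\<psi>] dir_deriv_mult d\<phi> d\<psi> del: of_real_mult)
  have eY: "dir_deriv (basis_v i) (Y i) z = complex_of_real (F (fst z) $ i) * (\<phi> z * dir_deriv (basis_v i) \<psi> z + dir_deriv (basis_v i) \<phi> z * \<psi> z)" for i z
    unfolding Y_def using smooth_differentiable[OF F]
    by (simp add: coefficient_derivatives(2)[OF d\<phi>\<psi>, of "\<lambda>x. F x $ i"] dir_deriv_mult d\<phi> d\<psi>)
  have eU: "dir_deriv (basis_v i) (U i) z = \<phi> z * dir_deriv (basis_v i) (dir_deriv (basis_v i) \<psi>) z - dir_deriv (basis_v i) (dir_deriv (basis_v i) \<phi>) z * \<psi> z" for i z
  proof -
    have d: "(dir_deriv (basis_v i) \<phi>) differentiable (at z)" "(dir_deriv (basis_v i) \<psi>) differentiable (at z)"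
      using t\<phi>(5) t\<psi>(5) by (auto intro: smooth_differentiable test_function_smooth)
    have "dir_deriv (basis_v i) (U i) z = dir_deriv (basis_v i) (\<lambda>z. \<phi> z * dir_deriv (basis_v i) \<psi> z) z - dir_deriv (basis_v i) (\<lambda>z. dir_deriv (basis_v i) \<phi> z * \<psi> z) z"
      unfolding U_def
      by (rule dir_deriv_eq, rule has_derivative_diff) (intro has_derivative_dir_deriv differentiable_mult d d\<phi> d\<psi>)+
    then show ?thesis using d d\<phi> d\<psi> by (simp add: dir_deriv_mult)
  qed
  define D where "D z = (\<Sum>i\<in>UNIV. dir_deriv (basis_x i) (X i) z) + (\<Sum>i\<in>UNIV. dir_deriv (basis_v i) (Y i) z)
      - (\<Sum>i\<in>UNIV. complex_of_real a * dir_deriv (basis_v i) (U i) z)" for z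
  have D: "\<phi> z * Pop \<psi> z - T.Pop \<phi> z * \<psi> z = D z" for z
    unfolding D_def eX eY eU Pop_def T.Pop_def
    by (simp add: scaleR_conv_of_real algebra_simps sum_distrib_left sum_distrib_right sum.distrib sum_subtractf sum_negf)
  have i: "integrable lborel (dir_deriv (basis_x i) (X i))" "integrable lborel (dir_deriv (basis_v i) (Y i))" "integrable lborel (dir_deriv (basis_v i) (U i))" for i
    by (intro test_function_integrable test_function_dir_deriv tt basis_x_v_in_Basis)+
  have "(\<integral>z. D z \<partial>lborel) = 0"
    unfolding D_def using i by (simp add: integral_dir_deriv_test tt basis_x_v_in_Basis)
  then have "(\<integral>z. \<phi> z * Pop \<psi> z - T.Pop \<phi> z * \<psi> z \<partial>lborel) = 0" by (simp add: D)
  moreover have "integrable lborel (\<lambda>z. \<phi> z * Pop \<psi> z)" "integrable lborel (\<lambda>z. T.Pop \<phi> z * \<psi> z)"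
    by (intro test_function_integrable prod Pop_test \<phi> \<psi> F TP)+
  ultimately show "(\<integral>y. \<phi> y * Pop \<psi> y \<partial>lborel) = (\<integral>y. T.Pop \<phi> y * \<psi> y \<partial>lborel)" by simp
qed

end

section \<open>A fixed point theorem for the seminorm\<close>

lemma nLp_le_0I:
  fixes f :: "'a::euclidean_space \<Rightarrow> complex"
  assumes "\<And>n. nLp p f \<le> c * (1/2) ^ n"
  shows "nLp p f \<le> 0"
proof (rule LIMSEQ_le_const)
  show "(\<lambda>n. c * (1/2) ^ n) \<longlonglongrightarrow> 0" by real_asymp
qed (use assms in auto)

text \<open>Banach's iteration started at 0: its increments are bounded by
  \<open>c * (1/2) ^ n\<close>, the form that the completeness statement expects. The limit is a
  fixed point up to a null set, which is all that a seminorm can see.\<close>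

lemma Lp_contraction:
  fixes T :: "('a::euclidean_space \<Rightarrow> complex) \<Rightarrow> 'a \<Rightarrow> complex"
  assumes p: "p > 1" and T: "\<And>f. mLp p f \<Longrightarrow> mLp p (T f)"
    and le: "\<And>f g. mLp p f \<Longrightarrow> mLp p g \<Longrightarrow> nLp p (\<lambda>z. T f z - T g z) \<le> 1 / 2 * nLp p (\<lambda>z. f z - g z)"
  shows "\<exists>f. mLp p f \<and> (AE z in lborel. T f z = f z)"
proof -
  define s where "s n = (T ^^ n) (\<lambda>z. 0)" for n
  have s: "mLp p (s n)" for n by (induction n) (auto simp: s_def mLp_0 T)
  have s_Suc: "s (Suc n) = T (s n)" for n by (simp add: s_def)
  define c where "c = nLp p (\<lambda>z. s 1 z - s 0 z)"
  have c: "c \<ge> 0" by (simp add: c_def nLp_nonneg)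
  have d: "nLp p (\<lambda>z. s (Suc n) z - s n z) \<le> c * (1/2) ^ n" for n
  proof (induction n)
    case (Suc n)
    show ?case using le[OF s[of "Suc n"] s[of n]] Suc by (simp add: s_Suc)
  qed (simp add: c_def)
  obtain f where f: "mLp p f" "\<And>n. nLp p (\<lambda>z. s n z - f z) \<le> 2 * c * (1/2) ^ n"
    using Lp_complete_geometric[OF s p c d] by blast
  have Tf: "mLp p (T f)" by (rule T[OF f(1)])
  have "nLp p (\<lambda>z. T f z - f z) \<le> (2 * c) * (1/2) ^ n" for n
  proof -
    have "nLp p (\<lambda>z. T f z - f z) = nLp p (\<lambda>z. (s (Suc n) z - f z) - (T (s n) z - T f z))"
      by (simp add: s_Suc)
    also have "\<dots> \<le> nLp p (\<lambda>z. s (Suc n) z - f z) + nLp p (\<lambda>z. T (s n) z - T f z)"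
      by (intro mLp_minus s f T p)
    also have "\<dots> \<le> 2 * c * (1/2) ^ Suc n + 1 / 2 * (2 * c * (1/2) ^ n)"
      using le[OF s[of n] f(1)] f(2)[of n] by (intro add_mono f) linarith
    also have "\<dots> = (2 * c) * (1/2) ^ n" by simp
    finally show ?thesis .
  qed
  then have "AE z in lborel. T f z - f z = 0"
    by (intro nLp_eq_0_imp_AE[OF mLp_minus(1)[OF Tf f(1) p] p] nLp_le_0I)
  then show ?thesis using f(1) by auto
qed

section \<open>Solvability by duality, and the full region\<close>

context kfp begin

text \<open>\<open>g\<close> is the image of \<open>f\<close> under the transpose of \<open>Pop\<close>, in the sense of distributions.\<close>

definition rel :: "real \<Rightarrow> ('n phase \<Rightarrow> complex) \<Rightarrow> ('n phase \<Rightarrow> complex) \<Rightarrow> bool" where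
  "rel p f g \<longleftrightarrow> mLp p f \<and> mLp p g \<and> (\<forall>\<psi>\<in>test_functions. (\<integral>y. f y * Pop \<psi> y \<partial>lborel) = (\<integral>y. g y * \<psi> y \<partial>lborel))"

text \<open>Integrating the kernels over the pole inverts the transposed operator up to the contraction
  \<open>E\<close>: the identity \<open>left_parametrix\<close> for test functions is exactly the dual statement.\<close>

lemma right_parametrix:
  fixes h :: "'n phase \<Rightarrow> complex"
  assumes F: "\<And>i. smooth (\<lambda>x. F x $ i)" and p: "p > 1" and z: "Re z < 0"
    and C: "C > 0" "schur_le (Gk z) C" "schur_le (Ek z) (1 / 2)" and h: "mLp p h"
  shows "\<exists>f. mLp p f \<and> (\<forall>\<phi>\<in>test_functions. (\<integral>y. f y * kfp.Pop (- m) a b d0 (\<lambda>x. - F x) \<phi> y \<partial>lborel) = (\<integral>y. (z * f y + h y) * \<phi> y \<partial>lborel))"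
proof -
  have tr: "schur_le (\<lambda>y q. K q y) D" if "schur_le K D" for K :: "'n phase \<Rightarrow> 'n phase \<Rightarrow> complex" and D
    using that unfolding schur_le_def by blast
  have mt: "case_prod (\<lambda>y q. K q y) \<in> borel_measurable (borel \<Otimes>\<^sub>M borel)" if "case_prod K \<in> borel_measurable (borel \<Otimes>\<^sub>M borel)"
    for K :: "'n phase \<Rightarrow> 'n phase \<Rightarrow> complex"
    using that by measurable
  have half: "(1 / 2 :: real) > 0" by simp
  note SG = schur_le_test[OF mt[OF Gk_measurable] tr[OF C(2)] C(1) p]
  note SE = schur_le_test[OF mt[OF Ek_measurable] tr[OF C(3)] half p]
  note IE = schur_AE_integrable[OF mt[OF Ek_measurable] tr[OF C(3)] half p]
  define E where "E f y = (\<integral>q. Ek z q y * f q \<partial>lborel)" for f y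
  have E: "mLp p (E f)" "nLp p (E f) \<le> 1 / 2 * nLp p f" if "mLp p f" for f
    unfolding E_def[abs_def] using SE[OF that] by auto
  have E_diff: "AE y in lborel. E f y - E g y = E (\<lambda>q. f q - g q) y" if "mLp p f" "mLp p g" for f g
    using IE[OF that(1)] IE[OF that(2)]
    by eventually_elim (simp add: E_def algebra_simps)
  \<comment> \<open>The equation \<open>h' + E h' = h\<close> is solved first, as a fixed point of a
    contraction; the transposed \<open>G\<close> applied to \<open>h'\<close> is then the desired
    \<open>f\<close>.\<close>
  have "\<exists>h'. mLp p h' \<and> (AE y in lborel. h y - E h' y = h' y)"
  proof (rule Lp_contraction[OF p])
    show "mLp p (\<lambda>y. h y - E f y)" if "mLp p f" for f by (intro mLp_minus h E that p)
    fix f g :: "'n phase \<Rightarrow> complex" assume fg: "mLp p f" "mLp p g"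
    have "AE y in lborel. E (\<lambda>q. g q - f q) y = (h y - E f y) - (h y - E g y)"
      using E_diff[OF fg(2,1)] by eventually_elim simp
    then have "nLp p (\<lambda>y. (h y - E f y) - (h y - E g y)) = nLp p (E (\<lambda>q. g q - f q))"
      using E(1)[OF fg(1)] E(1)[OF fg(2)] h
      by (intro mLp_cong_AE(2)[OF E(1)[OF mLp_minus(1)[OF fg(2,1) p]]]) (auto simp: mLp_def)
    also have "\<dots> \<le> 1 / 2 * nLp p (\<lambda>q. g q - f q)" by (rule E(2)[OF mLp_minus(1)[OF fg(2,1) p]])
    also have "nLp p (\<lambda>q. g q - f q) = nLp p (\<lambda>q. f q - g q)" by (simp add: nLp_def norm_minus_commute)
    finally show "nLp p (\<lambda>y. (h y - E f y) - (h y - E g y)) \<le> 1 / 2 * nLp p (\<lambda>q. f q - g q)" .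
  qed
  then obtain h' where h': "mLp p h'" "AE y in lborel. h y - E h' y = h' y" by blast
  define f where "f y = (\<integral>q. Gk z q y * h' q \<partial>lborel)" for y
  have f: "mLp p f" unfolding f_def[abs_def] by (rule SG(1)[OF h'(1)])
  have "(\<integral>y. f y * kfp.Pop (- m) a b d0 (\<lambda>x. - F x) \<phi> y \<partial>lborel) = (\<integral>y. (z * f y + h y) * \<phi> y \<partial>lborel)"
    if \<phi>: "\<phi> \<in> test_functions" for \<phi>
  proof -
    define \<theta> where "\<theta> = kfp.Pop (- m) a b d0 (\<lambda>x. - F x) \<phi>"
    have \<theta>: "\<theta> \<in> test_functions" unfolding \<theta>_def by (rule Pop_transpose(2)[OF \<phi> \<phi> F])
    \<comment> \<open>Transposition exhibits \<open>\<theta>\<close> as the weak image of the test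
      function \<open>\<phi>\<close>, so the left parametrix identity holds for
      \<open>\<phi>\<close>. Pairing it with \<open>h'\<close> moves \<open>G\<close> and
      \<open>E\<close> over to \<open>h'\<close>.\<close>
    have dual: "(\<integral>y. \<phi> y * Pop \<psi> y \<partial>lborel) = (\<integral>y. \<theta> y * \<psi> y \<partial>lborel)" if "\<psi> \<in> test_functions" for \<psi>
      unfolding \<theta>_def by (rule Pop_transpose(1)[OF \<phi> that F])
    define \<eta> where "\<eta> y = \<theta> y - z * \<phi> y" for y
    have \<eta>: "\<eta> \<in> test_functions" unfolding \<eta>_def[abs_def] by (intro test_function_diff test_function_cmult \<theta> \<phi>)
    have lp: "AE q in lborel. \<phi> q + (\<integral>y. Ek z q y * \<phi> y \<partial>lborel) = (\<integral>y. Gk z q y * \<eta> y \<partial>lborel)"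
      unfolding \<eta>_def by (rule left_parametrix[OF test_function_mLp[OF \<phi> p] test_function_mLp[OF \<theta> p] p z dual])
    obtain B1 R1 where B1: "\<And>z. norm (\<phi> z) \<le> B1 * indicator (cball 0 R1) z"
      by (rule test_function_bounded[OF \<phi>]) blast
    obtain B2 R2 where B2: "\<And>z. norm (\<eta> z) \<le> B2 * indicator (cball 0 R2) z"
      by (rule test_function_bounded[OF \<eta>]) blast
    note tG = schur_transpose[OF Gk_measurable C(2,1) p h'(1) test_function_measurable[OF \<eta>] B2]
    note tE = schur_transpose[OF Ek_measurable C(3) half p h'(1) test_function_measurable[OF \<phi>] B1]
    have i: "integrable lborel (\<lambda>q. u q * \<psi> q)" if "mLp p u" "\<psi> \<in> test_functions" for u \<psi>
      by (rule locally_integrable_test[OF mLp_locally_integrable[OF that(1) p] that(2)])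
    have dl: "c * w = c * u + c * v" if "u + v = w" for c u v w :: complex
      using that by (auto simp: distrib_left)
    have dr: "v * x + u * x = w * x" if "w - u = v" for x u v w :: complex
      using that by (auto simp: algebra_simps)
    have "(\<integral>y. f y * \<eta> y \<partial>lborel) = (\<integral>q. h' q * (\<integral>y. Gk z q y * \<eta> y \<partial>lborel) \<partial>lborel)"
      unfolding f_def by (rule tG(1))
    also have "\<dots> = (\<integral>q. h' q * \<phi> q + h' q * (\<integral>y. Ek z q y * \<phi> y \<partial>lborel) \<partial>lborel)"
    proof (rule integral_cong_AE)
      show "(\<lambda>q. h' q * (\<integral>y. Gk z q y * \<eta> y \<partial>lborel)) \<in> borel_measurable lborel" using tG(2) by simp
      show "(\<lambda>q. h' q * \<phi> q + h' q * (\<integral>y. Ek z q y * \<phi> y \<partial>lborel)) \<in> borel_measurable lborel"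
        by (intro borel_measurable_add borel_measurable_integrable i[OF h'(1) \<phi>] tE(2))
      show "AE q in lborel. h' q * (\<integral>y. Gk z q y * \<eta> y \<partial>lborel) = h' q * \<phi> q + h' q * (\<integral>y. Ek z q y * \<phi> y \<partial>lborel)"
        using lp by eventually_elim (rule dl)
    qed
    also have "\<dots> = (\<integral>q. h' q * \<phi> q \<partial>lborel) + (\<integral>y. E h' y * \<phi> y \<partial>lborel)"
      unfolding Bochner_Integration.integral_add[OF i[OF h'(1) \<phi>] tE(2)] E_def by (simp only: tE(1))
    also have "\<dots> = (\<integral>y. h' y * \<phi> y + E h' y * \<phi> y \<partial>lborel)"
      by (rule Bochner_Integration.integral_add[symmetric]) (intro i h' \<phi> E)+
    also have "\<dots> = (\<integral>y. h y * \<phi> y \<partial>lborel)"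
    proof (rule integral_cong_AE)
      show "AE y in lborel. h' y * \<phi> y + E h' y * \<phi> y = h y * \<phi> y"
        using h'(2) by eventually_elim (rule dr)
    qed (use i[OF h'(1) \<phi>] i[OF E(1)[OF h'(1)] \<phi>] i[OF h \<phi>] in auto)
    finally have 1: "(\<integral>y. f y * \<eta> y \<partial>lborel) = (\<integral>y. h y * \<phi> y \<partial>lborel)" .
    have "(\<integral>y. f y * \<theta> y \<partial>lborel) = (\<integral>y. f y * \<eta> y + z * (f y * \<phi> y) \<partial>lborel)"
      by (simp add: \<eta>_def algebra_simps)
    also have "\<dots> = (\<integral>y. h y * \<phi> y \<partial>lborel) + z * (\<integral>y. f y * \<phi> y \<partial>lborel)"
      using i[OF f \<eta>] i[OF f \<phi>] by (simp add: 1)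
    also have "\<dots> = (\<integral>y. h y * \<phi> y + z * (f y * \<phi> y) \<partial>lborel)"
      using i[OF f \<phi>] i[OF h \<phi>] by simp
    also have "\<dots> = (\<integral>y. (z * f y + h y) * \<phi> y \<partial>lborel)" by (simp add: algebra_simps)
    finally show ?thesis by (simp add: \<theta>_def)
  qed
  with f show ?thesis by blast
qed

lemma resolvent_half_plane:
  assumes F: "\<And>i. smooth (\<lambda>x. F x $ i)" and p: "p > 1"
  shows "\<exists>C>0. \<exists>c>0. \<forall>z. Re z \<le> - c \<longrightarrow>
     (\<forall>f g. rel p f g \<longrightarrow> nLp p f \<le> C / (1 + \<bar>Re z\<bar> + sqrt \<bar>Im z\<bar>) * nLp p (\<lambda>y. g y - z * f y)) \<and>
     (\<forall>h. mLp p h \<longrightarrow> (\<exists>f. rel p f (\<lambda>y. z * f y + h y)))"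
proof -
  \<comment> \<open>The estimate uses the kernels of the operator itself, solvability those of its
    transpose: \<open>T.right_parametrix\<close> solves the transposed equation for
    \<open>T\<close>, and transposing twice restores \<open>m\<close> and \<open>F\<close>.\<close>
  interpret T: kfp "- m" a b d0 "\<lambda>x. - F x" L
    using m a b L lip by unfold_locales (auto simp: norm_minus_commute)
  have F': "smooth (\<lambda>x. (- F x) $ i)" for i
    using smooth_mult[OF smooth_const[of "-1"] F[of i]] by simp
  obtain C1 c1 where 1: "C1 > 0" "c1 > 0" "\<And>z. Re z \<le> - c1 \<Longrightarrow>
     schur_le (Gk z) (C1 / (1 + \<bar>Re z\<bar> + sqrt \<bar>Im z\<bar>)) \<and> schur_le (Ek z) (1 / 2)"
    using apriori by blast
  obtain C2 c2 where 2: "C2 > 0" "c2 > 0" "\<And>z. Re z \<le> - c2 \<Longrightarrow>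
     schur_le (T.Gk z) (C2 / (1 + \<bar>Re z\<bar> + sqrt \<bar>Im z\<bar>)) \<and> schur_le (T.Ek z) (1 / 2)"
    using T.apriori by blast
  have "(\<forall>f g. rel p f g \<longrightarrow> nLp p f \<le> 2 * C1 / (1 + \<bar>Re z\<bar> + sqrt \<bar>Im z\<bar>) * nLp p (\<lambda>y. g y - z * f y)) \<and>
     (\<forall>h. mLp p h \<longrightarrow> (\<exists>f. rel p f (\<lambda>y. z * f y + h y)))" if z: "Re z \<le> - (c1 + c2)" for z
  proof (intro conjI allI impI)
    have z': "Re z \<le> - c1" "Re z \<le> - c2" "Re z < 0" using z 1(2) 2(2) by linarith+
    have pos: "1 + \<bar>Re z\<bar> + sqrt \<bar>Im z\<bar> > 0" by (intro add_pos_nonneg) auto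
    fix f g assume "rel p f g"
    then have r: "mLp p f" "mLp p g" "\<And>\<psi>. \<psi> \<in> test_functions \<Longrightarrow> (\<integral>y. f y * Pop \<psi> y \<partial>lborel) = (\<integral>y. g y * \<psi> y \<partial>lborel)"
      by (auto simp: rel_def)
    have "nLp p f \<le> 2 * (C1 / (1 + \<bar>Re z\<bar> + sqrt \<bar>Im z\<bar>)) * nLp p (\<lambda>y. g y - z * f y)"
      using 1(3)[OF z'(1)] 1(1) pos by (intro apriori_estimate[OF r(1,2) p z'(3) r(3)]) auto
    then show "nLp p f \<le> 2 * C1 / (1 + \<bar>Re z\<bar> + sqrt \<bar>Im z\<bar>) * nLp p (\<lambda>y. g y - z * f y)" by simp
  next
    have z': "Re z \<le> - c1" "Re z \<le> - c2" "Re z < 0" using z 1(2) 2(2) by linarith+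
    have pos: "1 + \<bar>Re z\<bar> + sqrt \<bar>Im z\<bar> > 0" by (intro add_pos_nonneg) auto
    fix h :: "'n phase \<Rightarrow> complex" assume h: "mLp p h"
    obtain f where f: "mLp p f" "\<forall>\<phi>\<in>test_functions. (\<integral>y. f y * kfp.Pop (- (- m)) a b d0 (\<lambda>x. - (- F x)) \<phi> y \<partial>lborel) = (\<integral>y. (z * f y + h y) * \<phi> y \<partial>lborel)"
      using T.right_parametrix[OF F' p z'(3) divide_pos_pos[OF 2(1) pos] conjunct1[OF 2(3)[OF z'(2)]] conjunct2[OF 2(3)[OF z'(2)]] h] by blast
    then have "rel p f (\<lambda>y. z * f y + h y)"
      using mLp_add(1)[OF mLp_cmult(1)[OF f(1) p] h p] by (auto simp: rel_def)
    then show "\<exists>f. rel p f (\<lambda>y. z * f y + h y)" by blast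
  qed
  moreover have "2 * C1 > 0" "c1 + c2 > 0" using 1 2 by auto
  ultimately show ?thesis by blast
qed

lemma rel_diff:
  assumes F: "\<And>i. smooth (\<lambda>x. F x $ i)" and p: "p > 1" and r: "rel p f g" "rel p f' g'"
  shows "rel p (\<lambda>y. f y - f' y) (\<lambda>y. g y - g' y)"
proof -
  have m: "mLp p f" "mLp p g" "mLp p f'" "mLp p g'" using r by (auto simp: rel_def)
  have i: "integrable lborel (\<lambda>q. u q * \<psi> q)" if "mLp p u" "\<psi> \<in> test_functions" for u \<psi> :: "'n phase \<Rightarrow> complex"
    by (rule locally_integrable_test[OF mLp_locally_integrable[OF that(1) p] that(2)])
  show ?thesis unfolding rel_def
  proof (intro conjI ballI mLp_minus m p)
    fix \<psi> :: "'n phase \<Rightarrow> complex" assume \<psi>: "\<psi> \<in> test_functions"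
    have "(\<integral>y. f y * Pop \<psi> y \<partial>lborel) = (\<integral>y. g y * \<psi> y \<partial>lborel)" "(\<integral>y. f' y * Pop \<psi> y \<partial>lborel) = (\<integral>y. g' y * \<psi> y \<partial>lborel)"
      using r \<psi> by (auto simp: rel_def)
    then show "(\<integral>y. (f y - f' y) * Pop \<psi> y \<partial>lborel) = (\<integral>y. (g y - g' y) * \<psi> y \<partial>lborel)"
      unfolding left_diff_distrib using i[OF m(1) Pop_test[OF \<psi> F]] i[OF m(3) Pop_test[OF \<psi> F]] i[OF m(2) \<psi>] i[OF m(4) \<psi>] by simp
  qed
qed

lemma rel_cong_AE:
  assumes r: "rel p f g" and m: "f' \<in> borel_measurable borel" "g' \<in> borel_measurable borel"
    and ae: "AE y in lborel. f y = f' y" "AE y in lborel. g y = g' y"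
  shows "rel p f' g'"
proof -
  have [measurable]: "f \<in> borel_measurable borel" "g \<in> borel_measurable borel" "f' \<in> borel_measurable borel" "g' \<in> borel_measurable borel"
    using r m by (auto simp: rel_def mLp_def)
  have mL: "mLp p f'" "mLp p g'" using r mLp_cong_AE(1)[OF _ m(1) ae(1)] mLp_cong_AE(1)[OF _ m(2) ae(2)] by (auto simp: rel_def)
  have "(\<integral>y. f' y * Pop \<psi> y \<partial>lborel) = (\<integral>y. g' y * \<psi> y \<partial>lborel)" if \<psi>: "\<psi> \<in> test_functions" for \<psi>
  proof -
    note [measurable] = Pop_test_measurable[OF \<psi>] test_function_measurable[OF \<psi>]
    have "(\<integral>y. f' y * Pop \<psi> y \<partial>lborel) = (\<integral>y. f y * Pop \<psi> y \<partial>lborel)"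
      by (rule integral_cong_AE) (use ae(1) in \<open>auto elim: eventually_mono\<close>)
    also have "\<dots> = (\<integral>y. g y * \<psi> y \<partial>lborel)" using r \<psi> by (simp add: rel_def)
    also have "\<dots> = (\<integral>y. g' y * \<psi> y \<partial>lborel)"
      by (rule integral_cong_AE) (use ae(2) in \<open>auto elim: eventually_mono\<close>)
    finally show ?thesis .
  qed
  with mL show ?thesis by (simp add: rel_def)
qed

text \<open>The statement on functions that \<open>z\<close> lies in the resolvent set with
  resolvent norm at most \<open>\<kappa>\<close>: the estimate carries injectivity and the bound,
  the second half surjectivity.\<close>

definition resolvent_bound :: "real \<Rightarrow> complex \<Rightarrow> real \<Rightarrow> bool" where
  "resolvent_bound p z \<kappa> \<longleftrightarrow> (\<forall>f g. rel p f g \<longrightarrow> nLp p f \<le> \<kappa> * nLp p (\<lambda>y. g y - z * f y)) \<and>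
     (\<forall>h. mLp p h \<longrightarrow> (\<exists>f. rel p f (\<lambda>y. z * f y + h y)))"

lemma resolvent_bound_mono: "resolvent_bound p z \<kappa> \<Longrightarrow> \<kappa> \<le> \<kappa>' \<Longrightarrow> resolvent_bound p z \<kappa>'"
  unfolding resolvent_bound_def by (auto intro: order_trans[OF _ mult_right_mono[OF _ nLp_nonneg]])

text \<open>The Neumann series as a fixed point: a solution at \<open>z\<close> is a fixed point of
  the map sending \<open>u\<close> to the solution at \<open>z0\<close> with right-hand side
  \<open>h + (z - z0) * u\<close>, which contracts by \<open>\<kappa> * norm (z - z0)\<close>. The
  estimate survives with twice the constant by absorption.\<close>

lemma resolvent_perturbation:
  assumes F: "\<And>i. smooth (\<lambda>x. F x $ i)" and p: "p > 1" and r: "resolvent_bound p z0 \<kappa>" and \<kappa>: "\<kappa> \<ge> 0"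
    and small: "\<kappa> * norm (z - z0) \<le> 1 / 2"
  shows "resolvent_bound p z (2 * \<kappa>)"
proof -
  have est: "nLp p f \<le> \<kappa> * nLp p (\<lambda>y. g y - z0 * f y)" if "rel p f g" for f g
    using r that by (simp add: resolvent_bound_def)
  have solv: "\<exists>f. rel p f (\<lambda>y. z0 * f y + h y)" if "mLp p h" for h
    using r that by (simp add: resolvent_bound_def)
  define d where "d = z - z0"
  have d: "\<kappa> * (norm d * nLp p u) \<le> 1 / 2 * nLp p u" for u
    using mult_right_mono[OF small nLp_nonneg[of p u]] by (simp add: d_def mult.assoc)
  have "nLp p f \<le> 2 * \<kappa> * nLp p (\<lambda>y. g y - z * f y)" if fg: "rel p f g" for f g
  proof -
    have m: "mLp p f" "mLp p g" using fg by (auto simp: rel_def)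
    have "nLp p (\<lambda>y. g y - z0 * f y) = nLp p (\<lambda>y. (g y - z * f y) + d * f y)" by (simp add: d_def algebra_simps)
    also have "\<dots> \<le> nLp p (\<lambda>y. g y - z * f y) + nLp p (\<lambda>y. d * f y)"
      by (intro mLp_add(2) mLp_minus mLp_cmult m p)
    also have "nLp p (\<lambda>y. d * f y) = norm d * nLp p f" by (rule mLp_cmult(2)[OF m(1) p])
    finally have "\<kappa> * nLp p (\<lambda>y. g y - z0 * f y) \<le> \<kappa> * (nLp p (\<lambda>y. g y - z * f y) + norm d * nLp p f)"
      using \<kappa> by (rule mult_left_mono)
    with est[OF fg] have "nLp p f \<le> \<kappa> * nLp p (\<lambda>y. g y - z * f y) + \<kappa> * (norm d * nLp p f)"
      unfolding distrib_left by (rule order_trans)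
    with d[of f] have "nLp p f \<le> \<kappa> * nLp p (\<lambda>y. g y - z * f y) + 1 / 2 * nLp p f" by linarith
    then show ?thesis by simp
  qed
  moreover have "\<exists>f. rel p f (\<lambda>y. z * f y + h y)" if h: "mLp p h" for h
  proof -
    \<comment> \<open>The choice of a solution is harmless: the estimate at \<open>z0\<close>,
      applied to differences, controls any two chosen solutions by their right-hand sides.\<close>
    define T where "T u = (SOME f. rel p f (\<lambda>y. z0 * f y + (h y + d * u y)))" for u
    have T: "rel p (T u) (\<lambda>y. z0 * T u y + (h y + d * u y))" if "mLp p u" for u
      unfolding T_def by (rule someI_ex[OF solv]) (intro mLp_add mLp_cmult that h p)
    have "\<exists>f. mLp p f \<and> (AE y in lborel. T f y = f y)"
    proof (rule Lp_contraction[OF p])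
      show "mLp p (T u)" if "mLp p u" for u using T[OF that] by (simp add: rel_def)
      fix u v :: "'n phase \<Rightarrow> complex" assume uv: "mLp p u" "mLp p v"
      have uv': "mLp p (\<lambda>y. u y - v y)" by (rule mLp_minus(1)[OF uv p])
      have "nLp p (\<lambda>y. T u y - T v y) \<le> \<kappa> * nLp p (\<lambda>y. ((z0 * T u y + (h y + d * u y)) - (z0 * T v y + (h y + d * v y))) - z0 * (T u y - T v y))"
        by (rule est[OF rel_diff[OF F p T[OF uv(1)] T[OF uv(2)]]])
      also have "(\<lambda>y. ((z0 * T u y + (h y + d * u y)) - (z0 * T v y + (h y + d * v y))) - z0 * (T u y - T v y)) = (\<lambda>y. d * (u y - v y))"
        by (simp add: fun_eq_iff algebra_simps)
      also have "nLp p (\<lambda>y. d * (u y - v y)) = norm d * nLp p (\<lambda>y. u y - v y)" by (rule mLp_cmult(2)[OF uv' p])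
      also note d
      finally show "nLp p (\<lambda>y. T u y - T v y) \<le> 1 / 2 * nLp p (\<lambda>y. u y - v y)" .
    qed
    then obtain f where f: "mLp p f" "AE y in lborel. T f y = f y" by blast
    have "rel p f (\<lambda>y. z * f y + h y)"
    proof (rule rel_cong_AE[OF T[OF f(1)] _ _ f(2)])
      show "AE y in lborel. z0 * T f y + (h y + d * f y) = z * f y + h y"
        using f(2) by eventually_elim (simp add: d_def algebra_simps)
      show "(\<lambda>y. z * f y + h y) \<in> borel_measurable borel" "f \<in> borel_measurable borel"
        using f(1) h by (auto simp: mLp_def)
    qed
    then show ?thesis by blast
  qed
  ultimately show ?thesis by (simp add: resolvent_bound_def)
qed

text \<open>To the right of the line \<open>Re z = - c\<close>, the complement of the region forces
  \<open>sqrt (norm (Im z))\<close> to be at least a large multiple of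
  \<open>1 + norm (Re z)\<close>. The distance to the line is then at most a small fraction of the
  inverse resolvent norm on it.\<close>

lemma resolvent_region:
  assumes F: "\<And>i. smooth (\<lambda>x. F x $ i)" and p: "p > 1"
  shows "\<exists>c>0. \<exists>C>0. \<forall>z. \<not> (Re z \<ge> - c \<and> \<bar>Im z\<bar> \<le> C * ((Re z)\<^sup>2 + 1)) \<longrightarrow>
     resolvent_bound p z (C / (1 + \<bar>Re z\<bar> + sqrt \<bar>Im z\<bar>))"
proof -
  obtain C1 c where C1: "C1 > 0" and c: "c > 0" and
    H: "\<And>z. Re z \<le> - c \<Longrightarrow> resolvent_bound p z (C1 / (1 + \<bar>Re z\<bar> + sqrt \<bar>Im z\<bar>))"
    using resolvent_half_plane[OF F p] unfolding resolvent_bound_def by blast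
  \<comment> \<open>\<open>D\<close> is the multiple just mentioned, up to a factor 2: its summand 2
    gives \<open>1 + x \<le> y\<close>, the other one makes the perturbation small. In
    \<open>C\<close> the square \<open>D\<^sup>2\<close> enforces this multiple, and
    \<open>4 * C1\<close> is the constant of the final bound: one factor 2 from the perturbation,
    one from \<open>1 + x + y \<le> 2 * y\<close>.\<close>
  define D where "D = 2 + 4 * C1 * (1 + c)"
  define C where "C = D\<^sup>2 + 4 * C1"
  have D: "D \<ge> 2" "D \<ge> 4 * C1 * (1 + c)" using C1 c by (auto simp: D_def)
  have C: "C > 0" "C \<ge> D\<^sup>2" "C \<ge> 4 * C1" using C1 D by (auto simp: C_def add_nonneg_pos)
  have "resolvent_bound p z (C / (1 + \<bar>Re z\<bar> + sqrt \<bar>Im z\<bar>))"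
    if z: "\<not> (Re z \<ge> - c \<and> \<bar>Im z\<bar> \<le> C * ((Re z)\<^sup>2 + 1))" for z
  proof (cases "Re z \<le> - c")
    case True
    have "C1 / (1 + \<bar>Re z\<bar> + sqrt \<bar>Im z\<bar>) \<le> C / (1 + \<bar>Re z\<bar> + sqrt \<bar>Im z\<bar>)"
      using C C1 by (intro divide_right_mono) auto
    with H[OF True] show ?thesis by (rule resolvent_bound_mono)
  next
    case False
    define x y where "x = \<bar>Re z\<bar>" and "y = sqrt \<bar>Im z\<bar>"
    have x: "x \<ge> 0" by (simp add: x_def)
    have "\<bar>Im z\<bar> > C * ((Re z)\<^sup>2 + 1)" using z False by linarith
    moreover have "C * ((Re z)\<^sup>2 + 1) \<ge> D\<^sup>2 * ((Re z)\<^sup>2 + 1)" using C by (intro mult_right_mono) auto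
    moreover have "(1 + x)\<^sup>2 \<le> 4 * ((Re z)\<^sup>2 + 1)"
      using zero_le_power2[of "x - 1"] zero_le_power2[of x] unfolding x_def power2_abs[of "Re z", symmetric] power2_sum power2_diff by auto
    then have "D\<^sup>2 * (1 + x)\<^sup>2 \<le> D\<^sup>2 * (4 * ((Re z)\<^sup>2 + 1))" by (rule mult_left_mono) auto
    moreover have "D\<^sup>2 * (4 * ((Re z)\<^sup>2 + 1)) = 4 * (D\<^sup>2 * ((Re z)\<^sup>2 + 1))" by simp
    moreover have "(D * (1 + x) / 2)\<^sup>2 = D\<^sup>2 * (1 + x)\<^sup>2 / 4" by (simp add: power_mult_distrib power_divide)
    ultimately have "(D * (1 + x) / 2)\<^sup>2 \<le> \<bar>Im z\<bar>" by linarith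
    then have y: "D * (1 + x) / 2 \<le> y" unfolding y_def by (rule real_le_rsqrt)
    have "2 * (1 + x) \<le> D * (1 + x)" using D x by (intro mult_right_mono) auto
    also have yD: "D * (1 + x) \<le> 2 * y" using mult_left_mono[OF y, of 2] by simp
    finally have yx: "1 + x \<le> y" by simp
    have y0: "y \<ge> 0" by (simp add: y_def)
    \<comment> \<open>The point of the line with the same imaginary part, so that the bound at
      \<open>z0\<close> already decays in \<open>Im z\<close>.\<close>
    define z0 where "z0 = Complex (- c) (Im z)"
    define \<kappa> where "\<kappa> = C1 / (1 + c + y)"
    have \<kappa>: "\<kappa> \<ge> 0" using C1 c y0 by (simp add: \<kappa>_def)
    have r: "resolvent_bound p z0 \<kappa>" using H[of z0] c by (simp add: z0_def \<kappa>_def y_def)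
    have "norm (z - z0) = \<bar>Re z + c\<bar>" by (simp add: z0_def cmod_def)
    also have "\<dots> \<le> (1 + c) * (1 + x)"
    proof -
      have "0 \<le> c * x" using c x by simp
      moreover have "(1 + c) * (1 + x) = 1 + c + x + c * x" by (simp add: algebra_simps)
      ultimately show ?thesis using c unfolding x_def by linarith
    qed
    finally have n: "norm (z - z0) \<le> (1 + c) * (1 + x)" .
    have "4 * C1 * (1 + c) * (1 + x) \<le> D * (1 + x)" using D x by (intro mult_right_mono) auto
    also note yD
    finally have s: "2 * (C1 * ((1 + c) * (1 + x))) \<le> y" by (simp add: mult.assoc)
    have "\<kappa> * norm (z - z0) \<le> \<kappa> * ((1 + c) * (1 + x))" using n \<kappa> by (rule mult_left_mono)
    also have "\<dots> = (C1 * ((1 + c) * (1 + x))) / (1 + c + y)" by (simp add: \<kappa>_def)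
    also have "\<dots> \<le> (y / 2) / (1 + c + y)"
      using s c y0 by (intro divide_right_mono) auto
    also have "(y / 2) / (1 + c + y) \<le> 1 / 2" using c y0 by (simp add: pos_divide_le_eq)
    finally have "\<kappa> * norm (z - z0) \<le> 1 / 2" .
    from resolvent_perturbation[OF F p r \<kappa> this] have "resolvent_bound p z (2 * \<kappa>)" .
    moreover have "2 * \<kappa> \<le> C / (1 + x + y)"
    proof -
      have "(4 * C1) / (2 * (1 + c + y)) \<le> C / (1 + x + y)"
        using C C1 c x y0 yx by (intro frac_le) auto
      moreover have "2 * \<kappa> = (2 * (2 * C1)) / (2 * (1 + c + y))"
        unfolding \<kappa>_def mult_divide_mult_cancel_left[OF zero_neq_numeral[symmetric]] by simp
      ultimately show ?thesis by simp
    qed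
    ultimately show ?thesis unfolding x_def y_def by (rule resolvent_bound_mono)
  qed
  with c C(1) show ?thesis by blast
qed

end

section \<open>Passage to classes of functions\<close>

lemma ae_rel_refl_iff: "ae_rel f f \<longleftrightarrow> f \<in> borel_measurable borel"
  by (simp add: ae_rel_def)

lemma abs_L0_surj:
  obtains F where "F \<in> borel_measurable borel" "f = abs_L0 F"
  using Quotient3_abs_rep[OF Quotient3_L0, of f] Quotient3_rep_reflp[OF Quotient3_L0, of f] ae_rel_refl_iff by metis

lemma abs_L0_eq_iff:
  "f \<in> borel_measurable borel \<Longrightarrow> g \<in> borel_measurable borel \<Longrightarrow> abs_L0 f = abs_L0 g \<longleftrightarrow> (AE z in lborel. f z = g z)"
  using Quotient3_rel[OF Quotient3_L0, of f g] by (auto simp: ae_rel_def)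

lemma Lp_abs_iff: "f \<in> borel_measurable borel \<Longrightarrow> abs_L0 f \<in> Lp p \<longleftrightarrow> mLp p f"
  by (simp add: Lp_def Lp_integrable.abs_eq ae_rel_refl_iff mLp_def)

lemma Lp_norm_abs: "f \<in> borel_measurable borel \<Longrightarrow> Lp_norm p (abs_L0 f) = nLp p f"
  by (simp add: Lp_norm.abs_eq ae_rel_refl_iff nLp_def)

lemma minus_cscale_abs:
  "f \<in> borel_measurable borel \<Longrightarrow> g \<in> borel_measurable borel \<Longrightarrow>
    abs_L0 g - cscale c (abs_L0 f) = abs_L0 (\<lambda>z. g z - c * f z)"
  by (simp add: cscale.abs_eq minus_L0.abs_eq ae_rel_refl_iff)

lemma Lp_cases:
  assumes "f \<in> Lp p" obtains F where "mLp p F" "f = abs_L0 F"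
  using assms by (metis abs_L0_surj Lp_abs_iff)

lemma distr_of_abs:
  assumes [measurable]: "f \<in> borel_measurable borel" "\<phi> \<in> borel_measurable borel"
  shows "distr_of (abs_L0 f) \<phi> = (\<integral>z. f z * \<phi> z \<partial>lborel)"
  by (simp add: distr_of.abs_eq ae_rel_refl_iff integral_completion)

section \<open>Lipschitz continuity of the force\<close>

text \<open>The exceptional set is open by continuity, and a nonempty open set is not null. This
  turns the essential bounds on the derivatives of \<open>V\<close> into bounds at every point, as
  the mean value inequality requires.\<close>

lemma AE_bound_everywhere:
  fixes f :: "'a::euclidean_space \<Rightarrow> 'b::real_normed_vector"
  assumes f: "continuous_on UNIV f" and ae: "AE z in lborel. norm (f z) \<le> K"
  shows "norm (f z) \<le> K"
proof -
  have o: "open {z. K < norm (f z)}" using f by (intro open_Collect_less continuous_intros)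
  have "{z. K < norm (f z)} \<in> null_sets lborel"
    using ae o by (intro iffD2[OF AE_iff_null_sets]) (auto simp: not_less elim: eventually_mono)
  then have "negligible {z. K < norm (f z)}" by (simp add: negligible_iff_null_sets null_sets_completionI)
  then have "{z. K < norm (f z)} = {}" using open_not_negligible[OF o] by blast
  then show ?thesis by (auto simp: not_less)
qed

lemma lipschitz_of_bounded_partials:
  fixes g :: "'a::euclidean_space \<Rightarrow> real"
  assumes g: "\<And>x. g differentiable (at x)" and K: "\<And>b. b \<in> Basis \<Longrightarrow> \<exists>K. \<forall>x. \<bar>dir_deriv b g x\<bar> \<le> K"
  shows "\<exists>K\<ge>0. \<forall>x y. \<bar>g x - g y\<bar> \<le> K * norm (x - y)"
proof -
  obtain K' where K': "\<And>b x. b \<in> Basis \<Longrightarrow> \<bar>dir_deriv b g x\<bar> \<le> K' b" using K by metis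
  define N where "N = (\<Sum>b\<in>Basis. \<bar>K' b\<bar>)"
  have "norm (dir_deriv w g x) \<le> N * norm w" for w x
  proof -
    have l: "linear (\<lambda>w. dir_deriv w g x)" by (rule has_derivative_linear[OF has_derivative_dir_deriv[OF g]])
    have "dir_deriv w g x = dir_deriv (\<Sum>b\<in>Basis. (w \<bullet> b) *\<^sub>R b) g x" by (simp add: euclidean_representation)
    also have "\<dots> = (\<Sum>b\<in>Basis. (w \<bullet> b) * dir_deriv b g x)"
      using linear_sum[OF l, of "\<lambda>b. (w \<bullet> b) *\<^sub>R b" Basis] linear_cmul[OF l] by simp
    also have "norm \<dots> \<le> (\<Sum>b\<in>Basis. norm w * \<bar>K' b\<bar>)"
      unfolding real_norm_def
      by (rule order_trans[OF sum_abs sum_mono])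
         (auto simp: abs_mult Basis_le_norm intro!: mult_mono order_trans[OF K' abs_ge_self])
    finally show ?thesis by (simp add: N_def sum_distrib_left mult.commute)
  qed
  then have on: "onorm (\<lambda>w. dir_deriv w g x) \<le> N" for x
    by (intro onorm_bound) (auto simp: N_def sum_nonneg)
  have "norm (g x - g y) \<le> N * norm (x - y)" for x y
    by (rule differentiable_bound[of UNIV g "\<lambda>x w. dir_deriv w g x"]) (use has_derivative_dir_deriv[OF g] on in auto)
  then show ?thesis by (intro exI[of _ N]) (auto simp: N_def sum_nonneg)
qed

lemma gradient_lipschitz:
  fixes V :: "real^'n::finite \<Rightarrow> real"
  assumes V: "smooth V" and b: "\<And>bs. bs \<in> lists Basis \<Longrightarrow> length bs \<ge> 2 \<Longrightarrow> iter_partial bs V \<in> Linf"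
  shows "\<exists>L\<ge>0. \<forall>x y. norm ((\<chi> i. dir_deriv (axis i 1) V x) - (\<chi> i. dir_deriv (axis i 1) V y)) \<le> L * norm (x - y)"
proof -
  have s: "smooth (dir_deriv (axis i 1) V)" for i by (rule smooth_dir_deriv[OF V]) (simp add: axis_in_Basis_iff)
  have "\<exists>K\<ge>0. \<forall>x y. \<bar>dir_deriv (axis i 1) V x - dir_deriv (axis i 1) V y\<bar> \<le> K * norm (x - y)" for i
  proof (rule lipschitz_of_bounded_partials)
    show "dir_deriv (axis i 1) V differentiable (at x)" for x by (rule smooth_differentiable[OF s])
    fix w :: "real^'n" assume w: "w \<in> Basis"
    have "iter_partial [w, axis i 1] V \<in> Linf" using w by (intro b) (auto simp: axis_in_Basis_iff)
    then obtain K where "AE z in lborel. norm (dir_deriv w (dir_deriv (axis i 1) V) z) \<le> K" by (auto simp: Linf_def)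
    from AE_bound_everywhere[OF smooth_continuous_on[OF smooth_dir_deriv[OF s w]] this]
    show "\<exists>K. \<forall>x. \<bar>dir_deriv w (dir_deriv (axis i 1) V) x\<bar> \<le> K" by auto
  qed
  then obtain K where K: "\<And>i. K i \<ge> 0" "\<And>i x y. \<bar>dir_deriv (axis i 1) V x - dir_deriv (axis i 1) V y\<bar> \<le> K i * norm (x - y)"
    by metis
  have "norm ((\<chi> i. dir_deriv (axis i 1) V x) - (\<chi> i. dir_deriv (axis i 1) V y)) \<le> (\<Sum>i\<in>UNIV. K i) * norm (x - y)" for x y
    by (rule order_trans[OF norm_le_l1_cart]) (auto simp: sum_distrib_right intro!: sum_mono K)
  then show ?thesis using K(1) by (intro exI[of _ "\<Sum>i\<in>UNIV. K i"]) (auto simp: sum_nonneg)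
qed

section \<open>Identification with the operator on classes\<close>

context kfp begin

text \<open>Domain and action enter only through their correspondence with \<open>rel\<close>.
  Applied to the difference of two elements with the same image, the estimate gives injectivity;
  applied to a preimage it bounds the resolvent and hence the supremum over the unit ball.\<close>

lemma resolvent_bound_imp:
  fixes D :: "'n phase L0 set" and op :: "'n phase L0 \<Rightarrow> 'n phase L0"
  assumes F: "\<And>i. smooth (\<lambda>x. F x $ i)" and p: "p > 1"
    and D: "\<And>u. u \<in> D \<Longrightarrow> \<exists>f g. u = abs_L0 f \<and> rel p f g"
    and op: "\<And>f g. rel p f g \<Longrightarrow> abs_L0 f \<in> D \<and> op (abs_L0 f) = abs_L0 g"
    and r: "resolvent_bound p z \<kappa>" and \<kappa>: "\<kappa> \<ge> 0"
  shows "z \<in> resolvent_set p D op" "Lp_opnorm p (resolvent D op z) \<le> \<kappa>"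
proof -
  have est: "nLp p f \<le> \<kappa> * nLp p (\<lambda>y. g y - z * f y)" if "rel p f g" for f g
    using r that by (simp add: resolvent_bound_def)
  have meas: "f \<in> borel_measurable borel" "g \<in> borel_measurable borel" if "rel p f g" for f g
    using that by (auto simp: rel_def mLp_def)
  have val: "op (abs_L0 f) - cscale z (abs_L0 f) = abs_L0 (\<lambda>y. g y - z * f y)" if "rel p f g" for f g
    using op[OF that] meas[OF that] by (simp add: minus_cscale_abs)
  have mval: "mLp p (\<lambda>y. g y - z * f y)" if "rel p f g" for f g
    using that by (intro mLp_minus mLp_cmult p) (auto simp: rel_def)
  have inj: "inj_on (\<lambda>u. op u - cscale z u) D"
  proof (rule inj_onI)
    fix u u' assume "u \<in> D" "u' \<in> D" and eq: "op u - cscale z u = op u' - cscale z u'"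
    then obtain f g f' g' where u: "u = abs_L0 f" "rel p f g" "u' = abs_L0 f'" "rel p f' g'" using D by metis
    have "abs_L0 (\<lambda>y. g y - z * f y) = abs_L0 (\<lambda>y. g' y - z * f' y)" using eq u val by simp
    then have ae: "AE y in lborel. g y - z * f y = g' y - z * f' y"
      using mval[OF u(2)] mval[OF u(4)] by (subst (asm) abs_L0_eq_iff) (auto simp: mLp_def)
    have rd: "rel p (\<lambda>y. f y - f' y) (\<lambda>y. g y - g' y)" by (rule rel_diff[OF F p u(2,4)])
    have "AE y in lborel. (g y - g' y) - z * (f y - f' y) = 0"
      using ae by eventually_elim (simp add: algebra_simps)
    then have "nLp p (\<lambda>y. (g y - g' y) - z * (f y - f' y)) = 0"
      using mLp_cong_AE(2)[OF mval[OF rd], of "\<lambda>_. 0"] by (simp add: mLp_0(2)[OF p])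
    then have "nLp p (\<lambda>y. f y - f' y) \<le> 0" using est[OF rd] by simp
    then have "AE y in lborel. f y - f' y = 0"
      using rd by (intro nLp_eq_0_imp_AE[OF _ p]) (auto simp: rel_def)
    then show "u = u'" using meas(1)[OF u(2)] meas(1)[OF u(4)] u by (simp add: abs_L0_eq_iff)
  qed
  have surj: "(\<lambda>u. op u - cscale z u) ` D = Lp p"
  proof (intro equalityI subsetI)
    fix w assume "w \<in> (\<lambda>u. op u - cscale z u) ` D"
    then obtain f g where fg: "rel p f g" "w = op (abs_L0 f) - cscale z (abs_L0 f)" using D by blast
    then show "w \<in> Lp p" using val[OF fg(1)] mval[OF fg(1)] by (simp add: Lp_abs_iff mLp_def)
  next
    fix w :: "'n phase L0" assume "w \<in> Lp p"
    then obtain h where h: "mLp p h" "w = abs_L0 h" by (rule Lp_cases)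
    then obtain f where f: "rel p f (\<lambda>y. z * f y + h y)" using r by (auto simp: resolvent_bound_def)
    have "op (abs_L0 f) - cscale z (abs_L0 f) = w" using val[OF f] h by simp
    then show "w \<in> (\<lambda>u. op u - cscale z u) ` D" using op[OF f] by (auto intro!: image_eqI[of _ _ "abs_L0 f"])
  qed
  have bound: "Lp_norm p (resolvent D op z w) \<le> \<kappa> * Lp_norm p w" if w: "w \<in> Lp p" for w
  proof -
    define u where "u = resolvent D op z w"
    have "w \<in> (\<lambda>u. op u - cscale z u) ` D" using w surj by simp
    then have u: "u \<in> D" "op u - cscale z u = w"
      unfolding u_def resolvent_def by (auto intro: inv_into_into f_inv_into_f[where f="\<lambda>u. op u - cscale z u"])
    then obtain f g where fg: "u = abs_L0 f" "rel p f g" using D by blast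
    then have "w = abs_L0 (\<lambda>y. g y - z * f y)" using u val by simp
    then have "Lp_norm p u \<le> \<kappa> * Lp_norm p w" using est[OF fg(2)] mval[OF fg(2)] meas[OF fg(2)] fg(1)
      by (simp add: Lp_norm_abs mLp_def)
    then show ?thesis by (simp add: u_def)
  qed
  then show "z \<in> resolvent_set p D op"
    using inj surj by (auto simp: resolvent_set_def Lp_bounded_def bij_betw_def)
  show "Lp_opnorm p (resolvent D op z) \<le> \<kappa>"
    unfolding Lp_opnorm_def
  proof (rule cSUP_least)
    have "abs_L0 (\<lambda>_. 0) \<in> {w \<in> Lp p. Lp_norm p w \<le> 1}"
      using p by (simp add: Lp_abs_iff Lp_norm_abs mLp_0)
    then show "{w \<in> Lp p. Lp_norm p (w :: 'n phase L0) \<le> 1} \<noteq> {}" by blast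
    fix w :: "'n phase L0" assume "w \<in> {w \<in> Lp p. Lp_norm p w \<le> 1}"
    then have w: "w \<in> Lp p" "Lp_norm p w \<le> 1" by auto
    show "Lp_norm p (resolvent D op z w) \<le> \<kappa>"
      using bound[OF w(1)] mult_left_mono[OF w(2) \<kappa>] by simp
  qed
qed

text \<open>A distributional derivative contributes one sign, so first-order terms change sign and
  second-order terms do not. The coefficient multiplies the test function before it is
  differentiated and is then pulled out of the derivative. This yields \<open>Pop\<close> with
  velocity coefficient \<open>- m'\<close> and force equal to the gradient of
  \<open>V\<close>.\<close>

lemma fp_maps_iff:
  fixes f g :: "'n phase \<Rightarrow> complex" and V :: "real^'n \<Rightarrow> real"
  assumes f: "mLp p f" and g: "mLp p g" and p: "p > 1" and V: "smooth V"
    and params: "m = - m'" "a = \<gamma> / \<beta>" "b = \<gamma> / \<beta> * (m'\<^sup>2 * \<beta>\<^sup>2 / 4)" "d0 = \<gamma> / \<beta> * (m' * \<beta> * real CARD('n) / 2)"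
      "F = (\<lambda>x. \<chi> i. dir_deriv (axis i 1) V x)"
  shows "fp_maps m' \<beta> \<gamma> V (abs_L0 f) (abs_L0 g) \<longleftrightarrow> rel p f g"
proof -
  have "fokker_planck m' \<beta> \<gamma> V (distr_of (abs_L0 f)) \<phi> = (\<integral>y. f y * Pop \<phi> y \<partial>lborel)" if \<phi>: "\<phi> \<in> test_functions" for \<phi>
  proof -
    have sV: "smooth (dir_deriv (axis i 1) V)" for i by (rule smooth_dir_deriv[OF V]) (simp add: axis_in_Basis_iff)
    have sF: "smooth (\<lambda>x. F x $ i)" for i using sV by (simp add: params(5))
    note t = test_terms[OF \<phi> sF]
    note d\<phi> = smooth_differentiable[OF test_function_smooth[OF \<phi>]]
    have dist: "distr_of (abs_L0 f) \<psi> = (\<integral>y. f y * \<psi> y \<partial>lborel)" if "\<psi> \<in> test_functions" for \<psi>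
      using f that by (intro distr_of_abs) (auto simp: mLp_def)
    have i: "integrable lborel (\<lambda>y. f y * \<psi> y)" if "\<psi> \<in> test_functions" for \<psi>
      by (rule locally_integrable_test[OF mLp_locally_integrable[OF f p] that])
    have X: "distr_mult (\<lambda>(x, v). m' * v $ i) (distr_deriv (basis_x i) (distr_of (abs_L0 f))) \<phi>
       = - (\<integral>y. f y * (complex_of_real (m' * snd y $ i) * dir_deriv (basis_x i) \<phi> y) \<partial>lborel)" for i
      unfolding distr_mult_def distr_deriv_def case_prod_beta coefficient_derivatives(1)[OF d\<phi>]
      by (simp only: dist[OF test_terms(1)[OF t(4) sF]])
    have Y: "distr_mult (\<lambda>(x, v). dir_deriv (axis i 1) V x) (distr_deriv (basis_v i) (distr_of (abs_L0 f))) \<phi>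
       = - (\<integral>y. f y * (complex_of_real (F (fst y) $ i) * dir_deriv (basis_v i) \<phi> y) \<partial>lborel)" for i
      unfolding distr_mult_def distr_deriv_def case_prod_beta coefficient_derivatives(2)[OF d\<phi> smooth_differentiable[OF sV]]
      using dist[OF test_terms(2)[OF t(5) sF]] by (simp add: params(5))
    have U: "distr_deriv (basis_v i) (distr_deriv (basis_v i) (distr_of (abs_L0 f))) \<phi>
       = (\<integral>y. f y * dir_deriv (basis_v i) (dir_deriv (basis_v i) \<phi>) y \<partial>lborel)" for i
      unfolding distr_deriv_def by (simp add: dist t)
    define N where "N y = complex_of_real ((norm (snd y))\<^sup>2) * \<phi> y" for y
    have N: "N \<in> test_functions" unfolding N_def
      by (intro test_function_of_real_mult \<phi> smooth_norm_sq smooth_bounded_linear bounded_linear_snd)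
    have cN: "(\<lambda>z. complex_of_real (m'\<^sup>2 * \<beta>\<^sup>2 / 4 * (norm (snd z))\<^sup>2) * \<phi> z) = (\<lambda>z. complex_of_real (m'\<^sup>2 * \<beta>\<^sup>2 / 4) * N z)"
      by (simp add: N_def fun_eq_iff mult.assoc)
    have W: "distr_mult (\<lambda>(x, v). m'\<^sup>2 * \<beta>\<^sup>2 / 4 * (norm v)\<^sup>2) (distr_of (abs_L0 f)) \<phi> = complex_of_real (m'\<^sup>2 * \<beta>\<^sup>2 / 4) * (\<integral>y. f y * N y \<partial>lborel)"
      unfolding distr_mult_def case_prod_beta cN dist[OF test_function_cmult[OF N]]
      by (simp only: mult.left_commute[of _ "complex_of_real (m'\<^sup>2 * \<beta>\<^sup>2 / 4)"] integral_mult_right_zero)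
    define Xt where "Xt i y = complex_of_real (m' * snd y $ i) * dir_deriv (basis_x i) \<phi> y" for i y
    define Yt where "Yt i y = complex_of_real (F (fst y) $ i) * dir_deriv (basis_v i) \<phi> y" for i y
    define Ut where "Ut i y = dir_deriv (basis_v i) (dir_deriv (basis_v i) \<phi>) y" for i y
    have tt: "Xt i \<in> test_functions" "Yt i \<in> test_functions" "Ut i \<in> test_functions" for i
      unfolding Xt_def Yt_def Ut_def by (intro test_terms(1,2)[OF _ sF] t)+
    have "fokker_planck m' \<beta> \<gamma> V (distr_of (abs_L0 f)) \<phi>
      = ((\<Sum>i\<in>UNIV. - (\<integral>y. f y * Xt i y \<partial>lborel)) - (\<Sum>i\<in>UNIV. - (\<integral>y. f y * Yt i y \<partial>lborel)))
        + complex_of_real (\<gamma> / \<beta>) * (- (\<Sum>i\<in>UNIV. \<integral>y. f y * Ut i y \<partial>lborel)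
          + complex_of_real (m'\<^sup>2 * \<beta>\<^sup>2 / 4) * (\<integral>y. f y * N y \<partial>lborel)
          - complex_of_real (m' * \<beta> * real CARD('n) / 2) * (\<integral>y. f y * \<phi> y \<partial>lborel))"
      unfolding fokker_planck_def transport_def oscillator_def X Y U W dist[OF \<phi>] Xt_def Yt_def Ut_def ..
    also have "\<dots> = (\<integral>y. ((\<Sum>i\<in>UNIV. - (f y * Xt i y)) - (\<Sum>i\<in>UNIV. - (f y * Yt i y)))
        + complex_of_real (\<gamma> / \<beta>) * (- (\<Sum>i\<in>UNIV. f y * Ut i y)
          + complex_of_real (m'\<^sup>2 * \<beta>\<^sup>2 / 4) * (f y * N y)
          - complex_of_real (m' * \<beta> * real CARD('n) / 2) * (f y * \<phi> y)) \<partial>lborel)"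
      using i[OF tt(1)] i[OF tt(2)] i[OF tt(3)] i[OF N] i[OF \<phi>] by simp
    also have "\<dots> = (\<integral>y. f y * Pop \<phi> y \<partial>lborel)"
    proof (intro Bochner_Integration.integral_cong refl)
      fix y
      have Pop: "Pop \<phi> y = (\<Sum>i\<in>UNIV. - Xt i y) + (\<Sum>i\<in>UNIV. Yt i y) - complex_of_real a * (\<Sum>i\<in>UNIV. Ut i y)
          + (complex_of_real b * N y - complex_of_real d0 * \<phi> y)"
        unfolding Pop_def Xt_def Yt_def Ut_def N_def
        by (simp add: scaleR_conv_of_real params(1) sum_distrib_left algebra_simps)
      have coeffs: "complex_of_real a = complex_of_real (\<gamma> / \<beta>)"
        "complex_of_real b = complex_of_real (\<gamma> / \<beta>) * complex_of_real (m'\<^sup>2 * \<beta>\<^sup>2 / 4)"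
        "complex_of_real d0 = complex_of_real (\<gamma> / \<beta>) * complex_of_real (m' * \<beta> * real CARD('n) / 2)"
        unfolding params(2-4) by (simp_all only: of_real_mult)
      have "((\<Sum>i\<in>UNIV. - (f y * Xt i y)) - (\<Sum>i\<in>UNIV. - (f y * Yt i y)))
          + c1 * (- (\<Sum>i\<in>UNIV. f y * Ut i y) + c2 * (f y * N y) - c3 * (f y * \<phi> y))
        = f y * ((\<Sum>i\<in>UNIV. - Xt i y) + (\<Sum>i\<in>UNIV. Yt i y) - c1 * (\<Sum>i\<in>UNIV. Ut i y) + (c1 * c2 * N y - c1 * c3 * \<phi> y))"
        for c1 c2 c3 :: complex
        unfolding sum_negf sum_distrib_left[symmetric] by (simp add: algebra_simps)
      then show "((\<Sum>i\<in>UNIV. - (f y * Xt i y)) - (\<Sum>i\<in>UNIV. - (f y * Yt i y)))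
        + complex_of_real (\<gamma> / \<beta>) * (- (\<Sum>i\<in>UNIV. f y * Ut i y)
          + complex_of_real (m'\<^sup>2 * \<beta>\<^sup>2 / 4) * (f y * N y)
          - complex_of_real (m' * \<beta> * real CARD('n) / 2) * (f y * \<phi> y)) = f y * Pop \<phi> y"
        unfolding Pop coeffs .
    qed
    finally show ?thesis .
  qed
  moreover have "distr_of (abs_L0 g) \<phi> = (\<integral>y. g y * \<phi> y \<partial>lborel)" if "\<phi> \<in> test_functions" for \<phi>
    using g that by (intro distr_of_abs) (auto simp: mLp_def)
  ultimately show ?thesis using f g by (simp add: fp_maps_def rel_def)
qed

end

theorem theorem1p15:
  fixes V :: "real^'n::finite \<Rightarrow> real" and m \<beta> \<gamma> p :: real
  assumes "m > 0" and "\<beta> > 0" and "\<gamma> > 0"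
    and "smooth V"
    and "\<And>bs. bs \<in> lists Basis \<Longrightarrow> length bs \<ge> 2 \<Longrightarrow> iter_partial bs V \<in> Linf"
    and "1 < p"
  shows "\<exists>c>0. \<exists>C>0.
    spectrum p (fp_domain m \<beta> \<gamma> V p) (fp_op m \<beta> \<gamma> V p)
      \<subseteq> {z. Re z \<ge> - c \<and> \<bar>Im z\<bar> \<le> C * ((Re z)\<^sup>2 + 1)} \<and>
    (\<forall>z. z \<notin> {z. Re z \<ge> - c \<and> \<bar>Im z\<bar> \<le> C * ((Re z)\<^sup>2 + 1)} \<longrightarrow>
      Lp_opnorm p (resolvent (fp_domain m \<beta> \<gamma> V p) (fp_op m \<beta> \<gamma> V p) z)
        \<le> C * inverse (1 + \<bar>Re z\<bar> + \<bar>Im z\<bar> powr (1/2)))"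
proof -
  note p = \<open>1 < p\<close>
  define F where "F x = (\<chi> i. dir_deriv (axis i 1) V x)" for x
  obtain L where L: "L \<ge> 0" "\<And>x y. norm (F x - F y) \<le> L * norm (x - y)"
    using gradient_lipschitz[OF assms(4,5)] unfolding F_def by blast
  define a b d0 where "a = \<gamma> / \<beta>" and "b = \<gamma> / \<beta> * (m\<^sup>2 * \<beta>\<^sup>2 / 4)"
    and "d0 = \<gamma> / \<beta> * (m * \<beta> * real CARD('n) / 2)"
  have ab: "a > 0" "b > 0"
    using assms(1-3) unfolding a_def b_def by (intro mult_pos_pos divide_pos_pos zero_less_power; simp)+
  interpret kfp "- m" a b d0 F L
    by unfold_locales (use assms(1) in simp, rule ab, rule ab, rule L, rule L)
  have sF: "smooth (\<lambda>x. F x $ i)" for i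
    using smooth_dir_deriv[OF assms(4), of "axis i 1"] by (simp add: F_def axis_in_Basis_iff)
  have F_eq: "F = (\<lambda>x. \<chi> i. dir_deriv (axis i 1) V x)" by (simp add: fun_eq_iff F_def)
  note maps = fp_maps_iff[OF _ _ p assms(4) refl a_def b_def d0_def F_eq]
  have D: "\<exists>f g. u = abs_L0 f \<and> rel p f g" if "u \<in> fp_domain m \<beta> \<gamma> V p" for u
  proof -
    obtain w where w: "u \<in> Lp p" "w \<in> Lp p" "fp_maps m \<beta> \<gamma> V u w" using \<open>u \<in> _\<close> by (auto simp: fp_domain_def)
    obtain f where f: "mLp p f" "u = abs_L0 f" using w(1) by (rule Lp_cases)
    obtain g where g: "mLp p g" "w = abs_L0 g" using w(2) by (rule Lp_cases)
    show ?thesis using maps[OF f(1) g(1)] w(3) f(2) g(2) by blast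
  qed
  \<comment> \<open>\<open>fp_op\<close> is a definite description, so its value on a pair in
    \<open>rel\<close> requires uniqueness of the image class.\<close>
  have op: "abs_L0 f \<in> fp_domain m \<beta> \<gamma> V p \<and> fp_op m \<beta> \<gamma> V p (abs_L0 f) = abs_L0 g" if r: "rel p f g" for f g
  proof
    have m: "mLp p f" "mLp p g" using r by (auto simp: rel_def)
    have fg: "abs_L0 f \<in> Lp p" "abs_L0 g \<in> Lp p" "fp_maps m \<beta> \<gamma> V (abs_L0 f) (abs_L0 g)"
      using m r maps[OF m] by (auto simp: Lp_abs_iff mLp_def)
    then show "abs_L0 f \<in> fp_domain m \<beta> \<gamma> V p" by (auto simp: fp_domain_def)
    show "fp_op m \<beta> \<gamma> V p (abs_L0 f) = abs_L0 g"
      unfolding fp_op_def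
    proof (rule the_equality)
      show "abs_L0 g \<in> Lp p \<and> fp_maps m \<beta> \<gamma> V (abs_L0 f) (abs_L0 g)" using fg by simp
      fix w assume "w \<in> Lp p \<and> fp_maps m \<beta> \<gamma> V (abs_L0 f) w"
      then have w: "w \<in> Lp p" "fp_maps m \<beta> \<gamma> V (abs_L0 f) w" by auto
      obtain g' where g': "mLp p g'" "w = abs_L0 g'" using w(1) by (rule Lp_cases)
      have r': "rel p f g'" using w(2) maps[OF m(1) g'(1)] g'(2) by simp
      \<comment> \<open>Two images of the same \<open>f\<close> differ by a function paired with 0,
        so all its test integrals vanish and the fundamental lemma identifies the classes.\<close>
      have rd: "rel p (\<lambda>y. f y - f y) (\<lambda>y. g' y - g y)" by (rule rel_diff[OF sF p r' r])
      have "AE y in lborel. g' y - g y = 0"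
        using rd by (intro fundamental_lemma[OF mLp_locally_integrable[OF mLp_minus(1)[OF g'(1) m(2) p] p]]) (auto simp: rel_def)
      then show "w = abs_L0 g" using g' m by (simp add: abs_L0_eq_iff mLp_def)
    qed
  qed
  obtain c C where c: "c > 0" and C: "C > 0" and
    H: "\<And>z. \<not> (Re z \<ge> - c \<and> \<bar>Im z\<bar> \<le> C * ((Re z)\<^sup>2 + 1)) \<Longrightarrow> resolvent_bound p z (C / (1 + \<bar>Re z\<bar> + sqrt \<bar>Im z\<bar>))"
    using resolvent_region[OF sF p] by blast
  have R: "z \<in> resolvent_set p (fp_domain m \<beta> \<gamma> V p) (fp_op m \<beta> \<gamma> V p)"
    "Lp_opnorm p (resolvent (fp_domain m \<beta> \<gamma> V p) (fp_op m \<beta> \<gamma> V p) z) \<le> C / (1 + \<bar>Re z\<bar> + sqrt \<bar>Im z\<bar>)"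
    if "\<not> (Re z \<ge> - c \<and> \<bar>Im z\<bar> \<le> C * ((Re z)\<^sup>2 + 1))" for z
    using resolvent_bound_imp[OF sF p D op H[OF that]] C by (auto simp: add_nonneg_nonneg)
  show ?thesis
  proof (rule exI[of _ c], rule conjI[OF c], rule exI[of _ C], intro conjI C subsetI allI impI)
    fix z assume "z \<in> spectrum p (fp_domain m \<beta> \<gamma> V p) (fp_op m \<beta> \<gamma> V p)"
    then show "z \<in> {z. Re z \<ge> - c \<and> \<bar>Im z\<bar> \<le> C * ((Re z)\<^sup>2 + 1)}"
      using R(1)[of z] unfolding spectrum_def by blast
  next
    fix z assume "z \<notin> {z. Re z \<ge> - c \<and> \<bar>Im z\<bar> \<le> C * ((Re z)\<^sup>2 + 1)}"
    then show "Lp_opnorm p (resolvent (fp_domain m \<beta> \<gamma> V p) (fp_op m \<beta> \<gamma> V p) z)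
        \<le> C * inverse (1 + \<bar>Re z\<bar> + \<bar>Im z\<bar> powr (1/2))"
      using R(2)[of z] unfolding powr_half_sqrt[OF abs_ge_zero] divide_inverse[of C] by blast
  qed
qed

end
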